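(* Let $\Bbbk$ be a commutative ring, $q\in\Bbbk$, and $n,r\in\mathbb N$. The Iwahori–Hecke algebra $H_n=M_{(1^n);(1^n)}$ and the $q$-Schur algebra $\mathscr S_{r,n}=\bigoplus_{\lambda,\mu}M_{\lambda;\mu}$ are standardly filtered algebras over $\Bbbk$ on the set of compositions of $n$ ordered by the reversed dominance order. For each composition $\nu$ of $n$ their ideal filters and attached Morita contexts are given by $$H_n^{\ge\nu}:=M^{\ge\nu}_{(1^n);(1^n)}\quad\text{with}\quad(S_\nu,S_\nu^* )$$ and $$\mathscr S_{r,n}^{\ge\nu}:=\bigoplus_{\lambda,\mu}M^{\ge\nu}_{\lambda;\mu}\quad\text{with}\quad\Bigl(\bigoplus_\lambda S_{\nu;\lambda},\ \bigoplus_\lambda S^*_{\nu;\lambda}\Bigr).$$ These standard filters are involutive.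
   Context: Iwahori–Hecke algebra $H_n=H_n(q)$: the $\Bbbk$-algebra generated by $T_1,\dots,T_{n-1}$ with $T_iT_j=T_jT_i$ for $|i-j|\ge2$, $T_iT_{i+1}T_i=T_{i+1}T_iT_{i+1}$, $(T_i-q)(T_i+1)=0$. $T_w$ ($w\in\mathfrak S_n$) is the usual basis, and $(T_w)^*:=T_{w^{-1}}$ defines an anti-involution. A composition of $n$ is a sequence $\lambda=(\lambda_1,\lambda_2,\dots)$ of non-negative integers with sum $n$; $\mathfrak S_\lambda$ is the Young subgroup, $m_\lambda=\sum_{w\in\mathfrak S_\lambda}T_w$. Dominance order: $\lambda\le\mu$ iff $\lambda_1+\dots+\lambda_k\le\mu_1+\dots+\mu_k$ for all $k$. $M_{\lambda;\mu}:=H_nm_\lambda\cap m_\mu H_n$, with well-defined products $\circ_\mu\colon M_{\mu;\nu}\otimes M_{\lambda;\mu}\to M_{\lambda;\nu}$, $xm_\mu\otimes m_\mu y\mapsto xm_\mu y$. $M_{\lambda;\mu}\simeq\operatorname{Hom}_{H_n}(H_nm_\mu,H_nm_\lambda)$ and $\circ$ is the reversed composition. $\mathscr S_{r,n}:=\bigoplus_{\lambda,\mu}M_{\lambda;\mu}$ with product $\circ$, where $\lambda,\mu$ run over compositions of $n$ with $\lambda_i=\mu_i=0$ for $i>r$; in the direct sums defining its Morita contexts $\lambda$ runs over the same set. The anti-involution on $\mathscr S_{r,n}$ is induced by $*\colon M_{\lambda;\mu}\to M_{\mu;\lambda}$. $(1^n)=(1,\dots,1)$. $M^\nu_{\lambda;\mu}:=M_{\nu;\mu}\circ_\nu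 M_{\lambda;\nu}$, $M^{\ge\nu}_{\lambda;\mu}:=\sum_{\pi\ge\nu}M^\pi_{\lambda;\mu}$, $M^{>\nu}_{\lambda;\mu}:=\sum_{\pi>\nu}M^\pi_{\lambda;\mu}$, $M^{(\nu)}_{\lambda;\mu}:=M_{\lambda;\mu}/M^{>\nu}_{\lambda;\mu}$. $S_{\nu;\lambda}:=M^{(\nu)}_{\nu;\lambda}$, $S^*_{\nu;\lambda}:=M^{(\nu)}_{\lambda;\nu}$, $S_\nu:=S_{\nu;(1^n)}$, $S^*_\nu:=S^*_{\nu;(1^n)}$. The algebra $S_{\nu;\nu}$ is a quotient $\Bbbk/B'_\nu$ of $\Bbbk$ (spanned by $m_\nu$), and the structure maps of the Morita contexts are induced by the products $\circ$. Morita context between algebras $A$, $B$: an $(A,B)$-bimodule $M$ and a $(B,A)$-bimodule $N$ with bimodule maps $\eta\colon M\otimes_BN\to A$, $\rho\colon N\otimes_AM\to B$ such that $\eta(x\otimes y)x'=x\rho(y\otimes x')$, $\rho(y\otimes x)y'=y\eta(x\otimes y')$; trace ideal in $A$: image of $\eta$. If $A,B$ have anti-involutions, it is involutive if there is an isomorphism $M\simeq N^*$ of $(A,B)$-bimodules ($N^*$ being $N$ with sides exchanged through the anti-involutions) under which $\eta(x\otimes y)^*=\eta(y^*\otimes x^* )$ and $\rho(y\otimes x)^*=\rho(x^*\otimes y^* )$. A standard filter of $A$ over $\Bbbk$ on a poset $(\Lambda,\preceq)$: 2-sided ideals $\{A^{\preceq\lambda}\}$ with $A^{\preceq\lambda}\subset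 A^{\preceq\mu}$ if $\lambda\preceq\mu$, $\sum_\lambda A^{\preceq\lambda}=A$, $A^{\preceq\lambda}A^{\preceq\mu}\subset\sum_{\nu\preceq\lambda,\mu}A^{\preceq\nu}$; and for each $\lambda$ an ideal $B'_\lambda\subset\Bbbk$ and a Morita context $(M_\lambda,N_\lambda)$ between $A/A^{\prec\lambda}$ and $\Bbbk/B'_\lambda$ ($A^{\prec\lambda}:=\sum_{\mu\prec\lambda}A^{\preceq\mu}$) with trace ideal $A^{\preceq\lambda}/A^{\prec\lambda}$ in $A/A^{\prec\lambda}$, such that $A^{\preceq\mu}M_\lambda=0$, $N_\lambda A^{\preceq\mu}=0$ if $\lambda\not\preceq\mu$. It is involutive if $A$ has an anti-involution preserving all $A^{\preceq\lambda}$ and each Morita context is involutive ($\Bbbk$ having the trivial anti-involution). Here $\preceq$ is the reversed dominance order, so $A^{\preceq\nu}$ is written $A^{\ge\nu}$. *)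

theory Defs
  imports "HOL-Combinatorics.Permutations" "HOL-Algebra.Module" "HOL-Algebra.QuotRing" "HOL-Algebra.Generated_Groups"
begin

section \<open>Associative algebras, quotients, bimodules\<close>

text \<open>The library locale \<^locale>\<open>algebra\<close> is restricted to commutative algebras.\<close>

locale assoc_algebra = module K A + A?: ring A for K (structure) and A (structure) +
  assumes smult_mult_l:
      "\<lbrakk>c \<in> carrier K; x \<in> carrier A; y \<in> carrier A\<rbrakk> \<Longrightarrow>
        (c \<odot>\<^bsub>A\<^esub> x) \<otimes>\<^bsub>A\<^esub> y = c \<odot>\<^bsub>A\<^esub> (x \<otimes>\<^bsub>A\<^esub> y)"
    and smult_mult_r:
      "\<lbrakk>c \<in> carrier K; x \<in> carrier A; y \<in> carrier A\<rbrakk> \<Longrightarrow>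
        x \<otimes>\<^bsub>A\<^esub> (c \<odot>\<^bsub>A\<^esub> y) = c \<odot>\<^bsub>A\<^esub> (x \<otimes>\<^bsub>A\<^esub> y)"

definition self_algebra :: "('k, 'x) ring_scheme \<Rightarrow> ('k, 'k) module" where
  "self_algebra K = ring.extend (ring.truncate K) (module.fields (\<lambda>c x. c \<otimes>\<^bsub>K\<^esub> x))"

definition quotient_algebra :: "('k, 'a, 'x) module_scheme \<Rightarrow> 'a set \<Rightarrow> ('k, 'a set) module" where
  "quotient_algebra A I =
     ring.extend (A Quot I) (module.fields (\<lambda>c W. \<Union>x\<in>W. I +>\<^bsub>A\<^esub> (c \<odot>\<^bsub>A\<^esub> x)))"

definition add_span :: "('a, 'x) ring_scheme \<Rightarrow> 'a set \<Rightarrow> 'a set" where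
  "add_span A S = generate (add_monoid A) S"

definition anti_involution :: "('k, 'x) ring_scheme \<Rightarrow> ('k, 'a, 'y) module_scheme \<Rightarrow> ('a \<Rightarrow> 'a) \<Rightarrow> bool"
  where "anti_involution K A f \<longleftrightarrow>
    f \<in> carrier A \<rightarrow> carrier A \<and>
    (\<forall>x\<in>carrier A. \<forall>y\<in>carrier A. f (x \<oplus>\<^bsub>A\<^esub> y) = f x \<oplus>\<^bsub>A\<^esub> f y) \<and>
    (\<forall>c\<in>carrier K. \<forall>x\<in>carrier A. f (c \<odot>\<^bsub>A\<^esub> x) = c \<odot>\<^bsub>A\<^esub> f x) \<and>
    (\<forall>x\<in>carrier A. \<forall>y\<in>carrier A. f (x \<otimes>\<^bsub>A\<^esub> y) = f y \<otimes>\<^bsub>A\<^esub> f x) \<and>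
    (\<forall>x\<in>carrier A. f (f x) = x)"

text \<open>As for library modules, the inherited fields \<open>mult\<close> and \<open>one\<close> of a bimodule carry no meaning.\<close>

record ('k, 'a, 'b, 'm) bimodule = "('k, 'm) module" +
  lact :: "'a \<Rightarrow> 'm \<Rightarrow> 'm"
  ract :: "'m \<Rightarrow> 'b \<Rightarrow> 'm"

locale bimodule =
  A: assoc_algebra K A + B: assoc_algebra K B + M: module K M
  for K :: "('k, 'x) ring_scheme" (structure) and A :: "('k, 'a, 'y) module_scheme" and B :: "('k, 'b, 'z) module_scheme"
    and M :: "('k, 'a, 'b, 'm) bimodule" +
  assumes lact_closed: "\<lbrakk>a \<in> carrier A; x \<in> carrier M\<rbrakk> \<Longrightarrow> lact M a x \<in> carrier M"
    and lact_add_l: "\<lbrakk>a \<in> carrier A; a' \<in> carrier A; x \<in> carrier M\<rbrakk> \<Longrightarrow>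
          lact M (a \<oplus>\<^bsub>A\<^esub> a') x = lact M a x \<oplus>\<^bsub>M\<^esub> lact M a' x"
    and lact_add_r: "\<lbrakk>a \<in> carrier A; x \<in> carrier M; x' \<in> carrier M\<rbrakk> \<Longrightarrow>
          lact M a (x \<oplus>\<^bsub>M\<^esub> x') = lact M a x \<oplus>\<^bsub>M\<^esub> lact M a x'"
    and lact_mult: "\<lbrakk>a \<in> carrier A; a' \<in> carrier A; x \<in> carrier M\<rbrakk> \<Longrightarrow>
          lact M (a \<otimes>\<^bsub>A\<^esub> a') x = lact M a (lact M a' x)"
    and lact_one: "x \<in> carrier M \<Longrightarrow> lact M \<one>\<^bsub>A\<^esub> x = x"
    and lact_smult_l: "\<lbrakk>c \<in> carrier K; a \<in> carrier A; x \<in> carrier M\<rbrakk> \<Longrightarrow>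
          lact M (c \<odot>\<^bsub>A\<^esub> a) x = c \<odot>\<^bsub>M\<^esub> lact M a x"
    and lact_smult_r: "\<lbrakk>c \<in> carrier K; a \<in> carrier A; x \<in> carrier M\<rbrakk> \<Longrightarrow>
          lact M a (c \<odot>\<^bsub>M\<^esub> x) = c \<odot>\<^bsub>M\<^esub> lact M a x"
    and ract_closed: "\<lbrakk>b \<in> carrier B; x \<in> carrier M\<rbrakk> \<Longrightarrow> ract M x b \<in> carrier M"
    and ract_add_r: "\<lbrakk>b \<in> carrier B; b' \<in> carrier B; x \<in> carrier M\<rbrakk> \<Longrightarrow>
          ract M x (b \<oplus>\<^bsub>B\<^esub> b') = ract M x b \<oplus>\<^bsub>M\<^esub> ract M x b'"
    and ract_add_l: "\<lbrakk>b \<in> carrier B; x \<in> carrier M; x' \<in> carrier M\<rbrakk> \<Longrightarrow>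
          ract M (x \<oplus>\<^bsub>M\<^esub> x') b = ract M x b \<oplus>\<^bsub>M\<^esub> ract M x' b"
    and ract_mult: "\<lbrakk>b \<in> carrier B; b' \<in> carrier B; x \<in> carrier M\<rbrakk> \<Longrightarrow>
          ract M x (b \<otimes>\<^bsub>B\<^esub> b') = ract M (ract M x b) b'"
    and ract_one: "x \<in> carrier M \<Longrightarrow> ract M x \<one>\<^bsub>B\<^esub> = x"
    and ract_smult_r: "\<lbrakk>c \<in> carrier K; b \<in> carrier B; x \<in> carrier M\<rbrakk> \<Longrightarrow>
          ract M x (c \<odot>\<^bsub>B\<^esub> b) = c \<odot>\<^bsub>M\<^esub> ract M x b"
    and ract_smult_l: "\<lbrakk>c \<in> carrier K; b \<in> carrier B; x \<in> carrier M\<rbrakk> \<Longrightarrow>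
          ract M (c \<odot>\<^bsub>M\<^esub> x) b = c \<odot>\<^bsub>M\<^esub> ract M x b"
    and lact_ract: "\<lbrakk>a \<in> carrier A; b \<in> carrier B; x \<in> carrier M\<rbrakk> \<Longrightarrow>
          ract M (lact M a x) b = lact M a (ract M x b)"

definition bimodule_iso ::
    "('k, 'x) ring_scheme \<Rightarrow> ('k, 'a, 'y) module_scheme \<Rightarrow> ('k, 'b, 'z) module_scheme \<Rightarrow>
      ('k, 'a, 'b, 'm) bimodule \<Rightarrow> ('k, 'a, 'b, 'n) bimodule \<Rightarrow> ('m \<Rightarrow> 'n) \<Rightarrow> bool" where
  "bimodule_iso K A B M N \<phi> \<longleftrightarrow>
    bij_betw \<phi> (carrier M) (carrier N) \<and>
    (\<forall>x\<in>carrier M. \<forall>y\<in>carrier M. \<phi> (x \<oplus>\<^bsub>M\<^esub> y) = \<phi> x \<oplus>\<^bsub>N\<^esub> \<phi> y) \<and>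
    (\<forall>c\<in>carrier K. \<forall>x\<in>carrier M. \<phi> (c \<odot>\<^bsub>M\<^esub> x) = c \<odot>\<^bsub>N\<^esub> \<phi> x) \<and>
    (\<forall>a\<in>carrier A. \<forall>x\<in>carrier M. \<phi> (lact M a x) = lact N a (\<phi> x)) \<and>
    (\<forall>b\<in>carrier B. \<forall>x\<in>carrier M. \<phi> (ract M x b) = ract N (\<phi> x) b)"

text \<open>The bimodule \<open>N\<^sup>*\<close>: the sides of the \<open>(B,A)\<close>-bimodule \<open>N\<close> are exchanged through the
  anti-involutions \<open>sA\<close>, \<open>sB\<close> of \<open>A\<close>, \<open>B\<close>.\<close>

definition swap_sides ::
    "('a \<Rightarrow> 'a) \<Rightarrow> ('b \<Rightarrow> 'b) \<Rightarrow> ('k, 'b, 'a, 'n) bimodule \<Rightarrow> ('k, 'a, 'b, 'n) bimodule" where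
  "swap_sides sA sB N =
     module.extend (module.truncate N)
       (bimodule.fields (\<lambda>a y. ract N y (sA a)) (\<lambda>y b. lact N (sB b) y))"

section \<open>Morita contexts\<close>

text \<open>The library has no tensor product over a non-commutative ring.  An \<open>(A,A)\<close>-bimodule map
  \<open>M \<otimes>\<^sub>B N \<rightarrow> A\<close> is given, by the universal property of \<open>\<otimes>\<^sub>B\<close>, as a \<open>B\<close>-balanced biadditive map
  on \<open>M \<times> N\<close> that is \<open>A\<close>-linear on both outer sides.\<close>

locale tensor_bimodule_map =
  M: bimodule K A B M + N: bimodule K B A N
  for K :: "('k, 'x) ring_scheme" (structure) and A :: "('k, 'a, 'y) module_scheme" and B :: "('k, 'b, 'z) module_scheme"
    and M :: "('k, 'a, 'b, 'm) bimodule" and N :: "('k, 'b, 'a, 'n) bimodule" +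
  fixes \<eta> :: "'m \<Rightarrow> 'n \<Rightarrow> 'a"
  assumes map_closed: "\<lbrakk>x \<in> carrier M; y \<in> carrier N\<rbrakk> \<Longrightarrow> \<eta> x y \<in> carrier A"
    and map_add_l: "\<lbrakk>x \<in> carrier M; x' \<in> carrier M; y \<in> carrier N\<rbrakk> \<Longrightarrow>
          \<eta> (x \<oplus>\<^bsub>M\<^esub> x') y = \<eta> x y \<oplus>\<^bsub>A\<^esub> \<eta> x' y"
    and map_add_r: "\<lbrakk>x \<in> carrier M; y \<in> carrier N; y' \<in> carrier N\<rbrakk> \<Longrightarrow>
          \<eta> x (y \<oplus>\<^bsub>N\<^esub> y') = \<eta> x y \<oplus>\<^bsub>A\<^esub> \<eta> x y'"
    and map_balanced: "\<lbrakk>x \<in> carrier M; b \<in> carrier B; y \<in> carrier N\<rbrakk> \<Longrightarrow>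
          \<eta> (ract M x b) y = \<eta> x (lact N b y)"
    and map_lact: "\<lbrakk>a \<in> carrier A; x \<in> carrier M; y \<in> carrier N\<rbrakk> \<Longrightarrow>
          \<eta> (lact M a x) y = a \<otimes>\<^bsub>A\<^esub> \<eta> x y"
    and map_ract: "\<lbrakk>a \<in> carrier A; x \<in> carrier M; y \<in> carrier N\<rbrakk> \<Longrightarrow>
          \<eta> x (ract N y a) = \<eta> x y \<otimes>\<^bsub>A\<^esub> a"

locale morita_context =
  eta: tensor_bimodule_map K A B M N \<eta> + rho: tensor_bimodule_map K B A N M \<rho>
  for K :: "('k, 'x) ring_scheme" (structure) and A :: "('k, 'a, 'y) module_scheme" and B :: "('k, 'b, 'z) module_scheme"
    and M :: "('k, 'a, 'b, 'm) bimodule" and N :: "('k, 'b, 'a, 'n) bimodule"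
    and \<eta> :: "'m \<Rightarrow> 'n \<Rightarrow> 'a" and \<rho> :: "'n \<Rightarrow> 'm \<Rightarrow> 'b" +
  assumes eta_rho: "\<lbrakk>x \<in> carrier M; y \<in> carrier N; x' \<in> carrier M\<rbrakk> \<Longrightarrow>
          lact M (\<eta> x y) x' = ract M x (\<rho> y x')"
    and rho_eta: "\<lbrakk>y \<in> carrier N; x \<in> carrier M; y' \<in> carrier N\<rbrakk> \<Longrightarrow>
          lact N (\<rho> y x) y' = ract N y (\<eta> x y')"

definition trace_ideal ::
    "('k, 'a, 'y) module_scheme \<Rightarrow> ('k, 'a, 'b, 'm) bimodule \<Rightarrow> ('k, 'b, 'a, 'n) bimodule \<Rightarrow>
      ('m \<Rightarrow> 'n \<Rightarrow> 'a) \<Rightarrow> 'a set" where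
  "trace_ideal A M N \<eta> = add_span A {\<eta> x y | x y. x \<in> carrier M \<and> y \<in> carrier N}"

definition involutive_context ::
    "('k, 'x) ring_scheme \<Rightarrow> ('k, 'a, 'y) module_scheme \<Rightarrow> ('k, 'b, 'z) module_scheme \<Rightarrow>
      ('a \<Rightarrow> 'a) \<Rightarrow> ('b \<Rightarrow> 'b) \<Rightarrow> ('k, 'a, 'b, 'm) bimodule \<Rightarrow> ('k, 'b, 'a, 'n) bimodule \<Rightarrow>
      ('m \<Rightarrow> 'n \<Rightarrow> 'a) \<Rightarrow> ('n \<Rightarrow> 'm \<Rightarrow> 'b) \<Rightarrow> bool" where
  "involutive_context K A B sA sB M N \<eta> \<rho> \<longleftrightarrow>
    (\<exists>\<phi>. bimodule_iso K A B M (swap_sides sA sB N) \<phi> \<and>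
      (\<forall>x\<in>carrier M. \<forall>y\<in>carrier N.
        sA (\<eta> x y) = \<eta> (inv_into (carrier M) \<phi> y) (\<phi> x) \<and>
        sB (\<rho> y x) = \<rho> (\<phi> x) (inv_into (carrier M) \<phi> y)))"

section \<open>Standard filters\<close>

definition filter_below ::
    "('k, 'a, 'x) module_scheme \<Rightarrow> 'l set \<Rightarrow> ('l \<Rightarrow> 'l \<Rightarrow> bool) \<Rightarrow> ('l \<Rightarrow> 'a set) \<Rightarrow> 'l \<Rightarrow> 'a set" where
  "filter_below A \<Lambda> leq F l = add_span A (\<Union>k\<in>{k\<in>\<Lambda>. leq k l \<and> k \<noteq> l}. F k)"

locale standard_filter = assoc_algebra K A
  for K :: "('k, 'x) ring_scheme" (structure) and A :: "('k, 'a, 'y) module_scheme" (structure) +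
  fixes \<Lambda> :: "'l set"
    and leq :: "'l \<Rightarrow> 'l \<Rightarrow> bool"
    and F :: "'l \<Rightarrow> 'a set"
    and B' :: "'l \<Rightarrow> 'k set"
    and M :: "'l \<Rightarrow> ('k, 'a set, 'k set, 'm) bimodule"
    and N :: "'l \<Rightarrow> ('k, 'k set, 'a set, 'n) bimodule"
    and \<eta> :: "'l \<Rightarrow> 'm \<Rightarrow> 'n \<Rightarrow> 'a set"
    and \<rho> :: "'l \<Rightarrow> 'n \<Rightarrow> 'm \<Rightarrow> 'k set"
  assumes poset: "reflp_on \<Lambda> leq" "transp_on \<Lambda> leq" "antisymp_on \<Lambda> leq"
    and filter_ideal: "l \<in> \<Lambda> \<Longrightarrow> ideal (F l) A"
    and filter_mono: "\<lbrakk>k \<in> \<Lambda>; l \<in> \<Lambda>; leq k l\<rbrakk> \<Longrightarrow> F k \<subseteq> F l"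
    and filter_total: "add_span A (\<Union>l\<in>\<Lambda>. F l) = carrier A"
    and filter_mult: "\<lbrakk>k \<in> \<Lambda>; l \<in> \<Lambda>; a \<in> F k; b \<in> F l\<rbrakk> \<Longrightarrow>
          a \<otimes>\<^bsub>A\<^esub> b \<in> add_span A (\<Union>j\<in>{j\<in>\<Lambda>. leq j k \<and> leq j l}. F j)"
    and base_ideal: "l \<in> \<Lambda> \<Longrightarrow> ideal (B' l) K"
    and context_at: "l \<in> \<Lambda> \<Longrightarrow>
          morita_context K (quotient_algebra A (filter_below A \<Lambda> leq F l))
            (quotient_algebra (self_algebra K) (B' l)) (M l) (N l) (\<eta> l) (\<rho> l)"
    and context_trace: "l \<in> \<Lambda> \<Longrightarrow>
          trace_ideal (quotient_algebra A (filter_below A \<Lambda> leq F l)) (M l) (N l) (\<eta> l) =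
            (\<lambda>a. filter_below A \<Lambda> leq F l +>\<^bsub>A\<^esub> a) ` F l"
    and annihil_l: "\<lbrakk>k \<in> \<Lambda>; l \<in> \<Lambda>; \<not> leq l k; a \<in> F k; x \<in> carrier (M l)\<rbrakk> \<Longrightarrow>
          lact (M l) (filter_below A \<Lambda> leq F l +>\<^bsub>A\<^esub> a) x = \<zero>\<^bsub>M l\<^esub>"
    and annihil_r: "\<lbrakk>k \<in> \<Lambda>; l \<in> \<Lambda>; \<not> leq l k; a \<in> F k; y \<in> carrier (N l)\<rbrakk> \<Longrightarrow>
          ract (N l) y (filter_below A \<Lambda> leq F l +>\<^bsub>A\<^esub> a) = \<zero>\<^bsub>N l\<^esub>"

text \<open>The anti-involution is a parameter here; it acts on \<open>A / A\<^bsup>\<prec>l\<^esup>\<close> by taking images of cosets and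
  trivially on \<open>K / B'\<^sub>l\<close>.\<close>

locale involutive_standard_filter = standard_filter K A \<Lambda> leq F B' M N \<eta> \<rho>
  for K :: "('k, 'x) ring_scheme" (structure) and A :: "('k, 'a, 'y) module_scheme" (structure)
    and \<Lambda> and leq and F and B' and M and N and \<eta> and \<rho> +
  fixes star :: "'a \<Rightarrow> 'a"
  assumes anti_invol: "anti_involution K A star"
    and star_filter: "l \<in> \<Lambda> \<Longrightarrow> star ` F l = F l"
    and invol_context: "l \<in> \<Lambda> \<Longrightarrow>
          involutive_context K (quotient_algebra A (filter_below A \<Lambda> leq F l))
            (quotient_algebra (self_algebra K) (B' l)) (\<lambda>W. star ` W) (\<lambda>C. C)
            (M l) (N l) (\<eta> l) (\<rho> l)"

section \<open>Compositions and Young subgroups\<close>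

text \<open>Compositions are indexed from 0: \<open>\<nu> i\<close> is the part \<open>\<nu>\<^bsub>i+1\<^esub>\<close>.\<close>

definition compositions :: "nat \<Rightarrow> (nat \<Rightarrow> nat) set" where
  "compositions n = {\<nu>. finite {i. \<nu> i \<noteq> 0} \<and> (\<Sum>i | \<nu> i \<noteq> 0. \<nu> i) = n}"

definition compositions_upto :: "nat \<Rightarrow> nat \<Rightarrow> (nat \<Rightarrow> nat) set" where
  "compositions_upto r n = {\<nu> \<in> compositions n. \<forall>i\<ge>r. \<nu> i = 0}"

definition ones :: "nat \<Rightarrow> nat \<Rightarrow> nat" where
  "ones n = (\<lambda>i. if i < n then 1 else 0)"

definition dom_le :: "(nat \<Rightarrow> nat) \<Rightarrow> (nat \<Rightarrow> nat) \<Rightarrow> bool" where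
  "dom_le \<alpha> \<beta> \<longleftrightarrow> (\<forall>k. (\<Sum>i<k. \<alpha> i) \<le> (\<Sum>i<k. \<beta> i))"

definition dom_ge :: "(nat \<Rightarrow> nat) \<Rightarrow> (nat \<Rightarrow> nat) \<Rightarrow> bool" where
  "dom_ge \<alpha> \<beta> \<longleftrightarrow> dom_le \<beta> \<alpha>"

definition block :: "(nat \<Rightarrow> nat) \<Rightarrow> nat \<Rightarrow> nat set" where
  "block \<nu> k = {(\<Sum>i<k. \<nu> i)<..(\<Sum>i\<le>k. \<nu> i)}"

definition young_subgroup :: "nat \<Rightarrow> (nat \<Rightarrow> nat) \<Rightarrow> (nat \<Rightarrow> nat) set" where
  "young_subgroup n \<nu> = {w. w permutes {1..n} \<and> (\<forall>k. w ` block \<nu> k = block \<nu> k)}"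

section \<open>The Iwahori--Hecke algebra\<close>

text \<open>The free algebra on \<open>I\<close>: finitely supported functions on words over \<open>I\<close>, with convolution
  over all factorisations of a word.\<close>

definition free_algebra :: "('k, 'x) ring_scheme \<Rightarrow> 'i set \<Rightarrow> ('k, 'i list \<Rightarrow> 'k) module" where
  "free_algebra K I =
    \<lparr>carrier = {f. (\<forall>w. f w \<in> carrier K) \<and> finite {w. f w \<noteq> \<zero>\<^bsub>K\<^esub>} \<and> (\<forall>w. w \<notin> lists I \<longrightarrow> f w = \<zero>\<^bsub>K\<^esub>)},
     mult = (\<lambda>f g w. \<Oplus>\<^bsub>K\<^esub>i\<in>{..length w}. f (take i w) \<otimes>\<^bsub>K\<^esub> g (drop i w)),
     one = (\<lambda>w. if w = [] then \<one>\<^bsub>K\<^esub> else \<zero>\<^bsub>K\<^esub>),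
     zero = (\<lambda>w. \<zero>\<^bsub>K\<^esub>),
     add = (\<lambda>f g w. f w \<oplus>\<^bsub>K\<^esub> g w),
     smult = (\<lambda>c f w. c \<otimes>\<^bsub>K\<^esub> f w)\<rparr>"

definition free_gen :: "('k, 'x) ring_scheme \<Rightarrow> 'i \<Rightarrow> 'i list \<Rightarrow> 'k" where
  "free_gen K i = (\<lambda>w. if w = [i] then \<one>\<^bsub>K\<^esub> else \<zero>\<^bsub>K\<^esub>)"

definition hecke_relations :: "('k, 'x) ring_scheme \<Rightarrow> 'k \<Rightarrow> nat \<Rightarrow> (nat list \<Rightarrow> 'k) set" where
  "hecke_relations K q n =
    (let A = free_algebra K {1..<n}; g = free_gen K in
      {g i \<otimes>\<^bsub>A\<^esub> g j \<ominus>\<^bsub>A\<^esub> g j \<otimes>\<^bsub>A\<^esub> g i | i j.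
         i \<in> {1..<n} \<and> j \<in> {1..<n} \<and> (i + 2 \<le> j \<or> j + 2 \<le> i)} \<union>
      {g i \<otimes>\<^bsub>A\<^esub> g (i + 1) \<otimes>\<^bsub>A\<^esub> g i \<ominus>\<^bsub>A\<^esub> g (i + 1) \<otimes>\<^bsub>A\<^esub> g i \<otimes>\<^bsub>A\<^esub> g (i + 1) | i.
         i \<in> {1..<n} \<and> i + 1 \<in> {1..<n}} \<union>
      {(g i \<ominus>\<^bsub>A\<^esub> q \<odot>\<^bsub>A\<^esub> \<one>\<^bsub>A\<^esub>) \<otimes>\<^bsub>A\<^esub> (g i \<oplus>\<^bsub>A\<^esub> \<one>\<^bsub>A\<^esub>) | i. i \<in> {1..<n}})"

type_synonym 'k hecke = "(nat list \<Rightarrow> 'k) set"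

definition hecke_ideal :: "('k, 'x) ring_scheme \<Rightarrow> 'k \<Rightarrow> nat \<Rightarrow> (nat list \<Rightarrow> 'k) set" where
  "hecke_ideal K q n = Idl\<^bsub>free_algebra K {1..<n}\<^esub> (hecke_relations K q n)"

definition hecke_algebra :: "('k, 'x) ring_scheme \<Rightarrow> 'k \<Rightarrow> nat \<Rightarrow> ('k, 'k hecke) module" where
  "hecke_algebra K q n = quotient_algebra (free_algebra K {1..<n}) (hecke_ideal K q n)"

text \<open>Words act on \<open>{1..n}\<close> through \<open>i \<mapsto> (i i+1)\<close>; permutations are composed from right to left.\<close>

definition word_perm :: "nat list \<Rightarrow> nat \<Rightarrow> nat" where
  "word_perm ws = foldr (\<lambda>i p. transpose i (Suc i) \<circ> p) ws id"

definition reduced_word :: "nat \<Rightarrow> (nat \<Rightarrow> nat) \<Rightarrow> nat list" where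
  "reduced_word n w = (ARG_MIN length ws. set ws \<subseteq> {1..<n} \<and> word_perm ws = w)"

locale q_schur_data =
  fixes K :: "('k, 'x) ring_scheme" (structure) and q :: 'k and n :: nat
begin

abbreviation H :: "('k, 'k hecke) module" where
  "H \<equiv> hecke_algebra K q n"

definition T_gen :: "nat \<Rightarrow> 'k hecke" where
  "T_gen i = hecke_ideal K q n +>\<^bsub>free_algebra K {1..<n}\<^esub> free_gen K i"

definition T :: "(nat \<Rightarrow> nat) \<Rightarrow> 'k hecke" where
  "T w = foldr (\<lambda>i h. T_gen i \<otimes>\<^bsub>H\<^esub> h) (reduced_word n w) \<one>\<^bsub>H\<^esub>"

definition star :: "'k hecke \<Rightarrow> 'k hecke" where
  "star = (THE f. f \<in> carrier H \<rightarrow>\<^sub>E carrier H \<and>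
     (\<forall>x\<in>carrier H. \<forall>y\<in>carrier H. f (x \<oplus>\<^bsub>H\<^esub> y) = f x \<oplus>\<^bsub>H\<^esub> f y) \<and>
     (\<forall>c\<in>carrier K. \<forall>x\<in>carrier H. f (c \<odot>\<^bsub>H\<^esub> x) = c \<odot>\<^bsub>H\<^esub> f x) \<and>
     (\<forall>w. w permutes {1..n} \<longrightarrow> f (T w) = T (inv_into UNIV w)))"

definition m :: "(nat \<Rightarrow> nat) \<Rightarrow> 'k hecke" where
  "m \<nu> = (\<Oplus>\<^bsub>H\<^esub>w\<in>young_subgroup n \<nu>. T w)"

section \<open>The spaces \<open>M\<^bsub>\<alpha>;\<beta>\<^esub>\<close> and their products\<close>

definition MM :: "(nat \<Rightarrow> nat) \<Rightarrow> (nat \<Rightarrow> nat) \<Rightarrow> 'k hecke set" where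
  "MM \<alpha> \<beta> = {h \<otimes>\<^bsub>H\<^esub> m \<alpha> | h. h \<in> carrier H} \<inter> {m \<beta> \<otimes>\<^bsub>H\<^esub> h | h. h \<in> carrier H}"

definition circ :: "(nat \<Rightarrow> nat) \<Rightarrow> 'k hecke \<Rightarrow> 'k hecke \<Rightarrow> 'k hecke" where
  "circ \<kappa> u v = (THE z. \<exists>x\<in>carrier H. \<exists>y\<in>carrier H.
     u = x \<otimes>\<^bsub>H\<^esub> m \<kappa> \<and> v = m \<kappa> \<otimes>\<^bsub>H\<^esub> y \<and> z = x \<otimes>\<^bsub>H\<^esub> m \<kappa> \<otimes>\<^bsub>H\<^esub> y)"

text \<open>\<open>M_through \<nu> \<alpha> \<beta>\<close>, \<open>M_ge \<nu> \<alpha> \<beta>\<close>, \<open>M_gt \<nu> \<alpha> \<beta>\<close>, \<open>M_quot \<nu> \<alpha> \<beta>\<close> are the spaces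
  \<open>M\<^sub>\<alpha>\<^sub>;\<^sub>\<beta>\<close> with upper index \<open>\<nu>\<close>, \<open>\<ge>\<nu>\<close>, \<open>>\<nu>\<close> and \<open>(\<nu>)\<close>, respectively.\<close>

definition M_through :: "(nat \<Rightarrow> nat) \<Rightarrow> (nat \<Rightarrow> nat) \<Rightarrow> (nat \<Rightarrow> nat) \<Rightarrow> 'k hecke set" where
  "M_through \<nu> \<alpha> \<beta> = add_span H {circ \<nu> u v | u v. u \<in> MM \<nu> \<beta> \<and> v \<in> MM \<alpha> \<nu>}"

definition M_ge :: "(nat \<Rightarrow> nat) \<Rightarrow> (nat \<Rightarrow> nat) \<Rightarrow> (nat \<Rightarrow> nat) \<Rightarrow> 'k hecke set" where
  "M_ge \<nu> \<alpha> \<beta> = add_span H (\<Union>\<pi>\<in>{\<pi>\<in>compositions n. dom_le \<nu> \<pi>}. M_through \<pi> \<alpha> \<beta>)"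

definition M_gt :: "(nat \<Rightarrow> nat) \<Rightarrow> (nat \<Rightarrow> nat) \<Rightarrow> (nat \<Rightarrow> nat) \<Rightarrow> 'k hecke set" where
  "M_gt \<nu> \<alpha> \<beta> = add_span H (\<Union>\<pi>\<in>{\<pi>\<in>compositions n. dom_le \<nu> \<pi> \<and> \<pi> \<noteq> \<nu>}. M_through \<pi> \<alpha> \<beta>)"

definition M_quot ::
    "(nat \<Rightarrow> nat) \<Rightarrow> (nat \<Rightarrow> nat) \<Rightarrow> (nat \<Rightarrow> nat) \<Rightarrow> ('k, 'k hecke set) module" where
  "M_quot \<nu> \<alpha> \<beta> =
    \<lparr>carrier = (\<lambda>x. M_gt \<nu> \<alpha> \<beta> +>\<^bsub>H\<^esub> x) ` MM \<alpha> \<beta>,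
     mult = undefined, one = undefined,
     zero = M_gt \<nu> \<alpha> \<beta>,
     add = set_add H,
     smult = (\<lambda>c W. \<Union>x\<in>W. M_gt \<nu> \<alpha> \<beta> +>\<^bsub>H\<^esub> (c \<odot>\<^bsub>H\<^esub> x))\<rparr>"

text \<open>The product \<open>M_quot \<nu> \<kappa> \<beta> \<times> M_quot \<nu> \<alpha> \<kappa> \<rightarrow> M_quot \<nu> \<alpha> \<beta>\<close> induced by \<open>circ \<kappa>\<close>.\<close>

definition qcirc :: "(nat \<Rightarrow> nat) \<Rightarrow> (nat \<Rightarrow> nat) \<Rightarrow> (nat \<Rightarrow> nat) \<Rightarrow> (nat \<Rightarrow> nat) \<Rightarrow>
    'k hecke set \<Rightarrow> 'k hecke set \<Rightarrow> 'k hecke set" where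
  "qcirc \<nu> \<alpha> \<kappa> \<beta> W Y = (\<Union>x\<in>W. \<Union>y\<in>Y. M_gt \<nu> \<alpha> \<beta> +>\<^bsub>H\<^esub> circ \<kappa> x y)"

text \<open>\<open>K / B' \<nu>\<close> is identified with the algebra \<open>S\<^sub>\<nu>\<^sub>;\<^sub>\<nu>\<close> (whose unit is the class of \<open>m \<nu>\<close>) along
  \<open>c \<mapsto> c m\<^sub>\<nu>\<close>: \<open>of_base\<close> is this map on cosets, \<open>to_base\<close> takes preimages.\<close>

definition B' :: "(nat \<Rightarrow> nat) \<Rightarrow> 'k set" where
  "B' \<nu> = {c \<in> carrier K. c \<odot>\<^bsub>H\<^esub> m \<nu> \<in> M_gt \<nu> \<nu> \<nu>}"

definition of_base :: "(nat \<Rightarrow> nat) \<Rightarrow> 'k set \<Rightarrow> 'k hecke set" where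
  "of_base \<nu> C = (\<Union>c\<in>C. M_gt \<nu> \<nu> \<nu> +>\<^bsub>H\<^esub> (c \<odot>\<^bsub>H\<^esub> m \<nu>))"

definition to_base :: "(nat \<Rightarrow> nat) \<Rightarrow> 'k hecke set \<Rightarrow> 'k set" where
  "to_base \<nu> W = {c \<in> carrier K. c \<odot>\<^bsub>H\<^esub> m \<nu> \<in> W}"

abbreviation S_sp :: "(nat \<Rightarrow> nat) \<Rightarrow> (nat \<Rightarrow> nat) \<Rightarrow> ('k, 'k hecke set) module" where
  "S_sp \<nu> \<alpha> \<equiv> M_quot \<nu> \<nu> \<alpha>"

abbreviation S'_sp :: "(nat \<Rightarrow> nat) \<Rightarrow> (nat \<Rightarrow> nat) \<Rightarrow> ('k, 'k hecke set) module" where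
  "S'_sp \<nu> \<alpha> \<equiv> M_quot \<nu> \<alpha> \<nu>"

section \<open>Filter and contexts of the Hecke algebra\<close>

definition hecke_filter :: "(nat \<Rightarrow> nat) \<Rightarrow> 'k hecke set" where
  "hecke_filter \<nu> = M_ge \<nu> (ones n) (ones n)"

definition hecke_S :: "(nat \<Rightarrow> nat) \<Rightarrow> ('k, 'k hecke set, 'k set, 'k hecke set) bimodule" where
  "hecke_S \<nu> = module.extend (S_sp \<nu> (ones n))
     (bimodule.fields
       (\<lambda>W Y. qcirc \<nu> \<nu> (ones n) (ones n) W Y)
       (\<lambda>Y C. qcirc \<nu> \<nu> \<nu> (ones n) Y (of_base \<nu> C)))"

definition hecke_S' :: "(nat \<Rightarrow> nat) \<Rightarrow> ('k, 'k set, 'k hecke set, 'k hecke set) bimodule" where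
  "hecke_S' \<nu> = module.extend (S'_sp \<nu> (ones n))
     (bimodule.fields
       (\<lambda>C Z. qcirc \<nu> (ones n) \<nu> \<nu> (of_base \<nu> C) Z)
       (\<lambda>Z W. qcirc \<nu> (ones n) (ones n) \<nu> Z W))"

definition hecke_eta :: "(nat \<Rightarrow> nat) \<Rightarrow> 'k hecke set \<Rightarrow> 'k hecke set \<Rightarrow> 'k hecke set" where
  "hecke_eta \<nu> Y Z = qcirc \<nu> (ones n) \<nu> (ones n) Y Z"

definition hecke_rho :: "(nat \<Rightarrow> nat) \<Rightarrow> 'k hecke set \<Rightarrow> 'k hecke set \<Rightarrow> 'k set" where
  "hecke_rho \<nu> Z Y = to_base \<nu> (qcirc \<nu> \<nu> (ones n) \<nu> Z Y)"

section \<open>The q-Schur algebra, its filter and contexts\<close>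

text \<open>Direct sums over the finite set of compositions with at most \<open>r\<close> parts are rendered as
  extensional families.\<close>

definition schur_algebra ::
    "nat \<Rightarrow> ('k, (nat \<Rightarrow> nat) \<times> (nat \<Rightarrow> nat) \<Rightarrow> 'k hecke) module" where
  "schur_algebra r = (let I = compositions_upto r n in
    \<lparr>carrier = (\<Pi>\<^sub>E (\<alpha>, \<beta>)\<in>I \<times> I. MM \<alpha> \<beta>),
     mult = (\<lambda>x y. \<lambda>(\<alpha>, \<beta>)\<in>I \<times> I. \<Oplus>\<^bsub>H\<^esub>\<kappa>\<in>I. circ \<kappa> (x (\<kappa>, \<beta>)) (y (\<alpha>, \<kappa>))),
     one = (\<lambda>(\<alpha>, \<beta>)\<in>I \<times> I. if \<alpha> = \<beta> then m \<alpha> else \<zero>\<^bsub>H\<^esub>),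
     zero = (\<lambda>(\<alpha>, \<beta>)\<in>I \<times> I. \<zero>\<^bsub>H\<^esub>),
     add = (\<lambda>x y. \<lambda>(\<alpha>, \<beta>)\<in>I \<times> I. x (\<alpha>, \<beta>) \<oplus>\<^bsub>H\<^esub> y (\<alpha>, \<beta>)),
     smult = (\<lambda>c x. \<lambda>(\<alpha>, \<beta>)\<in>I \<times> I. c \<odot>\<^bsub>H\<^esub> x (\<alpha>, \<beta>))\<rparr>)"

definition schur_star :: "nat \<Rightarrow> ((nat \<Rightarrow> nat) \<times> (nat \<Rightarrow> nat) \<Rightarrow> 'k hecke) \<Rightarrow>
    (nat \<Rightarrow> nat) \<times> (nat \<Rightarrow> nat) \<Rightarrow> 'k hecke" where
  "schur_star r x =
     (\<lambda>(\<alpha>, \<beta>)\<in>compositions_upto r n \<times> compositions_upto r n. star (x (\<beta>, \<alpha>)))"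

definition schur_filter ::
    "nat \<Rightarrow> (nat \<Rightarrow> nat) \<Rightarrow> ((nat \<Rightarrow> nat) \<times> (nat \<Rightarrow> nat) \<Rightarrow> 'k hecke) set" where
  "schur_filter r \<nu> =
     (\<Pi>\<^sub>E (\<alpha>, \<beta>)\<in>compositions_upto r n \<times> compositions_upto r n. M_ge \<nu> \<alpha> \<beta>)"

text \<open>The \<open>(\<alpha>,\<beta>)\<close>-component, an element of \<open>M_quot \<nu> \<alpha> \<beta>\<close>, of a coset modulo
  \<open>\<Oplus>\<^bsub>\<alpha>,\<beta>\<^esub> M_gt \<nu> \<alpha> \<beta>\<close>.\<close>

definition component :: "((nat \<Rightarrow> nat) \<times> (nat \<Rightarrow> nat) \<Rightarrow> 'k hecke) set \<Rightarrow>
    (nat \<Rightarrow> nat) \<Rightarrow> (nat \<Rightarrow> nat) \<Rightarrow> 'k hecke set" where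
  "component W \<alpha> \<beta> = (\<lambda>x. x (\<alpha>, \<beta>)) ` W"

definition dsum :: "nat \<Rightarrow> ((nat \<Rightarrow> nat) \<Rightarrow> ('k, 'k hecke set) module) \<Rightarrow>
    ('k, (nat \<Rightarrow> nat) \<Rightarrow> 'k hecke set) module" where
  "dsum r P = (let I = compositions_upto r n in
    \<lparr>carrier = (\<Pi>\<^sub>E \<alpha>\<in>I. carrier (P \<alpha>)),
     mult = undefined, one = undefined,
     zero = (\<lambda>\<alpha>\<in>I. \<zero>\<^bsub>P \<alpha>\<^esub>),
     add = (\<lambda>x y. \<lambda>\<alpha>\<in>I. x \<alpha> \<oplus>\<^bsub>P \<alpha>\<^esub> y \<alpha>),
     smult = (\<lambda>c x. \<lambda>\<alpha>\<in>I. c \<odot>\<^bsub>P \<alpha>\<^esub> x \<alpha>)\<rparr>)"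

definition schur_S :: "nat \<Rightarrow> (nat \<Rightarrow> nat) \<Rightarrow>
    ('k, ((nat \<Rightarrow> nat) \<times> (nat \<Rightarrow> nat) \<Rightarrow> 'k hecke) set, 'k set,
      (nat \<Rightarrow> nat) \<Rightarrow> 'k hecke set) bimodule" where
  "schur_S r \<nu> = (let I = compositions_upto r n in
    module.extend (dsum r (S_sp \<nu>))
     (bimodule.fields
       (\<lambda>W Y. \<lambda>\<beta>\<in>I. \<Oplus>\<^bsub>S_sp \<nu> \<beta>\<^esub>\<alpha>\<in>I. qcirc \<nu> \<nu> \<alpha> \<beta> (component W \<alpha> \<beta>) (Y \<alpha>))
       (\<lambda>Y C. \<lambda>\<alpha>\<in>I. qcirc \<nu> \<nu> \<nu> \<alpha> (Y \<alpha>) (of_base \<nu> C))))"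

definition schur_S' :: "nat \<Rightarrow> (nat \<Rightarrow> nat) \<Rightarrow>
    ('k, 'k set, ((nat \<Rightarrow> nat) \<times> (nat \<Rightarrow> nat) \<Rightarrow> 'k hecke) set,
      (nat \<Rightarrow> nat) \<Rightarrow> 'k hecke set) bimodule" where
  "schur_S' r \<nu> = (let I = compositions_upto r n in
    module.extend (dsum r (S'_sp \<nu>))
     (bimodule.fields
       (\<lambda>C Z. \<lambda>\<alpha>\<in>I. qcirc \<nu> \<alpha> \<nu> \<nu> (of_base \<nu> C) (Z \<alpha>))
       (\<lambda>Z W. \<lambda>\<alpha>\<in>I. \<Oplus>\<^bsub>S'_sp \<nu> \<alpha>\<^esub>\<beta>\<in>I. qcirc \<nu> \<alpha> \<beta> \<nu> (Z \<beta>) (component W \<alpha> \<beta>))))"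

text \<open>\<open>schur_eta\<close> is the coset whose \<open>(\<alpha>,\<beta>)\<close>-component is the product of \<open>Y \<beta>\<close> and \<open>Z \<alpha>\<close>.\<close>

definition schur_eta :: "nat \<Rightarrow> (nat \<Rightarrow> nat) \<Rightarrow> ((nat \<Rightarrow> nat) \<Rightarrow> 'k hecke set) \<Rightarrow>
    ((nat \<Rightarrow> nat) \<Rightarrow> 'k hecke set) \<Rightarrow> ((nat \<Rightarrow> nat) \<times> (nat \<Rightarrow> nat) \<Rightarrow> 'k hecke) set" where
  "schur_eta r \<nu> Y Z =
    (\<Pi>\<^sub>E (\<alpha>, \<beta>)\<in>compositions_upto r n \<times> compositions_upto r n. qcirc \<nu> \<alpha> \<nu> \<beta> (Y \<beta>) (Z \<alpha>))"

definition schur_rho :: "nat \<Rightarrow> (nat \<Rightarrow> nat) \<Rightarrow> ((nat \<Rightarrow> nat) \<Rightarrow> 'k hecke set) \<Rightarrow>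
    ((nat \<Rightarrow> nat) \<Rightarrow> 'k hecke set) \<Rightarrow> 'k set" where
  "schur_rho r \<nu> Z Y = to_base \<nu>
     (\<Oplus>\<^bsub>M_quot \<nu> \<nu> \<nu>\<^esub>\<alpha>\<in>compositions_upto r n. qcirc \<nu> \<nu> \<alpha> \<nu> (Z \<alpha>) (Y \<alpha>))"

end

end

(* The heart of the proof is that M_{a;b} is spanned by the products u o v through compositions
   c dominating both a and b, together with K m_a if a = b.  The coefficients of an element of
   M_{a;b} in the basis T_w are constant along double cosets.  Take w of maximal length in the
   support and give each position p the smaller of the indices of the a-block of p and of the
   b-block of w(p) as its key.  The numbers of positions with a given key form a composition c
   dominating a and b, and sorting the positions by their keys factorizes w = x t e with additive
   lengths, where t is the longest element of the Young subgroup of c.  Multiplying suitable sums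
   of T_z over the double cosets of x and of e yields u in M_{c;b} and v in M_{a;c} with
   u o v = T_w + (shorter terms), and one subtracts a multiple of this product.

   Consequently M_{c;c} = K m_c + M^{>c}_{c;c}, so that the products land in K/B'_c, and a product
   of something through c with something through d passes through compositions dominating both c
   and d, which gives multiplicativity and the annihilation conditions.  The Hecke algebra is the
   algebra of 1x1 matrices over the spaces M_{a;b}, indexed by (1^n), and the q-Schur algebra is a
   larger matrix algebra, so both are handled at once.  That the T_w form a basis follows from the
   action of the free algebra on functions on permutations. *)

theory Submission
  imports Defs
begin

section \<open>Permutations, inversions and reduced words\<close>

text \<open>\<open>q\<close> may be zero or a zero divisor, so no coefficient can be divided by, and
  every element used to clear the support must have leading coefficient one. The plain product of
  two double coset sums would contain m m, which is m times the Poincare polynomial of the Young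
  subgroup at \<open>q\<close>. The product \<open>circ\<close> removes one copy of m: with u = X m
  and v = m Y, where X and Y are supported on shortest coset representatives, u o v = X m Y is a
  product of elements with leading terms \<open>T x\<close>, \<open>T t\<close>, \<open>T e\<close>,
  whose lengths add.

  The key is a minimum because the positions with key below k then include both the positions in the
  first k blocks of a and those that w sends into the first k blocks of b. Counting gives both
  dominance relations at once. If c = a = b, the counts agree, every key equals both block indices,
  and w lies in the Young subgroup; being at least as long as its longest element t, it equals t.
  Only then does m itself serve as the element with leading term \<open>T w\<close>.\<close>

abbreviation pinv :: "(nat \<Rightarrow> nat) \<Rightarrow> nat \<Rightarrow> nat" where
  "pinv \<equiv> inv_into UNIV"

text \<open>The pairs range over all naturals, so the length needs no parameter \<open>n\<close>;
  \<open>inversions_subset\<close> provides finiteness for permutations of {1..n}.\<close>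

definition inversions :: "(nat \<Rightarrow> nat) \<Rightarrow> (nat \<times> nat) set" where
  "inversions w = {(i, j). i < j \<and> w j < w i}"

definition len :: "(nat \<Rightarrow> nat) \<Rightarrow> nat" where
  "len w = card (inversions w)"

lemma permutes_outside: "w permutes {1..n} \<Longrightarrow> i \<notin> {1..n::nat} \<Longrightarrow> w i = i"
  by (rule permutes_not_in)

text \<open>Beyond n every position is fixed. If the smaller position of a pair is fixed there, so
  is the larger one; position 0 is fixed and too small to start an inversion.\<close>

lemma inversions_subset:
  assumes w: "w permutes {1..n}"
  shows "inversions w \<subseteq> {1..n} \<times> {1..n}"
proof -
  have i: "i \<in> {1..n}" if ij: "i < j" "w j < w i" for i j
  proof (rule ccontr)
    assume i: "i \<notin> {1..n}"
    then have wi: "w i = i" using w by (rule permutes_outside[rotated])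
    show False
    proof (cases "i = 0")
      case True then show ?thesis using ij wi by simp
    next
      case False
      then have "j \<notin> {1..n}" using i ij by auto
      then have "w j = j" using w by (rule permutes_outside[rotated])
      then show ?thesis using ij wi by simp
    qed
  qed
  have j: "j \<in> {1..n}" if ij: "i < j" "w j < w i" for i j
  proof (rule ccontr)
    assume j: "j \<notin> {1..n}"
    then have wj: "w j = j" using w by (rule permutes_outside[rotated])
    have "w i \<in> {1..n}" using i[OF ij] w by (simp only: permutes_in_image)
    then show False using ij wj j by auto
  qed
  show ?thesis
    unfolding inversions_def using i j by blast
qed

lemma finite_inversions: "w permutes {1..n::nat} \<Longrightarrow> finite (inversions w)"
  by (rule finite_subset[OF inversions_subset]) auto

lemma permutes_less_cases:
  assumes "w permutes S" "(i::'a) \<noteq> j"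
  shows "(w i :: 'a :: linorder) < w j \<or> w j < w i"
  using assms permutes_inj[OF assms(1)] by (metis injD linorder_neqE)

text \<open>By \<open>sub\<close>, \<open>x\<close> does not repair any pair that \<open>y\<close>
  inverts, so the inversions of \<open>y\<close> remain inversions of \<open>x \<circ> y\<close>.
  The others, increasing under \<open>y\<close>, are carried by \<open>y\<close> bijectively onto
  the inversions of \<open>x\<close>: an inversion of \<open>x\<close> reached by \<open>y\<close>
  from positions in the wrong order would contradict \<open>sub\<close>. This criterion underlies
  every additivity of lengths below.\<close>

lemma len_comp_add:
  assumes x: "x permutes {1..n::nat}" and y: "y permutes {1..n}"
    and sub: "\<And>i j. i < j \<Longrightarrow> y j < y i \<Longrightarrow> x (y j) < x (y i)"
  shows "len (x \<circ> y) = len x + len y"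
proof -
  let ?N = "{(i, j). i < j \<and> y i < y j \<and> x (y j) < x (y i)}"
  have fin: "finite (inversions (x \<circ> y))" using permutes_compose[OF y x] by (rule finite_inversions)
  have eq: "inversions (x \<circ> y) = ?N \<union> inversions y"
    using sub permutes_less_cases[OF y] by (fastforce simp: inversions_def)
  have disj: "?N \<inter> inversions y = {}" by (auto simp: inversions_def)
  have bij: "bij_betw (\<lambda>(i, j). (y i, y j)) ?N (inversions x)"
  proof (rule bij_betwI[where g = "\<lambda>(i, j). (pinv y i, pinv y j)"])
    show "(\<lambda>(i, j). (y i, y j)) \<in> ?N \<rightarrow> inversions x" by (auto simp: inversions_def)
    show "(\<lambda>(i, j). (pinv y i, pinv y j)) \<in> inversions x \<rightarrow> ?N"
    proof (clarsimp simp: inversions_def permutes_inverses[OF y])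
      fix r r' :: nat assume r: "r < r'" "x r' < x r"
      show "pinv y r < pinv y r'"
      proof (rule ccontr)
        assume "\<not> pinv y r < pinv y r'"
        then have "pinv y r' < pinv y r" using permutes_less_cases[OF permutes_inv[OF y], of r r'] r by auto
        from sub[OF this] show False using r by (simp add: permutes_inverses[OF y])
      qed
    qed
  qed (auto simp: permutes_inverses[OF y])
  have "len (x \<circ> y) = card ?N + card (inversions y)"
    unfolding len_def eq
    by (rule card_Un_disjoint) (use fin eq disj in auto)
  then show ?thesis using bij_betw_same_card[OF bij] by (simp add: len_def)
qed

lemma len_inv:
  assumes w: "w permutes {1..n::nat}"
  shows "len (pinv w) = len w"
proof -
  have "bij_betw (\<lambda>(i, j). (w j, w i)) (inversions w) (inversions (pinv w))"
    by (rule bij_betwI[where g = "\<lambda>(i, j). (pinv w j, pinv w i)"])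
      (auto simp: inversions_def permutes_inverses[OF w])
  then show ?thesis by (simp add: len_def bij_betw_same_card)
qed

section \<open>Adjacent transpositions and descents\<close>

abbreviation adj :: "nat \<Rightarrow> nat \<Rightarrow> nat" where
  "adj i \<equiv> transpose i (Suc i)"

lemma adj_permutes: "i \<in> {1..<n} \<Longrightarrow> adj i permutes {1..n}"
  by (rule permutes_swap_id) auto

lemma len_adj: "len (adj i) = 1"
proof -
  have "inversions (adj i) = {(i, Suc i)}"
    by (auto simp: inversions_def transpose_def split: if_splits)
  then show ?thesis by (simp add: len_def)
qed

lemma len_id: "len id = 0"
proof -
  have "inversions id = {}" by (auto simp: inversions_def)
  then show ?thesis by (simp add: len_def)
qed

text \<open>Multiplying by \<open>adj i\<close> on the left exchanges the values i and i + 1, whose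
  positions are read off from \<open>pinv w\<close>. No other pair of values changes its order, and
  \<open>up\<close> says that this pair is not inverted by \<open>w\<close>.\<close>

lemma len_adj_comp_up:
  assumes w: "w permutes {1..n}" and i: "i \<in> {1..<n}" and up: "pinv w i < pinv w (Suc i)"
  shows "len (adj i \<circ> w) = Suc (len w)"
proof -
  have "len (adj i \<circ> w) = len (adj i) + len w"
  proof (rule len_comp_add[OF adj_permutes[OF i] w])
    fix a b assume ab: "a < b" "w b < w a"
    show "adj i (w b) < adj i (w a)"
    proof (cases "w b = i \<and> w a = Suc i")
      case True
      then have "pinv w i = b" "pinv w (Suc i) = a" using permutes_inverses(2)[OF w] by metis+
      then show ?thesis using ab up by simp
    next
      case False then show ?thesis using ab by (auto simp: transpose_def)
    qed
  qed
  then show ?thesis by (simp add: len_adj)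
qed

lemma inv_adj_comp: "w permutes {1..n} \<Longrightarrow> i \<in> {1..<n} \<Longrightarrow> pinv (adj i \<circ> w) = pinv w \<circ> adj i"
  using o_inv_distrib[OF permutes_bij[OF adj_permutes] permutes_bij, of i n w "{1..n}"]
  by (simp add: inv_swap_id)

lemma adj_adj_comp: "adj i \<circ> (adj i \<circ> w) = w"
  by (auto simp: fun_eq_iff)

lemma len_adj_comp_down:
  assumes w: "w permutes {1..n}" and i: "i \<in> {1..<n}" and down: "pinv w (Suc i) < pinv w i"
  shows "Suc (len (adj i \<circ> w)) = len w"
proof -
  have "len (adj i \<circ> (adj i \<circ> w)) = Suc (len (adj i \<circ> w))"
    by (rule len_adj_comp_up[OF permutes_compose[OF w adj_permutes[OF i]] i])
      (simp add: inv_adj_comp[OF w i] down)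
  then show ?thesis by (simp add: adj_adj_comp)
qed

lemma len_comp_adj_up:
  assumes w: "w permutes {1..n}" and i: "i \<in> {1..<n}" and up: "w i < w (Suc i)"
  shows "len (w \<circ> adj i) = Suc (len w)"
proof -
  have "len (w \<circ> adj i) = len (pinv (w \<circ> adj i))"
    by (rule len_inv[symmetric], rule permutes_compose[OF adj_permutes[OF i] w])
  also have "pinv (w \<circ> adj i) = adj i \<circ> pinv w"
    using o_inv_distrib[OF permutes_bij[OF w] permutes_bij[OF adj_permutes[OF i]]] by (simp add: inv_swap_id)
  also have "len (adj i \<circ> pinv w) = Suc (len (pinv w))"
    by (rule len_adj_comp_up[OF permutes_inv[OF w] i]) (simp add: permutes_inv_inv[OF w] up)
  finally show ?thesis unfolding len_inv[OF w] .
qed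

lemma comp_adj_adj: "w \<circ> adj i \<circ> adj i = w"
  by (auto simp: fun_eq_iff)

lemma len_comp_adj_down:
  assumes w: "w permutes {1..n}" and i: "i \<in> {1..<n}" and down: "w (Suc i) < w i"
  shows "Suc (len (w \<circ> adj i)) = len w"
  using len_comp_adj_up[OF permutes_compose[OF adj_permutes[OF i] w] i] down
  by (simp add: comp_adj_adj)

text \<open>A strictly increasing map f on the naturals satisfies i \<le> f i; applied to
  \<open>w\<close> and to \<open>pinv w\<close> this gives equality. The absence of inversions
  extends the monotonicity from {1..n} to all naturals.\<close>

lemma permutes_mono_id:
  assumes w: "w permutes {1..n::nat}"
    and mono: "\<And>i j. i \<in> {1..n} \<Longrightarrow> j \<in> {1..n} \<Longrightarrow> i < j \<Longrightarrow> w i < w j"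
  shows "w = id"
proof -
  have "inversions w = {}"
  proof (rule ccontr)
    assume "inversions w \<noteq> {}"
    then obtain i j where ij: "i < j" "w j < w i" "(i, j) \<in> inversions w" by (auto simp: inversions_def)
    with inversions_subset[OF w] have "i \<in> {1..n}" "j \<in> {1..n}" by auto
    from mono[OF this ij(1)] ij(2) show False by simp
  qed
  then have sm: "w i < w j" if "i < j" for i j
    using that permutes_less_cases[OF w, of i j] by (auto simp: inversions_def)
  have ge: "f i \<ge> i" if "\<And>i j. i < j \<Longrightarrow> f i < f j" for f :: "nat \<Rightarrow> nat" and i
    by (induction i) (use that in \<open>auto simp: Suc_le_eq intro: le_less_trans\<close>)
  have smi: "pinv w i < pinv w j" if "i < j" for i j
  proof (rule ccontr)
    assume "\<not> pinv w i < pinv w j"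
    then have "pinv w j < pinv w i" using permutes_less_cases[OF permutes_inv[OF w], of i j] that by auto
    from sm[OF this] show False using that by (simp add: permutes_inverses[OF w])
  qed
  show ?thesis
  proof
    fix i
    have "pinv w (w i) \<ge> w i" by (rule ge) (rule smi)
    then have "w i \<le> i" by (simp add: permutes_inverses[OF w])
    then show "w i = id i" using ge[of w i] sm by (simp add: le_antisym)
  qed
qed

lemma mono_of_adjacent:
  fixes f :: "nat \<Rightarrow> nat"
  assumes step: "\<And>k. i \<le> k \<Longrightarrow> k < j \<Longrightarrow> f k < f (Suc k)" and "i < j"
  shows "f i < f j"
  using assms
proof (induction j)
  case (Suc j)
  show ?case
  proof (cases "i = j")
    case True then show ?thesis using Suc.prems(1)[of i] by simp
  next
    case False
    then have "f i < f j" using Suc by simp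
    also have "\<dots> < f (Suc j)" using Suc.prems(1)[of j] Suc.prems(2) by simp
    finally show ?thesis .
  qed
qed simp

lemma ex_descent:
  assumes w: "w permutes {1..n}" and "w \<noteq> id"
  shows "\<exists>i\<in>{1..<n}. w (Suc i) < w i"
proof (rule ccontr)
  assume no: "\<not> ?thesis"
  have "w i < w j" if "i \<in> {1..n}" "j \<in> {1..n}" "i < j" for i j
  proof (rule mono_of_adjacent[OF _ that(3)])
    fix k assume "i \<le> k" "k < j"
    then have "k \<in> {1..<n}" using that by auto
    then show "w k < w (Suc k)" using no permutes_less_cases[OF w, of k "Suc k"] by auto
  qed
  then have "w = id" by (rule permutes_mono_id[OF w])
  then show False using assms by simp
qed

lemma len_eq_0: "w permutes {1..n} \<Longrightarrow> len w = 0 \<Longrightarrow> w = id"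
  using ex_descent len_comp_adj_down by (metis Zero_not_Suc)

section \<open>Words in adjacent transpositions and Matsumoto's theorem\<close>

lemma word_perm_Nil [simp]: "word_perm [] = id"
  and word_perm_Cons [simp]: "word_perm (i # ws) = adj i \<circ> word_perm ws"
  by (simp_all add: word_perm_def)

lemma word_perm_append: "word_perm (us @ vs) = word_perm us \<circ> word_perm vs"
  by (induction us) (auto simp: o_assoc)

lemma word_perm_permutes: "set ws \<subseteq> {1..<n} \<Longrightarrow> word_perm ws permutes {1..n}"
proof (induction ws)
  case Nil show ?case by (simp only: word_perm_Nil permutes_id)
next
  case (Cons i ws)
  have "adj i \<circ> word_perm ws permutes {1..n}"
    by (rule permutes_compose[OF _ adj_permutes]) (use Cons in auto)
  then show ?case by (simp only: word_perm_Cons)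
qed

lemma len_adj_comp_le:
  assumes w: "w permutes {1..n}" and i: "i \<in> {1..<n}"
  shows "len (adj i \<circ> w) \<le> Suc (len w)"
  using permutes_less_cases[OF permutes_inv[OF w], of i "Suc i"] len_adj_comp_up[OF w i] len_adj_comp_down[OF w i]
  by fastforce

lemma len_word_perm: "set ws \<subseteq> {1..<n} \<Longrightarrow> len (word_perm ws) \<le> length ws"
proof (induction ws)
  case (Cons i ws)
  have "len (adj i \<circ> word_perm ws) \<le> Suc (len (word_perm ws))"
    by (rule len_adj_comp_le[OF word_perm_permutes]) (use Cons in auto)
  moreover have "len (word_perm ws) \<le> length ws" using Cons by auto
  ultimately have "len (adj i \<circ> word_perm ws) \<le> length (i # ws)" by simp
  then show ?case by (simp only: word_perm_Cons)
qed (simp add: len_id)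

text \<open>A descent of \<open>pinv w\<close> lets a transposition be split off on the left while
  the length drops by one, so the word is found from its first letter on.\<close>

lemma ex_reduced_word:
  "w permutes {1..n} \<Longrightarrow> \<exists>ws. set ws \<subseteq> {1..<n} \<and> word_perm ws = w \<and> length ws = len w"
proof (induction "len w" arbitrary: w)
  case 0
  then have "w = id" using len_eq_0[of w n] by simp
  show ?case
  proof (intro exI conjI)
    show "set [] \<subseteq> {1..<n}" by simp
    show "word_perm [] = w" using \<open>w = id\<close> by simp
    show "length [] = len w" using 0 by simp
  qed
next
  case (Suc l)
  have "pinv w \<noteq> id"
  proof
    assume "pinv w = id"
    then have "len w = 0" using len_inv[OF Suc.prems] by (simp add: len_id)
    then show False using Suc by simp
  qed
  then obtain i where i: "i \<in> {1..<n}" "pinv w (Suc i) < pinv w i"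
    using ex_descent[OF permutes_inv[OF Suc.prems]] by blast
  let ?w = "adj i \<circ> w"
  have l: "Suc (len ?w) = len w" by (rule len_adj_comp_down[OF Suc.prems i])
  then have "l = len ?w" using Suc.hyps(2) by simp
  then obtain ws where ws: "set ws \<subseteq> {1..<n}" "word_perm ws = ?w" "length ws = len ?w"
    using Suc.hyps(1)[of ?w] permutes_compose[OF Suc.prems adj_permutes[OF i(1)]] by blast
  show ?case
    by (intro exI[of _ "i # ws"]) (use ws l i in \<open>simp add: adj_adj_comp\<close>)
qed

text \<open>\<open>reduced_word\<close> minimizes over all words for \<open>w\<close>. By
  \<open>len_word_perm\<close> no word is shorter than the number of inversions, and
  \<open>ex_reduced_word\<close> attains this bound.\<close>

lemma reduced_word:
  assumes w: "w permutes {1..n}"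
  shows "set (reduced_word n w) \<subseteq> {1..<n}" "word_perm (reduced_word n w) = w"
    "length (reduced_word n w) = len w"
proof -
  obtain ws where ws: "set ws \<subseteq> {1..<n}" "word_perm ws = w" "length ws = len w"
    using ex_reduced_word[OF w] by blast
  let ?P = "\<lambda>ws. set ws \<subseteq> {1..<n} \<and> word_perm ws = w"
  have P: "?P ws" using ws by simp
  have *: "?P (reduced_word n w)"
    unfolding reduced_word_def by (rule arg_min_natI[where P = ?P, OF P])
  have "length (reduced_word n w) \<le> length ws"
    unfolding reduced_word_def by (rule arg_min_nat_le[where P = ?P, OF P])
  then show "set (reduced_word n w) \<subseteq> {1..<n}" "word_perm (reduced_word n w) = w"
    "length (reduced_word n w) = len w"
    using * ws len_word_perm[of "reduced_word n w" n] by auto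
qed

text \<open>Matsumoto's theorem for an arbitrary function of words. If the first letters i and j
  differ, both are left descents of the permutation, which therefore has reduced words beginning
  with the two forms of the longest word in i and j. The induction hypothesis on the tails links
  these words to \<open>us\<close> and to \<open>vs\<close>, and a braid relation exchanges their
  beginnings.\<close>

lemma matsumoto:
  fixes P :: "nat list \<Rightarrow> 'a"
  assumes cong: "\<And>i u v. i \<in> {1..<n} \<Longrightarrow> set u \<subseteq> {1..<n} \<Longrightarrow> set v \<subseteq> {1..<n} \<Longrightarrow> P u = P v \<Longrightarrow> P (i # u) = P (i # v)"
    and comm: "\<And>i j u. i \<in> {1..<n} \<Longrightarrow> j \<in> {1..<n} \<Longrightarrow> i + 2 \<le> j \<Longrightarrow> set u \<subseteq> {1..<n} \<Longrightarrow> P (i # j # u) = P (j # i # u)"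
    and braid: "\<And>i u. i \<in> {1..<n} \<Longrightarrow> Suc i \<in> {1..<n} \<Longrightarrow> set u \<subseteq> {1..<n} \<Longrightarrow>
        P (i # Suc i # i # u) = P (Suc i # i # Suc i # u)"
    and u: "set us \<subseteq> {1..<n}" "length us = len (word_perm us)"
    and v: "set vs \<subseteq> {1..<n}" "length vs = len (word_perm vs)"
    and eq: "word_perm us = word_perm vs"
  shows "P us = P vs"
  using u v eq
proof (induction "length us" arbitrary: us vs rule: less_induct)
  case less
  define w where "w = word_perm us"
  have w: "w permutes {1..n}" unfolding w_def by (rule word_perm_permutes) fact
  \<comment> \<open>If the first letter of a reduced word were not a left descent, the tail would
    represent a permutation with more inversions than the tail has letters.\<close>
  have descent: "pinv w (Suc i) < pinv w i" "length x = len (word_perm x)" "word_perm x = adj i \<circ> w" "i \<in> {1..<n}" "set x \<subseteq> {1..<n}"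
    if "i # x = us \<or> i # x = vs" for i x
  proof -
    show s: "i \<in> {1..<n}" "set x \<subseteq> {1..<n}" using that less.prems by auto
    have wx: "w = adj i \<circ> word_perm x" using that less.prems w_def by auto
    then show x: "word_perm x = adj i \<circ> w" by (simp add: adj_adj_comp)
    have lw: "Suc (length x) = len w" using that less.prems w_def by auto
    have le: "len (adj i \<circ> w) \<le> length x" using len_word_perm[OF s(2)] x by simp
    show d: "pinv w (Suc i) < pinv w i"
    proof (rule ccontr)
      assume "\<not> ?thesis"
      then have "pinv w i < pinv w (Suc i)" using permutes_less_cases[OF permutes_inv[OF w], of i "Suc i"] by auto
      from len_adj_comp_up[OF w s(1) this] show False using lw le by simp
    qed
    show "length x = len (word_perm x)" using len_adj_comp_down[OF w s(1) d] lw x by simp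
  qed
  have main: "P (i # x) = P (j # y)" if ij: "i < j"
    and x: "i # x = us \<or> i # x = vs" and y: "j # y = us \<or> j # y = vs" for i j x y
  proof -
    note dx = descent[OF x] and dy = descent[OF y]
    have lx: "length x < length us" "length y < length us" using x y less.prems by auto
    have w': "adj k \<circ> w permutes {1..n}" if "k \<in> {1..<n}" for k
      using permutes_compose[OF w adj_permutes[OF that]] .
    show ?thesis
    proof (cases "i + 2 \<le> j")
      case True
      let ?w2 = "adj j \<circ> (adj i \<circ> w)"
      have d2: "pinv (adj i \<circ> w) (Suc j) < pinv (adj i \<circ> w) j"
        using dy(1) True by (simp add: inv_adj_comp[OF w dx(4)] transpose_def)
      have p2: "?w2 permutes {1..n}" by (rule permutes_compose[OF w'[OF dx(4)] adj_permutes[OF dy(4)]])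
      have l2: "Suc (len ?w2) = len (adj i \<circ> w)" by (rule len_adj_comp_down[OF w'[OF dx(4)] dy(4) d2])
      obtain z where z: "set z \<subseteq> {1..<n}" "word_perm z = ?w2" "length z = len ?w2"
        using ex_reduced_word[OF p2] by blast
      have sw: "adj j \<circ> (adj i \<circ> w) = adj i \<circ> (adj j \<circ> w)"
        using True by (auto simp: fun_eq_iff transpose_def)
      have wz: "word_perm (j # z) = adj i \<circ> w" "word_perm (i # z) = adj j \<circ> w"
        unfolding word_perm_Cons z(2) by (simp add: adj_adj_comp, simp add: sw adj_adj_comp)
      have ly: "len (adj i \<circ> w) = len (adj j \<circ> w)"
        using len_adj_comp_down[OF w dx(4) dx(1)] len_adj_comp_down[OF w dy(4) dy(1)] by simp
      have "P x = P (j # z)"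
        by (rule less.hyps) (use lx dx dy z wz l2 in auto)
      moreover have "P y = P (i # z)"
        by (rule less.hyps) (use lx dx dy z wz l2 ly in auto)
      ultimately have "P (i # x) = P (i # j # z)" "P (j # y) = P (j # i # z)"
        using dx(4,5) dy(4,5) z(1) by (auto intro!: cong)
      then show ?thesis using comm[OF dx(4) dy(4) True z(1)] by simp
    next
      case False
      then have j: "j = Suc i" using ij by simp
      note jn = dy(4)[unfolded j] and dj = dy(1)[unfolded j]
      \<comment> \<open>\<open>?c\<close> is what remains of \<open>w\<close> after the longest
        element generated by \<open>adj i\<close> and \<open>adj (Suc i)\<close> has been split off
        on the left; a reduced word for it completes both sides of the braid relation.\<close>
      let ?a = "adj i \<circ> w" let ?b = "adj (Suc i) \<circ> ?a" let ?c = "adj i \<circ> ?b"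
      have ia: "pinv ?a = pinv w \<circ> adj i" by (rule inv_adj_comp[OF w dx(4)])
      have pa: "?a permutes {1..n}" by (rule w'[OF dx(4)])
      have pb: "?b permutes {1..n}" by (rule permutes_compose[OF pa adj_permutes[OF jn]])
      have ib: "pinv ?b = pinv w \<circ> adj i \<circ> adj (Suc i)" by (simp only: inv_adj_comp[OF pa jn] ia)
      have pc: "?c permutes {1..n}" by (rule permutes_compose[OF pb adj_permutes[OF dx(4)]])
      have lb: "Suc (len ?b) = len ?a"
        by (rule len_adj_comp_down[OF pa jn]) (use dx(1) dj in \<open>simp add: ia transpose_def\<close>)
      have lc: "Suc (len ?c) = len ?b"
        by (rule len_adj_comp_down[OF pb dx(4)]) (use dx(1) dj in \<open>simp add: ib transpose_def\<close>)
      obtain z where z: "set z \<subseteq> {1..<n}" "word_perm z = ?c" "length z = len ?c"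
        using ex_reduced_word[OF pc] by blast
      have wz: "word_perm (Suc i # i # z) = ?a" unfolding word_perm_Cons z(2) by (simp add: adj_adj_comp)
      have wz2: "word_perm (i # Suc i # z) = adj (Suc i) \<circ> w"
        unfolding word_perm_Cons z(2) by (auto simp: fun_eq_iff transpose_def)
      have ly: "len ?a = len (adj (Suc i) \<circ> w)"
        using len_adj_comp_down[OF w dx(4) dx(1)] len_adj_comp_down[OF w jn dj] by simp
      have "P x = P (Suc i # i # z)"
        by (rule less.hyps) (use lx dx jn z wz lb lc in auto)
      moreover have "P y = P (i # Suc i # z)"
        by (rule less.hyps) (use lx dx dy j z wz2 lb lc ly in auto)
      ultimately have "P (i # x) = P (i # Suc i # i # z)" "P (Suc i # y) = P (Suc i # i # Suc i # z)"
        using cong[OF dx(4), of x "Suc i # i # z"] cong[OF jn, of y "i # Suc i # z"] dx(4,5) dy(5) jn z(1)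
        by simp_all
      then show ?thesis using braid[OF dx(4) jn z(1)] j by simp
    qed
  qed
  show ?case
  proof (cases us)
    case Nil
    then show ?thesis using less.prems by (simp add: len_id)
  next
    case (Cons i x)
    then obtain j y where vs: "vs = j # y" using less.prems by (cases vs) (auto simp: len_id)
    consider "i = j" | "i < j" | "j < i" by linarith
    then show ?thesis
    proof cases
      case 1
      note di = descent[of i x] and dj = descent[of i y]
      have "P x = P y"
        by (rule less.hyps) (use di dj Cons vs 1 in auto)
      then have "P (i # x) = P (i # y)" using Cons vs 1 by (intro cong di dj) auto
      then show ?thesis using Cons vs 1 by simp
    next
      case 2 then show ?thesis using main[of i j x y] Cons vs by simp
    next
      case 3 then show ?thesis using main[of j i y x] Cons vs by simp
    qed
  qed
qed

section \<open>Young subgroups and distinguished coset representatives\<close>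

text \<open>A composition enters only through the weakly increasing function sending a position to the
  index of its block.\<close>

definition yg :: "nat \<Rightarrow> (nat \<Rightarrow> nat) \<Rightarrow> (nat \<Rightarrow> nat) set" where
  "yg n b = {w. w permutes {1..n} \<and> (\<forall>p\<in>{1..n}. b (w p) = b p)}"

text \<open>These \<open>d\<close> are the shortest representatives of the left cosets of
  \<open>yg n b\<close>: by \<open>len_comp_yg\<close>, the element \<open>d \<circ> t\<close> has
  length \<open>len d + len t\<close>.\<close>

definition inc_on_blocks :: "nat \<Rightarrow> (nat \<Rightarrow> nat) \<Rightarrow> (nat \<Rightarrow> nat) \<Rightarrow> bool" where
  "inc_on_blocks n b d \<longleftrightarrow> (\<forall>i\<in>{1..n}. \<forall>j\<in>{1..n}. i < j \<longrightarrow> b i = b j \<longrightarrow> d i < d j)"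

lemma yg_permutes: "w \<in> yg n b \<Longrightarrow> w permutes {1..n}"
  by (simp add: yg_def)

lemma permutes_mem: "w permutes S \<Longrightarrow> i \<in> S \<Longrightarrow> w i \<in> S"
  by (simp add: permutes_in_image)

lemma id_yg: "id \<in> yg n b"
  using permutes_id by (auto simp: yg_def simp del: One_nat_def)

lemma yg_block: "w \<in> yg n b \<Longrightarrow> p \<in> {1..n} \<Longrightarrow> b (w p) = b p"
  unfolding yg_def by blast

lemma ygI: "w permutes {1..n} \<Longrightarrow> (\<And>p. p \<in> {1..n} \<Longrightarrow> b (w p) = b p) \<Longrightarrow> w \<in> yg n b"
  unfolding yg_def by blast

lemma comp_yg:
  assumes v: "v \<in> yg n b" and w: "w \<in> yg n b" shows "v \<circ> w \<in> yg n b"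
proof (rule ygI[OF permutes_compose[OF yg_permutes[OF w] yg_permutes[OF v]]])
  fix p assume p: "p \<in> {1..n}"
  show "b ((v \<circ> w) p) = b p"
    using yg_block[OF v permutes_mem[OF yg_permutes[OF w] p]] yg_block[OF w p] by simp
qed

lemma inv_yg:
  assumes "w \<in> yg n b" shows "pinv w \<in> yg n b"
proof -
  have w: "w permutes {1..n}" by (rule yg_permutes) fact
  have "b (pinv w p) = b p" if "p \<in> {1..n}" for p
  proof -
    have "b (w (pinv w p)) = b (pinv w p)"
      using assms permutes_mem[OF permutes_inv[OF w] that] by (simp only: yg_def) blast
    then show ?thesis by (simp add: permutes_inverses[OF w])
  qed
  then show ?thesis using permutes_inv[OF w] by (simp only: yg_def) blast
qed

lemma finite_yg: "finite (yg n b)"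
  by (rule finite_subset[OF _ finite_permutations[of "{1..n}"]]) (auto simp: yg_def)

text \<open>Blocks are intervals. Monotonicity of \<open>b\<close> compares the labels of i and j
  directly, and once more through their images, which \<open>t\<close> keeps in the same blocks but
  lists in the opposite order.\<close>

lemma yg_inversion:
  assumes t: "t \<in> yg n b" and b: "mono_on {1..n} b" and ij: "i < j" "t j < t i"
  shows "i \<in> {1..n}" "j \<in> {1..n}" "b i = b j"
proof -
  have p: "t permutes {1..n}" using t by (rule yg_permutes)
  have "(i, j) \<in> inversions t" using ij by (simp add: inversions_def)
  then show i: "i \<in> {1..n}" and j: "j \<in> {1..n}" using inversions_subset[OF p] by blast+
  have "b (t j) \<le> b (t i)"
    using mono_onD[OF b permutes_mem[OF p j] permutes_mem[OF p i]] ij by simp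
  then have "b j \<le> b i" using t i j by (auto simp: yg_def)
  moreover have "b i \<le> b j" using mono_onD[OF b i j] ij by simp
  ultimately show "b i = b j" by simp
qed

text \<open>The inversions of \<open>t\<close> lie inside blocks, where \<open>d\<close> is
  increasing, so \<open>len_comp_add\<close> applies.\<close>

lemma len_comp_yg:
  assumes d: "d permutes {1..n}" "inc_on_blocks n b d" and t: "t \<in> yg n b" and b: "mono_on {1..n} b"
  shows "len (d \<circ> t) = len d + len t"
proof (rule len_comp_add[OF d(1) yg_permutes[OF t]])
  fix i j assume ij: "i < j" "t j < t i"
  note y = yg_inversion[OF t b ij]
  have "b (t i) = b i" "b (t j) = b j" using t y by (auto simp: yg_def)
  then have "b (t j) = b (t i)" using y by simp
  then show "d (t j) < d (t i)"
    using d(2) ij permutes_mem[OF yg_permutes[OF t] y(1)] permutes_mem[OF yg_permutes[OF t] y(2)]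
    unfolding inc_on_blocks_def by blast
qed

text \<open>Positions between two positions of one block belong to that block, so a failure of
  strict increase shows up at neighbours. Taking a general \<open>f\<close> also covers decreasing
  permutations, through \<open>n - w p\<close>.\<close>

lemma ex_ascent_descent_block:
  fixes f b :: "nat \<Rightarrow> nat"
  assumes b: "mono_on {1..n} b" and "i \<in> {1..n}" "j \<in> {1..n}" "i < j" "b i = b j" "\<not> f i < f j"
  shows "\<exists>k\<in>{1..<n}. b k = b (Suc k) \<and> \<not> f k < f (Suc k)"
proof (rule ccontr)
  assume no: "\<not> ?thesis"
  have "f i < f j"
  proof (rule mono_of_adjacent[OF _ assms(4)])
    fix k assume k: "i \<le> k" "k < j"
    have "b i \<le> b k" "b k \<le> b (Suc k)" "b (Suc k) \<le> b j"
      using k assms(2-4) mono_onD[OF b, of i k] mono_onD[OF b, of k "Suc k"] mono_onD[OF b, of "Suc k" j] by auto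
    then have "b k = b (Suc k)" using assms(5) by linarith
    moreover have "k \<in> {1..<n}" using k assms by auto
    ultimately show "f k < f (Suc k)" using no by blast
  qed
  then show False using assms by simp
qed

lemma adj_yg: "k \<in> {1..<n} \<Longrightarrow> b k = b (Suc k) \<Longrightarrow> adj k \<in> yg n b"
  using adj_permutes by (simp only: yg_def) (auto simp: transpose_def)

text \<open>Sorting inside the blocks: as long as some neighbours in one block are in the wrong
  order, exchanging them shortens the permutation.\<close>

lemma coset_decomposition:
  assumes b: "mono_on {1..n} b"
  shows "w permutes {1..n} \<Longrightarrow>
    \<exists>d t. d permutes {1..n} \<and> inc_on_blocks n b d \<and> t \<in> yg n b \<and> w = d \<circ> t"
proof (induction "len w" arbitrary: w rule: less_induct)
  case less
  show ?case
  proof (cases "inc_on_blocks n b w")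
    case True then show ?thesis using less.prems id_yg by (intro exI[of _ w] exI[of _ id]) simp
  next
    case False
    then obtain k where k: "k \<in> {1..<n}" "b k = b (Suc k)" "\<not> w k < w (Suc k)"
      using ex_ascent_descent_block[OF b] unfolding inc_on_blocks_def by meson
    then have "w (Suc k) < w k" using permutes_less_cases[OF less.prems, of k "Suc k"] by auto
    from len_comp_adj_down[OF less.prems k(1) this]
    obtain d t where "d permutes {1..n}" "inc_on_blocks n b d" "t \<in> yg n b" "w \<circ> adj k = d \<circ> t"
      using less.hyps[of "w \<circ> adj k"] permutes_compose[OF adj_permutes[OF k(1)] less.prems] by auto
    moreover from this(4) have "w = d \<circ> (t \<circ> adj k)" by (metis comp_adj_adj o_assoc)
    ultimately show ?thesis using comp_yg[OF _ adj_yg[OF k(1,2)]] by blast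
  qed
qed

text \<open>The element h = t t'^-1 lies in the Young subgroup and d' = d h. An inversion of h would
  lie inside a block, where d and d' both increase, which is impossible.\<close>

lemma coset_decomposition_unique:
  assumes b: "mono_on {1..n} b"
    and d: "d permutes {1..n}" "inc_on_blocks n b d" and d': "d' permutes {1..n}" "inc_on_blocks n b d'"
    and t: "t \<in> yg n b" and t': "t' \<in> yg n b" and eq: "d \<circ> t = d' \<circ> t'"
  shows "d = d' \<and> t = t'"
proof -
  define h where "h = t \<circ> pinv t'"
  have h: "h \<in> yg n b" unfolding h_def by (intro comp_yg inv_yg t t')
  have "d \<circ> h = d' \<circ> t' \<circ> pinv t'" by (simp add: h_def eq[symmetric] o_assoc)
  then have dh: "d' = d \<circ> h"
    using permutes_inverses(1)[OF yg_permutes[OF t']] by (auto simp: fun_eq_iff)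
  have "h = id"
  proof (rule permutes_mono_id[OF yg_permutes[OF h]])
    fix i j assume ij: "i \<in> {1..n}" "j \<in> {1..n}" "i < j"
    have "\<not> h j < h i"
    proof
      assume hh: "h j < h i"
      note y = yg_inversion[OF h b ij(3) hh]
      have "d' i < d' j" using d'(2) ij y(3) unfolding inc_on_blocks_def by blast
      moreover have "b (h j) = b (h i)" using h ij y(3) unfolding yg_def by simp
      then have "d (h j) < d (h i)"
        using d(2) hh permutes_mem[OF yg_permutes[OF h] ij(1)] permutes_mem[OF yg_permutes[OF h] ij(2)]
        unfolding inc_on_blocks_def by blast
      ultimately show False by (simp add: dh)
    qed
    then show "h i < h j" using permutes_less_cases[OF yg_permutes[OF h], of i j] ij by auto
  qed
  then have "d = d'" using dh by simp
  moreover have "t = t'"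
  proof
    fix p
    have "d (t p) = d (t' p)" using eq \<open>d = d'\<close> by (metis comp_apply)
    then show "t p = t' p" using injD[OF permutes_inj[OF d(1)]] by blast
  qed
  ultimately show ?thesis by simp
qed

text \<open>The Young subgroup is generated by the exchanges of neighbours in one block. A descent
  of \<open>t\<close> is such an exchange by \<open>yg_inversion\<close>, and removing it shortens
  \<open>t\<close>.\<close>

lemma yg_invariant:
  assumes b: "mono_on {1..n} b"
    and f: "\<And>w k. w permutes {1..n} \<Longrightarrow> k \<in> {1..<n} \<Longrightarrow> b k = b (Suc k) \<Longrightarrow> f (w \<circ> adj k) = f w"
    and w: "w permutes {1..n}"
  shows "t \<in> yg n b \<Longrightarrow> f (w \<circ> t) = f w"
proof (induction "len t" arbitrary: t rule: less_induct)
  case less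
  show ?case
  proof (cases "t = id")
    case False
    then obtain k where k: "k \<in> {1..<n}" "t (Suc k) < t k" using ex_descent[OF yg_permutes[OF less.prems]] by blast
    have bk: "b k = b (Suc k)" using yg_inversion[OF less.prems b _ k(2)] by simp
    have "Suc (len (t \<circ> adj k)) = len t" by (rule len_comp_adj_down[OF yg_permutes[OF less.prems] k])
    then have "f (w \<circ> (t \<circ> adj k)) = f w"
      using less.hyps comp_yg[OF less.prems adj_yg[OF k(1) bk]] by simp
    moreover have "f (w \<circ> (t \<circ> adj k) \<circ> adj k) = f (w \<circ> (t \<circ> adj k))"
      by (rule f[OF _ k(1) bk])
        (rule permutes_compose[OF permutes_compose[OF adj_permutes[OF k(1)] yg_permutes[OF less.prems]] w])
    moreover have "w \<circ> (t \<circ> adj k) \<circ> adj k = w \<circ> t" by (auto simp: fun_eq_iff)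
    ultimately show ?thesis by simp
  qed simp
qed

text \<open>A sorted sequence is determined by how many of its values exceed each bound. If f p < g
  p, at most n - p values of f exceed f p, but at least n - p + 1 values of g do.\<close>

lemma mono_on_eqI_card:
  fixes f g :: "nat \<Rightarrow> nat"
  assumes f: "mono_on {1..n} f" and g: "mono_on {1..n} g"
    and card: "\<And>c. card {x\<in>{1..n}. c < f x} = card {x\<in>{1..n}. c < g x}"
    and p: "p \<in> {1..n}"
  shows "f p = g p"
proof -
  have main: "\<not> f p < g p" if f: "mono_on {1..n} f" and g: "mono_on {1..n} g"
    and card: "card {x\<in>{1..n}. f p < f x} = card {x\<in>{1..n}. f p < g x}" for f g :: "nat \<Rightarrow> nat"
  proof
    assume less: "f p < g p"
    have "{x\<in>{1..n}. f p < f x} \<subseteq> {p<..n}"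
    proof clarify
      fix x assume x: "x \<in> {1..n}" "f p < f x"
      then have "p < x" using mono_onD[OF f x(1) p] by (meson not_le)
      then show "x \<in> {p<..n}" using x by simp
    qed
    then have "card {x\<in>{1..n}. f p < f x} \<le> n - p" using card_mono[of "{p<..n}"] by simp
    moreover have "{p..n} \<subseteq> {x\<in>{1..n}. f p < g x}"
    proof
      fix x assume x: "x \<in> {p..n}"
      then have "x \<in> {1..n}" using p by auto
      moreover have "g p \<le> g x" using mono_onD[OF g p calculation] x by simp
      ultimately show "x \<in> {x\<in>{1..n}. f p < g x}" using less by simp
    qed
    then have "Suc n - p \<le> card {x\<in>{1..n}. f p < g x}" using card_mono[of "{x\<in>{1..n}. f p < g x}" "{p..n}"] by simp
    ultimately have "Suc n - p \<le> n - p" using card by linarith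
    then show False using p by auto
  qed
  from main[OF f g card] main[OF g f card[symmetric]] show ?thesis by simp
qed

text \<open>Two sorted arrangements of one multiset coincide; \<open>h\<close> carries the set of
  values above any bound bijectively.\<close>

lemma mono_on_perm_eq:
  fixes f :: "nat \<Rightarrow> nat"
  assumes f: "mono_on {1..n} f" and h: "h permutes {1..n}" and g: "mono_on {1..n} (\<lambda>x. f (h x))"
    and p: "p \<in> {1..n}"
  shows "f (h p) = f p"
proof (rule mono_on_eqI_card[OF g f _ p])
  fix c
  have "bij_betw h {x\<in>{1..n}. c < f (h x)} {x\<in>{1..n}. c < f x}"
    by (rule bij_betwI[where g = "pinv h"])
      (use permutes_mem[OF h] permutes_mem[OF permutes_inv[OF h]] in \<open>auto simp: permutes_inverses[OF h]\<close>)
  then show "card {x\<in>{1..n}. c < f (h x)} = card {x\<in>{1..n}. c < f x}" by (rule bij_betw_same_card)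
qed

lemma lex_code:
  fixes a b :: nat
  assumes "b < N" "b' < N"
  shows "a * N + b < a' * N + b' \<longleftrightarrow> a < a' \<or> (a = a' \<and> b < b')"
proof (cases a a' rule: linorder_cases)
  case less
  then have "Suc a * N \<le> a' * N" by (intro mult_right_mono) auto
  then show ?thesis using assms less by auto
next
  case greater
  then have "Suc a' * N \<le> a * N" by (intro mult_right_mono) auto
  then show ?thesis using assms greater by auto
qed simp

text \<open>Equal inversion sets make \<open>w \<circ> pinv z\<close> increasing, hence the
  identity.\<close>

lemma inversions_inject:
  assumes w: "w permutes {1..n}" and z: "z permutes {1..n}" and eq: "inversions w = inversions z"
  shows "w = z"
proof -
  have "w \<circ> pinv z = id"
  proof (rule permutes_mono_id[OF permutes_compose[OF permutes_inv[OF z] w]])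
    fix i j :: nat assume "i < j"
    define a b where "a = pinv z i" and "b = pinv z j"
    have z': "z a < z b" using \<open>i < j\<close> by (simp add: a_def b_def permutes_inverses[OF z])
    then have "a \<noteq> b" by auto
    have iff: "(r, s) \<in> inversions w \<longleftrightarrow> (r, s) \<in> inversions z" for r s using eq by simp
    have "w a < w b"
      using z' iff[of a b] iff[of b a] permutes_less_cases[OF w \<open>a \<noteq> b\<close>] \<open>a \<noteq> b\<close>
      unfolding inversions_def by auto
    then show "(w \<circ> pinv z) i < (w \<circ> pinv z) j" by (simp add: a_def b_def)
  qed
  then have "w (pinv z (z i)) = z i" for i by (metis comp_apply id_apply)
  then show ?thesis by (auto simp: permutes_inverses[OF z])
qed

text \<open>Both \<open>bm \<circ> d\<close> and \<open>bm \<circ> x\<close> are weakly increasing on blocks and agree up to a permutation of the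
  blocks, hence they coincide, and every inversion of \<open>d\<close> is one of \<open>x\<close>.\<close>

lemma coset_leading:
  fixes bp bm :: "nat \<Rightarrow> nat"
  assumes bp: "mono_on {1..n} bp" and bm: "mono_on {1..n} bm"
    and x: "x permutes {1..n}" "inc_on_blocks n bp x"
    and dec: "\<And>r r'. r \<in> {1..n} \<Longrightarrow> r' \<in> {1..n} \<Longrightarrow> r < r' \<Longrightarrow> bp r \<noteq> bp r' \<Longrightarrow> bm (x r) = bm (x r') \<Longrightarrow> x r' < x r"
    and d: "d permutes {1..n}" "inc_on_blocks n bp d"
    and h: "h \<in> yg n bp" and dh: "\<And>p. p \<in> {1..n} \<Longrightarrow> bm (d p) = bm (x (h p))"
  shows "d = x \<or> len d < len x"
proof -
  define N where "N = Suc (bm n)"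
  have N: "bm i < N" if "i \<in> {1..n}" for i using mono_onD[OF bm that, of n] that by (simp add: N_def)
  \<comment> \<open>Codes the pair of labels before and after \<open>v\<close>. It is weakly
    increasing in r because \<open>v\<close> increases on the blocks of \<open>bp\<close>; since
    \<open>h\<close> preserves these blocks, it rearranges the values for \<open>x\<close> into
    those for \<open>d\<close>.\<close>
  define F where "F = (\<lambda>v r. bp r * N + bm (v r))"
  have F: "mono_on {1..n} (F v)" if v: "v permutes {1..n}" "inc_on_blocks n bp v" for v
  proof (rule mono_onI)
    fix r r' assume r: "r \<in> {1..n}" "r' \<in> {1..n}" "r \<le> r'"
    note m = permutes_mem[OF v(1) r(1)] permutes_mem[OF v(1) r(2)]
    have "bp r \<le> bp r'" using mono_onD[OF bp] r by blast
    then consider "r = r'" | "r < r'" "bp r = bp r'" | "bp r < bp r'" using r by linarith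
    then show "F v r \<le> F v r'"
    proof cases
      case 2
      then have "v r < v r'" using v(2) r unfolding inc_on_blocks_def by blast
      then have "bm (v r) \<le> bm (v r')" using mono_onD[OF bm m] by simp
      then show ?thesis using 2 by (simp add: F_def)
    next
      case 3
      then show ?thesis using lex_code[OF N[OF m(1)] N[OF m(2)], of "bp r" "bp r'"] by (simp add: F_def)
    qed simp
  qed
  have Fd: "F x (h p) = F d p" if "p \<in> {1..n}" for p
    using h dh[OF that] that by (simp add: F_def yg_def)
  have "mono_on {1..n} (\<lambda>p. F x (h p))"
    using F[OF d] unfolding mono_on_def by (auto simp: Fd simp del: One_nat_def)
  then have "F x (h p) = F x p" if "p \<in> {1..n}" for p
    using mono_on_perm_eq[OF F[OF x] yg_permutes[OF h] _ that] by blast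
  then have bmd: "bm (d p) = bm (x p)" if "p \<in> {1..n}" for p
    using Fd[OF that] that by (simp add: F_def)
  have sub: "inversions d \<subseteq> inversions x"
  proof
    fix z assume z: "z \<in> inversions d"
    obtain r r' where rr: "z = (r, r')" by (cases z)
    have r: "r \<in> {1..n}" "r' \<in> {1..n}" "r < r'" "d r' < d r"
      using z rr inversions_subset[OF d(1)] by (auto simp: inversions_def simp del: One_nat_def)
    have ne: "bp r \<noteq> bp r'" using d(2) r unfolding inc_on_blocks_def by fastforce
    have "bm (d r') \<le> bm (d r)"
      using mono_onD[OF bm permutes_mem[OF d(1) r(2)] permutes_mem[OF d(1) r(1)]] r by simp
    \<comment> \<open>The \<open>bm\<close>-labels of \<open>d\<close> and \<open>x\<close> agree.
      If the label drops strictly from r to r', then \<open>x\<close> drops as well because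
      \<open>bm\<close> is monotone; if it stays the same, \<open>dec\<close> applies.\<close>
    then consider "bm (x r) = bm (x r')" | "bm (x r') < bm (x r)" using bmd r by fastforce
    then have "x r' < x r"
    proof cases
      case 1 then show ?thesis using dec[OF r(1-3) ne] by simp
    next
      case 2
      then show ?thesis
        using mono_onD[OF bm permutes_mem[OF x(1) r(1)] permutes_mem[OF x(1) r(2)]] by (meson leD not_le)
    qed
    then show "z \<in> inversions x" using rr r by (simp add: inversions_def)
  qed
  show ?thesis
  proof (cases "inversions d = inversions x")
    case True then show ?thesis using inversions_inject[OF d(1) x(1)] by simp
  next
    case False
    then have "card (inversions d) < card (inversions x)"
      using sub finite_inversions[OF x(1)] by (intro psubset_card_mono) auto
    then show ?thesis by (simp add: len_def)
  qed
qed

section \<open>Compositions\<close>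

text \<open>For p in {1..n} this is the index of the block containing p; taking the least index
  passes over empty parts.\<close>

definition blk :: "(nat \<Rightarrow> nat) \<Rightarrow> nat \<Rightarrow> nat" where
  "blk \<nu> p = (LEAST k. p \<le> (\<Sum>i\<le>k. \<nu> i))"

lemma compositions_psum:
  assumes "\<nu> \<in> compositions n"
  shows "\<exists>K. \<forall>k\<ge>K. (\<Sum>i<k. \<nu> i) = n"
proof -
  have fin: "finite {i. \<nu> i \<noteq> 0}" and sum: "(\<Sum>i | \<nu> i \<noteq> 0. \<nu> i) = n"
    using assms by (auto simp: compositions_def)
  obtain K where K: "\<forall>i\<in>{i. \<nu> i \<noteq> 0}. i < K" using fin by (auto simp: finite_nat_set_iff_bounded)
  have "(\<Sum>i<k. \<nu> i) = n" if "k \<ge> K" for k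
    unfolding sum[symmetric] by (rule sum.mono_neutral_right) (use K that in \<open>auto intro: less_le_trans\<close>)
  then show ?thesis by blast
qed

lemma psum_mono: "k \<le> (k' :: nat) \<Longrightarrow> (\<Sum>i<k. \<nu> i) \<le> (\<Sum>i<k'. \<nu> i :: nat)"
  by (rule sum_mono2) auto

lemma compositions_psum_le:
  assumes "\<nu> \<in> compositions n" shows "(\<Sum>i<k. \<nu> i) \<le> n"
proof -
  obtain K where "\<forall>k\<ge>K. (\<Sum>i<k. \<nu> i) = n" using compositions_psum[OF assms] by blast
  then have "(\<Sum>i<max k K. \<nu> i) = n" by simp
  then show ?thesis using psum_mono[of k "max k K" \<nu>] by simp
qed

lemma compositionsI:
  assumes "\<And>k. k \<ge> K \<Longrightarrow> \<nu> k = 0" "(\<Sum>i<K. \<nu> i) = n"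
  shows "\<nu> \<in> compositions n"
proof -
  have sub: "{i. \<nu> i \<noteq> 0} \<subseteq> {..<K}"
  proof
    fix i assume "i \<in> {i. \<nu> i \<noteq> 0}"
    then have "\<not> K \<le> i" using assms(1)[of i] by auto
    then show "i \<in> {..<K}" by simp
  qed
  then have "(\<Sum>i | \<nu> i \<noteq> 0. \<nu> i) = (\<Sum>i<K. \<nu> i)" by (intro sum.mono_neutral_left) auto
  then show ?thesis using sub assms(2) finite_subset by (auto simp: compositions_def)
qed

text \<open>Translates block indices into partial sums, the quantities compared by the dominance
  order. Positions start at 1, so none lies below the empty sum.\<close>

lemma blk_less_iff:
  assumes "\<nu> \<in> compositions n" "p \<in> {1..n}"
  shows "blk \<nu> p < k \<longleftrightarrow> p \<le> (\<Sum>i<k. \<nu> i)"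
proof
  obtain K where "\<forall>k\<ge>K. (\<Sum>i<k. \<nu> i) = n" using compositions_psum[OF assms(1)] by blast
  then have "(\<Sum>i<Suc K. \<nu> i) = n" by (metis le_SucI le_refl)
  then have "(\<Sum>i\<le>K. \<nu> i) = n" by (simp only: lessThan_Suc_atMost)
  then have "p \<le> (\<Sum>i\<le>K. \<nu> i)" using assms(2) by simp
  then have *: "p \<le> (\<Sum>i\<le>blk \<nu> p. \<nu> i)" unfolding blk_def by (rule LeastI)
  {
    assume "blk \<nu> p < k"
    then show "p \<le> (\<Sum>i<k. \<nu> i)"
      using * psum_mono[OF Suc_leI, of "blk \<nu> p" k \<nu>] unfolding lessThan_Suc_atMost by linarith
  next
    assume k: "p \<le> (\<Sum>i<k. \<nu> i)"
    then obtain k' where k': "k = Suc k'" using assms(2) by (cases k) auto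
    then have "blk \<nu> p \<le> k'" unfolding blk_def using k by (intro Least_le) (simp only: lessThan_Suc_atMost)
    then show "blk \<nu> p < k" using k' by simp
  }
qed

lemma nat_eqI_less: "(\<And>k. a < k \<longleftrightarrow> b < k) \<Longrightarrow> a = (b::nat)"
  by (metis lessI less_Suc_eq_le le_antisym)

lemma blk_mono: "\<nu> \<in> compositions n \<Longrightarrow> mono_on {1..n} (blk \<nu>)"
proof (rule mono_onI)
  fix p p' assume \<nu>: "\<nu> \<in> compositions n" and p: "p \<in> {1..n}" "p' \<in> {1..n}" "p \<le> p'"
  have "blk \<nu> p' < Suc (blk \<nu> p')" by simp
  then have "blk \<nu> p < Suc (blk \<nu> p')" using p(3) unfolding blk_less_iff[OF \<nu> p(2)] blk_less_iff[OF \<nu> p(1)] by simp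
  then show "blk \<nu> p \<le> blk \<nu> p'" by simp
qed

lemma mem_block_iff:
  assumes \<nu>: "\<nu> \<in> compositions n"
  shows "p \<in> block \<nu> k \<longleftrightarrow> p \<in> {1..n} \<and> blk \<nu> p = k"
proof -
  have in_range: "p \<in> {1..n}" if "p \<in> block \<nu> k"
    using that compositions_psum_le[OF \<nu>, of "Suc k"] by (auto simp: block_def lessThan_Suc_atMost)
  have "p \<in> block \<nu> k \<longleftrightarrow> blk \<nu> p = k" if p: "p \<in> {1..n}"
  proof -
    have "p \<in> block \<nu> k \<longleftrightarrow> \<not> blk \<nu> p < k \<and> blk \<nu> p < Suc k"
      unfolding blk_less_iff[OF \<nu> p] by (auto simp: block_def lessThan_Suc_atMost)
    then show ?thesis by auto
  qed
  then show ?thesis using in_range by blast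
qed

text \<open>A permutation that preserves labels maps each block into itself; its inverse does so
  too, which gives equality of images.\<close>

lemma young_subgroup_eq:
  assumes \<nu>: "\<nu> \<in> compositions n"
  shows "young_subgroup n \<nu> = yg n (blk \<nu>)"
proof (intro equalityI subsetI)
  fix w assume "w \<in> young_subgroup n \<nu>"
  then have w: "w permutes {1..n}" "\<And>k. w ` block \<nu> k = block \<nu> k" by (auto simp: young_subgroup_def)
  have "blk \<nu> (w p) = blk \<nu> p" if "p \<in> {1..n}" for p
  proof -
    have "p \<in> block \<nu> (blk \<nu> p)" using that mem_block_iff[OF \<nu>] by blast
    then have "w p \<in> block \<nu> (blk \<nu> p)" using w(2) by blast
    then show ?thesis using mem_block_iff[OF \<nu>] by blast
  qed
  then show "w \<in> yg n (blk \<nu>)" using w(1) unfolding yg_def by blast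
next
  have sub: "w ` block \<nu> k \<subseteq> block \<nu> k" if "w \<in> yg n (blk \<nu>)" for w k
    using that permutes_mem[of w "{1..n}"] unfolding yg_def by (auto simp: mem_block_iff[OF \<nu>] simp del: One_nat_def)
  fix w assume w: "w \<in> yg n (blk \<nu>)"
  note p = yg_permutes[OF w]
  have "w ` block \<nu> k = block \<nu> k" for k
  proof (rule antisym[OF sub[OF w]])
    have "w ` pinv w ` block \<nu> k \<subseteq> w ` block \<nu> k" using sub[OF inv_yg[OF w]] by blast
    then show "block \<nu> k \<subseteq> w ` block \<nu> k" by (simp add: image_comp permutes_inverses[OF p] comp_def)
  qed
  then show "w \<in> young_subgroup n \<nu>" using p by (simp add: young_subgroup_def)
qed

lemma card_blk_less:
  assumes \<nu>: "\<nu> \<in> compositions n"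
  shows "card {p\<in>{1..n}. blk \<nu> p < k} = (\<Sum>i<k. \<nu> i)"
proof -
  have "{p\<in>{1..n}. blk \<nu> p < k} = {p\<in>{1..n}. p \<le> (\<Sum>i<k. \<nu> i)}" using blk_less_iff[OF \<nu>] by blast
  also have "\<dots> = {1..(\<Sum>i<k. \<nu> i)}" using compositions_psum_le[OF \<nu>, of k] by auto
  finally show ?thesis by simp
qed

lemma ones_compositions: "ones n \<in> compositions n"
  by (rule compositionsI[of n]) (auto simp: ones_def)

lemma yg_ones: "yg n (blk (ones n)) = {id}"
proof -
  have eq: "p = p'" if p: "p \<in> {1..n}" "p' \<in> {1..n}" and b: "blk (ones n) p = blk (ones n) p'" for p p'
  proof -
    have s: "(\<Sum>i<k. ones n i) = k" if "k \<le> n" for k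
    proof -
      have "(\<Sum>i<k. ones n i) = (\<Sum>i<k. 1)" by (rule sum.cong) (use that in \<open>auto simp: ones_def\<close>)
      then show ?thesis by simp
    qed
    have "p \<le> k \<longleftrightarrow> p' \<le> k" if "k \<le> n" for k
      using blk_less_iff[OF ones_compositions p(1), of k] blk_less_iff[OF ones_compositions p(2), of k] b s[OF that] by simp
    from this[of p] this[of p'] p show ?thesis by auto
  qed
  show ?thesis
  proof (intro equalityI subsetI)
    fix w assume w: "w \<in> yg n (blk (ones n))"
    note pw = yg_permutes[OF w]
    have "w p = p" for p
    proof (cases "p \<in> {1..n}")
      case True
      show ?thesis by (rule eq[OF permutes_mem[OF pw True] True yg_block[OF w True]])
    qed (use permutes_outside[OF pw] in blast)
    then show "w \<in> {id}" by auto
  qed (use id_yg in auto)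
qed

lemma dom_le_refl: "dom_le \<nu> \<nu>" by (simp add: dom_le_def)

lemma dom_le_trans: "dom_le \<alpha> \<beta> \<Longrightarrow> dom_le \<beta> \<nu> \<Longrightarrow> dom_le \<alpha> \<nu>"
  unfolding dom_le_def using le_trans by blast

lemma dom_le_antisym: "dom_le \<alpha> \<beta> \<Longrightarrow> dom_le \<beta> \<alpha> \<Longrightarrow> \<alpha> = \<beta>"
proof
  fix k assume "dom_le \<alpha> \<beta>" "dom_le \<beta> \<alpha>"
  then have e: "(\<Sum>i<k. \<alpha> i) = (\<Sum>i<k. \<beta> i)" for k by (auto simp: dom_le_def intro: le_antisym)
  show "\<alpha> k = \<beta> k" using e[of "Suc k"] e[of k] by simp
qed

section \<open>Factorization through a dominating composition\<close>

text \<open>Ranking by an injective key. The explicit cardinality is kept among the conclusions so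
  that a rank can be compared with the partial sums of a composition.\<close>

lemma rank_permutation:
  fixes c :: "nat \<Rightarrow> nat"
  assumes inj: "inj_on c {1..n}"
  obtains y where "y permutes {1..n}"
    and "\<And>p p'. p \<in> {1..n} \<Longrightarrow> p' \<in> {1..n} \<Longrightarrow> y p < y p' \<longleftrightarrow> c p < c p'"
    and "\<And>p. p \<in> {1..n} \<Longrightarrow> y p = card {x\<in>{1..n}. c x \<le> c p}"
proof
  define y where "y = (\<lambda>p. if p \<in> {1..n} then card {x\<in>{1..n}. c x \<le> c p} else p)"
  show yc: "y p = card {x\<in>{1..n}. c x \<le> c p}" if "p \<in> {1..n}" for p unfolding y_def using that by (simp only: if_True)
  have less: "y p < y p'" if p: "p \<in> {1..n}" "p' \<in> {1..n}" and cc: "c p < c p'" for p p'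
  proof -
    have "{x\<in>{1..n}. c x \<le> c p} \<subseteq> {x\<in>{1..n}. c x \<le> c p'}" using cc by auto
    moreover have "p' \<in> {x\<in>{1..n}. c x \<le> c p'}" "p' \<notin> {x\<in>{1..n}. c x \<le> c p}" using cc p by auto
    ultimately have "{x\<in>{1..n}. c x \<le> c p} \<subset> {x\<in>{1..n}. c x \<le> c p'}" by blast
    then show ?thesis unfolding yc[OF p(1)] yc[OF p(2)] by (intro psubset_card_mono) simp
  qed
  show iff: "y p < y p' \<longleftrightarrow> c p < c p'" if p: "p \<in> {1..n}" "p' \<in> {1..n}" for p p'
  proof (cases "c p" "c p'" rule: linorder_cases)
    case equal
    then have "p = p'" using inj p by (auto dest: inj_onD)
    then show ?thesis by simp
  qed (use less[OF p] less[OF p(2,1)] in auto)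
  have inj_y: "inj_on y {1..n}"
  proof (rule inj_onI)
    fix p p' assume p: "p \<in> {1..n}" "p' \<in> {1..n}" and "y p = y p'"
    then have "c p = c p'" using iff[OF p] iff[OF p(2,1)] by auto
    then show "p = p'" using inj p by (auto dest: inj_onD)
  qed
  have "y p \<in> {1..n}" if p: "p \<in> {1..n}" for p
  proof -
    have "card {x\<in>{1..n}. c x \<le> c p} \<le> card {1..n}" by (rule card_mono) auto
    moreover have "card {p} \<le> card {x\<in>{1..n}. c x \<le> c p}" by (rule card_mono) (use p in auto)
    ultimately show ?thesis unfolding yc[OF p] by simp
  qed
  then have "y ` {1..n} \<subseteq> {1..n}" by blast
  then have "y ` {1..n} = {1..n}" using inj_y by (intro endo_inj_surj) auto
  then have "bij_betw y {1..n} {1..n}" using inj_y by (simp add: bij_betw_def)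
  then show "y permutes {1..n}"
    by (rule bij_imp_permutes) (simp only: y_def if_False)
qed

text \<open>Lowering labels enlarges each set of positions with label below k, so the partial sums
  grow. If the compositions agree, these nested finite sets have equal size for every k and thus
  coincide.\<close>

lemma dom_leI_blk:
  assumes \<alpha>: "\<alpha> \<in> compositions n" and w: "w permutes {1..n}"
    and \<pi>: "\<And>k. (\<Sum>i<k. \<pi> i) = card {p\<in>{1..n}. key p < k}"
    and le: "\<And>p. p \<in> {1..n} \<Longrightarrow> key p \<le> blk \<alpha> (w p)"
  shows "dom_le \<alpha> \<pi>" "\<alpha> = \<pi> \<Longrightarrow> p \<in> {1..n} \<Longrightarrow> key p = blk \<alpha> (w p)"
proof -
  have card: "card {p\<in>{1..n}. blk \<alpha> (w p) < k} = (\<Sum>i<k. \<alpha> i)" for k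
  proof -
    have "bij_betw w {p\<in>{1..n}. blk \<alpha> (w p) < k} {p\<in>{1..n}. blk \<alpha> p < k}"
      by (rule bij_betwI[where g = "pinv w"])
        (use permutes_mem[OF w] permutes_mem[OF permutes_inv[OF w]] in \<open>auto simp: permutes_inverses[OF w]\<close>)
    from bij_betw_same_card[OF this] show ?thesis unfolding card_blk_less[OF \<alpha>] .
  qed
  have sub: "{p\<in>{1..n}. blk \<alpha> (w p) < k} \<subseteq> {p\<in>{1..n}. key p < k}" for k
    using le le_less_trans by blast
  show "dom_le \<alpha> \<pi>"
    unfolding dom_le_def card[symmetric] \<pi> by (intro allI card_mono sub) simp
  show "key p = blk \<alpha> (w p)" if "\<alpha> = \<pi>" and p: "p \<in> {1..n}"
  proof (rule nat_eqI_less)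
    fix k
    have "{p\<in>{1..n}. blk \<alpha> (w p) < k} = {p\<in>{1..n}. key p < k}"
    proof (rule card_subset_eq[OF _ sub])
      show "card {p\<in>{1..n}. blk \<alpha> (w p) < k} = card {p\<in>{1..n}. key p < k}"
        unfolding card by (simp only: \<pi> that(1))
    qed simp
    then show "key p < k \<longleftrightarrow> blk \<alpha> (w p) < k" using p by blast
  qed
qed

text \<open>Position \<open>p\<close> gets the smaller of the block indices of \<open>p\<close> and of \<open>w p\<close> as its key; \<open>\<pi>\<close> counts the
  keys, \<open>t \<circ> e\<close> sorts the positions by increasing key and decreasing position, \<open>e\<close> by increasing key
  and increasing position.\<close>

lemma key_factorization:
  assumes \<alpha>: "\<alpha> \<in> compositions n" and \<beta>: "\<beta> \<in> compositions n" and w: "w permutes {1..n}"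
    and deca: "\<And>i j. i \<in> {1..n} \<Longrightarrow> j \<in> {1..n} \<Longrightarrow> i < j \<Longrightarrow> blk \<alpha> i = blk \<alpha> j \<Longrightarrow> w j < w i"
    and decb: "\<And>i j. i \<in> {1..n} \<Longrightarrow> j \<in> {1..n} \<Longrightarrow> i < j \<Longrightarrow> blk \<beta> i = blk \<beta> j \<Longrightarrow> pinv w j < pinv w i"
  obtains \<pi> x t e where "\<pi> \<in> compositions n" "dom_le \<alpha> \<pi>" "dom_le \<beta> \<pi>"
    "\<alpha> = \<pi> \<Longrightarrow> \<beta> = \<pi> \<Longrightarrow> w \<in> yg n (blk \<pi>)"
    "x permutes {1..n}" "e permutes {1..n}" "t \<in> yg n (blk \<pi>)" "w = x \<circ> t \<circ> e" "len w = len x + len t + len e"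
    "inc_on_blocks n (blk \<pi>) x" "inc_on_blocks n (blk \<pi>) (pinv e)"
    "\<And>g. g \<in> yg n (blk \<pi>) \<Longrightarrow> g = t \<or> len g < len t"
    "\<And>d h. d permutes {1..n} \<Longrightarrow> inc_on_blocks n (blk \<pi>) d \<Longrightarrow> h \<in> yg n (blk \<pi>) \<Longrightarrow>
      (\<And>p. p \<in> {1..n} \<Longrightarrow> blk \<beta> (d p) = blk \<beta> (x (h p))) \<Longrightarrow> d = x \<or> len d < len x"
    "\<And>d h. d permutes {1..n} \<Longrightarrow> inc_on_blocks n (blk \<pi>) d \<Longrightarrow> h \<in> yg n (blk \<pi>) \<Longrightarrow>
      (\<And>p. p \<in> {1..n} \<Longrightarrow> blk \<alpha> (d p) = blk \<alpha> (pinv e (h p))) \<Longrightarrow> d = pinv e \<or> len d < len (pinv e)"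
proof -
  define key where "key = (\<lambda>p. min (blk \<beta> (w p)) (blk \<alpha> p))"
  define \<pi> where "\<pi> = (\<lambda>k. card {p\<in>{1..n}. key p = k})"
  \<comment> \<open>Larger than both tie-breakers, p and n - p, as \<open>lex_code\<close>
    requires.\<close>
  define N where "N = Suc n"
  note ma = blk_mono[OF \<alpha>] and mb = blk_mono[OF \<beta>]
  have psum: "(\<Sum>i<k. \<pi> i) = card {p\<in>{1..n}. key p < k}" for k
  proof (induction k)
    case (Suc k)
    have "{p\<in>{1..n}. key p < Suc k} = {p\<in>{1..n}. key p < k} \<union> {p\<in>{1..n}. key p = k}" by auto
    moreover have "card \<dots> = card {p\<in>{1..n}. key p < k} + card {p\<in>{1..n}. key p = k}"
      by (rule card_Un_disjoint) auto
    ultimately show ?case using Suc by (simp add: \<pi>_def)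
  qed simp
  \<comment> \<open>The inserted 0 keeps the maximum defined when n = 0.\<close>
  define L where "L = Suc (Max (insert 0 (key ` {1..n})))"
  have L: "key p < L" if "p \<in> {1..n}" for p
    unfolding L_def less_Suc_eq_le by (rule Max_ge) (use that in auto)
  have \<pi>: "\<pi> \<in> compositions n"
  proof (rule compositionsI[of L])
    fix k assume "k \<ge> L"
    then have "{p\<in>{1..n}. key p = k} = {}" using L by fastforce
    then show "\<pi> k = 0" by (simp add: \<pi>_def)
  next
    have "{p\<in>{1..n}. key p < L} = {1..n}" using L by blast
    then show "(\<Sum>i<L. \<pi> i) = n" unfolding psum by simp
  qed
  note mp = blk_mono[OF \<pi>]
  \<comment> \<open>Whatever the tie-breaker \<open>f\<close>, sorting by key places the positions
    of key k exactly in the k-th block of \<pi>: the rank of p is compared with the number of keys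
    below k, which is the k-th partial sum.\<close>
  have blk_rank: "blk \<pi> (y p) = key p"
    if y: "y permutes {1..n}" and p: "p \<in> {1..n}" and yp: "y p = card {x\<in>{1..n}. key x * N + f x \<le> key p * N + f p}"
      and f: "\<And>x. x \<in> {1..n} \<Longrightarrow> f x < N" for y p and f :: "nat \<Rightarrow> nat"
  proof (rule nat_eqI_less)
    fix k
    have "blk \<pi> (y p) < k \<longleftrightarrow> card {x\<in>{1..n}. key x * N + f x \<le> key p * N + f p} \<le> card {x\<in>{1..n}. key x < k}"
      (is "_ \<longleftrightarrow> card ?A \<le> card ?B")
      using blk_less_iff[OF \<pi> permutes_mem[OF y p], of k] unfolding psum yp .
    moreover have "card ?A \<le> card ?B" if "key p < k"
    proof (rule card_mono)
      show "?A \<subseteq> ?B"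
      proof
        fix x assume "x \<in> ?A"
        then have x: "x \<in> {1..n}" "key x * N + f x \<le> key p * N + f p" by blast+
        have "key x \<le> key p" using x lex_code[OF f[OF p] f[OF x(1)], of "key p" "key x"] by linarith
        then show "x \<in> ?B" using x that by simp
      qed
    qed simp
    moreover have "card ?B < card ?A" if k: "\<not> key p < k"
    proof (rule psubset_card_mono)
      show "?B \<subset> ?A"
      proof (rule psubsetI)
        show "?B \<subseteq> ?A"
        proof
          fix x assume "x \<in> ?B"
          then have x: "x \<in> {1..n}" "key x < k" by blast+
          have "key x * N + f x < key p * N + f p" using x k lex_code[OF f[OF x(1)] f[OF p], of "key x" "key p"] by linarith
          then show "x \<in> ?A" using x by simp
        qed
        have "p \<in> ?A" "p \<notin> ?B" using p k by auto
        then show "?B \<noteq> ?A" by blast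
      qed
    qed simp
    ultimately show "blk \<pi> (y p) < k \<longleftrightarrow> key p < k" by (meson not_less)
  qed
  have fe: "p < N" if "p \<in> {1..n}" for p using that by (simp add: N_def)
  have fy: "n - p < N" for p by (simp add: N_def)
  have "inj_on (\<lambda>p. key p * N + p) {1..n}"
  proof (rule inj_onI)
    fix p p' assume p: "p \<in> {1..n}" "p' \<in> {1..n}" "key p * N + p = key p' * N + p'"
    then show "p = p'"
      using lex_code[OF fe[OF p(1)] fe[OF p(2)], of "key p" "key p'"] lex_code[OF fe[OF p(2)] fe[OF p(1)], of "key p'" "key p"]
      by linarith
  qed
  then obtain e where e: "e permutes {1..n}"
    and e_less: "\<And>p p'. p \<in> {1..n} \<Longrightarrow> p' \<in> {1..n} \<Longrightarrow> e p < e p' \<longleftrightarrow> key p * N + p < key p' * N + p'"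
    and e_card: "\<And>p. p \<in> {1..n} \<Longrightarrow> e p = card {x\<in>{1..n}. key x * N + x \<le> key p * N + p}"
    by (rule rank_permutation) blast
  have "inj_on (\<lambda>p. key p * N + (n - p)) {1..n}"
  proof (rule inj_onI)
    fix p p' assume p: "p \<in> {1..n}" "p' \<in> {1..n}" "key p * N + (n - p) = key p' * N + (n - p')"
    then have "n - p = n - p'"
      using lex_code[OF fy fy, of "key p" p "key p'" p'] lex_code[OF fy fy, of "key p'" p' "key p" p]
      by linarith
    then show "p = p'" using p by auto
  qed
  then obtain y where y: "y permutes {1..n}"
    and y_less: "\<And>p p'. p \<in> {1..n} \<Longrightarrow> p' \<in> {1..n} \<Longrightarrow> y p < y p' \<longleftrightarrow> key p * N + (n - p) < key p' * N + (n - p')"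
    and y_card: "\<And>p. p \<in> {1..n} \<Longrightarrow> y p = card {x\<in>{1..n}. key x * N + (n - x) \<le> key p * N + (n - p)}"
    by (rule rank_permutation) blast
  have blk_e: "blk \<pi> (e p) = key p" if "p \<in> {1..n}" for p
    by (rule blk_rank[OF e that e_card[OF that] fe])
  have blk_y: "blk \<pi> (y p) = key p" if "p \<in> {1..n}" for p
    by (rule blk_rank[OF y that y_card[OF that] fy])
  have e_iff: "e p < e p' \<longleftrightarrow> key p < key p' \<or> key p = key p' \<and> p < p'" if "p \<in> {1..n}" "p' \<in> {1..n}" for p p'
    unfolding e_less[OF that] by (rule lex_code[OF fe[OF that(1)] fe[OF that(2)]])
  have y_iff: "y p < y p' \<longleftrightarrow> key p < key p' \<or> key p = key p' \<and> p' < p" if "p \<in> {1..n}" "p' \<in> {1..n}" for p p'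
    unfolding y_less[OF that] lex_code[OF fy fy] using that by auto
  define t where "t = y \<circ> pinv e"
  define x where "x = w \<circ> pinv y"
  note ei = permutes_inv[OF e] and yi = permutes_inv[OF y]
  have te: "t \<circ> e = y" by (auto simp: t_def permutes_inverses[OF e])
  have xy: "x \<circ> y = w" by (auto simp: x_def permutes_inverses[OF y])
  have t: "t \<in> yg n (blk \<pi>)"
  proof (rule ygI)
    show "t permutes {1..n}" unfolding t_def by (rule permutes_compose[OF ei y])
    fix p assume p: "p \<in> {1..n}"
    show "blk \<pi> (t p) = blk \<pi> p"
      using blk_y[OF permutes_mem[OF ei p]] blk_e[OF permutes_mem[OF ei p]] by (simp add: t_def permutes_inverses[OF e])
  qed
  have x: "x permutes {1..n}" unfolding x_def by (rule permutes_compose[OF yi w])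
  have key_le: "key p \<le> key p'" if p: "p \<in> {1..n}" "p' \<in> {1..n}" "p \<le> p'" "blk \<beta> (w p) \<le> blk \<beta> (w p')" for p p'
    using mono_onD[OF ma p(1-3)] p(4) unfolding key_def by linarith
  \<comment> \<open>If w p < w p', the decreasing behaviour of \<open>w\<close> on the blocks of
    \<alpha> and of \<open>pinv w\<close> on those of \<beta> forces both block indices to grow
    strictly from p to p'. Then so does their minimum, and \<open>y\<close> would not invert the
    pair.\<close>
  have y_inv: "w p' < w p" if p: "p < p'" "y p' < y p" for p p'
  proof (rule ccontr)
    assume "\<not> w p' < w p"
    then have wp: "w p < w p'" using permutes_less_cases[OF w, of p p'] p by auto
    have "(p, p') \<in> inversions y" using p by (simp add: inversions_def)
    then have pn: "p \<in> {1..n}" "p' \<in> {1..n}" using inversions_subset[OF y] by blast+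
    note wn = permutes_mem[OF w pn(1)] permutes_mem[OF w pn(2)]
    have le: "key p' \<le> key p" using y_iff[OF pn(2,1)] p by auto
    have a: "blk \<alpha> p < blk \<alpha> p'"
      using deca[OF pn p(1)] mono_onD[OF ma pn] p(1) wp by fastforce
    have b: "blk \<beta> (w p) < blk \<beta> (w p')"
      using decb[OF wn wp] mono_onD[OF mb wn] p(1) wp by (fastforce simp: permutes_inverses[OF w])
    show False using a b le unfolding key_def by linarith
  qed
  have lw: "len w = len x + len y"
    unfolding xy[symmetric]
  proof (rule len_comp_add[OF x y])
    fix i j assume "i < j" "y j < y i"
    then show "x (y j) < x (y i)" using y_inv[of i j] by (simp add: x_def permutes_inverses[OF y])
  qed
  have inc_e: "inc_on_blocks n (blk \<pi>) (pinv e)"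
    unfolding inc_on_blocks_def
  proof (intro ballI impI)
    fix i j assume ij: "i \<in> {1..n}" "j \<in> {1..n}" "i < j" "blk \<pi> i = blk \<pi> j"
    note m = permutes_mem[OF ei ij(1)] permutes_mem[OF ei ij(2)]
    show "pinv e i < pinv e j"
      using e_iff[OF m] blk_e[OF m(1)] blk_e[OF m(2)] ij by (simp add: permutes_inverses[OF e])
  qed
  have inc_x: "inc_on_blocks n (blk \<pi>) x"
    unfolding inc_on_blocks_def
  proof (intro ballI impI)
    fix i j assume ij: "i \<in> {1..n}" "j \<in> {1..n}" "i < j" "blk \<pi> i = blk \<pi> j"
    note m = permutes_mem[OF yi ij(1)] permutes_mem[OF yi ij(2)]
    have "pinv y j < pinv y i"
      using y_iff[OF m] blk_y[OF m(1)] blk_y[OF m(2)] ij by (simp add: permutes_inverses[OF y])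
    from y_inv[OF this] show "x i < x j" using ij by (simp add: x_def permutes_inverses[OF y])
  qed
  have t_dec: "t j < t i" if ij: "i \<in> {1..n}" "j \<in> {1..n}" "i < j" "blk \<pi> i = blk \<pi> j" for i j
  proof -
    note m = permutes_mem[OF ei ij(1)] permutes_mem[OF ei ij(2)]
    have "key (pinv e i) = key (pinv e j)" using blk_e[OF m(1)] blk_e[OF m(2)] ij by (simp add: permutes_inverses[OF e])
    moreover have "pinv e i < pinv e j" using inc_e ij unfolding inc_on_blocks_def by blast
    ultimately show ?thesis using y_iff[OF m(2,1)] by (simp add: t_def)
  qed
  note tp = yg_permutes[OF t]
  have ly: "len y = len t + len e"
  proof -
    have "len y = len (pinv y)" by (rule len_inv[OF y, symmetric])
    also have "pinv y = pinv e \<circ> pinv t"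
      unfolding te[symmetric] by (rule o_inv_distrib[OF permutes_bij[OF tp] permutes_bij[OF e]])
    also have "len \<dots> = len (pinv e) + len (pinv t)" by (rule len_comp_yg[OF ei inc_e inv_yg[OF t] mp])
    finally show ?thesis by (simp only: len_inv[OF e] len_inv[OF tp])
  qed
  show thesis
  proof (rule that[of \<pi> x e t])
    show "\<pi> \<in> compositions n" "x permutes {1..n}" "e permutes {1..n}" "t \<in> yg n (blk \<pi>)"
      "inc_on_blocks n (blk \<pi>) x" "inc_on_blocks n (blk \<pi>) (pinv e)" by fact+
    show "w = x \<circ> t \<circ> e" using te xy by (simp only: o_assoc[symmetric])
    show "len w = len x + len t + len e" using lw ly by simp
    show "dom_le \<alpha> \<pi>"
      by (rule dom_leI_blk(1)[OF \<alpha> permutes_id psum]) (simp add: key_def)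
    show "dom_le \<beta> \<pi>"
      by (rule dom_leI_blk(1)[OF \<beta> w psum]) (simp add: key_def)
    show "w \<in> yg n (blk \<pi>)" if "\<alpha> = \<pi>" "\<beta> = \<pi>"
    proof (rule ygI[OF w])
      fix p assume p: "p \<in> {1..n}"
      have "key p = blk \<alpha> (id p)"
        by (rule dom_leI_blk(2)[OF \<alpha> permutes_id psum _ that(1) p]) (simp add: key_def)
      moreover have "key p = blk \<beta> (w p)"
        by (rule dom_leI_blk(2)[OF \<beta> w psum _ that(2) p]) (simp add: key_def)
      ultimately show "blk \<pi> (w p) = blk \<pi> p" using that by simp
    qed
    \<comment> \<open>\<open>t\<close> reverses each block of \<pi>, so it inverts every pair that
      an element of the Young subgroup can invert.\<close>
    show "g = t \<or> len g < len t" if g: "g \<in> yg n (blk \<pi>)" for g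
    proof (cases "inversions g = inversions t")
      case True then show ?thesis using inversions_inject[OF yg_permutes[OF g] tp] by simp
    next
      case False
      have "inversions g \<subseteq> inversions t"
      proof
        fix z assume z: "z \<in> inversions g"
        obtain i j where ij: "z = (i, j)" "i < j" "g j < g i" using z by (auto simp: inversions_def)
        note yy = yg_inversion[OF g mp ij(2,3)]
        show "z \<in> inversions t" using t_dec[OF yy(1,2) ij(2) yy(3)] ij by (simp add: inversions_def)
      qed
      then have "card (inversions g) < card (inversions t)"
        using False finite_inversions[OF tp] by (intro psubset_card_mono) auto
      then show ?thesis by (simp add: len_def)
    qed
    show "d = x \<or> len d < len x"
      if d: "d permutes {1..n}" "inc_on_blocks n (blk \<pi>) d" "h \<in> yg n (blk \<pi>)"
        "\<And>p. p \<in> {1..n} \<Longrightarrow> blk \<beta> (d p) = blk \<beta> (x (h p))" for d h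
    proof (rule coset_leading[OF mp mb x inc_x _ d])
      fix r r' assume r: "r \<in> {1..n}" "r' \<in> {1..n}" "r < r'" "blk \<pi> r \<noteq> blk \<pi> r'" "blk \<beta> (x r) = blk \<beta> (x r')"
      note m = permutes_mem[OF yi r(1)] permutes_mem[OF yi r(2)]
      let ?p = "pinv y r" and ?p' = "pinv y r'"
      have ky: "key ?p < key ?p'"
        using y_iff[OF m] blk_y[OF m(1)] blk_y[OF m(2)] r by (auto simp: permutes_inverses[OF y])
      have b: "blk \<beta> (w ?p) = blk \<beta> (w ?p')" using r by (simp add: x_def)
      \<comment> \<open>Inside one block of \<beta>, larger values come from smaller positions. With
        w ?p < w ?p' the position ?p' would precede ?p, and by \<open>key_le\<close> its key could
        not be the larger one.\<close>
      have "\<not> w ?p < w ?p'"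
      proof
        assume l: "w ?p < w ?p'"
        from decb[OF permutes_mem[OF w m(1)] permutes_mem[OF w m(2)] l b]
        have "?p' < ?p" by (simp add: permutes_inverses[OF w])
        then show False using key_le[OF m(2,1)] b ky by simp
      qed
      moreover have "?p \<noteq> ?p'" using ky by auto
      ultimately have "w ?p' < w ?p" using permutes_less_cases[OF w, of ?p ?p'] by auto
      then show "x r' < x r" by (simp add: x_def)
    qed
    show "d = pinv e \<or> len d < len (pinv e)"
      if d: "d permutes {1..n}" "inc_on_blocks n (blk \<pi>) d" "h \<in> yg n (blk \<pi>)"
        "\<And>p. p \<in> {1..n} \<Longrightarrow> blk \<alpha> (d p) = blk \<alpha> (pinv e (h p))" for d h
    proof (rule coset_leading[OF mp ma ei inc_e _ d])
      fix r r' assume r: "r \<in> {1..n}" "r' \<in> {1..n}" "r < r'" "blk \<pi> r \<noteq> blk \<pi> r'" "blk \<alpha> (pinv e r) = blk \<alpha> (pinv e r')"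
      note m = permutes_mem[OF ei r(1)] permutes_mem[OF ei r(2)]
      let ?p = "pinv e r" and ?p' = "pinv e r'"
      have ky: "key ?p < key ?p'"
        using e_iff[OF m] blk_e[OF m(1)] blk_e[OF m(2)] r by (auto simp: permutes_inverses[OF e])
      have "\<not> ?p < ?p'"
      proof
        assume l: "?p < ?p'"
        have "w ?p' < w ?p" by (rule deca[OF m l r(5)])
        then have b: "blk \<beta> (w ?p') \<le> blk \<beta> (w ?p)"
          using mono_onD[OF mb permutes_mem[OF w m(2)] permutes_mem[OF w m(1)]] by simp
        have "key ?p' \<le> key ?p" using b r(5) unfolding key_def by linarith
        then show False using ky by simp
      qed
      moreover have "?p \<noteq> ?p'" using ky by auto
      ultimately show "?p' < ?p" by simp
    qed
  qed
qed

section \<open>Quotient algebras\<close>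

lemma assoc_algebraI:
  assumes "module K A" "ring A"
    and "\<And>c x y. c \<in> carrier K \<Longrightarrow> x \<in> carrier A \<Longrightarrow> y \<in> carrier A \<Longrightarrow>
      (c \<odot>\<^bsub>A\<^esub> x) \<otimes>\<^bsub>A\<^esub> y = c \<odot>\<^bsub>A\<^esub> (x \<otimes>\<^bsub>A\<^esub> y)"
    and "\<And>c x y. c \<in> carrier K \<Longrightarrow> x \<in> carrier A \<Longrightarrow> y \<in> carrier A \<Longrightarrow>
      x \<otimes>\<^bsub>A\<^esub> (c \<odot>\<^bsub>A\<^esub> y) = c \<odot>\<^bsub>A\<^esub> (x \<otimes>\<^bsub>A\<^esub> y)"
  shows "assoc_algebra K A"
proof -
  interpret module K A by fact
  interpret A: ring A by fact
  show ?thesis by unfold_locales (use assms in auto)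
qed

lemma quotient_algebra_simps:
  "carrier (quotient_algebra A I) = a_rcosets\<^bsub>A\<^esub> I"
  "add (quotient_algebra A I) = set_add A"
  "mult (quotient_algebra A I) = rcoset_mult A I"
  "one (quotient_algebra A I) = I +>\<^bsub>A\<^esub> \<one>\<^bsub>A\<^esub>"
  "zero (quotient_algebra A I) = I"
  "smult (quotient_algebra A I) = (\<lambda>c W. \<Union>x\<in>W. I +>\<^bsub>A\<^esub> (c \<odot>\<^bsub>A\<^esub> x))"
  by (simp_all add: quotient_algebra_def ring.defs module.defs FactRing_def)

text \<open>Carries the ring axioms across record types, from the factor ring to its extension by a
  scalar multiplication.\<close>

lemma ring_truncate_cong:
  assumes "ring R" "carrier S = carrier R" "add S = add R" "mult S = mult R" "one S = one R" "zero S = zero R"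
  shows "ring S"
proof -
  interpret R: ring R by fact
  show ?thesis
  proof (intro ringI abelian_groupI monoidI, unfold assms(2-))
    fix x assume "x \<in> carrier R"
    then show "\<exists>y\<in>carrier R. y \<oplus>\<^bsub>R\<^esub> x = \<zero>\<^bsub>R\<^esub>" by (intro bexI[of _ "\<ominus>\<^bsub>R\<^esub> x"]) (simp_all add: R.l_neg)
  qed (auto simp: R.a_ac R.m_assoc R.l_distr R.r_distr)
qed

locale algebra_quotient = assoc_algebra K A + ideal I A
  for K :: "('k, 'x) ring_scheme" and A :: "('k, 'a, 'y) module_scheme" and I :: "'a set"
begin

abbreviation Q :: "('k, 'a set) module" where "Q \<equiv> quotient_algebra A I"

lemma ring_Q: "ring Q"
  by (rule ring_truncate_cong[OF quotient_is_ring]) (simp_all add: quotient_algebra_simps FactRing_def)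

lemma coset_closed [simp, intro]: "a \<in> carrier A \<Longrightarrow> I +>\<^bsub>A\<^esub> a \<in> carrier Q"
  by (auto simp: quotient_algebra_simps A_RCOSETS_def')

lemma coset_cases: "W \<in> carrier Q \<Longrightarrow> (\<And>a. a \<in> carrier A \<Longrightarrow> W = I +>\<^bsub>A\<^esub> a \<Longrightarrow> P) \<Longrightarrow> P"
  by (auto simp: quotient_algebra_simps A_RCOSETS_def')

lemma coset_eq_iff:
  assumes "a \<in> carrier A" "b \<in> carrier A"
  shows "I +>\<^bsub>A\<^esub> a = I +>\<^bsub>A\<^esub> b \<longleftrightarrow> a \<ominus>\<^bsub>A\<^esub> b \<in> I"
proof
  assume "I +>\<^bsub>A\<^esub> a = I +>\<^bsub>A\<^esub> b"
  then have "a \<in> I +>\<^bsub>A\<^esub> b" using a_rcos_self[OF assms(1)] by simp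
  then show "a \<ominus>\<^bsub>A\<^esub> b \<in> I" using a_rcos_module_minus[OF A.ring_axioms assms(2,1)] by simp
next
  assume "a \<ominus>\<^bsub>A\<^esub> b \<in> I"
  then have "a \<in> I +>\<^bsub>A\<^esub> b" using a_rcos_module_minus[OF A.ring_axioms assms(2,1)] by simp
  then show "I +>\<^bsub>A\<^esub> a = I +>\<^bsub>A\<^esub> b" using a_repr_independence[OF _ assms(2)] a_subgroup by simp
qed

lemma coset_add: "a \<in> carrier A \<Longrightarrow> b \<in> carrier A \<Longrightarrow>
    (I +>\<^bsub>A\<^esub> a) \<oplus>\<^bsub>Q\<^esub> (I +>\<^bsub>A\<^esub> b) = I +>\<^bsub>A\<^esub> (a \<oplus>\<^bsub>A\<^esub> b)"
  by (simp add: quotient_algebra_simps a_rcos_sum)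

lemma coset_mult: "a \<in> carrier A \<Longrightarrow> b \<in> carrier A \<Longrightarrow>
    (I +>\<^bsub>A\<^esub> a) \<otimes>\<^bsub>Q\<^esub> (I +>\<^bsub>A\<^esub> b) = I +>\<^bsub>A\<^esub> (a \<otimes>\<^bsub>A\<^esub> b)"
  by (simp add: quotient_algebra_simps rcoset_mult_add)

text \<open>A scalar acts as multiplication by its product with one, so two-sided ideals are stable
  under scalars.\<close>

lemma smult_ideal: assumes c: "c \<in> carrier K" and x: "x \<in> I" shows "c \<odot>\<^bsub>A\<^esub> x \<in> I"
proof -
  have xc: "x \<in> carrier A" using x by (rule a_Hcarr)
  have "(c \<odot>\<^bsub>A\<^esub> \<one>\<^bsub>A\<^esub>) \<otimes>\<^bsub>A\<^esub> x = c \<odot>\<^bsub>A\<^esub> x" using c xc by (simp add: smult_mult_l)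
  moreover have "(c \<odot>\<^bsub>A\<^esub> \<one>\<^bsub>A\<^esub>) \<otimes>\<^bsub>A\<^esub> x \<in> I" using c x by (intro I_l_closed) auto
  ultimately show ?thesis by simp
qed

lemma coset_smult: assumes c: "c \<in> carrier K" and a: "a \<in> carrier A"
  shows "c \<odot>\<^bsub>Q\<^esub> (I +>\<^bsub>A\<^esub> a) = I +>\<^bsub>A\<^esub> (c \<odot>\<^bsub>A\<^esub> a)"
proof -
  have "I +>\<^bsub>A\<^esub> (c \<odot>\<^bsub>A\<^esub> x) = I +>\<^bsub>A\<^esub> (c \<odot>\<^bsub>A\<^esub> a)" if x: "x \<in> I +>\<^bsub>A\<^esub> a" for x
  proof -
    obtain i where i: "i \<in> I" "x = i \<oplus>\<^bsub>A\<^esub> a" using x unfolding a_r_coset_def' by blast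
    have ic: "i \<in> carrier A" using i(1) by (rule a_Hcarr)
    have "c \<odot>\<^bsub>A\<^esub> x \<ominus>\<^bsub>A\<^esub> c \<odot>\<^bsub>A\<^esub> a = c \<odot>\<^bsub>A\<^esub> i"
    proof -
      have "c \<odot>\<^bsub>A\<^esub> x = c \<odot>\<^bsub>A\<^esub> i \<oplus>\<^bsub>A\<^esub> c \<odot>\<^bsub>A\<^esub> a" using c a ic by (simp add: i(2) smult_r_distr)
      then show ?thesis
        unfolding a_minus_def
        using M.a_assoc[of "c \<odot>\<^bsub>A\<^esub> i" "c \<odot>\<^bsub>A\<^esub> a" "\<ominus>\<^bsub>A\<^esub> (c \<odot>\<^bsub>A\<^esub> a)"] M.r_neg[of "c \<odot>\<^bsub>A\<^esub> a"] c a ic by simp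
    qed
    then show ?thesis using coset_eq_iff i ic a c smult_ideal by simp
  qed
  moreover have "a \<in> I +>\<^bsub>A\<^esub> a" by (rule a_rcos_self[OF a])
  ultimately show ?thesis unfolding quotient_algebra_simps by blast
qed

lemma coset_one: "\<one>\<^bsub>Q\<^esub> = I +>\<^bsub>A\<^esub> \<one>\<^bsub>A\<^esub>" and zero_Q: "\<zero>\<^bsub>Q\<^esub> = I"
  by (simp_all add: quotient_algebra_simps)

lemma coset_zero: "\<zero>\<^bsub>Q\<^esub> = I +>\<^bsub>A\<^esub> \<zero>\<^bsub>A\<^esub>"
  using A.ring_axioms by (simp add: zero_Q a_coset_add_zero a_subset)

lemma assoc_algebra_Q: "assoc_algebra K Q"
proof -
  interpret Q: ring Q by (rule ring_Q)
  show ?thesis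
  proof (rule assoc_algebraI[OF _ ring_Q])
    show "module K Q"
    proof (rule moduleI)
      show "cring K" by (rule R.is_cring)
      show "abelian_group Q" by (rule Q.is_abelian_group)
    qed (auto elim!: coset_cases simp: coset_smult coset_add coset_mult smult_l_distr smult_r_distr smult_assoc1)
  qed (auto elim!: coset_cases simp: coset_smult coset_mult smult_mult_l smult_mult_r)
qed

end

lemma assoc_algebra_self: assumes "cring K" shows "assoc_algebra K (self_algebra K)"
proof -
  interpret cring K by fact
  have simps: "carrier (self_algebra K) = carrier K" "add (self_algebra K) = add K" "mult (self_algebra K) = mult K"
    "one (self_algebra K) = one K" "zero (self_algebra K) = zero K" "smult (self_algebra K) = mult K"
    by (simp_all add: self_algebra_def ring.defs module.defs)
  have r: "ring (self_algebra K)" by (rule ring_truncate_cong[OF ring_axioms]) (simp_all add: simps)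
  interpret S: ring "self_algebra K" by (rule r)
  show ?thesis
  proof (rule assoc_algebraI[OF _ r])
    show "module K (self_algebra K)"
      by (rule moduleI) (auto simp: simps l_distr r_distr m_assoc intro: is_cring S.is_abelian_group)
  qed (auto simp: simps m_assoc m_lcomm)
qed

section \<open>The free algebra\<close>

text \<open>The product of \<open>free_algebra\<close>, here for arbitrary coefficient functions on
  words. In this generality the tail of a function after a fixed first letter is again an admissible
  argument, as the recursion \<open>conv_Cons\<close> requires.\<close>

definition conv :: "('k, 'x) ring_scheme \<Rightarrow> ('i list \<Rightarrow> 'k) \<Rightarrow> ('i list \<Rightarrow> 'k) \<Rightarrow> 'i list \<Rightarrow> 'k" where
  "conv K f g = (\<lambda>w. \<Oplus>\<^bsub>K\<^esub>i\<in>{..length w}. f (take i w) \<otimes>\<^bsub>K\<^esub> g (drop i w))"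

definition word_monom :: "('k, 'x) ring_scheme \<Rightarrow> 'i list \<Rightarrow> 'i list \<Rightarrow> 'k" where
  "word_monom K u = (\<lambda>w. if w = u then \<one>\<^bsub>K\<^esub> else \<zero>\<^bsub>K\<^esub>)"

lemma free_algebra_simps:
  "carrier (free_algebra K I) = {f. (\<forall>w. f w \<in> carrier K) \<and> finite {w. f w \<noteq> \<zero>\<^bsub>K\<^esub>} \<and> (\<forall>w. w \<notin> lists I \<longrightarrow> f w = \<zero>\<^bsub>K\<^esub>)}"
  "mult (free_algebra K I) = conv K"
  "one (free_algebra K I) = word_monom K []"
  "zero (free_algebra K I) = (\<lambda>w. \<zero>\<^bsub>K\<^esub>)"
  "add (free_algebra K I) = (\<lambda>f g w. f w \<oplus>\<^bsub>K\<^esub> g w)"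
  "smult (free_algebra K I) = (\<lambda>c f w. c \<otimes>\<^bsub>K\<^esub> f w)"
  by (auto simp: free_algebra_def conv_def word_monom_def fun_eq_iff)

context cring
begin

abbreviation fns :: "('i \<Rightarrow> 'a) set" where "fns \<equiv> {f. \<forall>w. f w \<in> carrier R}"

lemma conv_Nil: "f \<in> fns \<Longrightarrow> g \<in> fns \<Longrightarrow> conv R f g [] = f [] \<otimes> g []"
  by (simp add: conv_def)

text \<open>The factorization with empty left factor is split off; in all others the first letter
  belongs to \<open>f\<close>. With this recursion bilinearity and associativity become inductions
  on the word.\<close>

lemma conv_Cons:
  assumes "f \<in> fns" "g \<in> fns"
  shows "conv R f g (a # w) = f [] \<otimes> g (a # w) \<oplus> conv R (\<lambda>u. f (a # u)) g w"
proof -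
  have e: "{..length (a # w)} = insert 0 (Suc ` {..length w})"
    by (auto simp: image_iff) (metis atMost_iff not0_implies_Suc Suc_le_mono)
  show ?thesis
    unfolding conv_def e using assms
    by (subst finsum_insert) (auto simp: finsum_reindex inj_on_def)
qed

lemma conv_closed [simp]: "f \<in> fns \<Longrightarrow> g \<in> fns \<Longrightarrow> conv R f g w \<in> carrier R"
  unfolding conv_def by (auto intro!: finsum_closed)

lemma conv_zero_l: "g \<in> fns \<Longrightarrow> conv R (\<lambda>_. \<zero>) g w = \<zero>"
  by (induction w) (auto simp: conv_Nil conv_Cons)

lemma conv_zero_r: "g \<in> fns \<Longrightarrow> conv R g (\<lambda>_. \<zero>) w = \<zero>"
  by (induction w arbitrary: g) (auto simp: conv_Nil conv_Cons)

lemma conv_add_l: "f \<in> fns \<Longrightarrow> f' \<in> fns \<Longrightarrow> g \<in> fns \<Longrightarrow>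
    conv R (\<lambda>w. f w \<oplus> f' w) g w = conv R f g w \<oplus> conv R f' g w"
proof (induction w arbitrary: f f')
  case (Cons a w)
  have "conv R (\<lambda>u. f (a # u) \<oplus> f' (a # u)) g w = conv R (\<lambda>u. f (a # u)) g w \<oplus> conv R (\<lambda>u. f' (a # u)) g w"
    by (rule Cons.IH) (use Cons.prems in auto)
  then show ?case using Cons.prems by (simp add: conv_Cons l_distr a_ac)
qed (simp add: conv_Nil l_distr)

lemma conv_add_r: "f \<in> fns \<Longrightarrow> g \<in> fns \<Longrightarrow> g' \<in> fns \<Longrightarrow>
    conv R f (\<lambda>w. g w \<oplus> g' w) w = conv R f g w \<oplus> conv R f g' w"
proof (induction w arbitrary: f)
  case (Cons a w)
  have "conv R (\<lambda>u. f (a # u)) (\<lambda>w. g w \<oplus> g' w) w = conv R (\<lambda>u. f (a # u)) g w \<oplus> conv R (\<lambda>u. f (a # u)) g' w"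
    by (rule Cons.IH) (use Cons.prems in auto)
  then show ?case using Cons.prems by (simp add: conv_Cons r_distr a_ac)
qed (simp add: conv_Nil r_distr)

lemma conv_smult_l: "c \<in> carrier R \<Longrightarrow> f \<in> fns \<Longrightarrow> g \<in> fns \<Longrightarrow>
    conv R (\<lambda>w. c \<otimes> f w) g w = c \<otimes> conv R f g w"
proof (induction w arbitrary: f)
  case (Cons a w)
  have "conv R (\<lambda>u. c \<otimes> f (a # u)) g w = c \<otimes> conv R (\<lambda>u. f (a # u)) g w"
    by (rule Cons.IH) (use Cons.prems in auto)
  then show ?case using Cons.prems by (simp add: conv_Cons r_distr m_assoc)
qed (simp add: conv_Nil m_assoc)

lemma conv_smult_r: "c \<in> carrier R \<Longrightarrow> f \<in> fns \<Longrightarrow> g \<in> fns \<Longrightarrow>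
    conv R f (\<lambda>w. c \<otimes> g w) w = c \<otimes> conv R f g w"
proof (induction w arbitrary: f)
  case (Cons a w)
  have "conv R (\<lambda>u. f (a # u)) (\<lambda>w. c \<otimes> g w) w = c \<otimes> conv R (\<lambda>u. f (a # u)) g w"
    by (rule Cons.IH) (use Cons.prems in auto)
  then show ?case using Cons.prems by (simp add: conv_Cons r_distr m_lcomm)
qed (simp add: conv_Nil m_lcomm)

lemma conv_assoc: "f \<in> fns \<Longrightarrow> g \<in> fns \<Longrightarrow> h \<in> fns \<Longrightarrow> conv R (conv R f g) h w = conv R f (conv R g h) w"
proof (induction w arbitrary: f)
  case (Cons a w)
  note [simp] = Cons.prems[simplified]
  have 1: "(\<lambda>u. conv R f g (a # u)) = (\<lambda>u. f [] \<otimes> g (a # u) \<oplus> conv R (\<lambda>u. f (a # u)) g u)"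
    by (simp add: conv_Cons)
  have "conv R (\<lambda>u. f [] \<otimes> g (a # u) \<oplus> conv R (\<lambda>u. f (a # u)) g u) h w
      = conv R (\<lambda>u. f [] \<otimes> g (a # u)) h w \<oplus> conv R (conv R (\<lambda>u. f (a # u)) g) h w"
    by (rule conv_add_l) auto
  also have "conv R (\<lambda>u. f [] \<otimes> g (a # u)) h w = f [] \<otimes> conv R (\<lambda>u. g (a # u)) h w"
    by (rule conv_smult_l) auto
  also have "conv R (conv R (\<lambda>u. f (a # u)) g) h w = conv R (\<lambda>u. f (a # u)) (conv R g h) w"
    by (rule Cons.IH) auto
  finally show ?case by (simp add: conv_Cons 1 conv_Nil r_distr m_assoc a_assoc)
qed (simp add: conv_Nil m_assoc)

lemma word_monom_fns [simp]: "word_monom R u w \<in> carrier R"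
  by (simp add: word_monom_def)

lemma conv_monom_Cons:
  "g \<in> fns \<Longrightarrow> conv R (word_monom R (b # u)) g (a # w) = (if a = b then conv R (word_monom R u) g w else \<zero>)"
proof -
  assume g: "g \<in> fns"
  have "(\<lambda>v. word_monom R (b # u) (a # v)) = (if a = b then word_monom R u else (\<lambda>_. \<zero>))"
    by (auto simp: word_monom_def)
  then show ?thesis using g by (simp add: conv_Cons word_monom_def conv_zero_l)
qed

lemma conv_one_l: "g \<in> fns \<Longrightarrow> conv R (word_monom R []) g w = g w"
proof (cases w)
  case (Cons a v)
  assume g: "g \<in> fns"
  have "(\<lambda>v. word_monom R [] (a # v)) = (\<lambda>_. \<zero>)" by (auto simp: word_monom_def)
  then show ?thesis using g Cons by (simp add: conv_Cons conv_zero_l) (simp add: word_monom_def)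
qed (simp add: conv_Nil word_monom_def)

lemma conv_one_r: "g \<in> fns \<Longrightarrow> conv R g (word_monom R []) w = g w"
proof (induction w arbitrary: g)
  case (Cons a w)
  have "conv R (\<lambda>u. g (a # u)) (word_monom R []) w = g (a # w)"
    by (rule Cons.IH) (use Cons.prems in auto)
  then show ?case using Cons.prems by (simp add: conv_Cons) (simp add: word_monom_def)
qed (simp add: conv_Nil word_monom_def)

lemma conv_monom: "conv R (word_monom R u) (word_monom R v) w = word_monom R (u @ v) w"
proof (induction u arbitrary: w)
  case (Cons b u)
  show ?case
  proof (cases w)
    case Nil then show ?thesis by (simp add: conv_Nil) (simp add: word_monom_def)
  next
    case (Cons a w')
    then show ?thesis by (simp add: conv_monom_Cons Cons.IH) (auto simp: word_monom_def)
  qed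
qed (simp add: conv_one_l)

lemma conv_support:
  assumes "f \<in> fns" "g \<in> fns" "conv R f g w \<noteq> \<zero>"
  shows "\<exists>u v. w = u @ v \<and> f u \<noteq> \<zero> \<and> g v \<noteq> \<zero>"
proof (rule ccontr)
  assume no: "\<not> ?thesis"
  have "f (take i w) \<otimes> g (drop i w) = \<zero>" for i
    using no append_take_drop_id[of i w] assms by (metis (mono_tags, lifting) l_null mem_Collect_eq r_null)
  then have "conv R f g w = \<zero>" by (simp add: conv_def)
  then show False using assms by simp
qed

lemma assoc_algebra_free: "assoc_algebra R (free_algebra R I)"
proof -
  let ?F = "free_algebra R I"
  have sub: "f \<in> fns" if "f \<in> carrier ?F" for f using that by (simp add: free_algebra_simps)
  have add: "(\<lambda>w. f w \<oplus> g w) \<in> carrier ?F" if "f \<in> carrier ?F" "g \<in> carrier ?F" for f g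
  proof -
    have "{w. f w \<oplus> g w \<noteq> \<zero>} \<subseteq> {w. f w \<noteq> \<zero>} \<union> {w. g w \<noteq> \<zero>}" by auto
    then have "finite {w. f w \<oplus> g w \<noteq> \<zero>}" by (rule finite_subset) (use that in \<open>simp add: free_algebra_simps\<close>)
    then show ?thesis using that by (simp add: free_algebra_simps)
  qed
  have smult: "(\<lambda>w. c \<otimes> f w) \<in> carrier ?F" if "c \<in> carrier R" "f \<in> carrier ?F" for c f
  proof -
    have "{w. c \<otimes> f w \<noteq> \<zero>} \<subseteq> {w. f w \<noteq> \<zero>}" using that by auto
    then have "finite {w. c \<otimes> f w \<noteq> \<zero>}" by (rule finite_subset) (use that in \<open>simp add: free_algebra_simps\<close>)
    then show ?thesis using that by (simp add: free_algebra_simps)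
  qed
  have neg: "\<exists>g\<in>carrier ?F. (\<lambda>w. g w \<oplus> f w) = (\<lambda>w. \<zero>)" if "f \<in> carrier ?F" for f
    by (rule bexI[OF _ smult[OF _ that, of "\<ominus> \<one>"]]) (use sub[OF that] in \<open>auto simp: l_minus l_neg\<close>)
  have mult: "conv R f g \<in> carrier ?F" if f: "f \<in> carrier ?F" and g: "g \<in> carrier ?F" for f g
  proof -
    note s = conv_support[OF sub[OF f] sub[OF g]]
    have "{w. conv R f g w \<noteq> \<zero>} \<subseteq> (\<lambda>(u, v). u @ v) ` ({w. f w \<noteq> \<zero>} \<times> {w. g w \<noteq> \<zero>})"
      using s by force
    then have fin: "finite {w. conv R f g w \<noteq> \<zero>}"
      by (rule finite_subset) (use f g in \<open>auto simp: free_algebra_simps\<close>)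
    have "conv R f g w = \<zero>" if "w \<notin> lists I" for w
    proof (rule ccontr)
      assume "conv R f g w \<noteq> \<zero>"
      then obtain u v where uv: "w = u @ v" "f u \<noteq> \<zero>" "g v \<noteq> \<zero>" using s by blast
      then have "u \<in> lists I" "v \<in> lists I" using f g unfolding free_algebra_simps by blast+
      then show False using that uv by simp
    qed
    then show ?thesis using fin sub[OF f] sub[OF g] by (simp add: free_algebra_simps)
  qed
  have r: "ring ?F"
  proof (intro ringI abelian_groupI monoidI)
    show "\<one>\<^bsub>?F\<^esub> \<in> carrier ?F" by (simp add: free_algebra_simps) (auto simp: word_monom_def)
    show "\<zero>\<^bsub>?F\<^esub> \<in> carrier ?F" by (simp add: free_algebra_simps)
  qed (use sub add mult neg in \<open>simp_all add: free_algebra_simps(2-) a_ac conv_assoc conv_add_l conv_add_r conv_one_l conv_one_r l_zero fun_eq_iff\<close>)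
  interpret F: ring ?F by (rule r)
  show ?thesis
  proof (rule assoc_algebraI[OF _ r])
    show "module R ?F"
      by (rule moduleI)
        (use sub smult in \<open>auto simp: free_algebra_simps(2-) l_distr r_distr m_assoc fun_eq_iff intro: is_cring F.is_abelian_group\<close>)
  qed (use sub in \<open>simp_all add: free_algebra_simps(2-) conv_smult_l conv_smult_r fun_eq_iff\<close>)
qed

lemma word_monom_carrier: "u \<in> lists I \<Longrightarrow> word_monom R u \<in> carrier (free_algebra R I)"
  by (auto simp: free_algebra_simps word_monom_def)

lemma free_algebra_induct [consumes 1, case_names zero step]:
  assumes f: "f \<in> carrier (free_algebra R I)"
    and zero: "P (\<lambda>w. \<zero>)"
    and step: "\<And>f c u. f \<in> carrier (free_algebra R I) \<Longrightarrow> P f \<Longrightarrow> c \<in> carrier R \<Longrightarrow> u \<in> lists I \<Longrightarrow>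
      P (\<lambda>w. f w \<oplus> c \<otimes> word_monom R u w)"
  shows "P f"
  using f
proof (induction "card {w. f w \<noteq> \<zero>}" arbitrary: f rule: less_induct)
  case less
  have f: "\<And>w. f w \<in> carrier R" "finite {w. f w \<noteq> \<zero>}" "\<And>w. w \<notin> lists I \<Longrightarrow> f w = \<zero>"
    using less.prems by (auto simp: free_algebra_simps)
  show ?case
  proof (cases "\<forall>w. f w = \<zero>")
    case True
    then have "f = (\<lambda>w. \<zero>)" by auto
    then show ?thesis using zero by simp
  next
    case False
    then obtain u where u: "f u \<noteq> \<zero>" by blast
    then have uI: "u \<in> lists I" using f by blast
    define g where "g = f(u := \<zero>)"
    have sup: "{w. g w \<noteq> \<zero>} = {w. f w \<noteq> \<zero>} - {u}" by (auto simp: g_def)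
    have g: "g \<in> carrier (free_algebra R I)"
      using f by (simp add: free_algebra_simps sup) (simp add: g_def)
    have "P g"
    proof (rule less.hyps[OF _ g])
      show "card {w. g w \<noteq> \<zero>} < card {w. f w \<noteq> \<zero>}"
        unfolding sup by (rule card_Diff1_less) (use u f in auto)
    qed
    from step[OF g this f(1)[of u] uI] have "P (\<lambda>w. g w \<oplus> f u \<otimes> word_monom R u w)" .
    moreover have "(\<lambda>w. g w \<oplus> f u \<otimes> word_monom R u w) = f"
      using f by (auto simp: g_def word_monom_def fun_eq_iff)
    ultimately show ?thesis by simp
  qed
qed

end

declare One_nat_def [simp del]

section \<open>The basis of the Hecke algebra\<close>

text \<open>The free algebra acts on functions of \<open>u\<close>, thought of as coefficients of \<open>T\<^bsub>u\<^sup>-\<^sup>1\<^esub>\<close>, by left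
  multiplication.\<close>

definition gen_act :: "('k, 'x) ring_scheme \<Rightarrow> 'k \<Rightarrow> nat \<Rightarrow> ((nat \<Rightarrow> nat) \<Rightarrow> 'k) \<Rightarrow> (nat \<Rightarrow> nat) \<Rightarrow> 'k" where
  "gen_act K q i v u = (if u (Suc i) < u i then v (u \<circ> adj i) \<oplus>\<^bsub>K\<^esub> (q \<ominus>\<^bsub>K\<^esub> \<one>\<^bsub>K\<^esub>) \<otimes>\<^bsub>K\<^esub> v u
     else q \<otimes>\<^bsub>K\<^esub> v (u \<circ> adj i))"

definition word_act :: "('k, 'x) ring_scheme \<Rightarrow> 'k \<Rightarrow> nat list \<Rightarrow> ((nat \<Rightarrow> nat) \<Rightarrow> 'k) \<Rightarrow> (nat \<Rightarrow> nat) \<Rightarrow> 'k" where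
  "word_act K q ws v = foldr (gen_act K q) ws v"

definition free_act :: "('k, 'x) ring_scheme \<Rightarrow> 'k \<Rightarrow> (nat list \<Rightarrow> 'k) \<Rightarrow> ((nat \<Rightarrow> nat) \<Rightarrow> 'k) \<Rightarrow> (nat \<Rightarrow> nat) \<Rightarrow> 'k" where
  "free_act K q f v u = (\<Oplus>\<^bsub>K\<^esub>ws\<in>{ws. f ws \<noteq> \<zero>\<^bsub>K\<^esub>}. f ws \<otimes>\<^bsub>K\<^esub> word_act K q ws v u)"

locale hecke_setting = q_schur_data K q n + cring K
  for K :: "('k, 'x) ring_scheme" (structure) and q :: 'k and n :: nat +
  assumes q_closed [simp, intro]: "q \<in> carrier K"
begin

abbreviation FA :: "('k, nat list \<Rightarrow> 'k) module" where "FA \<equiv> free_algebra K {1..<n}"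
abbreviation HI :: "(nat list \<Rightarrow> 'k) set" where "HI \<equiv> hecke_ideal K q n"

section \<open>Linearity of the action and compatibility with products\<close>

lemma gen_act_closed: "v \<in> fns \<Longrightarrow> gen_act K q i v \<in> fns"
  by (simp add: gen_act_def)

lemma word_act_simps [simp]: "word_act K q [] v = v" "word_act K q (i # ws) v = gen_act K q i (word_act K q ws v)"
  by (simp_all add: word_act_def)

lemma word_act_append: "word_act K q (us @ ws) v = word_act K q us (word_act K q ws v)"
  by (simp add: word_act_def)

lemma word_act_closed: "v \<in> fns \<Longrightarrow> word_act K q ws v \<in> fns"
  by (induction ws) (use gen_act_closed in auto)

lemma word_act_closed' [simp]: "v \<in> fns \<Longrightarrow> word_act K q ws v u \<in> carrier K"
  using word_act_closed by blast

lemma gen_act_add: "v \<in> fns \<Longrightarrow> v' \<in> fns \<Longrightarrow>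
    gen_act K q i (\<lambda>u. v u \<oplus> v' u) = (\<lambda>u. gen_act K q i v u \<oplus> gen_act K q i v' u)"
  by (auto simp: gen_act_def fun_eq_iff r_distr a_ac)

lemma gen_act_smult: "c \<in> carrier K \<Longrightarrow> v \<in> fns \<Longrightarrow>
    gen_act K q i (\<lambda>u. c \<otimes> v u) = (\<lambda>u. c \<otimes> gen_act K q i v u)"
  by (auto simp: gen_act_def fun_eq_iff r_distr m_lcomm)

lemma word_act_add: "v \<in> fns \<Longrightarrow> v' \<in> fns \<Longrightarrow>
    word_act K q ws (\<lambda>u. v u \<oplus> v' u) = (\<lambda>u. word_act K q ws v u \<oplus> word_act K q ws v' u)"
  by (induction ws) (simp_all add: gen_act_add)

lemma word_act_smult: "c \<in> carrier K \<Longrightarrow> v \<in> fns \<Longrightarrow>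
    word_act K q ws (\<lambda>u. c \<otimes> v u) = (\<lambda>u. c \<otimes> word_act K q ws v u)"
  by (induction ws) (simp_all add: gen_act_smult)

lemma word_act_zero: "word_act K q ws (\<lambda>_. \<zero>) = (\<lambda>_. \<zero>)"
  by (induction ws) (auto simp: gen_act_def fun_eq_iff)

lemma FA_fns: "f \<in> carrier FA \<Longrightarrow> f \<in> fns" "f \<in> carrier FA \<Longrightarrow> finite {w. f w \<noteq> \<zero>}"
  by (auto simp: free_algebra_simps)

lemma free_act_support:
  assumes "f \<in> fns" "v \<in> fns" "finite S" "{w. f w \<noteq> \<zero>} \<subseteq> S"
  shows "free_act K q f v u = (\<Oplus>ws\<in>S. f ws \<otimes> word_act K q ws v u)"
  unfolding free_act_def
  by (rule add.finprod_mono_neutral_cong_left) (use assms in auto)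

lemma free_act_closed [simp]: "f \<in> fns \<Longrightarrow> v \<in> fns \<Longrightarrow> free_act K q f v u \<in> carrier K"
  unfolding free_act_def by (rule finsum_closed) auto

lemma free_act_add:
  assumes f: "f \<in> carrier FA" and g: "g \<in> carrier FA" and v: "v \<in> fns"
  shows "free_act K q (\<lambda>w. f w \<oplus> g w) v u = free_act K q f v u \<oplus> free_act K q g v u"
proof -
  let ?S = "{w. f w \<noteq> \<zero>} \<union> {w. g w \<noteq> \<zero>}"
  note c = FA_fns[OF f] FA_fns[OF g]
  have S: "finite ?S" using c by simp
  have "free_act K q (\<lambda>w. f w \<oplus> g w) v u = (\<Oplus>ws\<in>?S. (f ws \<oplus> g ws) \<otimes> word_act K q ws v u)"
    by (rule free_act_support[OF _ v S]) (use c in auto)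
  also have "\<dots> = (\<Oplus>ws\<in>?S. f ws \<otimes> word_act K q ws v u \<oplus> g ws \<otimes> word_act K q ws v u)"
    by (rule finsum_cong') (use c v in \<open>auto simp: l_distr\<close>)
  also have "\<dots> = (\<Oplus>ws\<in>?S. f ws \<otimes> word_act K q ws v u) \<oplus> (\<Oplus>ws\<in>?S. g ws \<otimes> word_act K q ws v u)"
    by (rule finsum_addf) (use c v in auto)
  finally show ?thesis
    using free_act_support[OF c(1) v S, of u] free_act_support[OF c(3) v S, of u] by simp
qed

lemma free_act_monom:
  assumes "c \<in> carrier K" "v \<in> fns"
  shows "free_act K q (\<lambda>w. c \<otimes> word_monom K ws w) v u = c \<otimes> word_act K q ws v u"
proof -
  have "free_act K q (\<lambda>w. c \<otimes> word_monom K ws w) v u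
      = (\<Oplus>w\<in>{ws}. c \<otimes> word_monom K ws w \<otimes> word_act K q w v u)"
    by (rule free_act_support) (use assms in \<open>auto simp: word_monom_def\<close>)
  then show ?thesis using assms by (simp add: word_monom_def)
qed

lemma free_act_zero: "free_act K q (\<lambda>w. \<zero>) v u = \<zero>"
  by (simp add: free_act_def)

lemma free_act_smult:
  assumes c: "c \<in> carrier K" and f: "f \<in> carrier FA" and v: "v \<in> fns"
  shows "free_act K q (\<lambda>w. c \<otimes> f w) v u = c \<otimes> free_act K q f v u"
proof -
  note d = FA_fns[OF f]
  have "free_act K q (\<lambda>w. c \<otimes> f w) v u = (\<Oplus>ws\<in>{w. f w \<noteq> \<zero>}. c \<otimes> f ws \<otimes> word_act K q ws v u)"
    by (rule free_act_support[OF _ v d(2)]) (use c d in auto)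
  also have "\<dots> = (\<Oplus>ws\<in>{w. f w \<noteq> \<zero>}. c \<otimes> (f ws \<otimes> word_act K q ws v u))"
    by (rule finsum_cong') (use c d v in \<open>auto simp: m_assoc\<close>)
  also have "\<dots> = c \<otimes> free_act K q f v u"
    unfolding free_act_def by (rule finsum_rdistr[symmetric]) (use c d v in auto)
  finally show ?thesis .
qed

sublocale F: assoc_algebra K FA by (rule assoc_algebra_free)

lemma FA_add: "f \<in> carrier FA \<Longrightarrow> g \<in> carrier FA \<Longrightarrow> (\<lambda>w. f w \<oplus> g w) \<in> carrier FA"
  using F.M.a_closed[of f g] by (simp add: free_algebra_simps(5))

lemma FA_smult: "c \<in> carrier K \<Longrightarrow> f \<in> carrier FA \<Longrightarrow> (\<lambda>w. c \<otimes> f w) \<in> carrier FA"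
  using F.smult_closed[of c f] by (simp add: free_algebra_simps(6))

lemma FA_monom: "ws \<in> lists {1..<n} \<Longrightarrow> word_monom K ws \<in> carrier FA"
  by (rule word_monom_carrier)

lemma free_act_word_mult:
  assumes ws: "ws \<in> lists {1..<n}" and v: "v \<in> fns" and g: "g \<in> carrier FA"
  shows "free_act K q (conv K (word_monom K ws) g) v = word_act K q ws (free_act K q g v)"
  using g
proof (induction rule: free_algebra_induct)
  case zero
  have "conv K (word_monom K ws) (\<lambda>w. \<zero>) = (\<lambda>w. \<zero>)" by (auto simp: conv_zero_r)
  moreover have "free_act K q (\<lambda>w. \<zero>) v = (\<lambda>u. \<zero>)" by (auto simp: free_act_zero)
  ultimately show ?case using word_act_zero by simp
next
  case (step g c us)
  have m: "(\<lambda>w. c \<otimes> word_monom K us w) \<in> carrier FA" by (rule FA_smult[OF step.hyps(2) FA_monom[OF step.hyps(3)]])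
  have g: "g \<in> fns" using FA_fns step by blast
  have c: "conv K (word_monom K ws) (\<lambda>w. g w \<oplus> c \<otimes> word_monom K us w)
      = (\<lambda>w. conv K (word_monom K ws) g w \<oplus> c \<otimes> word_monom K (ws @ us) w)"
    using g step by (simp add: fun_eq_iff conv_add_r conv_smult_r conv_monom)
  have cm: "conv K (word_monom K ws) g \<in> carrier FA"
    using F.A.m_closed[OF FA_monom[OF ws] step.hyps(1)] by (simp add: free_algebra_simps(2))
  have m2: "(\<lambda>w. c \<otimes> word_monom K (ws @ us) w) \<in> carrier FA"
    by (rule FA_smult[OF step.hyps(2) FA_monom]) (use ws step in auto)
  have "free_act K q (\<lambda>w. g w \<oplus> c \<otimes> word_monom K us w) v
      = (\<lambda>u. free_act K q g v u \<oplus> c \<otimes> word_act K q us v u)"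
    using free_act_add[OF step.hyps(1) m v] free_act_monom[OF step.hyps(2) v] by (simp add: fun_eq_iff)
  then have "word_act K q ws (free_act K q (\<lambda>w. g w \<oplus> c \<otimes> word_monom K us w) v)
      = (\<lambda>u. word_act K q ws (free_act K q g v) u \<oplus> c \<otimes> word_act K q (ws @ us) v u)"
    using g v step by (simp add: word_act_add word_act_smult word_act_append)
  then show ?case
    unfolding c using free_act_add[OF cm m2 v] free_act_monom[OF step.hyps(2) v] step.IH by (simp add: fun_eq_iff)
qed

text \<open>The module law. It extends linearly from words, where concatenation turns into
  composition of operators.\<close>

lemma free_act_mult:
  assumes f: "f \<in> carrier FA" and g: "g \<in> carrier FA" and v: "v \<in> fns"
  shows "free_act K q (conv K f g) v u = free_act K q f (free_act K q g v) u"
  using f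
proof (induction rule: free_algebra_induct)
  case zero
  have "conv K (\<lambda>w. \<zero>) g = (\<lambda>w. \<zero>)" using FA_fns[OF g] by (auto simp: conv_zero_l)
  then show ?case by (simp add: free_act_zero)
next
  case (step f c ws)
  note gf = FA_fns[OF g] and ff = FA_fns[OF step.hyps(1)]
  have gv: "free_act K q g v \<in> fns" using gf v by simp
  have m: "(\<lambda>w. c \<otimes> word_monom K ws w) \<in> carrier FA" by (rule FA_smult[OF step.hyps(2) FA_monom[OF step.hyps(3)]])
  have c: "conv K (\<lambda>w. f w \<oplus> c \<otimes> word_monom K ws w) g
      = (\<lambda>w. conv K f g w \<oplus> c \<otimes> conv K (word_monom K ws) g w)"
    using gf ff step by (simp add: fun_eq_iff conv_add_l conv_smult_l)
  have cf: "conv K f g \<in> carrier FA" "conv K (word_monom K ws) g \<in> carrier FA"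
    using F.A.m_closed[OF FA_monom[OF step.hyps(3)] g] F.A.m_closed[OF step.hyps(1) g] by (simp_all add: free_algebra_simps(2))
  show ?case
    unfolding c
    using free_act_add[OF cf(1) FA_smult[OF step.hyps(2) cf(2)] v, of u] free_act_smult[OF step.hyps(2) cf(2) v, of u]
      free_act_word_mult[OF step.hyps(3) v g] free_act_add[OF step.hyps(1) m gv, of u] free_act_monom[OF step.hyps(2) gv, of ws u] step.IH
    by simp
qed

lemma free_act_minus:
  assumes f: "f \<in> carrier FA" and g: "g \<in> carrier FA" and v: "v \<in> fns"
  shows "free_act K q (f \<ominus>\<^bsub>FA\<^esub> g) v u = free_act K q f v u \<ominus> free_act K q g v u"
proof -
  have d: "f \<ominus>\<^bsub>FA\<^esub> g \<in> carrier FA" using f g by simp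
  have "(f \<ominus>\<^bsub>FA\<^esub> g) \<oplus>\<^bsub>FA\<^esub> g = f" using f g by (simp add: a_minus_def F.M.a_assoc F.M.l_neg)
  then have "free_act K q f v u = free_act K q (f \<ominus>\<^bsub>FA\<^esub> g) v u \<oplus> free_act K q g v u"
    using free_act_add[OF d g v, of u] by (simp add: free_algebra_simps(5))
  then show ?thesis
    using FA_fns(1)[OF d] FA_fns(1)[OF g] v by (simp add: a_minus_def a_assoc r_neg)
qed

lemma free_act_word: "v \<in> fns \<Longrightarrow> free_act K q (word_monom K ws) v u = word_act K q ws v u"
  using free_act_monom[of \<one> v ws u] by simp

lemma free_gen_eq: "free_gen K i = word_monom K [i]"
  by (simp add: free_gen_def word_monom_def)

text \<open>The annihilator of the module. Once it contains the Hecke relations it contains the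
  ideal generated by them, and the action descends to \<open>H\<close>.\<close>

definition act_kernel :: "(nat list \<Rightarrow> 'k) set" where
  "act_kernel = {f \<in> carrier FA. \<forall>v\<in>fns. \<forall>u. free_act K q f v u = \<zero>}"

lemma ideal_act_kernel: "ideal act_kernel FA"
proof (rule idealI)
  show "ring FA" by (rule F.A.ring_axioms)
  show "subgroup act_kernel (add_monoid FA)"
  proof (rule F.M.add.subgroupI)
    show "act_kernel \<noteq> {}"
    proof -
      have "\<zero>\<^bsub>FA\<^esub> \<in> carrier FA" by simp
      then have "(\<lambda>w. \<zero>) \<in> act_kernel" by (simp add: act_kernel_def free_act_zero free_algebra_simps(4))
      then show ?thesis by blast
    qed
    fix f assume f: "f \<in> act_kernel"
    then have fc: "f \<in> carrier FA" by (simp add: act_kernel_def)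
    show "\<ominus>\<^bsub>FA\<^esub> f \<in> act_kernel"
    proof -
      have "\<ominus>\<^bsub>FA\<^esub> f = \<zero>\<^bsub>FA\<^esub> \<ominus>\<^bsub>FA\<^esub> f" using fc by (simp add: a_minus_def)
      moreover have "free_act K q (\<zero>\<^bsub>FA\<^esub> \<ominus>\<^bsub>FA\<^esub> f) v u = \<zero>" if "v \<in> fns" for v u
      proof -
        have "free_act K q \<zero>\<^bsub>FA\<^esub> v u = \<zero>" by (simp add: free_algebra_simps(4) free_act_zero)
        moreover have "free_act K q f v u = \<zero>" using f that by (simp add: act_kernel_def)
        ultimately show ?thesis using free_act_minus[OF F.M.zero_closed fc that, of u] by (simp add: a_minus_def)
      qed
      ultimately show ?thesis using fc by (simp add: act_kernel_def)
    qed
    fix g assume g: "g \<in> act_kernel"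
    then have gc: "g \<in> carrier FA" by (simp add: act_kernel_def)
    show "f \<oplus>\<^bsub>FA\<^esub> g \<in> act_kernel"
      using f g FA_add[OF fc gc] free_act_add[OF fc gc] by (simp add: act_kernel_def free_algebra_simps(5))
  qed (auto simp: act_kernel_def)
next
  fix a x assume a: "a \<in> act_kernel" and x: "x \<in> carrier FA"
  then have ac: "a \<in> carrier FA" by (simp add: act_kernel_def)
  have z: "free_act K q a v = (\<lambda>_. \<zero>)" if "v \<in> fns" for v using a that by (auto simp: act_kernel_def)
  have z0: "free_act K q f (\<lambda>_. \<zero>) u = \<zero>" if "f \<in> carrier FA" for f u
    unfolding free_act_def using FA_fns(1)[OF that] by (simp add: word_act_zero)
  show "x \<otimes>\<^bsub>FA\<^esub> a \<in> act_kernel"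
    using F.A.m_closed[OF x ac] free_act_mult[OF x ac] z z0[OF x] by (simp add: act_kernel_def free_algebra_simps(2))
  show "a \<otimes>\<^bsub>FA\<^esub> x \<in> act_kernel"
    using F.A.m_closed[OF ac x] free_act_mult[OF ac x] z FA_fns(1)[OF x] by (simp add: act_kernel_def free_algebra_simps(2))
qed

text \<open>Besides ascents and descents there is the case u i = u (i + 1), because u is an
  arbitrary function: then \<open>u \<circ> adj i\<close> equals u and the generator acts there as
  the scalar \<open>q\<close>, a root of the quadratic polynomial.\<close>

lemma gen_act_quadratic:
  assumes v: "v \<in> fns"
  shows "gen_act K q i (gen_act K q i v) u = (q \<ominus> \<one>) \<otimes> gen_act K q i v u \<oplus> q \<otimes> v u"
proof -
  have [simp]: "v w \<in> carrier K" for w using v by simp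
  define p where "p = q \<ominus> \<one>"
  have [simp]: "p \<in> carrier K" by (simp add: p_def)
  have q: "q = p \<oplus> \<one>" by (simp add: p_def a_minus_def a_assoc l_neg)
  note g = gen_act_def[of K q, folded p_def]
  consider "u i < u (Suc i)" | "u (Suc i) < u i" | "u i = u (Suc i)" by linarith
  then have "gen_act K q i (gen_act K q i v) u = p \<otimes> gen_act K q i v u \<oplus> q \<otimes> v u"
  proof cases
    case 1
    then show ?thesis by (simp add: g comp_adj_adj r_distr m_ac a_ac)
  next
    case 2
    then show ?thesis by (simp add: g comp_adj_adj r_distr m_ac a_ac)
  next
    case 3
    then have [simp]: "u \<circ> adj i = u" by (auto simp: fun_eq_iff transpose_def)
    have "gen_act K q i v u = q \<otimes> v u" using 3 by (simp add: g)
    moreover have "gen_act K q i (gen_act K q i v) u = q \<otimes> gen_act K q i v u" using 3 by (simp add: g)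
    moreover have "q \<otimes> (q \<otimes> v u) = p \<otimes> (q \<otimes> v u) \<oplus> q \<otimes> v u"
      unfolding m_assoc[symmetric, OF q_closed q_closed \<open>v u \<in> carrier K\<close>]
      by (subst (1) q) (simp add: l_distr m_assoc)
    ultimately show ?thesis by simp
  qed
  then show ?thesis by (simp add: p_def)
qed

lemma gen_act_comm:
  assumes v: "v \<in> fns" and ij: "i + 2 \<le> j"
  shows "gen_act K q i (gen_act K q j v) u = gen_act K q j (gen_act K q i v) u"
proof -
  have [simp]: "v w \<in> carrier K" for w using v by simp
  have e: "u \<circ> adj i \<circ> adj j = u \<circ> adj j \<circ> adj i" using ij by (auto simp: fun_eq_iff transpose_def)
  have [simp]: "adj i j = j" "adj i (Suc j) = Suc j" "adj j i = i" "adj j (Suc i) = Suc i"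
    using ij by (auto simp: transpose_def)
  show ?thesis
    by (simp add: gen_act_def e r_distr m_ac a_ac)
qed

text \<open>Both sides are governed by the relative order of the values of u at i, i + 1 and i + 2.
  The thirteen cases are the weak orders on three elements: six without ties, as for permutations,
  and seven with ties.\<close>

lemma gen_act_braid:
  assumes v: "v \<in> fns"
  shows "gen_act K q i (gen_act K q (Suc i) (gen_act K q i v)) u
    = gen_act K q (Suc i) (gen_act K q i (gen_act K q (Suc i) v)) u"
proof -
  have [simp]: "v w \<in> carrier K" for w using v by simp
  let ?a = "adj i" and ?b = "adj (Suc i)"
  have e: "u \<circ> ?a \<circ> ?b \<circ> ?a = u \<circ> ?b \<circ> ?a \<circ> ?b" by (auto simp: fun_eq_iff transpose_def)
  have e1: "w \<circ> ?a \<circ> ?a = w" "w \<circ> ?b \<circ> ?b = w" for w :: "nat \<Rightarrow> nat" by (simp_all only: comp_adj_adj)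
  have s [simp]: "?a i = Suc i" "?a (Suc i) = i" "?a (Suc (Suc i)) = Suc (Suc i)"
    "?b i = i" "?b (Suc i) = Suc (Suc i)" "?b (Suc (Suc i)) = Suc i"
    by (auto simp: transpose_def)
  define x y z where "x = u i" and "y = u (Suc i)" and "z = u (Suc (Suc i))"
  have xy: "u \<circ> ?a = u" if "x = y" using that by (auto simp: fun_eq_iff transpose_def x_def y_def)
  have xy': "u \<circ> ?b \<circ> ?a \<circ> ?b = u \<circ> ?b \<circ> ?a" if "x = y" using e xy[OF that] by simp
  have yz: "u \<circ> ?b = u" if "y = z" using that by (auto simp: fun_eq_iff transpose_def z_def y_def)
  have xz: "u \<circ> ?a \<circ> ?b = u \<circ> ?a" "u \<circ> ?b \<circ> ?a = u \<circ> ?b" if "x = z"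
    using that by (auto simp: fun_eq_iff transpose_def x_def z_def)
  define p where "p = q \<ominus> \<one>"
  have [simp]: "p \<in> carrier K" by (simp add: p_def)
  have [simp]: "u i = x" "u (Suc i) = y" "u (Suc (Suc i)) = z" by (simp_all add: x_def y_def z_def)
  note g = gen_act_def[of K q, folded p_def]
  have q: "q = p \<oplus> \<one>" by (simp add: p_def a_minus_def a_assoc l_neg)
  \<comment> \<open>In the cases with ties a generator can act as the scalar \<open>q\<close>, and
    squares of \<open>q\<close> then have to be matched with terms containing p = q - 1.\<close>
  have qq: "q \<otimes> (q \<otimes> t) = p \<otimes> (q \<otimes> t) \<oplus> q \<otimes> t" if "t \<in> carrier K" for t
    unfolding m_assoc[symmetric, OF q_closed q_closed that]
    by (subst (1) q) (use that in \<open>simp add: l_distr m_assoc\<close>)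
  consider "x < y" "y < z" | "x < z" "z < y" | "y < x" "x < z" | "y < z" "z < x" | "z < x" "x < y" | "z < y" "y < x"
    | "x = y" "y < z" | "x = y" "z < y" | "y = z" "x < y" | "y = z" "y < x" | "x = z" "x < y" | "x = z" "y < x"
    | "x = y" "y = z"
    by (cases x y rule: linorder_cases; cases y z rule: linorder_cases; cases x z rule: linorder_cases; blast)
  then show ?thesis
  proof cases
    case 1 then show ?thesis by (simp add: g e e1 r_distr m_ac a_ac)
  next
    case 2 then show ?thesis by (simp add: g e e1 r_distr m_ac a_ac)
  next
    case 3 then show ?thesis by (simp add: g e e1 r_distr m_ac a_ac)
  next
    case 4 then show ?thesis by (simp add: g e e1 r_distr m_ac a_ac)
  next
    case 5 then show ?thesis by (simp add: g e e1 r_distr m_ac a_ac)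
  next
    case 6 then show ?thesis by (simp add: g e e1 r_distr m_ac a_ac)
  next
    case 7 then show ?thesis using xy xy' by (simp add: g e e1 qq r_distr m_ac a_ac)
  next
    case 8 then show ?thesis using xy xy' by (simp add: g e e1 qq r_distr m_ac a_ac)
  next
    case 9 then show ?thesis using yz by (simp add: g e e1 qq r_distr m_ac a_ac)
  next
    case 10 then show ?thesis using yz by (simp add: g e e1 qq r_distr m_ac a_ac)
  next
    case 11 then show ?thesis using xz by (simp add: g e e1 qq r_distr m_ac a_ac)
  next
    case 12 then show ?thesis using xz by (simp add: g e e1 qq r_distr m_ac a_ac)
  next
    case 13 then show ?thesis using xy yz by (simp add: g e e1 qq r_distr m_ac a_ac)
  qed
qed

text \<open>\<open>cf h w\<close> is the coefficient of \<open>T w\<close> in \<open>h\<close>, read off from the action on the unit vector; the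
  functions acted on are indexed by inverses.\<close>

definition delta :: "(nat \<Rightarrow> nat) \<Rightarrow> (nat \<Rightarrow> nat) \<Rightarrow> 'k" where
  "delta w u = (if u = w then \<one> else \<zero>)"

definition cf :: "'k hecke \<Rightarrow> (nat \<Rightarrow> nat) \<Rightarrow> 'k" where
  "cf h w = free_act K q (SOME f. f \<in> carrier FA \<and> h = HI +>\<^bsub>FA\<^esub> f) (delta id) (pinv w)"

lemma delta_fns [simp]: "delta w \<in> fns" by (simp add: delta_def)

lemma FA_gen: "i \<in> {1..<n} \<Longrightarrow> free_gen K i \<in> carrier FA"
  unfolding free_gen_eq by (rule FA_monom) simp

lemma gen_mult: "free_gen K i \<otimes>\<^bsub>FA\<^esub> free_gen K j = word_monom K [i, j]"
  "word_monom K [i, j] \<otimes>\<^bsub>FA\<^esub> free_gen K l = word_monom K [i, j, l]"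
  by (simp_all add: free_gen_eq free_algebra_simps(2) fun_eq_iff conv_monom)

lemma hecke_relations_subset: "hecke_relations K q n \<subseteq> carrier FA"
  using FA_gen by (auto simp: hecke_relations_def Let_def)

lemma hecke_relations_kernel: "hecke_relations K q n \<subseteq> act_kernel"
proof
  fix r assume r: "r \<in> hecke_relations K q n"
  have rc: "r \<in> carrier FA" using r hecke_relations_subset by blast
  have l: "i \<in> {1..<n} \<Longrightarrow> j \<in> {1..<n} \<Longrightarrow> word_monom K [i, j] \<in> carrier FA"
    "i \<in> {1..<n} \<Longrightarrow> j \<in> {1..<n} \<Longrightarrow> word_monom K [i, j, i] \<in> carrier FA" for i j
    by (rule FA_monom, simp)+
  have "free_act K q r v u = \<zero>" if v: "v \<in> fns" for v u
  proof -
    consider (comm) i j where "r = free_gen K i \<otimes>\<^bsub>FA\<^esub> free_gen K j \<ominus>\<^bsub>FA\<^esub> free_gen K j \<otimes>\<^bsub>FA\<^esub> free_gen K i"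
        "i \<in> {1..<n}" "j \<in> {1..<n}" "i + 2 \<le> j \<or> j + 2 \<le> i"
      | (braid) i where "r = free_gen K i \<otimes>\<^bsub>FA\<^esub> free_gen K (i + 1) \<otimes>\<^bsub>FA\<^esub> free_gen K i \<ominus>\<^bsub>FA\<^esub>
          free_gen K (i + 1) \<otimes>\<^bsub>FA\<^esub> free_gen K i \<otimes>\<^bsub>FA\<^esub> free_gen K (i + 1)" "i \<in> {1..<n}" "i + 1 \<in> {1..<n}"
      | (quad) i where "r = (free_gen K i \<ominus>\<^bsub>FA\<^esub> q \<odot>\<^bsub>FA\<^esub> \<one>\<^bsub>FA\<^esub>) \<otimes>\<^bsub>FA\<^esub> (free_gen K i \<oplus>\<^bsub>FA\<^esub> \<one>\<^bsub>FA\<^esub>)" "i \<in> {1..<n}"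
      using r unfolding hecke_relations_def Let_def by blast
    then show ?thesis
    proof cases
      case comm
      have "gen_act K q i (gen_act K q j v) u = gen_act K q j (gen_act K q i v) u"
        using comm(4) gen_act_comm[OF v, of i j] gen_act_comm[OF v, of j i] by auto
      then show ?thesis
        unfolding comm(1) gen_mult using free_act_minus[OF l(1)[OF comm(2,3)] l(1)[OF comm(3,2)] v, of u] v gen_act_closed
        by (simp add: free_act_word a_minus_def r_neg)
    next
      case braid
      have "gen_act K q i (gen_act K q (i + 1) (gen_act K q i v)) u = gen_act K q (i + 1) (gen_act K q i (gen_act K q (i + 1) v)) u"
        using gen_act_braid[OF v, of i u] by (simp only: Suc_eq_plus1)
      then show ?thesis
        unfolding braid(1) gen_mult
        using free_act_minus[OF l(2)[OF braid(2,3)] l(2)[OF braid(3,2)] v, of u] v gen_act_closed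
        by (simp add: free_act_word a_minus_def r_neg)
    next
      case quad
      note g = FA_gen[OF quad(2)]
      have one: "\<one>\<^bsub>FA\<^esub> \<in> carrier FA" "q \<odot>\<^bsub>FA\<^esub> \<one>\<^bsub>FA\<^esub> \<in> carrier FA" by simp_all
      let ?a = "free_gen K i \<ominus>\<^bsub>FA\<^esub> q \<odot>\<^bsub>FA\<^esub> \<one>\<^bsub>FA\<^esub>" and ?b = "free_gen K i \<oplus>\<^bsub>FA\<^esub> \<one>\<^bsub>FA\<^esub>"
      have ab: "?a \<in> carrier FA" "?b \<in> carrier FA" using g one by simp_all
      \<comment> \<open>\<open>w\<close> is (T_i + 1) v. The quadratic relation amounts to T_i
        acting on it as the scalar \<open>q\<close>.\<close>
      define w where "w = (\<lambda>u. gen_act K q i v u \<oplus> v u)"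
      have gv: "gen_act K q i v \<in> fns" by (rule gen_act_closed[OF v])
      have w: "w \<in> fns" using gv v by (simp add: w_def)
      have "free_act K q ?b v = w"
        using free_act_add[OF g one(1) v] v
        by (auto simp: w_def free_algebra_simps(3,5) free_gen_eq free_act_word fun_eq_iff)
      then have "free_act K q r v u = free_act K q ?a w u"
        using free_act_mult[OF ab v, of u] by (simp add: quad(1) free_algebra_simps(2))
      also have "\<dots> = gen_act K q i w u \<ominus> q \<otimes> w u"
        using free_act_minus[OF g one(2) w, of u] free_act_smult[OF q_closed one(1) w, of u] w
        by (simp add: free_algebra_simps(3,6) free_gen_eq free_act_word)
      also have "gen_act K q i w u = gen_act K q i (gen_act K q i v) u \<oplus> gen_act K q i v u"
        unfolding w_def gen_act_add[OF gv v] ..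
      also have "\<dots> = q \<otimes> w u"
      proof -
        have [simp]: "gen_act K q i v u \<in> carrier K" "v u \<in> carrier K" using gv v by simp_all
        define x y where "x = gen_act K q i v u" and "y = v u"
        have [simp]: "x \<in> carrier K" "y \<in> carrier K" by (simp_all add: x_def y_def)
        have "(q \<ominus> \<one>) \<otimes> x \<oplus> x = ((q \<ominus> \<one>) \<oplus> \<one>) \<otimes> x" by (simp add: l_distr)
        also have "(q \<ominus> \<one>) \<oplus> \<one> = q" by (simp add: a_minus_def a_assoc l_neg)
        finally have qx: "q \<otimes> x = (q \<ominus> \<one>) \<otimes> x \<oplus> x" ..
        have "(q \<ominus> \<one>) \<otimes> x \<oplus> q \<otimes> y \<oplus> x = q \<otimes> (x \<oplus> y)"
          unfolding r_distr[OF \<open>x \<in> carrier K\<close> \<open>y \<in> carrier K\<close> q_closed] qx by (simp add: a_ac)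
        then show ?thesis unfolding gen_act_quadratic[OF v] w_def x_def y_def .
      qed
      finally show ?thesis using w by (simp add: a_minus_def r_neg)
    qed
  qed
  then show "r \<in> act_kernel" using rc by (simp add: act_kernel_def)
qed

lemma ideal_HI: "ideal HI FA"
  unfolding hecke_ideal_def by (rule F.A.genideal_ideal[OF hecke_relations_subset])

lemma HI_kernel: "HI \<subseteq> act_kernel"
  unfolding hecke_ideal_def by (rule F.A.genideal_minimal[OF ideal_act_kernel hecke_relations_kernel])

lemma relations_HI: "r \<in> hecke_relations K q n \<Longrightarrow> r \<in> HI"
  unfolding hecke_ideal_def using F.A.genideal_self[OF hecke_relations_subset] by blast

sublocale HQ: algebra_quotient K FA HI
  by (intro algebra_quotient.intro F.assoc_algebra_axioms ideal_HI)

sublocale Hk: assoc_algebra K H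
  unfolding hecke_algebra_def by (rule HQ.assoc_algebra_Q)

lemma delta_closed [simp]: "delta w u \<in> carrier K"
  by (simp add: delta_def)

section \<open>Words in the generators of \<open>H\<close> and the elements
  \<open>T w\<close>\<close>

definition tw :: "nat list \<Rightarrow> 'k hecke" where
  "tw ws = foldr (\<lambda>i h. T_gen i \<otimes>\<^bsub>H\<^esub> h) ws \<one>\<^bsub>H\<^esub>"

abbreviation Sn :: "(nat \<Rightarrow> nat) set" where "Sn \<equiv> {w. w permutes {1..n}}"

lemma finite_Sn: "finite Sn" by (rule finite_permutations) simp

lemma tw_simps [simp]: "tw [] = \<one>\<^bsub>H\<^esub>" "tw (i # ws) = T_gen i \<otimes>\<^bsub>H\<^esub> tw ws"
  by (simp_all add: tw_def)

lemma T_eq_tw: "T w = tw (reduced_word n w)"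
  by (simp add: T_def tw_def)

lemma T_gen_closed [simp]: "i \<in> {1..<n} \<Longrightarrow> T_gen i \<in> carrier H"
  unfolding T_gen_def hecke_algebra_def using FA_gen by blast

lemma tw_closed [simp]: "set ws \<subseteq> {1..<n} \<Longrightarrow> tw ws \<in> carrier H"
  by (induction ws) auto

lemma coset_word: "set ws \<subseteq> {1..<n} \<Longrightarrow> HI +>\<^bsub>FA\<^esub> word_monom K ws = tw ws"
proof (induction ws)
  case Nil
  show ?case using HQ.coset_one by (simp add: hecke_algebra_def free_algebra_simps(3))
next
  case (Cons i ws)
  then have c: "free_gen K i \<in> carrier FA" "word_monom K ws \<in> carrier FA" by (auto intro: FA_gen FA_monom)
  have "free_gen K i \<otimes>\<^bsub>FA\<^esub> word_monom K ws = word_monom K (i # ws)"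
    by (simp add: free_gen_eq free_algebra_simps(2) fun_eq_iff conv_monom)
  then show ?case using HQ.coset_mult[OF c] Cons by (simp add: T_gen_def hecke_algebra_def)
qed

lemma H_cases: "h \<in> carrier H \<Longrightarrow> (\<And>f. f \<in> carrier FA \<Longrightarrow> h = HI +>\<^bsub>FA\<^esub> f \<Longrightarrow> P) \<Longrightarrow> P"
  unfolding hecke_algebra_def by (rule HQ.coset_cases)

lemma H_coset:
  "f \<in> carrier FA \<Longrightarrow> HI +>\<^bsub>FA\<^esub> f \<in> carrier H"
  "f \<in> carrier FA \<Longrightarrow> g \<in> carrier FA \<Longrightarrow> (HI +>\<^bsub>FA\<^esub> f) \<oplus>\<^bsub>H\<^esub> (HI +>\<^bsub>FA\<^esub> g) = HI +>\<^bsub>FA\<^esub> (f \<oplus>\<^bsub>FA\<^esub> g)"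
  "f \<in> carrier FA \<Longrightarrow> g \<in> carrier FA \<Longrightarrow> (HI +>\<^bsub>FA\<^esub> f) \<otimes>\<^bsub>H\<^esub> (HI +>\<^bsub>FA\<^esub> g) = HI +>\<^bsub>FA\<^esub> (f \<otimes>\<^bsub>FA\<^esub> g)"
  "c \<in> carrier K \<Longrightarrow> f \<in> carrier FA \<Longrightarrow> c \<odot>\<^bsub>H\<^esub> (HI +>\<^bsub>FA\<^esub> f) = HI +>\<^bsub>FA\<^esub> (c \<odot>\<^bsub>FA\<^esub> f)"
  "\<one>\<^bsub>H\<^esub> = HI +>\<^bsub>FA\<^esub> \<one>\<^bsub>FA\<^esub>" "\<zero>\<^bsub>H\<^esub> = HI +>\<^bsub>FA\<^esub> \<zero>\<^bsub>FA\<^esub>"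
  unfolding hecke_algebra_def
  by (simp_all only: HQ.coset_closed HQ.coset_add HQ.coset_mult HQ.coset_smult HQ.coset_one HQ.coset_zero)

lemma H_word_induct [consumes 1, case_names zero step]:
  assumes h: "h \<in> carrier H" and zero: "P \<zero>\<^bsub>H\<^esub>"
    and step: "\<And>h c ws. h \<in> carrier H \<Longrightarrow> P h \<Longrightarrow> c \<in> carrier K \<Longrightarrow> set ws \<subseteq> {1..<n} \<Longrightarrow> P (h \<oplus>\<^bsub>H\<^esub> c \<odot>\<^bsub>H\<^esub> tw ws)"
  shows "P h"
proof -
  obtain f where f: "f \<in> carrier FA" "h = HI +>\<^bsub>FA\<^esub> f" using h by (rule H_cases)
  from f(1) have "P (HI +>\<^bsub>FA\<^esub> f)"
  proof (induction rule: free_algebra_induct)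
    case zero then show ?case using assms(2) by (simp add: H_coset(6) free_algebra_simps(4))
  next
    case (step f c ws)
    have ws: "set ws \<subseteq> {1..<n}" using step by (simp add: in_lists_conv_set subset_iff)
    have m: "word_monom K ws \<in> carrier FA" by (rule FA_monom) fact
    have "P ((HI +>\<^bsub>FA\<^esub> f) \<oplus>\<^bsub>H\<^esub> c \<odot>\<^bsub>H\<^esub> tw ws)"
      by (rule assms(3)) (use step ws H_coset(1) in auto)
    moreover have "(HI +>\<^bsub>FA\<^esub> f) \<oplus>\<^bsub>H\<^esub> c \<odot>\<^bsub>H\<^esub> tw ws = HI +>\<^bsub>FA\<^esub> (f \<oplus>\<^bsub>FA\<^esub> c \<odot>\<^bsub>FA\<^esub> word_monom K ws)"
      using step.hyps m F.smult_closed[OF step.hyps(2) m]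
      by (simp only: coset_word[OF ws, symmetric] H_coset)
    ultimately show ?case by (simp add: free_algebra_simps(5,6))
  qed
  then show ?thesis using f by simp
qed

lemma minus_eq_zero_iff: "x \<in> carrier K \<Longrightarrow> y \<in> carrier K \<Longrightarrow> x \<ominus> y = \<zero> \<Longrightarrow> x = y"
  unfolding a_minus_def by (metis a_inv_closed minus_equality minus_minus)

text \<open>Two representatives of a coset differ by an element of \<open>HI\<close>, which acts as
  zero; so the choice in \<open>cf\<close> does not affect the value.\<close>

lemma cf_coset:
  assumes f: "f \<in> carrier FA"
  shows "cf (HI +>\<^bsub>FA\<^esub> f) w = free_act K q f (delta id) (pinv w)"
proof -
  define g where "g = (SOME g. g \<in> carrier FA \<and> HI +>\<^bsub>FA\<^esub> f = HI +>\<^bsub>FA\<^esub> g)"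
  have g: "g \<in> carrier FA \<and> HI +>\<^bsub>FA\<^esub> f = HI +>\<^bsub>FA\<^esub> g"
    unfolding g_def by (rule someI[of _ f]) (use f in simp)
  then have "g \<ominus>\<^bsub>FA\<^esub> f \<in> HI" using HQ.coset_eq_iff[of g f] f by simp
  then have "g \<ominus>\<^bsub>FA\<^esub> f \<in> act_kernel" using HI_kernel by blast
  then have "free_act K q g (delta id) (pinv w) \<ominus> free_act K q f (delta id) (pinv w) = \<zero>"
    using free_act_minus[of g f "delta id" "pinv w"] f g by (simp add: act_kernel_def)
  moreover have "free_act K q f (delta id) (pinv w) \<in> carrier K" "free_act K q g (delta id) (pinv w) \<in> carrier K"
    using FA_fns f g by auto
  ultimately have "free_act K q g (delta id) (pinv w) = free_act K q f (delta id) (pinv w)"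
    using minus_eq_zero_iff by blast
  then show ?thesis by (simp add: cf_def g_def[symmetric])
qed

lemma cf_closed [simp]: "h \<in> carrier H \<Longrightarrow> cf h w \<in> carrier K"
  by (erule H_cases) (use FA_fns in \<open>auto simp: cf_coset\<close>)

lemma cf_add [simp]: "h \<in> carrier H \<Longrightarrow> g \<in> carrier H \<Longrightarrow> cf (h \<oplus>\<^bsub>H\<^esub> g) w = cf h w \<oplus> cf g w"
proof (elim H_cases)
  fix f f' assume c: "f \<in> carrier FA" "f' \<in> carrier FA" and e: "h = HI +>\<^bsub>FA\<^esub> f" "g = HI +>\<^bsub>FA\<^esub> f'"
  show ?thesis
    using free_act_add[OF c delta_fns] cf_coset[OF F.M.a_closed[OF c]] unfolding e
    by (simp add: H_coset(2)[OF c] cf_coset c free_algebra_simps(5))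
qed

lemma cf_smult [simp]: "c \<in> carrier K \<Longrightarrow> h \<in> carrier H \<Longrightarrow> cf (c \<odot>\<^bsub>H\<^esub> h) w = c \<otimes> cf h w"
proof (elim H_cases)
  fix f assume c: "c \<in> carrier K" "f \<in> carrier FA" and e: "h = HI +>\<^bsub>FA\<^esub> f"
  show ?thesis
    using free_act_smult[OF c delta_fns] cf_coset[OF F.smult_closed[OF c]] unfolding e
    by (simp add: H_coset(4)[OF c] cf_coset c free_algebra_simps(6))
qed

lemma cf_zero [simp]: "cf \<zero>\<^bsub>H\<^esub> w = \<zero>"
  using cf_coset[OF F.M.zero_closed] by (simp add: H_coset(6)) (simp add: free_algebra_simps(4) free_act_zero)

lemma cf_one: "w \<in> Sn \<Longrightarrow> cf \<one>\<^bsub>H\<^esub> w = (if w = id then \<one> else \<zero>)"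
proof -
  assume w: "w \<in> Sn"
  have "pinv w = id \<longleftrightarrow> w = id"
    using w permutes_inv_inv[of w "{1..n}"] by (auto simp: inv_id)
  moreover have "cf \<one>\<^bsub>H\<^esub> w = delta id (pinv w)"
    using cf_coset[OF F.A.one_closed, of w] by (simp add: H_coset(5) free_algebra_simps(3) free_act_word)
  ultimately show ?thesis by (simp add: delta_def)
qed

text \<open>The functions acted on are indexed by inverses, which turns
  \<open>pinv w \<circ> adj i\<close> into the coefficient at
  \<open>adj i \<circ> w\<close>.\<close>

lemma cf_T_gen:
  assumes i: "i \<in> {1..<n}" and h: "h \<in> carrier H" and w: "w \<in> Sn"
  shows "cf (T_gen i \<otimes>\<^bsub>H\<^esub> h) w = (if pinv w (Suc i) < pinv w i then cf h (adj i \<circ> w) \<oplus> (q \<ominus> \<one>) \<otimes> cf h w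
    else q \<otimes> cf h (adj i \<circ> w))"
  using h
proof (rule H_cases)
  fix f assume f: "f \<in> carrier FA" and e: "h = HI +>\<^bsub>FA\<^esub> f"
  have "cf (T_gen i \<otimes>\<^bsub>H\<^esub> h) w = free_act K q (free_gen K i \<otimes>\<^bsub>FA\<^esub> f) (delta id) (pinv w)"
    unfolding e T_gen_def H_coset(3)[OF FA_gen[OF i] f] by (rule cf_coset[OF F.A.m_closed[OF FA_gen[OF i] f]])
  also have "\<dots> = free_act K q (free_gen K i) (free_act K q f (delta id)) (pinv w)"
    using free_act_mult[OF FA_gen[OF i] f delta_fns] by (simp add: free_algebra_simps(2))
  also have "\<dots> = gen_act K q i (free_act K q f (delta id)) (pinv w)"
    unfolding free_gen_eq by (subst free_act_word) (use FA_fns(1)[OF f] in auto)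
  finally show ?thesis
    using w i unfolding e by (simp add: gen_act_def cf_coset[OF f] inv_adj_comp)
qed

lemma H_rel:
  assumes "x \<in> carrier FA" "y \<in> carrier FA" "x \<ominus>\<^bsub>FA\<^esub> y \<in> hecke_relations K q n"
  shows "HI +>\<^bsub>FA\<^esub> x = HI +>\<^bsub>FA\<^esub> y"
  using HQ.coset_eq_iff[OF assms(1,2)] relations_HI[OF assms(3)] by simp

lemma T_gen_comm:
  assumes "i \<in> {1..<n}" "j \<in> {1..<n}" "i + 2 \<le> j"
  shows "T_gen i \<otimes>\<^bsub>H\<^esub> T_gen j = T_gen j \<otimes>\<^bsub>H\<^esub> T_gen i"
  unfolding T_gen_def H_coset(3)[OF FA_gen[OF assms(1)] FA_gen[OF assms(2)]] H_coset(3)[OF FA_gen[OF assms(2)] FA_gen[OF assms(1)]]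
proof (rule H_rel)
  show "free_gen K i \<otimes>\<^bsub>FA\<^esub> free_gen K j \<ominus>\<^bsub>FA\<^esub> free_gen K j \<otimes>\<^bsub>FA\<^esub> free_gen K i \<in> hecke_relations K q n"
    unfolding hecke_relations_def Let_def using assms by blast
qed (use assms FA_gen in auto)

lemma T_gen_braid:
  assumes "i \<in> {1..<n}" "Suc i \<in> {1..<n}"
  shows "T_gen i \<otimes>\<^bsub>H\<^esub> (T_gen (Suc i) \<otimes>\<^bsub>H\<^esub> T_gen i) = T_gen (Suc i) \<otimes>\<^bsub>H\<^esub> (T_gen i \<otimes>\<^bsub>H\<^esub> T_gen (Suc i))"
proof -
  note g = FA_gen[OF assms(1)] FA_gen[OF assms(2)]
  have "HI +>\<^bsub>FA\<^esub> (free_gen K i \<otimes>\<^bsub>FA\<^esub> free_gen K (Suc i) \<otimes>\<^bsub>FA\<^esub> free_gen K i)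
      = HI +>\<^bsub>FA\<^esub> (free_gen K (Suc i) \<otimes>\<^bsub>FA\<^esub> free_gen K i \<otimes>\<^bsub>FA\<^esub> free_gen K (Suc i))"
  proof (rule H_rel)
    show "free_gen K i \<otimes>\<^bsub>FA\<^esub> free_gen K (Suc i) \<otimes>\<^bsub>FA\<^esub> free_gen K i
      \<ominus>\<^bsub>FA\<^esub> free_gen K (Suc i) \<otimes>\<^bsub>FA\<^esub> free_gen K i \<otimes>\<^bsub>FA\<^esub> free_gen K (Suc i) \<in> hecke_relations K q n"
      unfolding hecke_relations_def Let_def Suc_eq_plus1 using assms[unfolded Suc_eq_plus1] by blast
  qed (use g in auto)
  then show ?thesis
    using g by (simp add: T_gen_def H_coset(1,3) F.A.m_assoc)
qed

lemma T_gen_quad: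
  assumes i: "i \<in> {1..<n}"
  shows "T_gen i \<otimes>\<^bsub>H\<^esub> T_gen i = (q \<ominus> \<one>) \<odot>\<^bsub>H\<^esub> T_gen i \<oplus>\<^bsub>H\<^esub> q \<odot>\<^bsub>H\<^esub> \<one>\<^bsub>H\<^esub>"
proof -
  note g = FA_gen[OF i]
  let ?a = "T_gen i"
  have a: "?a \<in> carrier H" using i by simp
  have r: "(free_gen K i \<ominus>\<^bsub>FA\<^esub> q \<odot>\<^bsub>FA\<^esub> \<one>\<^bsub>FA\<^esub>) \<otimes>\<^bsub>FA\<^esub> (free_gen K i \<oplus>\<^bsub>FA\<^esub> \<one>\<^bsub>FA\<^esub>) \<in> hecke_relations K q n"
    using i by (auto simp: hecke_relations_def Let_def)
  have "HI +>\<^bsub>FA\<^esub> (free_gen K i \<otimes>\<^bsub>FA\<^esub> (free_gen K i \<oplus>\<^bsub>FA\<^esub> \<one>\<^bsub>FA\<^esub>))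
      = HI +>\<^bsub>FA\<^esub> ((q \<odot>\<^bsub>FA\<^esub> \<one>\<^bsub>FA\<^esub>) \<otimes>\<^bsub>FA\<^esub> (free_gen K i \<oplus>\<^bsub>FA\<^esub> \<one>\<^bsub>FA\<^esub>))"
    by (rule H_rel) (use g r in \<open>simp_all add: F.A.l_distr F.A.l_minus a_minus_def\<close>)
  then have "?a \<otimes>\<^bsub>H\<^esub> (?a \<oplus>\<^bsub>H\<^esub> \<one>\<^bsub>H\<^esub>) = (q \<odot>\<^bsub>H\<^esub> \<one>\<^bsub>H\<^esub>) \<otimes>\<^bsub>H\<^esub> (?a \<oplus>\<^bsub>H\<^esub> \<one>\<^bsub>H\<^esub>)"
    using g by (simp add: T_gen_def H_coset)
  then have e: "?a \<otimes>\<^bsub>H\<^esub> ?a \<oplus>\<^bsub>H\<^esub> ?a = q \<odot>\<^bsub>H\<^esub> ?a \<oplus>\<^bsub>H\<^esub> q \<odot>\<^bsub>H\<^esub> \<one>\<^bsub>H\<^esub>"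
    using a by (simp add: Hk.A.r_distr Hk.smult_mult_l Hk.smult_r_distr)
  have "(q \<ominus> \<one>) \<odot>\<^bsub>H\<^esub> ?a \<oplus>\<^bsub>H\<^esub> ?a = ((q \<ominus> \<one>) \<oplus> \<one>) \<odot>\<^bsub>H\<^esub> ?a"
    using a by (simp add: Hk.smult_l_distr)
  also have "(q \<ominus> \<one>) \<oplus> \<one> = q" by (simp add: a_minus_def a_assoc l_neg)
  finally have qa: "q \<odot>\<^bsub>H\<^esub> ?a = (q \<ominus> \<one>) \<odot>\<^bsub>H\<^esub> ?a \<oplus>\<^bsub>H\<^esub> ?a" ..
  have "?a \<otimes>\<^bsub>H\<^esub> ?a \<oplus>\<^bsub>H\<^esub> ?a = ((q \<ominus> \<one>) \<odot>\<^bsub>H\<^esub> ?a \<oplus>\<^bsub>H\<^esub> q \<odot>\<^bsub>H\<^esub> \<one>\<^bsub>H\<^esub>) \<oplus>\<^bsub>H\<^esub> ?a"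
    unfolding e qa using a by (simp add: Hk.M.a_ac)
  then show ?thesis
    using a by (simp add: Hk.M.add.right_cancel)
qed

lemma tw_append: "set us \<subseteq> {1..<n} \<Longrightarrow> set vs \<subseteq> {1..<n} \<Longrightarrow> tw (us @ vs) = tw us \<otimes>\<^bsub>H\<^esub> tw vs"
  by (induction us) (auto simp: Hk.A.m_assoc)

text \<open>Matsumoto's theorem for the evaluation of words in \<open>H\<close>: every reduced word
  yields the same element as the chosen \<open>reduced_word\<close>.\<close>

lemma T_word:
  assumes "set ws \<subseteq> {1..<n}" "length ws = len (word_perm ws)"
  shows "tw ws = T (word_perm ws)"
  unfolding T_eq_tw
proof (rule matsumoto[where P = tw, OF _ _ _ assms])
  note w = word_perm_permutes[OF assms(1)]
  show "set (reduced_word n (word_perm ws)) \<subseteq> {1..<n}"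
    "length (reduced_word n (word_perm ws)) = len (word_perm (reduced_word n (word_perm ws)))"
    "word_perm ws = word_perm (reduced_word n (word_perm ws))"
    using reduced_word[OF w] by simp_all
next
  fix i j u assume "i \<in> {1..<n}" "j \<in> {1..<n}" "i + 2 \<le> j" "set u \<subseteq> {1..<n}"
  then show "tw (i # j # u) = tw (j # i # u)"
    using T_gen_comm[of i j] by (simp add: Hk.A.m_assoc[symmetric])
next
  fix i u assume "i \<in> {1..<n}" "Suc i \<in> {1..<n}" "set u \<subseteq> {1..<n}"
  then show "tw (i # Suc i # i # u) = tw (Suc i # i # Suc i # u)"
    using arg_cong[OF T_gen_braid[of i], of "\<lambda>x. x \<otimes>\<^bsub>H\<^esub> tw u"] by (simp add: Hk.A.m_assoc)
qed simp

lemma T_closed [simp]: "w \<in> Sn \<Longrightarrow> T w \<in> carrier H"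
  unfolding T_eq_tw using reduced_word(1) by simp

text \<open>If the lengths add, the concatenation of reduced words is reduced.\<close>

lemma T_mult:
  assumes x: "x \<in> Sn" and y: "y \<in> Sn" and l: "len (x \<circ> y) = len x + len y"
  shows "T x \<otimes>\<^bsub>H\<^esub> T y = T (x \<circ> y)"
proof -
  have rx: "set (reduced_word n x) \<subseteq> {1..<n}" "word_perm (reduced_word n x) = x" "length (reduced_word n x) = len x"
    and ry: "set (reduced_word n y) \<subseteq> {1..<n}" "word_perm (reduced_word n y) = y" "length (reduced_word n y) = len y"
    using reduced_word x y by simp_all
  have "T x \<otimes>\<^bsub>H\<^esub> T y = tw (reduced_word n x @ reduced_word n y)"
    unfolding T_eq_tw using rx ry by (simp add: tw_append)
  also have "\<dots> = T (word_perm (reduced_word n x @ reduced_word n y))"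
    by (rule T_word) (use rx ry l in \<open>auto simp: word_perm_append\<close>)
  finally show ?thesis using rx ry by (simp add: word_perm_append)
qed

lemma T_id: "T id = \<one>\<^bsub>H\<^esub>"
  using T_word[of "[]"] by (simp add: len_id)

lemma T_adj: "i \<in> {1..<n} \<Longrightarrow> T (adj i) = T_gen i"
  using T_word[of "[i]"] by (simp add: len_adj)

lemma adj_Sn: "i \<in> {1..<n} \<Longrightarrow> adj i \<in> Sn"
  using adj_permutes by blast

lemma comp_Sn: "x \<in> Sn \<Longrightarrow> y \<in> Sn \<Longrightarrow> x \<circ> y \<in> Sn"
  using permutes_compose by blast

lemma inv_Sn: "w \<in> Sn \<Longrightarrow> pinv w \<in> Sn"
  using permutes_inv by blast

lemma id_Sn: "id \<in> Sn"
  using permutes_id by blast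

lemma T_gen_up:
  assumes "i \<in> {1..<n}" "w \<in> Sn" "pinv w i < pinv w (Suc i)"
  shows "T_gen i \<otimes>\<^bsub>H\<^esub> T w = T (adj i \<circ> w)"
  using T_mult[OF adj_Sn[OF assms(1)] assms(2)] len_adj_comp_up[of w n i] assms by (simp add: T_adj len_adj)

lemma T_gen_down:
  assumes i: "i \<in> {1..<n}" and w: "w \<in> Sn" and d: "pinv w (Suc i) < pinv w i"
  shows "T_gen i \<otimes>\<^bsub>H\<^esub> T w = (q \<ominus> \<one>) \<odot>\<^bsub>H\<^esub> T w \<oplus>\<^bsub>H\<^esub> q \<odot>\<^bsub>H\<^esub> T (adj i \<circ> w)"
proof -
  let ?w = "adj i \<circ> w"
  have w': "?w \<in> Sn" by (rule comp_Sn[OF adj_Sn[OF i] w])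
  have Tw: "T w = T_gen i \<otimes>\<^bsub>H\<^esub> T ?w"
    using T_gen_up[OF i w'] d w i by (simp add: inv_adj_comp adj_adj_comp)
  have "T_gen i \<otimes>\<^bsub>H\<^esub> T w = T_gen i \<otimes>\<^bsub>H\<^esub> T_gen i \<otimes>\<^bsub>H\<^esub> T ?w"
    unfolding Tw using i w' by (simp add: Hk.A.m_assoc)
  also have "\<dots> = (q \<ominus> \<one>) \<odot>\<^bsub>H\<^esub> (T_gen i \<otimes>\<^bsub>H\<^esub> T ?w) \<oplus>\<^bsub>H\<^esub> q \<odot>\<^bsub>H\<^esub> T ?w"
    unfolding T_gen_quad[OF i] using i w' by (simp add: Hk.A.l_distr Hk.smult_mult_l)
  finally show ?thesis by (simp only: Tw[symmetric])
qed

text \<open>Linear independence of the \<open>T w\<close>. With a left descent i split off from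
  \<open>w\<close>, the recursion \<open>cf_T_gen\<close> could produce a term with q - 1 only at z
  = \<open>?w\<close>, which has no descent at i, and a term with \<open>q\<close> only at z = w,
  which has one. What remains is the coefficient one at z = w.\<close>

lemma cf_T: "w \<in> Sn \<Longrightarrow> z \<in> Sn \<Longrightarrow> cf (T w) z = (if z = w then \<one> else \<zero>)"
proof (induction "len w" arbitrary: w z rule: less_induct)
  case less
  then have w: "w permutes {1..n}" and z: "z permutes {1..n}" by auto
  show ?case
  proof (cases "w = id")
    case True then show ?thesis using cf_one[OF less.prems(2)] by (simp add: T_id)
  next
    case False
    then have "pinv w \<noteq> id" using permutes_inv_inv[OF w] by (auto simp: inv_id)
    then obtain i where i: "i \<in> {1..<n}" "pinv w (Suc i) < pinv w i"
      using ex_descent[OF permutes_inv[OF w]] by blast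
    let ?w = "adj i \<circ> w"
    have w': "?w \<in> Sn" by (rule comp_Sn[OF adj_Sn[OF i(1)] less.prems(1)])
    have l: "len ?w < len w" using len_adj_comp_down[OF w i] by simp
    have Tw: "T w = T_gen i \<otimes>\<^bsub>H\<^esub> T ?w"
      using T_gen_up[OF i(1) w'] i w by (simp add: inv_adj_comp adj_adj_comp)
    have IH: "cf (T ?w) z' = (if z' = ?w then \<one> else \<zero>)" if "z' \<in> Sn" for z'
      by (rule less.hyps[OF l w' that])
    have e: "adj i \<circ> z = ?w \<longleftrightarrow> z = w" by (metis adj_adj_comp)
    have ne: "z \<noteq> ?w" if "pinv z (Suc i) < pinv z i"
      using that i w by (auto simp: inv_adj_comp)
    have z': "adj i \<circ> z \<in> Sn" by (rule comp_Sn[OF adj_Sn[OF i(1)] less.prems(2)])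
    show ?thesis
      unfolding Tw cf_T_gen[OF i(1) T_closed[OF w'] less.prems(2)] IH[OF less.prems(2)] IH[OF z'] e
      using ne i by auto
  qed
qed

text \<open>The relabelling \<sigma> allows two uses: the identity gives the expansion in the basis,
  and inversion gives the anti-involution.\<close>

definition expand_by :: "((nat \<Rightarrow> nat) \<Rightarrow> nat \<Rightarrow> nat) \<Rightarrow> 'k hecke \<Rightarrow> 'k hecke" where
  "expand_by \<sigma> h = (\<Oplus>\<^bsub>H\<^esub>w\<in>Sn. cf h w \<odot>\<^bsub>H\<^esub> T (\<sigma> w))"

lemma expand_by_closed:
  assumes "\<sigma> \<in> Sn \<rightarrow> Sn" "h \<in> carrier H" shows "expand_by \<sigma> h \<in> carrier H"
  unfolding expand_by_def by (rule Hk.M.finsum_closed) (use assms in \<open>auto simp: Pi_iff\<close>)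

lemma expand_by_add:
  assumes \<sigma>: "\<sigma> \<in> Sn \<rightarrow> Sn" and h: "h \<in> carrier H" and g: "g \<in> carrier H"
  shows "expand_by \<sigma> (h \<oplus>\<^bsub>H\<^esub> g) = expand_by \<sigma> h \<oplus>\<^bsub>H\<^esub> expand_by \<sigma> g"
proof -
  have "expand_by \<sigma> (h \<oplus>\<^bsub>H\<^esub> g) = (\<Oplus>\<^bsub>H\<^esub>w\<in>Sn. cf h w \<odot>\<^bsub>H\<^esub> T (\<sigma> w) \<oplus>\<^bsub>H\<^esub> cf g w \<odot>\<^bsub>H\<^esub> T (\<sigma> w))"
    unfolding expand_by_def by (rule Hk.M.finsum_cong') (use assms in \<open>auto simp: Hk.smult_l_distr Pi_iff\<close>)
  also have "\<dots> = expand_by \<sigma> h \<oplus>\<^bsub>H\<^esub> expand_by \<sigma> g"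
    unfolding expand_by_def by (rule Hk.M.finsum_addf) (use assms in \<open>auto simp: Pi_iff\<close>)
  finally show ?thesis .
qed

lemma H_finsum_smult:
  assumes "finite S" "c \<in> carrier K" "f \<in> S \<rightarrow> carrier H"
  shows "c \<odot>\<^bsub>H\<^esub> (\<Oplus>\<^bsub>H\<^esub>w\<in>S. f w) = (\<Oplus>\<^bsub>H\<^esub>w\<in>S. c \<odot>\<^bsub>H\<^esub> f w)"
  using assms by (induction S rule: finite_induct) (auto simp: Pi_iff Hk.smult_r_distr)

lemma expand_by_smult:
  assumes \<sigma>: "\<sigma> \<in> Sn \<rightarrow> Sn" and c: "c \<in> carrier K" and h: "h \<in> carrier H"
  shows "expand_by \<sigma> (c \<odot>\<^bsub>H\<^esub> h) = c \<odot>\<^bsub>H\<^esub> expand_by \<sigma> h"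
proof -
  have "c \<odot>\<^bsub>H\<^esub> expand_by \<sigma> h = (\<Oplus>\<^bsub>H\<^esub>w\<in>Sn. c \<odot>\<^bsub>H\<^esub> (cf h w \<odot>\<^bsub>H\<^esub> T (\<sigma> w)))"
    unfolding expand_by_def by (rule H_finsum_smult[OF finite_Sn]) (use assms in \<open>auto simp: Pi_iff\<close>)
  also have "\<dots> = expand_by \<sigma> (c \<odot>\<^bsub>H\<^esub> h)"
    unfolding expand_by_def by (rule Hk.M.finsum_cong') (use assms in \<open>auto simp: Hk.smult_assoc1 Pi_iff\<close>)
  finally show ?thesis ..
qed

lemma expand_by_T:
  assumes \<sigma>: "\<sigma> \<in> Sn \<rightarrow> Sn" and w: "w \<in> Sn" shows "expand_by \<sigma> (T w) = T (\<sigma> w)"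
proof -
  have "expand_by \<sigma> (T w) = (\<Oplus>\<^bsub>H\<^esub>z\<in>Sn. if w = z then T (\<sigma> z) else \<zero>\<^bsub>H\<^esub>)"
    unfolding expand_by_def by (rule Hk.M.finsum_cong') (use w \<sigma> in \<open>auto simp: cf_T Pi_iff\<close>)
  also have "\<dots> = T (\<sigma> w)" by (rule Hk.M.finsum_singleton[OF w finite_Sn]) (use \<sigma> in \<open>auto simp: Pi_iff\<close>)
  finally show ?thesis .
qed

abbreviation expansion :: "'k hecke \<Rightarrow> 'k hecke" where
  "expansion \<equiv> expand_by (\<lambda>w. w)"

lemma expansion_def: "expansion h = (\<Oplus>\<^bsub>H\<^esub>w\<in>Sn. cf h w \<odot>\<^bsub>H\<^esub> T w)"
  by (simp add: expand_by_def)

lemma id_Pi: "(\<lambda>w. w) \<in> Sn \<rightarrow> Sn" by simp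

lemmas expansion_add = expand_by_add[of "\<lambda>w. w", OF id_Pi]
  and expansion_smult = expand_by_smult[of "\<lambda>w. w", OF id_Pi]
  and expansion_T = expand_by_T[of "\<lambda>w. w", OF id_Pi]

lemma expansion_zero: "expansion \<zero>\<^bsub>H\<^esub> = \<zero>\<^bsub>H\<^esub>"
proof -
  have "expansion \<zero>\<^bsub>H\<^esub> = (\<Oplus>\<^bsub>H\<^esub>z\<in>Sn. \<zero>\<^bsub>H\<^esub>)"
    unfolding expansion_def by (rule Hk.M.finsum_cong') auto
  then show ?thesis by simp
qed

text \<open>Spanning by the \<open>T w\<close>: the elements equal to their expansion include one
  and are stable under left multiplication by the generators, hence include all words.\<close>

lemma expansion_T_gen:
  assumes i: "i \<in> {1..<n}" and h: "h \<in> carrier H" "expansion h = h"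
  shows "expansion (T_gen i \<otimes>\<^bsub>H\<^esub> h) = T_gen i \<otimes>\<^bsub>H\<^esub> h"
proof -
  have T: "expansion (T_gen i \<otimes>\<^bsub>H\<^esub> T w) = T_gen i \<otimes>\<^bsub>H\<^esub> T w" if w: "w \<in> Sn" for w
  proof -
    have p: "w permutes {1..n}" using w by simp
    have w': "adj i \<circ> w \<in> Sn" by (rule comp_Sn[OF adj_Sn[OF i] w])
    consider "pinv w i < pinv w (Suc i)" | "pinv w (Suc i) < pinv w i"
      using permutes_less_cases[OF permutes_inv[OF p], of i "Suc i"] by auto
    then show ?thesis
    proof cases
      case 1 then show ?thesis using expansion_T[OF w'] by (simp add: T_gen_up[OF i w])
    next
      case 2 then show ?thesis using expansion_T[OF w'] expansion_T[OF w] w w'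
        by (simp add: T_gen_down[OF i w] expansion_add expansion_smult)
    qed
  qed
  have sum: "expansion (T_gen i \<otimes>\<^bsub>H\<^esub> (\<Oplus>\<^bsub>H\<^esub>w\<in>S. cf h w \<odot>\<^bsub>H\<^esub> T w)) = T_gen i \<otimes>\<^bsub>H\<^esub> (\<Oplus>\<^bsub>H\<^esub>w\<in>S. cf h w \<odot>\<^bsub>H\<^esub> T w)"
    if "finite S" "S \<subseteq> Sn" for S
    using that
  proof (induction S rule: finite_induct)
    case empty then show ?case using i by (simp add: expansion_zero)
  next
    case (insert w S)
    have c: "(\<lambda>w. cf h w \<odot>\<^bsub>H\<^esub> T w) \<in> S \<rightarrow> carrier H" using insert.prems h by auto
    have cc: "(\<Oplus>\<^bsub>H\<^esub>w\<in>S. cf h w \<odot>\<^bsub>H\<^esub> T w) \<in> carrier H" by (rule Hk.M.finsum_closed[OF c])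
    have w: "w \<in> Sn" using insert.prems by blast
    have e: "expansion (T_gen i \<otimes>\<^bsub>H\<^esub> (cf h w \<odot>\<^bsub>H\<^esub> T w)) = T_gen i \<otimes>\<^bsub>H\<^esub> (cf h w \<odot>\<^bsub>H\<^esub> T w)"
      using i h w T[OF w] by (simp add: Hk.smult_mult_r expansion_smult)
    show ?case
      using insert i h w c cc e by (simp add: Hk.A.r_distr expansion_add)
  qed
  show ?thesis using sum[OF finite_Sn order_refl] unfolding expansion_def[symmetric] h(2) .
qed

lemma expansion_eq: "h \<in> carrier H \<Longrightarrow> expansion h = h"
proof (induction rule: H_word_induct)
  case zero show ?case by (rule expansion_zero)
next
  case (step h c ws)
  have "expansion (tw ws) = tw ws" using step.hyps(3)
  proof (induction ws)
    case Nil then show ?case using expansion_T[OF id_Sn] by (simp add: T_id)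
  next
    case (Cons i ws) then show ?case by (simp add: expansion_T_gen)
  qed
  then show ?case using step by (simp add: expansion_add expansion_smult)
qed

lemma H_T_induct [consumes 1, case_names zero step]:
  assumes h: "h \<in> carrier H" and zero: "P \<zero>\<^bsub>H\<^esub>"
    and step: "\<And>h c w. h \<in> carrier H \<Longrightarrow> P h \<Longrightarrow> c \<in> carrier K \<Longrightarrow> w \<in> Sn \<Longrightarrow> P (h \<oplus>\<^bsub>H\<^esub> c \<odot>\<^bsub>H\<^esub> T w)"
  shows "P h"
proof -
  have "P (\<Oplus>\<^bsub>H\<^esub>w\<in>S. cf h w \<odot>\<^bsub>H\<^esub> T w)" if "finite S" "S \<subseteq> Sn" for S
    using that
  proof (induction S rule: finite_induct)
    case empty then show ?case using zero by simp
  next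
    case (insert w S)
    have c: "(\<lambda>w. cf h w \<odot>\<^bsub>H\<^esub> T w) \<in> S \<rightarrow> carrier H" using insert.prems h by auto
    have cc: "(\<Oplus>\<^bsub>H\<^esub>w\<in>S. cf h w \<odot>\<^bsub>H\<^esub> T w) \<in> carrier H" by (rule Hk.M.finsum_closed[OF c])
    have w: "w \<in> Sn" using insert.prems by blast
    have "P ((\<Oplus>\<^bsub>H\<^esub>w\<in>S. cf h w \<odot>\<^bsub>H\<^esub> T w) \<oplus>\<^bsub>H\<^esub> cf h w \<odot>\<^bsub>H\<^esub> T w)"
      by (rule step[OF cc _ _ w]) (use insert h in auto)
    then show ?case using insert c cc w h by (simp add: Hk.M.a_comm)
  qed
  from this[OF finite_Sn order_refl] show ?thesis unfolding expansion_def[symmetric] expansion_eq[OF h] .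
qed

lemma cf_eqI:
  assumes "h \<in> carrier H" "g \<in> carrier H" "\<And>w. w \<in> Sn \<Longrightarrow> cf h w = cf g w"
  shows "h = g"
proof -
  have "expansion h = expansion g"
    unfolding expansion_def by (rule Hk.M.finsum_cong') (use assms in auto)
  then show ?thesis using assms by (simp add: expansion_eq)
qed

section \<open>The anti-involution and right multiplication by generators\<close>

abbreviation star0 :: "'k hecke \<Rightarrow> 'k hecke" where
  "star0 \<equiv> expand_by pinv"

lemma pinv_Pi: "pinv \<in> Sn \<rightarrow> Sn"
  using inv_Sn by blast

lemmas star0_closed = expand_by_closed[OF pinv_Pi]
  and star0_add = expand_by_add[OF pinv_Pi]
  and star0_smult = expand_by_smult[OF pinv_Pi]
  and star0_T = expand_by_T[OF pinv_Pi]

text \<open>A linear map is determined by its values on the \<open>T w\<close>, and its values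
  outside the carrier are fixed by extensionality; this makes the definite description in
  \<open>star\<close> meaningful.\<close>

lemma star_eq: "star = restrict star0 (carrier H)"
  unfolding star_def
proof (rule the_equality)
  show "restrict star0 (carrier H) \<in> carrier H \<rightarrow>\<^sub>E carrier H \<and>
     (\<forall>x\<in>carrier H. \<forall>y\<in>carrier H. restrict star0 (carrier H) (x \<oplus>\<^bsub>H\<^esub> y) = restrict star0 (carrier H) x \<oplus>\<^bsub>H\<^esub> restrict star0 (carrier H) y) \<and>
     (\<forall>c\<in>carrier K. \<forall>x\<in>carrier H. restrict star0 (carrier H) (c \<odot>\<^bsub>H\<^esub> x) = c \<odot>\<^bsub>H\<^esub> restrict star0 (carrier H) x) \<and>
     (\<forall>w. w permutes {1..n} \<longrightarrow> restrict star0 (carrier H) (T w) = T (pinv w))"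
    using star0_closed star0_add star0_smult star0_T by auto
next
  fix f assume f: "f \<in> carrier H \<rightarrow>\<^sub>E carrier H \<and>
     (\<forall>x\<in>carrier H. \<forall>y\<in>carrier H. f (x \<oplus>\<^bsub>H\<^esub> y) = f x \<oplus>\<^bsub>H\<^esub> f y) \<and>
     (\<forall>c\<in>carrier K. \<forall>x\<in>carrier H. f (c \<odot>\<^bsub>H\<^esub> x) = c \<odot>\<^bsub>H\<^esub> f x) \<and>
     (\<forall>w. w permutes {1..n} \<longrightarrow> f (T w) = T (pinv w))"
  \<comment> \<open>The value at zero comes from homogeneity with the scalar zero.\<close>
  have z: "f \<zero>\<^bsub>H\<^esub> = star0 \<zero>\<^bsub>H\<^esub>"
  proof -
    have "\<zero> \<odot>\<^bsub>H\<^esub> T id = \<zero>\<^bsub>H\<^esub>" by (rule Hk.smult_l_null[OF T_closed[OF id_Sn]])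
    moreover have "f (\<zero> \<odot>\<^bsub>H\<^esub> T id) = \<zero> \<odot>\<^bsub>H\<^esub> f (T id)" "star0 (\<zero> \<odot>\<^bsub>H\<^esub> T id) = \<zero> \<odot>\<^bsub>H\<^esub> star0 (T id)"
      using f star0_smult[OF zero_closed T_closed[OF id_Sn]] T_closed[OF id_Sn] by blast+
    moreover have "f (T id) = star0 (T id)" using f star0_T[OF id_Sn] permutes_id[of "{1..n}"] by simp
    ultimately show ?thesis by simp
  qed
  have "f h = star0 h" if "h \<in> carrier H" for h
    using that
  proof (induction rule: H_T_induct)
    case (step h c w)
    then show ?case using f star0_add[of h "c \<odot>\<^bsub>H\<^esub> T w"] star0_smult[of c "T w"] star0_T[of w] by simp
  qed (rule z)
  then show "f = restrict star0 (carrier H)"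
    using f by (auto simp: PiE_iff extensional_def fun_eq_iff)
qed

lemma star_closed [simp]: "h \<in> carrier H \<Longrightarrow> star h \<in> carrier H"
  and star_add [simp]: "h \<in> carrier H \<Longrightarrow> g \<in> carrier H \<Longrightarrow> star (h \<oplus>\<^bsub>H\<^esub> g) = star h \<oplus>\<^bsub>H\<^esub> star g"
  and star_smult [simp]: "c \<in> carrier K \<Longrightarrow> h \<in> carrier H \<Longrightarrow> star (c \<odot>\<^bsub>H\<^esub> h) = c \<odot>\<^bsub>H\<^esub> star h"
  and star_T: "w \<in> Sn \<Longrightarrow> star (T w) = T (pinv w)"
  by (simp_all add: star_eq star0_closed star0_add star0_smult star0_T del: mem_Collect_eq)

lemma star_zero [simp]: "star \<zero>\<^bsub>H\<^esub> = \<zero>\<^bsub>H\<^esub>"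
  using star_smult[OF zero_closed Hk.M.zero_closed] by simp

lemma pinv_pinv: "w \<in> Sn \<Longrightarrow> pinv (pinv w) = w"
  using permutes_inv_inv by blast

lemma star_star [simp]: "h \<in> carrier H \<Longrightarrow> star (star h) = h"
  by (induction rule: H_T_induct) (simp_all add: star_T inv_Sn pinv_pinv del: mem_Collect_eq)

lemma cf_star: "h \<in> carrier H \<Longrightarrow> w \<in> Sn \<Longrightarrow> cf (star h) w = cf h (pinv w)"
proof (induction rule: H_T_induct)
  case (step h c z)
  have "w = pinv z \<longleftrightarrow> pinv w = z" using pinv_pinv step.hyps step.prems by metis
  then show ?case using step inv_Sn by (simp add: star_T cf_T del: mem_Collect_eq)
qed simp

text \<open>\<open>star\<close> is specified only as a linear map on the basis, so reversal of
  products has to be proved. For one generator, the left rules \<open>T_gen_up\<close> and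
  \<open>T_gen_down\<close> are matched with their mirror images on the right.\<close>

lemma star_T_gen_mult:
  assumes i: "i \<in> {1..<n}" and h: "h \<in> carrier H"
  shows "star (T_gen i \<otimes>\<^bsub>H\<^esub> h) = star h \<otimes>\<^bsub>H\<^esub> T_gen i"
  using h
proof (induction rule: H_T_induct)
  case zero show ?case using i by simp
next
  case (step h c w)
  have p: "w permutes {1..n}" using step by simp
  note w = step.hyps(3)
  have Tup: "T (pinv w) \<otimes>\<^bsub>H\<^esub> T_gen i = T (pinv w \<circ> adj i)" if up: "pinv w i < pinv w (Suc i)" and w: "w \<in> Sn" for w
    using T_mult[OF inv_Sn[OF w] adj_Sn[OF i]] len_comp_adj_up[OF permutes_inv i up] w by (simp add: T_adj[OF i] len_adj)
  have "star (T_gen i \<otimes>\<^bsub>H\<^esub> T w) = T (pinv w) \<otimes>\<^bsub>H\<^esub> T_gen i"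
  proof -
    have w': "adj i \<circ> w \<in> Sn" by (rule comp_Sn[OF adj_Sn[OF i] w])
    consider "pinv w i < pinv w (Suc i)" | "pinv w (Suc i) < pinv w i"
      using permutes_less_cases[OF permutes_inv[OF p], of i "Suc i"] by auto
    then show ?thesis
    proof cases
      case 1
      then show ?thesis using star_T[OF w'] Tup[OF 1 w] by (simp add: T_gen_up[OF i w] inv_adj_comp[OF p i])
    next
      case 2
      let ?w = "adj i \<circ> w"
      have up: "T (pinv ?w) \<otimes>\<^bsub>H\<^esub> T_gen i = T (pinv w)"
        using Tup[OF _ w'] 2 by (simp add: inv_adj_comp[OF p i] comp_adj_adj)
      have c: "T (pinv ?w) \<in> carrier H" by (rule T_closed[OF inv_Sn[OF w']])
      have "T (pinv w) \<otimes>\<^bsub>H\<^esub> T_gen i = T (pinv ?w) \<otimes>\<^bsub>H\<^esub> (T_gen i \<otimes>\<^bsub>H\<^esub> T_gen i)"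
        unfolding up[symmetric] using c i by (simp add: Hk.A.m_assoc)
      also have "\<dots> = (q \<ominus> \<one>) \<odot>\<^bsub>H\<^esub> T (pinv w) \<oplus>\<^bsub>H\<^esub> q \<odot>\<^bsub>H\<^esub> T (pinv ?w)"
        unfolding T_gen_quad[OF i] up[symmetric] using c i by (simp add: Hk.A.r_distr Hk.smult_mult_r)
      also have "\<dots> = star (T_gen i \<otimes>\<^bsub>H\<^esub> T w)"
        unfolding T_gen_down[OF i w 2] using w w' by (simp add: star_T del: mem_Collect_eq)
      finally show ?thesis ..
    qed
  qed
  then show ?case
    using step i inv_Sn by (simp add: Hk.A.r_distr Hk.A.l_distr Hk.smult_mult_r Hk.smult_mult_l star_T del: mem_Collect_eq)
qed

lemma star_mult:
  assumes g: "g \<in> carrier H" and h: "h \<in> carrier H"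
  shows "star (g \<otimes>\<^bsub>H\<^esub> h) = star h \<otimes>\<^bsub>H\<^esub> star g"
proof -
  have one: "star \<one>\<^bsub>H\<^esub> = \<one>\<^bsub>H\<^esub>" using star_T[OF id_Sn] by (simp add: T_id inv_id)
  have gen: "star (T_gen i) = T_gen i" if "i \<in> {1..<n}" for i
    using star_T_gen_mult[OF that, of "\<one>\<^bsub>H\<^esub>"] that by (simp add: one)
  have tw: "star (tw ws \<otimes>\<^bsub>H\<^esub> h) = star h \<otimes>\<^bsub>H\<^esub> star (tw ws)" if "set ws \<subseteq> {1..<n}" "h \<in> carrier H" for ws h
    using that
  proof (induction ws arbitrary: h)
    case Nil then show ?case by (simp add: one)
  next
    case (Cons i ws)
    have "star (tw (i # ws) \<otimes>\<^bsub>H\<^esub> h) = star (T_gen i \<otimes>\<^bsub>H\<^esub> (tw ws \<otimes>\<^bsub>H\<^esub> h))"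
      using Cons.prems by (simp add: Hk.A.m_assoc)
    also have "\<dots> = star h \<otimes>\<^bsub>H\<^esub> (star (tw ws) \<otimes>\<^bsub>H\<^esub> T_gen i)"
      using Cons by (simp add: star_T_gen_mult Hk.A.m_assoc)
    also have "star (tw ws) \<otimes>\<^bsub>H\<^esub> T_gen i = star (tw (i # ws))"
      using Cons.prems by (simp add: star_T_gen_mult)
    finally show ?case .
  qed
  from g show ?thesis
  proof (induction rule: H_word_induct)
    case (step g c ws)
    then show ?case using h tw by (simp add: Hk.A.l_distr Hk.A.r_distr Hk.smult_mult_l Hk.smult_mult_r)
  qed (use h in simp)
qed

lemma star_T_gen: "i \<in> {1..<n} \<Longrightarrow> star (T_gen i) = T_gen i"
  using star_T[OF adj_Sn, of i] by (simp add: T_adj inv_swap_id)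

text \<open>The module describes left multiplication only; \<open>star\<close> transports the
  formula to the right.\<close>

lemma cf_mult_T_gen:
  assumes i: "i \<in> {1..<n}" and h: "h \<in> carrier H" and w: "w \<in> Sn"
  shows "cf (h \<otimes>\<^bsub>H\<^esub> T_gen i) w = (if w (Suc i) < w i then cf h (w \<circ> adj i) \<oplus> (q \<ominus> \<one>) \<otimes> cf h w
    else q \<otimes> cf h (w \<circ> adj i))"
proof -
  have "h \<otimes>\<^bsub>H\<^esub> T_gen i = star (T_gen i \<otimes>\<^bsub>H\<^esub> star h)"
    using star_mult[of "T_gen i" "star h"] i h by (simp add: star_T_gen)
  moreover have "adj i \<circ> pinv w = pinv (w \<circ> adj i)"
    using o_inv_distrib[OF permutes_bij permutes_bij[OF adj_permutes[OF i]]] w by (simp add: inv_swap_id)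
  moreover have "pinv (pinv (w \<circ> adj i)) = w \<circ> adj i" "pinv (w \<circ> adj i) \<in> Sn"
    using pinv_pinv[OF comp_Sn[OF w adj_Sn[OF i]]] inv_Sn[OF comp_Sn[OF w adj_Sn[OF i]]] by auto
  ultimately show ?thesis
    using cf_T_gen[OF i star_closed[OF h] inv_Sn[OF w]] i h w inv_Sn[OF w] pinv_pinv[OF w]
    by (simp add: cf_star del: mem_Collect_eq)
qed

end

section \<open>The spaces \<open>MM\<close>\<close>

context hecke_setting
begin

lemma cf_finsum:
  assumes "finite S" "f \<in> S \<rightarrow> carrier H"
  shows "cf (\<Oplus>\<^bsub>H\<^esub>z\<in>S. f z) w = (\<Oplus>z\<in>S. cf (f z) w)"
  using assms by (induction S rule: finite_induct) (auto simp: Pi_iff)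

lemma young_Sn: "young_subgroup n \<nu> \<subseteq> Sn"
  by (auto simp: young_subgroup_def)

definition ind :: "(nat \<Rightarrow> nat) set \<Rightarrow> 'k hecke" where
  "ind S = (\<Oplus>\<^bsub>H\<^esub>w\<in>S. T w)"

lemma ind_closed: "S \<subseteq> Sn \<Longrightarrow> ind S \<in> carrier H"
  unfolding ind_def by (rule Hk.M.finsum_closed) auto

lemma cf_ind:
  assumes S: "S \<subseteq> Sn" and w: "w \<in> Sn"
  shows "cf (ind S) w = (if w \<in> S then \<one> else \<zero>)"
proof -
  have fin: "finite S" using S finite_Sn by (rule finite_subset)
  have "cf (ind S) w = (\<Oplus>z\<in>S. cf (T z) w)"
    unfolding ind_def by (rule cf_finsum[OF fin]) (use S in auto)
  also have "\<dots> = (\<Oplus>z\<in>S. if w = z then \<one> else \<zero>)"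
    by (rule finsum_cong') (use S w in \<open>auto simp: cf_T subset_iff\<close>)
  also have "\<dots> = (if w \<in> S then \<one> else \<zero>)"
  proof (cases "w \<in> S")
    case True then show ?thesis using finsum_singleton[OF True fin, of "\<lambda>_. \<one>"] by simp
  next
    case False
    then have "(\<Oplus>z\<in>S. if w = z then \<one> else \<zero>) = (\<Oplus>z\<in>S. \<zero>)" by (intro finsum_cong') auto
    then show ?thesis using False by simp
  qed
  finally show ?thesis .
qed

lemma m_ind: "m \<nu> = ind (young_subgroup n \<nu>)"
  by (simp add: m_def ind_def)

lemma mH_closed [simp]: "m \<nu> \<in> carrier H"
  unfolding m_ind by (rule ind_closed[OF young_Sn])

lemma cf_m:
  assumes "\<nu> \<in> compositions n" "w \<in> Sn"
  shows "cf (m \<nu>) w = (if w \<in> yg n (blk \<nu>) then \<one> else \<zero>)"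
  unfolding m_ind by (subst cf_ind[OF young_Sn assms(2)]) (simp add: young_subgroup_eq[OF assms(1)])

lemma star_m: "star (m \<nu>) = m \<nu>"
proof (rule cf_eqI)
  fix w assume w: "w \<in> Sn"
  have *: "pinv z \<in> young_subgroup n \<nu>" if "z \<in> young_subgroup n \<nu>" for z
  proof -
    have z: "z permutes {1..n}" "\<And>k. z ` block \<nu> k = block \<nu> k" using that by (auto simp: young_subgroup_def)
    have "pinv z ` block \<nu> k = block \<nu> k" for k
      using image_inv_f_f[OF permutes_inj[OF z(1)], of "block \<nu> k"] z(2)[of k] by simp
    then show ?thesis using permutes_inv[OF z(1)] by (simp add: young_subgroup_def)
  qed
  have "pinv w \<in> young_subgroup n \<nu> \<longleftrightarrow> w \<in> young_subgroup n \<nu>"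
    using *[of w] *[of "pinv w"] pinv_pinv[OF w] by auto
  then show "cf (star (m \<nu>)) w = cf (m \<nu>) w"
    using cf_ind[OF young_Sn w] cf_ind[OF young_Sn inv_Sn[OF w]] w by (simp add: cf_star m_ind[symmetric] del: mem_Collect_eq)
qed simp_all

text \<open>\<open>rc \<nu> h\<close> is equivalent to \<open>h\<close> being a left multiple of \<open>m \<nu>\<close>.\<close>

definition rc :: "(nat \<Rightarrow> nat) \<Rightarrow> 'k hecke \<Rightarrow> bool" where
  "rc \<nu> h \<longleftrightarrow> h \<in> carrier H \<and> (\<forall>w\<in>Sn. \<forall>t\<in>yg n (blk \<nu>). cf h (w \<circ> t) = cf h w)"

text \<open>Membership in the Young subgroup does not change under \<open>adj k\<close>. At a
  descent the coefficient is 1 + (q - 1) = q, at an ascent \<open>q\<close> appears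
  directly.\<close>

lemma m_T_gen:
  assumes \<nu>: "\<nu> \<in> compositions n" and k: "k \<in> {1..<n}" "blk \<nu> k = blk \<nu> (Suc k)"
  shows "m \<nu> \<otimes>\<^bsub>H\<^esub> T_gen k = q \<odot>\<^bsub>H\<^esub> m \<nu>"
proof (rule cf_eqI)
  fix w assume w: "w \<in> Sn"
  have y: "adj k \<in> yg n (blk \<nu>)" by (rule adj_yg[OF k])
  have "w \<circ> adj k \<in> yg n (blk \<nu>) \<longleftrightarrow> w \<in> yg n (blk \<nu>)"
    using comp_yg[OF _ y, of w] comp_yg[OF _ y, of "w \<circ> adj k"] by (auto simp: comp_adj_adj)
  then have e: "cf (m \<nu>) (w \<circ> adj k) = cf (m \<nu>) w"
    using cf_m[OF \<nu> w] cf_m[OF \<nu> comp_Sn[OF w adj_Sn[OF k(1)]]] by simp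
  have c: "cf (m \<nu>) w \<in> carrier K" by simp
  have "cf (m \<nu>) w \<oplus> (q \<ominus> \<one>) \<otimes> cf (m \<nu>) w = (\<one> \<oplus> (q \<ominus> \<one>)) \<otimes> cf (m \<nu>) w"
    using c by (simp add: l_distr)
  also have "\<one> \<oplus> (q \<ominus> \<one>) = q" by (simp add: a_minus_def a_lcomm r_neg)
  finally show "cf (m \<nu> \<otimes>\<^bsub>H\<^esub> T_gen k) w = cf (q \<odot>\<^bsub>H\<^esub> m \<nu>) w"
    by (simp add: cf_mult_T_gen[OF k(1) mH_closed w] e)
qed (use k in simp_all)

text \<open>\<open>m_T_gen\<close> gives g T_k = q g. At a z with a descent at k this reads cf (z s)
  + (q - 1) cf z = q cf z, where s is \<open>adj k\<close>, and the two coefficients agree by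
  cancelling a summand. At an ascent only q times their difference would vanish, so that case is
  reduced to the first by exchanging z and z s.\<close>

lemma rc_mult_m:
  assumes \<nu>: "\<nu> \<in> compositions n" and h: "h \<in> carrier H"
  shows "rc \<nu> (h \<otimes>\<^bsub>H\<^esub> m \<nu>)"
proof -
  define g where "g = h \<otimes>\<^bsub>H\<^esub> m \<nu>"
  have g: "g \<in> carrier H" using h by (simp add: g_def)
  have inv: "cf g (w \<circ> adj k) = cf g w" if w: "w permutes {1..n}" and k: "k \<in> {1..<n}" "blk \<nu> k = blk \<nu> (Suc k)" for w k
  proof -
    have e: "g \<otimes>\<^bsub>H\<^esub> T_gen k = q \<odot>\<^bsub>H\<^esub> g"
      unfolding g_def using m_T_gen[OF \<nu> k] h k by (simp add: Hk.A.m_assoc Hk.smult_mult_r)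
    have dn: "cf g (z \<circ> adj k) = cf g z" if z: "z \<in> Sn" "z (Suc k) < z k" for z
    proof -
      have "cf g (z \<circ> adj k) \<oplus> (q \<ominus> \<one>) \<otimes> cf g z = q \<otimes> cf g z"
        using cf_mult_T_gen[OF k(1) g z(1)] z(2) g by (simp add: e)
      also have "\<dots> = (\<one> \<oplus> (q \<ominus> \<one>)) \<otimes> cf g z" by (simp add: a_minus_def a_lcomm r_neg)
      also have "\<dots> = cf g z \<oplus> (q \<ominus> \<one>) \<otimes> cf g z" using g by (simp add: l_distr)
      finally show ?thesis using g by (simp add: add.right_cancel)
    qed
    have "w \<in> Sn" using w by simp
    then have wk: "w \<circ> adj k \<in> Sn" by (rule comp_Sn[OF _ adj_Sn[OF k(1)]])
    consider "w (Suc k) < w k" | "w k < w (Suc k)" using permutes_less_cases[OF w, of k "Suc k"] by auto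
    then show ?thesis
    proof cases
      case 1 then show ?thesis using dn[OF \<open>w \<in> Sn\<close>] by simp
    next
      case 2 then show ?thesis using dn[OF wk] by (simp add: comp_adj_adj)
    qed
  qed
  have "cf g (w \<circ> t) = cf g w" if "w \<in> Sn" "t \<in> yg n (blk \<nu>)" for w t
    by (rule yg_invariant[OF blk_mono[OF \<nu>], where f = "cf g"]) (use inv that in auto)
  then show ?thesis using g unfolding rc_def g_def by blast
qed

definition reps :: "(nat \<Rightarrow> nat) \<Rightarrow> (nat \<Rightarrow> nat) set" where
  "reps \<nu> = {d \<in> Sn. inc_on_blocks n (blk \<nu>) d}"

text \<open>For \<open>h\<close> satisfying \<open>rc \<nu>\<close> this is an explicit X with h = X
  m, as \<open>rc_factor\<close> shows; its support on shortest representatives makes its leading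
  term accessible.\<close>

definition rep_part :: "(nat \<Rightarrow> nat) \<Rightarrow> 'k hecke \<Rightarrow> 'k hecke" where
  "rep_part \<nu> h = (\<Oplus>\<^bsub>H\<^esub>d\<in>reps \<nu>. cf h d \<odot>\<^bsub>H\<^esub> T d)"

lemma reps_Sn: "reps \<nu> \<subseteq> Sn" and finite_reps: "finite (reps \<nu>)"
proof -
  show "reps \<nu> \<subseteq> Sn" by (auto simp: reps_def)
  then show "finite (reps \<nu>)" using finite_Sn by (rule finite_subset)
qed

lemma rep_part_terms: "h \<in> carrier H \<Longrightarrow> (\<lambda>d. cf h d \<odot>\<^bsub>H\<^esub> T d) \<in> reps \<nu> \<rightarrow> carrier H"
  using reps_Sn by (auto simp: subset_iff)

lemma rep_part_closed: "h \<in> carrier H \<Longrightarrow> rep_part \<nu> h \<in> carrier H"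
  unfolding rep_part_def by (rule Hk.M.finsum_closed[OF rep_part_terms])

lemma cf_rep_part:
  assumes h: "h \<in> carrier H" and w: "w \<in> Sn"
  shows "cf (rep_part \<nu> h) w = (if w \<in> reps \<nu> then cf h w else \<zero>)"
proof -
  have "cf (rep_part \<nu> h) w = (\<Oplus>d\<in>reps \<nu>. cf (cf h d \<odot>\<^bsub>H\<^esub> T d) w)"
    unfolding rep_part_def by (rule cf_finsum[OF finite_reps rep_part_terms[OF h]])
  also have "\<dots> = (\<Oplus>d\<in>reps \<nu>. if w = d then cf h d else \<zero>)"
    by (rule finsum_cong') (use reps_Sn h w in \<open>auto simp: cf_T subset_iff\<close>)
  also have "\<dots> = (if w \<in> reps \<nu> then cf h w else \<zero>)"
  proof (cases "w \<in> reps \<nu>")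
    case True then show ?thesis using finsum_singleton[OF True finite_reps, of "cf h"] h by simp
  next
    case False
    then have "(\<Oplus>d\<in>reps \<nu>. if w = d then cf h d else \<zero>) = (\<Oplus>d\<in>reps \<nu>. \<zero>)" by (intro finsum_cong') auto
    then show ?thesis using False by simp
  qed
  finally show ?thesis .
qed

lemma T_rep_mult_m:
  assumes \<nu>: "\<nu> \<in> compositions n" and d: "d \<in> reps \<nu>" and d0: "d0 \<in> reps \<nu>" and t0: "t0 \<in> yg n (blk \<nu>)"
  shows "cf (T d \<otimes>\<^bsub>H\<^esub> m \<nu>) (d0 \<circ> t0) = (if d = d0 then \<one> else \<zero>)"
proof -
  let ?Y = "yg n (blk \<nu>)"
  have Y: "t \<in> Sn" if "t \<in> ?Y" for t using yg_permutes[OF that] by simp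
  have dS: "d \<in> Sn" "d0 \<in> Sn" using d d0 reps_Sn by blast+
  have w: "d0 \<circ> t0 \<in> Sn" by (rule comp_Sn[OF dS(2) Y[OF t0]])
  have inj: "inj_on (\<lambda>t. d \<circ> t) ?Y"
  proof (rule inj_onI)
    fix t t' assume "d \<circ> t = d \<circ> t'"
    then have "d (t p) = d (t' p)" for p by (metis comp_apply)
    then show "t = t'" using permutes_inj dS(1) by (metis ext injD mem_Collect_eq)
  qed
  have "T d \<otimes>\<^bsub>H\<^esub> m \<nu> = (\<Oplus>\<^bsub>H\<^esub>t\<in>?Y. T d \<otimes>\<^bsub>H\<^esub> T t)"
    unfolding m_def young_subgroup_eq[OF \<nu>]
    by (rule Hk.A.finsum_rdistr[OF finite_yg]) (use dS Y in auto)
  also have "\<dots> = (\<Oplus>\<^bsub>H\<^esub>t\<in>?Y. T (d \<circ> t))"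
  proof (rule Hk.M.finsum_cong')
    show "(\<lambda>t. T (d \<circ> t)) \<in> ?Y \<rightarrow> carrier H" using comp_Sn[OF dS(1) Y] by auto
    fix t assume t: "t \<in> ?Y"
    show "T d \<otimes>\<^bsub>H\<^esub> T t = T (d \<circ> t)"
      by (rule T_mult[OF dS(1) Y[OF t]], rule len_comp_yg[OF _ _ t blk_mono[OF \<nu>]]) (use d in \<open>auto simp: reps_def\<close>)
  qed simp
  also have "\<dots> = ind ((\<lambda>t. d \<circ> t) ` ?Y)"
    unfolding ind_def by (rule Hk.M.finsum_reindex[OF _ inj, symmetric]) (use comp_Sn[OF dS(1) Y] in auto)
  finally have "cf (T d \<otimes>\<^bsub>H\<^esub> m \<nu>) (d0 \<circ> t0) = cf (ind ((\<lambda>t. d \<circ> t) ` ?Y)) (d0 \<circ> t0)" by simp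
  also have "\<dots> = (if d0 \<circ> t0 \<in> (\<lambda>t. d \<circ> t) ` ?Y then \<one> else \<zero>)"
    by (rule cf_ind[OF _ w]) (use comp_Sn[OF dS(1) Y] in auto)
  also have "d0 \<circ> t0 \<in> (\<lambda>t. d \<circ> t) ` ?Y \<longleftrightarrow> d = d0"
    using coset_decomposition_unique[OF blk_mono[OF \<nu>], of d0 d t0] d d0 t0 unfolding reps_def by blast
  finally show ?thesis .
qed

text \<open>Lengths add in d t, so \<open>T d\<close> times \<open>m \<nu>\<close> is the sum over
  the coset of d. Weighting these sums by the coefficients at the representatives restores any
  element that is constant on cosets.\<close>

lemma rc_factor:
  assumes \<nu>: "\<nu> \<in> compositions n" and h: "rc \<nu> h"
  shows "h = rep_part \<nu> h \<otimes>\<^bsub>H\<^esub> m \<nu>"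
proof (rule cf_eqI)
  show hc: "h \<in> carrier H" using h by (simp add: rc_def)
  show "rep_part \<nu> h \<otimes>\<^bsub>H\<^esub> m \<nu> \<in> carrier H" using rep_part_closed[OF hc] by simp
  fix w assume w: "w \<in> Sn"
  obtain d t where dt: "d permutes {1..n}" "inc_on_blocks n (blk \<nu>) d" "t \<in> yg n (blk \<nu>)" "w = d \<circ> t"
    using coset_decomposition[OF blk_mono[OF \<nu>]] w by blast
  have d: "d \<in> reps \<nu>" using dt by (simp add: reps_def)
  have R: "z \<in> Sn" if "z \<in> reps \<nu>" for z using that reps_Sn by blast
  have Tm: "T z \<otimes>\<^bsub>H\<^esub> m \<nu> \<in> carrier H" if "z \<in> reps \<nu>" for z using T_closed[OF R[OF that]] by simp
  have "rep_part \<nu> h \<otimes>\<^bsub>H\<^esub> m \<nu> = (\<Oplus>\<^bsub>H\<^esub>z\<in>reps \<nu>. (cf h z \<odot>\<^bsub>H\<^esub> T z) \<otimes>\<^bsub>H\<^esub> m \<nu>)"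
    unfolding rep_part_def by (rule Hk.A.finsum_ldistr[OF finite_reps mH_closed rep_part_terms[OF hc]])
  then have "cf (rep_part \<nu> h \<otimes>\<^bsub>H\<^esub> m \<nu>) w = (\<Oplus>z\<in>reps \<nu>. cf ((cf h z \<odot>\<^bsub>H\<^esub> T z) \<otimes>\<^bsub>H\<^esub> m \<nu>) w)"
    using cf_finsum[OF finite_reps, of "\<lambda>z. (cf h z \<odot>\<^bsub>H\<^esub> T z) \<otimes>\<^bsub>H\<^esub> m \<nu>" \<nu> w] rep_part_terms[OF hc, of \<nu>]
    by (simp add: Pi_iff)
  also have "\<dots> = (\<Oplus>z\<in>reps \<nu>. if d = z then cf h z else \<zero>)"
  proof (rule finsum_cong')
    fix z assume z: "z \<in> reps \<nu>"
    have "cf ((cf h z \<odot>\<^bsub>H\<^esub> T z) \<otimes>\<^bsub>H\<^esub> m \<nu>) w = cf h z \<otimes> cf (T z \<otimes>\<^bsub>H\<^esub> m \<nu>) w"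
      using T_closed[OF R[OF z]] hc by (simp add: Hk.smult_mult_l)
    then show "cf ((cf h z \<odot>\<^bsub>H\<^esub> T z) \<otimes>\<^bsub>H\<^esub> m \<nu>) w = (if d = z then cf h z else \<zero>)"
      using hc unfolding dt(4) T_rep_mult_m[OF \<nu> z d dt(3)] by auto
  qed (use hc in auto)
  also have "\<dots> = cf h d" by (rule finsum_singleton[OF d finite_reps]) (use hc in auto)
  also have "\<dots> = cf h w" using h dt(1,3) unfolding rc_def dt(4) by simp
  finally show "cf h w = cf (rep_part \<nu> h \<otimes>\<^bsub>H\<^esub> m \<nu>) w" ..
qed

section \<open>The spaces of common multiples and the product \<open>circ\<close>\<close>

lemma MM_closed: "u \<in> MM \<alpha> \<beta> \<Longrightarrow> u \<in> carrier H"
  by (auto simp: MM_def)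

lemma MM_E:
  assumes "u \<in> MM \<alpha> \<beta>"
  obtains x y where "x \<in> carrier H" "y \<in> carrier H" "u = x \<otimes>\<^bsub>H\<^esub> m \<alpha>" "u = m \<beta> \<otimes>\<^bsub>H\<^esub> y"
  using assms by (auto simp: MM_def)

lemma MM_I: "x \<in> carrier H \<Longrightarrow> y \<in> carrier H \<Longrightarrow> u = x \<otimes>\<^bsub>H\<^esub> m \<alpha> \<Longrightarrow> u = m \<beta> \<otimes>\<^bsub>H\<^esub> y \<Longrightarrow> u \<in> MM \<alpha> \<beta>"
  by (auto simp: MM_def)

lemma m_MM: "m \<nu> \<in> MM \<nu> \<nu>"
  by (rule MM_I[of "\<one>\<^bsub>H\<^esub>" "\<one>\<^bsub>H\<^esub>"]) simp_all

lemma MM_zero: "\<zero>\<^bsub>H\<^esub> \<in> MM \<alpha> \<beta>"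
  by (rule MM_I[of "\<zero>\<^bsub>H\<^esub>" "\<zero>\<^bsub>H\<^esub>"]) simp_all

lemma MM_add: "u \<in> MM \<alpha> \<beta> \<Longrightarrow> v \<in> MM \<alpha> \<beta> \<Longrightarrow> u \<oplus>\<^bsub>H\<^esub> v \<in> MM \<alpha> \<beta>"
proof (elim MM_E)
  fix x y x' y' assume "x \<in> carrier H" "y \<in> carrier H" "x' \<in> carrier H" "y' \<in> carrier H"
    "u = x \<otimes>\<^bsub>H\<^esub> m \<alpha>" "u = m \<beta> \<otimes>\<^bsub>H\<^esub> y" "v = x' \<otimes>\<^bsub>H\<^esub> m \<alpha>" "v = m \<beta> \<otimes>\<^bsub>H\<^esub> y'"
  then show ?thesis by (intro MM_I[of "x \<oplus>\<^bsub>H\<^esub> x'" "y \<oplus>\<^bsub>H\<^esub> y'"]) (simp_all add: Hk.A.l_distr Hk.A.r_distr)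
qed

lemma MM_smult: "c \<in> carrier K \<Longrightarrow> u \<in> MM \<alpha> \<beta> \<Longrightarrow> c \<odot>\<^bsub>H\<^esub> u \<in> MM \<alpha> \<beta>"
proof (elim MM_E)
  fix x y assume "c \<in> carrier K" "x \<in> carrier H" "y \<in> carrier H" "u = x \<otimes>\<^bsub>H\<^esub> m \<alpha>" "u = m \<beta> \<otimes>\<^bsub>H\<^esub> y"
  then show ?thesis by (intro MM_I[of "c \<odot>\<^bsub>H\<^esub> x" "c \<odot>\<^bsub>H\<^esub> y"]) (simp_all add: Hk.smult_mult_l Hk.smult_mult_r)
qed

lemma neg_smult: "u \<in> carrier H \<Longrightarrow> \<ominus>\<^bsub>H\<^esub> u = (\<ominus> \<one>) \<odot>\<^bsub>H\<^esub> u"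
  using Hk.smult_l_minus[of \<one> u] by simp

lemma star_MM: "u \<in> MM \<alpha> \<beta> \<Longrightarrow> star u \<in> MM \<beta> \<alpha>"
proof (elim MM_E)
  fix x y assume "x \<in> carrier H" "y \<in> carrier H" "u = x \<otimes>\<^bsub>H\<^esub> m \<alpha>" "u = m \<beta> \<otimes>\<^bsub>H\<^esub> y"
  then show ?thesis by (intro MM_I[of "star y" "star x"]) (simp, simp, metis mH_closed star_m star_mult, metis mH_closed star_m star_mult)
qed

text \<open>\<open>star\<close> exchanges the two sides and fixes \<open>m\<close>, so right
  multiples are recognized by the same criterion as left multiples.\<close>

lemma MM_iff:
  assumes \<alpha>: "\<alpha> \<in> compositions n" and \<beta>: "\<beta> \<in> compositions n"
  shows "u \<in> MM \<alpha> \<beta> \<longleftrightarrow> u \<in> carrier H \<and> rc \<alpha> u \<and> rc \<beta> (star u)"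
proof
  assume u: "u \<in> MM \<alpha> \<beta>"
  have "rc \<alpha> u" using u by (elim MM_E) (simp add: rc_mult_m[OF \<alpha>])
  moreover have "rc \<beta> (star u)" using star_MM[OF u] by (elim MM_E) (simp add: rc_mult_m[OF \<beta>])
  ultimately show "u \<in> carrier H \<and> rc \<alpha> u \<and> rc \<beta> (star u)" using MM_closed[OF u] by blast
next
  assume u: "u \<in> carrier H \<and> rc \<alpha> u \<and> rc \<beta> (star u)"
  let ?x = "rep_part \<alpha> u" and ?y = "rep_part \<beta> (star u)"
  have c: "?x \<in> carrier H" "?y \<in> carrier H" using u by (simp_all add: rep_part_closed)
  have "u = star (?y \<otimes>\<^bsub>H\<^esub> m \<beta>)" using rc_factor[OF \<beta>, of "star u"] u by simp
  also have "\<dots> = m \<beta> \<otimes>\<^bsub>H\<^esub> star ?y" using c by (simp add: star_mult star_m)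
  finally have e: "u = m \<beta> \<otimes>\<^bsub>H\<^esub> star ?y" .
  show "u \<in> MM \<alpha> \<beta>"
    by (rule MM_I[OF c(1) star_closed[OF c(2)] rc_factor[OF \<alpha>] e]) (use u in blast)
qed

text \<open>x m y equals x v, in which y does not occur, and u y, in which x does not occur.
  Changing one factorization at a time shows independence of both.\<close>

lemma circ_eq:
  assumes x: "x \<in> carrier H" and y: "y \<in> carrier H" and u: "u = x \<otimes>\<^bsub>H\<^esub> m \<kappa>" and v: "v = m \<kappa> \<otimes>\<^bsub>H\<^esub> y"
  shows "circ \<kappa> u v = x \<otimes>\<^bsub>H\<^esub> v" "circ \<kappa> u v = u \<otimes>\<^bsub>H\<^esub> y"
proof -
  have "circ \<kappa> u v = x \<otimes>\<^bsub>H\<^esub> m \<kappa> \<otimes>\<^bsub>H\<^esub> y"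
    unfolding circ_def
  proof (rule the_equality)
    show "\<exists>x'\<in>carrier H. \<exists>y'\<in>carrier H. u = x' \<otimes>\<^bsub>H\<^esub> m \<kappa> \<and> v = m \<kappa> \<otimes>\<^bsub>H\<^esub> y' \<and>
        x \<otimes>\<^bsub>H\<^esub> m \<kappa> \<otimes>\<^bsub>H\<^esub> y = x' \<otimes>\<^bsub>H\<^esub> m \<kappa> \<otimes>\<^bsub>H\<^esub> y'"
      using assms by blast
  next
    fix z assume "\<exists>x'\<in>carrier H. \<exists>y'\<in>carrier H. u = x' \<otimes>\<^bsub>H\<^esub> m \<kappa> \<and> v = m \<kappa> \<otimes>\<^bsub>H\<^esub> y' \<and> z = x' \<otimes>\<^bsub>H\<^esub> m \<kappa> \<otimes>\<^bsub>H\<^esub> y'"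
    then obtain x' y' where p: "x' \<in> carrier H" "y' \<in> carrier H" "u = x' \<otimes>\<^bsub>H\<^esub> m \<kappa>" "v = m \<kappa> \<otimes>\<^bsub>H\<^esub> y'"
      "z = x' \<otimes>\<^bsub>H\<^esub> m \<kappa> \<otimes>\<^bsub>H\<^esub> y'" by blast
    have "z = x \<otimes>\<^bsub>H\<^esub> m \<kappa> \<otimes>\<^bsub>H\<^esub> y'" using p u by simp
    also have "\<dots> = x \<otimes>\<^bsub>H\<^esub> v" using p x by (simp add: Hk.A.m_assoc)
    also have "\<dots> = x \<otimes>\<^bsub>H\<^esub> m \<kappa> \<otimes>\<^bsub>H\<^esub> y" using v x y by (simp add: Hk.A.m_assoc)
    finally show "z = x \<otimes>\<^bsub>H\<^esub> m \<kappa> \<otimes>\<^bsub>H\<^esub> y" .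
  qed
  then show "circ \<kappa> u v = x \<otimes>\<^bsub>H\<^esub> v" "circ \<kappa> u v = u \<otimes>\<^bsub>H\<^esub> y"
    using assms by (simp_all add: Hk.A.m_assoc)
qed

text \<open>With one factor fixed, \<open>circ\<close> is multiplication in \<open>H\<close> by a
  fixed element, whatever the other factor. Linearity and associativity of \<open>circ\<close> are
  thereby inherited from \<open>H\<close>.\<close>

lemma circ_l:
  assumes "u \<in> MM \<kappa> \<beta>" obtains x where "x \<in> carrier H" "u = x \<otimes>\<^bsub>H\<^esub> m \<kappa>"
    "\<And>\<alpha> v. v \<in> MM \<alpha> \<kappa> \<Longrightarrow> circ \<kappa> u v = x \<otimes>\<^bsub>H\<^esub> v"
proof -
  obtain x where x: "x \<in> carrier H" "u = x \<otimes>\<^bsub>H\<^esub> m \<kappa>" using assms by (rule MM_E)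
  have "circ \<kappa> u v = x \<otimes>\<^bsub>H\<^esub> v" if "v \<in> MM \<alpha> \<kappa>" for \<alpha> v
    using that by (rule MM_E) (use circ_eq(1)[OF x(1) _ x(2)] in blast)
  then show thesis using that x by blast
qed

lemma circ_r:
  assumes "v \<in> MM \<alpha> \<kappa>" obtains y where "y \<in> carrier H" "v = m \<kappa> \<otimes>\<^bsub>H\<^esub> y"
    "\<And>\<beta> u. u \<in> MM \<kappa> \<beta> \<Longrightarrow> circ \<kappa> u v = u \<otimes>\<^bsub>H\<^esub> y"
proof -
  obtain y where y: "y \<in> carrier H" "v = m \<kappa> \<otimes>\<^bsub>H\<^esub> y" using assms by (rule MM_E)
  have "circ \<kappa> u v = u \<otimes>\<^bsub>H\<^esub> y" if "u \<in> MM \<kappa> \<beta>" for \<beta> u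
    using that by (rule MM_E) (use circ_eq(2)[OF _ y(1) _ y(2)] in blast)
  then show thesis using that y by blast
qed

lemma circ_closed:
  assumes u: "u \<in> MM \<kappa> \<beta>" and v: "v \<in> MM \<alpha> \<kappa>"
  shows "circ \<kappa> u v \<in> MM \<alpha> \<beta>"
proof -
  obtain x where x: "x \<in> carrier H" "circ \<kappa> u v = x \<otimes>\<^bsub>H\<^esub> v" using circ_l[OF u] v by metis
  obtain y where y: "y \<in> carrier H" "circ \<kappa> u v = u \<otimes>\<^bsub>H\<^esub> y" using circ_r[OF v] u by metis
  obtain y' where y': "y' \<in> carrier H" "u = m \<beta> \<otimes>\<^bsub>H\<^esub> y'" using u by (rule MM_E)
  obtain x' where x': "x' \<in> carrier H" "v = x' \<otimes>\<^bsub>H\<^esub> m \<alpha>" using v by (rule MM_E)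
  show ?thesis
  proof (rule MM_I)
    show "x \<otimes>\<^bsub>H\<^esub> x' \<in> carrier H" "y' \<otimes>\<^bsub>H\<^esub> y \<in> carrier H" using x x' y y' by simp_all
    show "circ \<kappa> u v = x \<otimes>\<^bsub>H\<^esub> x' \<otimes>\<^bsub>H\<^esub> m \<alpha>" using x x' by (simp add: Hk.A.m_assoc)
    show "circ \<kappa> u v = m \<beta> \<otimes>\<^bsub>H\<^esub> (y' \<otimes>\<^bsub>H\<^esub> y)" using y y' by (simp add: Hk.A.m_assoc)
  qed
qed

lemma circ_add_l:
  assumes "u \<in> MM \<kappa> \<beta>" "u' \<in> MM \<kappa> \<beta>" "v \<in> MM \<alpha> \<kappa>"
  shows "circ \<kappa> (u \<oplus>\<^bsub>H\<^esub> u') v = circ \<kappa> u v \<oplus>\<^bsub>H\<^esub> circ \<kappa> u' v"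
proof -
  obtain y where "y \<in> carrier H" "\<And>\<beta> u. u \<in> MM \<kappa> \<beta> \<Longrightarrow> circ \<kappa> u v = u \<otimes>\<^bsub>H\<^esub> y" using circ_r[OF assms(3)] by metis
  then show ?thesis using assms MM_add[OF assms(1,2)] by (simp add: Hk.A.l_distr MM_closed)
qed

lemma circ_add_r:
  assumes "u \<in> MM \<kappa> \<beta>" "v \<in> MM \<alpha> \<kappa>" "v' \<in> MM \<alpha> \<kappa>"
  shows "circ \<kappa> u (v \<oplus>\<^bsub>H\<^esub> v') = circ \<kappa> u v \<oplus>\<^bsub>H\<^esub> circ \<kappa> u v'"
proof -
  obtain x where "x \<in> carrier H" "\<And>\<alpha> v. v \<in> MM \<alpha> \<kappa> \<Longrightarrow> circ \<kappa> u v = x \<otimes>\<^bsub>H\<^esub> v" using circ_l[OF assms(1)] by metis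
  then show ?thesis using assms MM_add[OF assms(2,3)] by (simp add: Hk.A.r_distr MM_closed)
qed

lemma circ_smult_l:
  assumes "c \<in> carrier K" "u \<in> MM \<kappa> \<beta>" "v \<in> MM \<alpha> \<kappa>"
  shows "circ \<kappa> (c \<odot>\<^bsub>H\<^esub> u) v = c \<odot>\<^bsub>H\<^esub> circ \<kappa> u v"
proof -
  obtain y where "y \<in> carrier H" "\<And>\<beta> u. u \<in> MM \<kappa> \<beta> \<Longrightarrow> circ \<kappa> u v = u \<otimes>\<^bsub>H\<^esub> y" using circ_r[OF assms(3)] by metis
  then show ?thesis using assms MM_smult[OF assms(1,2)] by (simp add: Hk.smult_mult_l MM_closed)
qed

lemma circ_smult_r:
  assumes "c \<in> carrier K" "u \<in> MM \<kappa> \<beta>" "v \<in> MM \<alpha> \<kappa>"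
  shows "circ \<kappa> u (c \<odot>\<^bsub>H\<^esub> v) = c \<odot>\<^bsub>H\<^esub> circ \<kappa> u v"
proof -
  obtain x where "x \<in> carrier H" "\<And>\<alpha> v. v \<in> MM \<alpha> \<kappa> \<Longrightarrow> circ \<kappa> u v = x \<otimes>\<^bsub>H\<^esub> v" using circ_l[OF assms(2)] by metis
  then show ?thesis using assms MM_smult[OF assms(1,3)] by (simp add: Hk.smult_mult_r MM_closed)
qed

lemma circ_assoc:
  assumes u: "u \<in> MM \<kappa> \<beta>" and v: "v \<in> MM \<alpha> \<kappa>" and w: "w \<in> MM \<gamma> \<alpha>"
  shows "circ \<alpha> (circ \<kappa> u v) w = circ \<kappa> u (circ \<alpha> v w)"
proof -
  obtain x where x: "x \<in> carrier H" "\<And>\<alpha> v. v \<in> MM \<alpha> \<kappa> \<Longrightarrow> circ \<kappa> u v = x \<otimes>\<^bsub>H\<^esub> v" using circ_l[OF u] by metis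
  obtain y where y: "y \<in> carrier H" "\<And>\<beta> u. u \<in> MM \<alpha> \<beta> \<Longrightarrow> circ \<alpha> u w = u \<otimes>\<^bsub>H\<^esub> y" using circ_r[OF w] by metis
  show ?thesis
    using x(2)[OF v] x(2)[OF circ_closed[OF v w]] y(2)[OF v] y(2)[OF circ_closed[OF u v]] x(1) y(1) MM_closed[OF v]
    by (simp add: Hk.A.m_assoc)
qed

lemma circ_m_r: "u \<in> MM \<kappa> \<beta> \<Longrightarrow> circ \<kappa> u (m \<kappa>) = u"
  by (elim MM_E) (use circ_eq(2)[of _ "\<one>\<^bsub>H\<^esub>"] in simp)

lemma circ_m_l: "v \<in> MM \<alpha> \<kappa> \<Longrightarrow> circ \<kappa> (m \<kappa>) v = v"
proof -
  assume v: "v \<in> MM \<alpha> \<kappa>"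
  obtain y where y: "y \<in> carrier H" "v = m \<kappa> \<otimes>\<^bsub>H\<^esub> y" using v by (rule MM_E)
  show ?thesis using circ_eq(1)[OF Hk.A.one_closed y(1) _ y(2), of "m \<kappa>"] MM_closed[OF v] by simp
qed

lemma star_circ:
  assumes u: "u \<in> MM \<kappa> \<beta>" and v: "v \<in> MM \<alpha> \<kappa>"
  shows "star (circ \<kappa> u v) = circ \<kappa> (star v) (star u)"
proof -
  obtain x where x: "x \<in> carrier H" "u = x \<otimes>\<^bsub>H\<^esub> m \<kappa>" "circ \<kappa> u v = x \<otimes>\<^bsub>H\<^esub> v" using circ_l[OF u] v by metis
  obtain y where y: "y \<in> carrier H" "v = m \<kappa> \<otimes>\<^bsub>H\<^esub> y" using v by (rule MM_E)
  have "star u = m \<kappa> \<otimes>\<^bsub>H\<^esub> star x" "star v = star y \<otimes>\<^bsub>H\<^esub> m \<kappa>" using x(1,2) y by (simp_all add: star_mult star_m)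
  from circ_eq(2)[OF star_closed[OF y(1)] star_closed[OF x(1)] this(2,1)]
  show ?thesis using x MM_closed[OF v] by (simp add: star_mult)
qed

text \<open>A multiplicative filtration, shifted by one: \<open>below 0\<close> is zero and \<open>T id\<close> lies in \<open>below 1\<close>.\<close>

definition below :: "nat \<Rightarrow> 'k hecke set" where
  "below k = {h \<in> carrier H. \<forall>w\<in>Sn. k \<le> len w \<longrightarrow> cf h w = \<zero>}"

lemma below_closed: "h \<in> below k \<Longrightarrow> h \<in> carrier H"
  by (simp add: below_def)

lemma below_add: "g \<in> below k \<Longrightarrow> h \<in> below k \<Longrightarrow> g \<oplus>\<^bsub>H\<^esub> h \<in> below k"
  by (simp add: below_def)

lemma below_smult: "c \<in> carrier K \<Longrightarrow> h \<in> below k \<Longrightarrow> c \<odot>\<^bsub>H\<^esub> h \<in> below k"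
  by (simp add: below_def)

lemma below_zero: "\<zero>\<^bsub>H\<^esub> \<in> below k"
  by (simp add: below_def)

lemma below_mono: "h \<in> below k \<Longrightarrow> k \<le> l \<Longrightarrow> h \<in> below l"
  by (auto simp: below_def)

lemma below_0: "h \<in> below 0 \<Longrightarrow> h = \<zero>\<^bsub>H\<^esub>"
  by (rule cf_eqI) (auto simp: below_def)

lemma T_below: "w \<in> Sn \<Longrightarrow> T w \<in> below (Suc (len w))"
  by (auto simp: below_def cf_T)

lemma below_T_gen:
  assumes i: "i \<in> {1..<n}" and h: "h \<in> below k"
  shows "T_gen i \<otimes>\<^bsub>H\<^esub> h \<in> below (Suc k)"
proof -
  have hc: "h \<in> carrier H" by (rule below_closed[OF h])
  have "cf (T_gen i \<otimes>\<^bsub>H\<^esub> h) w = \<zero>" if w: "w \<in> Sn" "Suc k \<le> len w" for w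
  proof -
    have "adj i \<circ> w \<in> Sn" by (rule comp_Sn[OF adj_Sn[OF i] w(1)])
    moreover have "len (adj i \<circ> (adj i \<circ> w)) \<le> Suc (len (adj i \<circ> w))"
      by (rule len_adj_comp_le[OF _ i]) (use calculation in simp)
    then have "k \<le> len (adj i \<circ> w)" using w(2) by (simp add: adj_adj_comp)
    ultimately have "cf h (adj i \<circ> w) = \<zero>" "cf h w = \<zero>" using h w by (auto simp: below_def)
    then show ?thesis using cf_T_gen[OF i hc w(1)] by simp
  qed
  then show ?thesis using hc i by (simp add: below_def)
qed

lemma below_T: assumes w: "w \<in> Sn" and h: "h \<in> below k" shows "T w \<otimes>\<^bsub>H\<^esub> h \<in> below (len w + k)"
proof -
  have "tw ws \<otimes>\<^bsub>H\<^esub> h \<in> below (length ws + k)" if "set ws \<subseteq> {1..<n}" for ws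
    using that
  proof (induction ws)
    case Nil then show ?case using h below_closed[OF h] by simp
  next
    case (Cons i ws)
    then have "T_gen i \<otimes>\<^bsub>H\<^esub> (tw ws \<otimes>\<^bsub>H\<^esub> h) \<in> below (Suc (length ws + k))" by (intro below_T_gen) auto
    then show ?case using Cons.prems below_closed[OF h] by (simp add: Hk.A.m_assoc)
  qed
  from this[of "reduced_word n w"] show ?thesis using reduced_word[of w n] w by (simp add: T_eq_tw)
qed

text \<open>\<open>below (Suc j)\<close> consists of combinations of \<open>T w\<close> with length
  at most j, so the shift by one in the filtration must be counted only once in the product.\<close>

lemma below_mult:
  assumes g: "g \<in> below (Suc j)" and h: "h \<in> below k"
  shows "g \<otimes>\<^bsub>H\<^esub> h \<in> below (j + k)"
proof -
  have gc: "g \<in> carrier H" and hc: "h \<in> carrier H" using g h by (auto intro: below_closed)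
  have "(\<Oplus>\<^bsub>H\<^esub>w\<in>S. cf g w \<odot>\<^bsub>H\<^esub> T w) \<otimes>\<^bsub>H\<^esub> h \<in> below (j + k)" if "finite S" "S \<subseteq> Sn" for S
    using that
  proof (induction S rule: finite_induct)
    case empty then show ?case using hc by (simp add: below_zero)
  next
    case (insert w S)
    have c: "(\<lambda>w. cf g w \<odot>\<^bsub>H\<^esub> T w) \<in> S \<rightarrow> carrier H" using insert.prems gc by auto
    have cc: "(\<Oplus>\<^bsub>H\<^esub>w\<in>S. cf g w \<odot>\<^bsub>H\<^esub> T w) \<in> carrier H" by (rule Hk.M.finsum_closed[OF c])
    have w: "w \<in> Sn" using insert.prems by blast
    have "(cf g w \<odot>\<^bsub>H\<^esub> T w) \<otimes>\<^bsub>H\<^esub> h \<in> below (j + k)"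
    proof (cases "len w \<le> j")
      case True
      have "T w \<otimes>\<^bsub>H\<^esub> h \<in> below (j + k)" by (rule below_mono[OF below_T[OF w h]]) (use True in simp)
      then show ?thesis using w gc hc by (simp add: Hk.smult_mult_l below_smult)
    next
      case False
      then have "cf g w = \<zero>" using g w by (simp add: below_def)
      then show ?thesis using w hc by (simp add: below_zero)
    qed
    moreover have "(\<Oplus>\<^bsub>H\<^esub>w\<in>S. cf g w \<odot>\<^bsub>H\<^esub> T w) \<otimes>\<^bsub>H\<^esub> h \<in> below (j + k)" using insert by blast
    ultimately show ?case
      using insert.hyps c cc w gc hc by (simp add: Hk.A.l_distr below_add)
  qed
  from this[OF finite_Sn order_refl] show ?thesis unfolding expansion_def[symmetric] expansion_eq[OF gc] .
qed

text \<open>The leading coefficient is required to be one, so that leading terms can be subtracted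
  over any base ring.\<close>

definition leading :: "(nat \<Rightarrow> nat) \<Rightarrow> 'k hecke \<Rightarrow> bool" where
  "leading x h \<longleftrightarrow> x \<in> Sn \<and> (\<exists>r\<in>below (len x). h = T x \<oplus>\<^bsub>H\<^esub> r)"

lemma leading_closed: "leading x h \<Longrightarrow> h \<in> carrier H"
  using below_closed by (auto simp: leading_def)

lemma leading_cf:
  assumes "leading x h" shows "cf h x = \<one>" "w \<in> Sn \<Longrightarrow> w \<noteq> x \<Longrightarrow> len x \<le> len w \<Longrightarrow> cf h w = \<zero>"
  using assms by (auto simp: leading_def below_def cf_T)

lemma leadingI:
  assumes x: "x \<in> Sn" and h: "h \<in> carrier H" and one: "cf h x = \<one>"
    and zero: "\<And>w. w \<in> Sn \<Longrightarrow> w \<noteq> x \<Longrightarrow> len x \<le> len w \<Longrightarrow> cf h w = \<zero>"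
  shows "leading x h"
proof -
  let ?r = "(\<ominus> \<one>) \<odot>\<^bsub>H\<^esub> T x \<oplus>\<^bsub>H\<^esub> h"
  have "?r \<in> below (len x)"
    using x h one zero by (auto simp: below_def cf_T l_neg)
  moreover have "T x \<oplus>\<^bsub>H\<^esub> ?r = h"
  proof -
    have "T x \<oplus>\<^bsub>H\<^esub> ?r = T x \<oplus>\<^bsub>H\<^esub> (\<ominus>\<^bsub>H\<^esub> T x) \<oplus>\<^bsub>H\<^esub> h" using x h by (simp add: neg_smult Hk.M.a_assoc)
    then show ?thesis using x h by (simp add: Hk.M.r_neg)
  qed
  ultimately show ?thesis using x by (auto simp: leading_def)
qed

lemma leading_mult:
  assumes g: "leading x g" and h: "leading y h" and l: "len (x \<circ> y) = len x + len y"
  shows "leading (x \<circ> y) (g \<otimes>\<^bsub>H\<^esub> h)"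
proof -
  have x: "x \<in> Sn" and y: "y \<in> Sn" using g h by (auto simp: leading_def)
  obtain r where r: "r \<in> below (len x)" "g = T x \<oplus>\<^bsub>H\<^esub> r" using g by (auto simp: leading_def)
  obtain s where s: "s \<in> below (len y)" "h = T y \<oplus>\<^bsub>H\<^esub> s" using h by (auto simp: leading_def)
  have c: "r \<in> carrier H" "s \<in> carrier H" using r s by (auto intro: below_closed)
  have hb: "h \<in> below (Suc (len y))"
    unfolding s(2) by (rule below_add[OF T_below[OF y] below_mono[OF s(1)]]) simp
  have "g \<otimes>\<^bsub>H\<^esub> h = T x \<otimes>\<^bsub>H\<^esub> h \<oplus>\<^bsub>H\<^esub> r \<otimes>\<^bsub>H\<^esub> h"
    using c x y leading_closed[OF h] by (simp add: r(2) Hk.A.l_distr)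
  also have "T x \<otimes>\<^bsub>H\<^esub> h = T (x \<circ> y) \<oplus>\<^bsub>H\<^esub> T x \<otimes>\<^bsub>H\<^esub> s"
    using c x y T_mult[OF x y l] by (simp add: s(2) Hk.A.r_distr)
  finally have e: "g \<otimes>\<^bsub>H\<^esub> h = T (x \<circ> y) \<oplus>\<^bsub>H\<^esub> (T x \<otimes>\<^bsub>H\<^esub> s \<oplus>\<^bsub>H\<^esub> r \<otimes>\<^bsub>H\<^esub> h)"
    using c x y comp_Sn[OF x y] leading_closed[OF h] by (simp add: Hk.M.a_assoc)
  have "r \<otimes>\<^bsub>H\<^esub> h \<in> below (len x + len y)"
  \<comment> \<open>\<open>below_mult\<close> asks for a successor on the left; for length zero the
    remainder \<open>r\<close> vanishes.\<close>
  proof (cases "len x")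
    case 0
    then have "r = \<zero>\<^bsub>H\<^esub>" using r(1) below_0 by simp
    then show ?thesis using leading_closed[OF h] by (simp add: below_zero)
  next
    case (Suc j)
    then show ?thesis using below_mult[OF _ hb, of r j] r(1) by simp
  qed
  then have "T x \<otimes>\<^bsub>H\<^esub> s \<oplus>\<^bsub>H\<^esub> r \<otimes>\<^bsub>H\<^esub> h \<in> below (len (x \<circ> y))"
    using below_T[OF x s(1)] l by (simp add: below_add)
  then show ?thesis using e comp_Sn[OF x y] by (auto simp: leading_def)
qed

lemma len_pinv: "w \<in> Sn \<Longrightarrow> len (pinv w) = len w"
  using len_inv by blast

lemma leading_star: assumes h: "leading x h" shows "leading (pinv x) (star h)"
proof (rule leadingI)
  have x: "x \<in> Sn" using h by (auto simp: leading_def)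
  note hc = leading_closed[OF h]
  show "pinv x \<in> Sn" by (rule inv_Sn[OF x])
  show "star h \<in> carrier H" using hc by simp
  show "cf (star h) (pinv x) = \<one>" using leading_cf(1)[OF h] x hc inv_Sn[OF x] by (simp add: cf_star pinv_pinv del: mem_Collect_eq)
  fix w assume w: "w \<in> Sn" "w \<noteq> pinv x" "len (pinv x) \<le> len w"
  have "cf h (pinv w) = \<zero>"
    by (rule leading_cf(2)[OF h inv_Sn[OF w(1)]]) (use w x pinv_pinv[OF w(1)] len_pinv[OF w(1)] len_pinv[OF x] in auto)
  then show "cf (star h) w = \<zero>" using w hc by (simp add: cf_star del: mem_Collect_eq)
qed

text \<open>\<open>D\<close> is the double coset of \<open>x\<close> between the Young subgroups of
  \<beta> and \<pi>, expressed through block labels. The sum of \<open>T z\<close> over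
  \<open>D\<close> is therefore constant along cosets on both sides, and by \<open>L\<close> the
  shortest left coset representatives contained in \<open>D\<close> are all shorter than
  \<open>x\<close>, except \<open>x\<close> itself.\<close>

lemma leading_ind_reps:
  assumes \<pi>: "\<pi> \<in> compositions n" and x: "x \<in> reps \<pi>"
    and L: "\<And>d h. d permutes {1..n} \<Longrightarrow> inc_on_blocks n (blk \<pi>) d \<Longrightarrow> h \<in> yg n (blk \<pi>) \<Longrightarrow>
      (\<And>p. p \<in> {1..n} \<Longrightarrow> blk \<beta> (d p) = blk \<beta> (x (h p))) \<Longrightarrow> d = x \<or> len d < len x"
  obtains u where "u \<in> carrier H" "rc \<pi> u" "rc \<beta> (star u)" "leading x (rep_part \<pi> u)"
proof -
  let ?Y = "yg n (blk \<pi>)"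
  define D where "D = {z \<in> Sn. \<exists>g\<in>?Y. \<forall>p\<in>{1..n}. blk \<beta> (z p) = blk \<beta> (x (g p))}"
  have D: "D \<subseteq> Sn" by (auto simp: D_def)
  have xS: "x \<in> Sn" using x reps_Sn by blast
  note uc = ind_closed[OF D]
  have Dr: "z \<circ> t \<in> D" if z: "z \<in> D" and t: "t \<in> ?Y" for z t
  proof -
    obtain g where g: "g \<in> ?Y" "\<forall>p\<in>{1..n}. blk \<beta> (z p) = blk \<beta> (x (g p))" using z by (auto simp: D_def)
    have "\<forall>p\<in>{1..n}. blk \<beta> ((z \<circ> t) p) = blk \<beta> (x ((g \<circ> t) p))"
      using g(2) permutes_mem[OF yg_permutes[OF t]] by simp
    moreover have "z \<circ> t \<in> Sn" by (rule comp_Sn) (use z D yg_permutes[OF t] in auto)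
    ultimately show ?thesis using comp_yg[OF g(1) t] unfolding D_def by blast
  qed
  have Dl: "s \<circ> z \<in> D" if z: "z \<in> D" and s: "s \<in> yg n (blk \<beta>)" for z s
  proof -
    obtain g where g: "g \<in> ?Y" "\<forall>p\<in>{1..n}. blk \<beta> (z p) = blk \<beta> (x (g p))" using z by (auto simp: D_def)
    have zp: "z permutes {1..n}" using z D by blast
    have "\<forall>p\<in>{1..n}. blk \<beta> ((s \<circ> z) p) = blk \<beta> (x (g p))"
      using g(2) yg_block[OF s permutes_mem[OF zp]] by simp
    moreover have "s \<circ> z \<in> Sn" by (rule comp_Sn) (use z D yg_permutes[OF s] in auto)
    ultimately show ?thesis using g(1) unfolding D_def by blast
  qed
  have inv_cancel: "z \<circ> t \<circ> pinv t = z" "pinv t \<circ> (t \<circ> z) = z" if "t \<in> yg n b" for z t b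
    using permutes_inverses[OF yg_permutes[OF that]] by (auto simp: fun_eq_iff)
  show thesis
  proof
    show "ind D \<in> carrier H" by (rule uc)
    show "rc \<pi> (ind D)"
      unfolding rc_def
    proof (intro conjI ballI uc)
      fix w t assume w: "w \<in> Sn" and t: "t \<in> ?Y"
      have "w \<circ> t \<in> D \<longleftrightarrow> w \<in> D"
        using Dr[OF _ t, of w] Dr[OF _ inv_yg[OF t], of "w \<circ> t"] inv_cancel(1)[OF t, of w] by auto
      moreover have "w \<circ> t \<in> Sn" by (rule comp_Sn[OF w]) (use yg_permutes[OF t] in simp)
      ultimately show "cf (ind D) (w \<circ> t) = cf (ind D) w" using cf_ind[OF D] w by simp
    qed
    show "rc \<beta> (star (ind D))"
      unfolding rc_def
    proof (intro conjI ballI star_closed uc)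
      fix w t assume w: "w \<in> Sn" and t: "t \<in> yg n (blk \<beta>)"
      have tS: "t \<in> Sn" using yg_permutes[OF t] by simp
      have e: "pinv (w \<circ> t) = pinv t \<circ> pinv w"
        using o_inv_distrib[OF permutes_bij permutes_bij] w tS by blast
      have "pinv t \<circ> pinv w \<in> D \<longleftrightarrow> pinv w \<in> D"
        using Dl[OF _ inv_yg[OF t], of "pinv w"] Dl[OF _ t, of "pinv t \<circ> pinv w"]
          inv_cancel(2)[OF inv_yg[OF t], of "pinv w"] pinv_pinv[OF tS] by auto
      moreover have "cf (star (ind D)) z = (if pinv z \<in> D then \<one> else \<zero>)" if "z \<in> Sn" for z
        using cf_star[OF uc that] cf_ind[OF D inv_Sn[OF that]] by simp
      ultimately show "cf (star (ind D)) (w \<circ> t) = cf (star (ind D)) w"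
        using w comp_Sn[OF w tS] by (simp add: e del: mem_Collect_eq)
    qed
    show "leading x (rep_part \<pi> (ind D))"
    proof (rule leadingI[OF xS rep_part_closed[OF uc]])
      have "x \<in> D" unfolding D_def using xS by (auto intro!: bexI[OF _ id_yg])
      then show "cf (rep_part \<pi> (ind D)) x = \<one>" using cf_rep_part[OF uc xS] x cf_ind[OF D xS] by simp
      fix w assume w: "w \<in> Sn" "w \<noteq> x" "len x \<le> len w"
      have "\<not> (w \<in> reps \<pi> \<and> w \<in> D)"
      proof
        assume "w \<in> reps \<pi> \<and> w \<in> D"
        then obtain g where "inc_on_blocks n (blk \<pi>) w" "g \<in> ?Y" "\<forall>p\<in>{1..n}. blk \<beta> (w p) = blk \<beta> (x (g p))"
          by (auto simp: reps_def D_def)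
        then have "w = x \<or> len w < len x" using L[of w g] w(1) by blast
        then show False using w by simp
      qed
      then show "cf (rep_part \<pi> (ind D)) w = \<zero>" using cf_rep_part[OF uc w(1)] cf_ind[OF D w(1)] by auto
    qed
  qed
qed

lemma leading_m:
  assumes \<nu>: "\<nu> \<in> compositions n" and t: "t \<in> yg n (blk \<nu>)"
    and max: "\<And>g. g \<in> yg n (blk \<nu>) \<Longrightarrow> g = t \<or> len g < len t"
  shows "leading t (m \<nu>)"
proof (rule leadingI[OF _ mH_closed])
  show tS: "t \<in> Sn" using yg_permutes[OF t] by simp
  show "cf (m \<nu>) t = \<one>" using cf_m[OF \<nu> tS] t by simp
  fix w assume w: "w \<in> Sn" "w \<noteq> t" "len t \<le> len w"
  then have "w \<notin> yg n (blk \<nu>)" using max[of w] by auto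
  then show "cf (m \<nu>) w = \<zero>" using cf_m[OF \<nu> w(1)] by simp
qed

text \<open>\<open>deca\<close> and \<open>decb\<close> say that \<open>w\<close> is the longest
  element of its double coset. These are the only permutations that can lead an element of
  \<open>MM \<alpha> \<beta>\<close>, and each of them is matched here by an element of the desired
  form.\<close>

lemma MM_leading:
  assumes \<alpha>: "\<alpha> \<in> compositions n" and \<beta>: "\<beta> \<in> compositions n" and w: "w \<in> Sn"
    and deca: "\<And>i j. i \<in> {1..n} \<Longrightarrow> j \<in> {1..n} \<Longrightarrow> i < j \<Longrightarrow> blk \<alpha> i = blk \<alpha> j \<Longrightarrow> w j < w i"
    and decb: "\<And>i j. i \<in> {1..n} \<Longrightarrow> j \<in> {1..n} \<Longrightarrow> i < j \<Longrightarrow> blk \<beta> i = blk \<beta> j \<Longrightarrow> pinv w j < pinv w i"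
  shows "\<exists>b\<in>MM \<alpha> \<beta>. leading w b \<and> (\<alpha> = \<beta> \<and> b = m \<alpha> \<or>
    (\<exists>\<pi>\<in>compositions n. dom_le \<alpha> \<pi> \<and> dom_le \<beta> \<pi> \<and> \<not> (\<alpha> = \<pi> \<and> \<beta> = \<pi>) \<and>
      (\<exists>u\<in>MM \<pi> \<beta>. \<exists>v\<in>MM \<alpha> \<pi>. b = circ \<pi> u v)))"
proof -
  have wp: "w permutes {1..n}" using w by simp
  show ?thesis
  proof (rule key_factorization[OF \<alpha> \<beta> wp deca decb])
    fix \<pi> x t e
    assume \<pi>: "\<pi> \<in> compositions n" and dom: "dom_le \<alpha> \<pi>" "dom_le \<beta> \<pi>"
      and triv: "\<alpha> = \<pi> \<Longrightarrow> \<beta> = \<pi> \<Longrightarrow> w \<in> yg n (blk \<pi>)"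
      and x: "x permutes {1..n}" and e: "e permutes {1..n}" and t: "t \<in> yg n (blk \<pi>)"
      and wf: "w = x \<circ> t \<circ> e" and lw: "len w = len x + len t + len e"
      and ix: "inc_on_blocks n (blk \<pi>) x" and ie: "inc_on_blocks n (blk \<pi>) (pinv e)"
      and tmax: "\<And>g. g \<in> yg n (blk \<pi>) \<Longrightarrow> g = t \<or> len g < len t"
      and Lx: "\<And>d h. d permutes {1..n} \<Longrightarrow> inc_on_blocks n (blk \<pi>) d \<Longrightarrow> h \<in> yg n (blk \<pi>) \<Longrightarrow>
        (\<And>p. p \<in> {1..n} \<Longrightarrow> blk \<beta> (d p) = blk \<beta> (x (h p))) \<Longrightarrow> d = x \<or> len d < len x"
      and Le: "\<And>d h. d permutes {1..n} \<Longrightarrow> inc_on_blocks n (blk \<pi>) d \<Longrightarrow> h \<in> yg n (blk \<pi>) \<Longrightarrow>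
        (\<And>p. p \<in> {1..n} \<Longrightarrow> blk \<alpha> (d p) = blk \<alpha> (pinv e (h p))) \<Longrightarrow> d = pinv e \<or> len d < len (pinv e)"
    note lm = leading_m[OF \<pi> t tmax]
    show ?thesis
    proof (cases "\<alpha> = \<pi> \<and> \<beta> = \<pi>")
      case True
      \<comment> \<open>\<open>w\<close> lies in the Young subgroup, so it is \<open>t\<close> or
        shorter than \<open>t\<close>; the length formula excludes the latter.\<close>
      have "w = t" using tmax[OF triv] True lw by fastforce
      then show ?thesis using True lm m_MM[of \<pi>] by (intro bexI[of _ "m \<pi>"]) auto
    next
      case False
      have xr: "x \<in> reps \<pi>" and er: "pinv e \<in> reps \<pi>" using x ix ie permutes_inv[OF e] by (auto simp: reps_def)
      obtain u where u: "u \<in> carrier H" "rc \<pi> u" "rc \<beta> (star u)" "leading x (rep_part \<pi> u)"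
        by (rule leading_ind_reps[OF \<pi> xr Lx])
      \<comment> \<open>The right-hand factor is first built as a left-hand one, for
        \<open>pinv e\<close> and \<alpha>, and then turned around by \<open>star\<close>.\<close>
      obtain v where v: "v \<in> carrier H" "rc \<pi> v" "rc \<alpha> (star v)" "leading (pinv e) (rep_part \<pi> v)"
        by (rule leading_ind_reps[OF \<pi> er Le])
      let ?X = "rep_part \<pi> u" and ?Y = "star (rep_part \<pi> v)"
      have c: "?X \<in> carrier H" "?Y \<in> carrier H" using u v by (simp_all add: rep_part_closed)
      have uM: "u \<in> MM \<pi> \<beta>" using u MM_iff[OF \<pi> \<beta>] by blast
      have "star v \<in> MM \<alpha> \<pi>" using v MM_iff[OF \<alpha> \<pi>, of "star v"] by simp
      moreover have "star v = m \<pi> \<otimes>\<^bsub>H\<^esub> ?Y"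
        using arg_cong[OF rc_factor[OF \<pi> v(2)], of star] v by (simp add: star_mult star_m rep_part_closed)
      ultimately have ce: "circ \<pi> u (star v) = ?X \<otimes>\<^bsub>H\<^esub> (m \<pi> \<otimes>\<^bsub>H\<^esub> ?Y)" and vM: "star v \<in> MM \<alpha> \<pi>"
        using circ_eq(1)[OF c rc_factor[OF \<pi> u(2)]] by simp_all
      have lt: "leading (x \<circ> t) (?X \<otimes>\<^bsub>H\<^esub> m \<pi>)"
        by (rule leading_mult[OF u(4) lm len_comp_yg[OF x ix t blk_mono[OF \<pi>]]])
      have ly: "leading e ?Y" using leading_star[OF v(4)] pinv_pinv[of e] e by simp
      have "len (x \<circ> t \<circ> e) = len (x \<circ> t) + len e"
        using lw wf len_comp_yg[OF x ix t blk_mono[OF \<pi>]] by simp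
      from leading_mult[OF lt ly this] have "leading w (circ \<pi> u (star v))"
        using c by (simp add: ce wf Hk.A.m_assoc)
      then show ?thesis using False \<pi> dom uM vM circ_closed[OF uM vM] by blast
    qed
  qed
qed

text \<open>If \<open>w\<close> increased between two neighbours of one block, exchanging them would
  give a longer permutation with the same nonzero coefficient. Passing to \<open>n - w p\<close>
  turns decrease into increase for \<open>ex_ascent_descent_block\<close>.\<close>

lemma rc_decreasing:
  assumes \<alpha>: "\<alpha> \<in> compositions n" and f: "rc \<alpha> f" and w: "w \<in> Sn" and nz: "cf f w \<noteq> \<zero>"
    and max: "\<And>z. z \<in> Sn \<Longrightarrow> cf f z \<noteq> \<zero> \<Longrightarrow> len z \<le> len w"
    and ij: "i \<in> {1..n}" "j \<in> {1..n}" "i < j" "blk \<alpha> i = blk \<alpha> j"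
  shows "w j < w i"
proof (rule ccontr)
  have wp: "w permutes {1..n}" using w by simp
  assume "\<not> w j < w i"
  then have "\<not> n - w i < n - w j" using permutes_mem[OF wp ij(1)] permutes_mem[OF wp ij(2)] by auto
  then obtain k where k: "k \<in> {1..<n}" "blk \<alpha> k = blk \<alpha> (Suc k)" "\<not> n - w k < n - w (Suc k)"
    using ex_ascent_descent_block[OF blk_mono[OF \<alpha>] ij, of "\<lambda>p. n - w p"] by blast
  have kn: "k \<in> {1..n}" "Suc k \<in> {1..n}" using k(1) by auto
  have "w k < w (Suc k)"
    using k(3) permutes_mem[OF wp kn(1)] permutes_mem[OF wp kn(2)] permutes_less_cases[OF wp, of k "Suc k"] by auto
  then have "len (w \<circ> adj k) = Suc (len w)" by (rule len_comp_adj_up[OF wp k(1)])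
  moreover have "cf f (w \<circ> adj k) = cf f w" using f w adj_yg[OF k(1,2)] by (simp add: rc_def)
  ultimately show False using max[OF comp_Sn[OF w adj_Sn[OF k(1)]]] nz by simp
qed

text \<open>Subtracting multiples of the elements with leading term \<open>T w\<close> clears the support from the top.\<close>

lemma MM_induct [consumes 3, case_names zero add m circ]:
  assumes \<alpha>: "\<alpha> \<in> compositions n" and \<beta>: "\<beta> \<in> compositions n" and f: "f \<in> MM \<alpha> \<beta>"
    and zero: "P \<zero>\<^bsub>H\<^esub>" and add: "\<And>a b. a \<in> MM \<alpha> \<beta> \<Longrightarrow> b \<in> MM \<alpha> \<beta> \<Longrightarrow> P a \<Longrightarrow> P b \<Longrightarrow> P (a \<oplus>\<^bsub>H\<^esub> b)"
    and Pm: "\<And>c. c \<in> carrier K \<Longrightarrow> \<alpha> = \<beta> \<Longrightarrow> P (c \<odot>\<^bsub>H\<^esub> m \<alpha>)"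
    and Pc: "\<And>\<pi> c u v. \<pi> \<in> compositions n \<Longrightarrow> dom_le \<alpha> \<pi> \<Longrightarrow> dom_le \<beta> \<pi> \<Longrightarrow> \<not> (\<alpha> = \<pi> \<and> \<beta> = \<pi>) \<Longrightarrow>
      c \<in> carrier K \<Longrightarrow> u \<in> MM \<pi> \<beta> \<Longrightarrow> v \<in> MM \<alpha> \<pi> \<Longrightarrow> P (c \<odot>\<^bsub>H\<^esub> circ \<pi> u v)"
  shows "P f"
proof -
  \<comment> \<open>\<open>X\<close> bounds the support and contains, with each element, all shorter
    permutations. One longest element is removed at a time, so ties in length cause no
    difficulty.\<close>
  have "P f" if "finite X" "X \<subseteq> Sn" "\<And>w z. w \<in> X \<Longrightarrow> z \<in> Sn \<Longrightarrow> len z < len w \<Longrightarrow> z \<in> X" "f \<in> MM \<alpha> \<beta>"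
    "\<And>w. w \<in> Sn \<Longrightarrow> cf f w \<noteq> \<zero> \<Longrightarrow> w \<in> X" for X f
    using that
  proof (induction X arbitrary: f rule: finite_psubset_induct)
    case (psubset X)
    note fc = MM_closed[OF psubset.prems(3)]
    show ?case
    proof (cases "X = {}")
      case True
      then have "f = \<zero>\<^bsub>H\<^esub>" using psubset.prems(4) fc by (intro cf_eqI) auto
      then show ?thesis using zero by simp
    next
      case False
      have "Max (len ` X) \<in> len ` X" using psubset.hyps(1) False by (intro Max_in) auto
      then obtain w where w: "w \<in> X" "len w = Max (len ` X)" by auto
      have w: "w \<in> X" "\<And>z. z \<in> X \<Longrightarrow> len z \<le> len w"
        using w psubset.hyps(1) by (auto intro: Max_ge)
      have wS: "w \<in> Sn" using w psubset.prems(1) by blast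
      have X': "X - {w} \<subset> X" "X - {w} \<subseteq> Sn" using w psubset.prems(1) by auto
      have down: "z \<in> X - {w}" if "w' \<in> X - {w}" "z \<in> Sn" "len z < len w'" for w' z
        using that psubset.prems(2)[of w' z] w(2)[of w'] by auto
      show ?thesis
      proof (cases "cf f w = \<zero>")
        case True
        show ?thesis
        proof (rule psubset.IH[OF X' down psubset.prems(3)])
          fix z assume "z \<in> Sn" "cf f z \<noteq> \<zero>"
          then show "z \<in> X - {w}" using psubset.prems(4) True by blast
        qed
      next
        case nz: False
        have mx: "len z \<le> len w" if "z \<in> Sn" "cf f z \<noteq> \<zero>" for z using psubset.prems(4)[OF that] w(2) by blast
        have r: "rc \<alpha> f" "rc \<beta> (star f)" using MM_iff[OF \<alpha> \<beta>] psubset.prems(3) by blast+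
        have deca: "w j < w i" if "i \<in> {1..n}" "j \<in> {1..n}" "i < j" "blk \<alpha> i = blk \<alpha> j" for i j
          using rc_decreasing[OF \<alpha> r(1) wS nz mx that] by blast
        have decb: "pinv w j < pinv w i" if "i \<in> {1..n}" "j \<in> {1..n}" "i < j" "blk \<beta> i = blk \<beta> j" for i j
        proof (rule rc_decreasing[OF \<beta> r(2) inv_Sn[OF wS] _ _ that])
          show "cf (star f) (pinv w) \<noteq> \<zero>" using nz cf_star[OF fc inv_Sn[OF wS]] pinv_pinv[OF wS] by simp
          fix z assume z: "z \<in> Sn" "cf (star f) z \<noteq> \<zero>"
          then have "len (pinv z) \<le> len w" using mx[OF inv_Sn[OF z(1)]] cf_star[OF fc z(1)] by simp
          then show "len z \<le> len (pinv w)" using len_pinv z(1) wS by simp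
        qed
        obtain b where b: "b \<in> MM \<alpha> \<beta>" "leading w b" and bc: "\<alpha> = \<beta> \<and> b = m \<alpha> \<or>
          (\<exists>\<pi>\<in>compositions n. dom_le \<alpha> \<pi> \<and> dom_le \<beta> \<pi> \<and> \<not> (\<alpha> = \<pi> \<and> \<beta> = \<pi>) \<and>
            (\<exists>u\<in>MM \<pi> \<beta>. \<exists>v\<in>MM \<alpha> \<pi>. b = circ \<pi> u v))"
          using MM_leading[OF \<alpha> \<beta> wS deca decb] by blast
        have Pb: "P (c \<odot>\<^bsub>H\<^esub> b)" if "c \<in> carrier K" for c using bc Pm[OF that] Pc[OF _ _ _ _ that] by blast
        define c where "c = cf f w"
        have c: "c \<in> carrier K" using fc by (simp add: c_def)
        define g where "g = f \<oplus>\<^bsub>H\<^esub> (\<ominus> c) \<odot>\<^bsub>H\<^esub> b"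
        note bcl = MM_closed[OF b(1)]
        have g: "g \<in> MM \<alpha> \<beta>" unfolding g_def by (rule MM_add[OF psubset.prems(3) MM_smult[OF _ b(1)]]) (use c in simp)
        have fg: "f = g \<oplus>\<^bsub>H\<^esub> c \<odot>\<^bsub>H\<^esub> b"
          using fc bcl c by (simp add: g_def Hk.M.a_assoc Hk.smult_l_distr[symmetric] l_neg)
        have "P g"
        proof (rule psubset.IH[OF X' down g])
          fix z assume z: "z \<in> Sn" "cf g z \<noteq> \<zero>"
          have cg: "cf g z = cf f z \<oplus> (\<ominus> c) \<otimes> cf b z" using fc bcl c by (simp add: g_def)
          have "z \<noteq> w" using z(2) c leading_cf(1)[OF b(2)] cg by (auto simp: c_def r_neg)
          \<comment> \<open>Since \<open>X\<close> contains every permutation shorter than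
            \<open>w\<close>, a z outside \<open>X\<close> is at least as long as \<open>w\<close>;
            its coefficient in \<open>b\<close> is then zero.\<close>
          moreover have "z \<in> X"
          proof (rule ccontr)
            assume zX: "z \<notin> X"
            then have "cf f z = \<zero>" using psubset.prems(4)[OF z(1)] by blast
            moreover have "len w \<le> len z" using psubset.prems(2)[OF w(1) z(1)] zX by (meson not_less)
            then have "cf b z = \<zero>" using leading_cf(2)[OF b(2) z(1) \<open>z \<noteq> w\<close>] by blast
            ultimately show False using z(2) cg c by simp
          qed
          ultimately show "z \<in> X - {w}" by blast
        qed
        then show ?thesis using add[OF g MM_smult[OF c b(1)]] Pb[OF c] fg by simp
      qed
    qed
  qed
  from this[OF finite_Sn order_refl _ f] show ?thesis by blast
qed

end

section \<open>Sums of the spaces \<open>M_through\<close>\<close>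

context abelian_group
begin

lemma add_span_incl: "x \<in> S \<Longrightarrow> x \<in> add_span G S"
  unfolding add_span_def by (rule generate.incl)

lemma add_span_zero: "\<zero> \<in> add_span G S"
  unfolding add_span_def using generate.one[of "add_monoid G" S] by simp

lemma add_span_add: "x \<in> add_span G S \<Longrightarrow> y \<in> add_span G S \<Longrightarrow> x \<oplus> y \<in> add_span G S"
  unfolding add_span_def using generate.eng[of x "add_monoid G" S y] by simp

lemma add_span_induct [consumes 2, case_names zero incl neg add]:
  assumes "x \<in> add_span G S" and S: "S \<subseteq> carrier G" and "P \<zero>"
    and incl: "\<And>s. s \<in> S \<Longrightarrow> P s" and neg: "\<And>s. s \<in> S \<Longrightarrow> P (\<ominus> s)"
    and add: "\<And>a b. a \<in> add_span G S \<Longrightarrow> b \<in> add_span G S \<Longrightarrow> P a \<Longrightarrow> P b \<Longrightarrow> P (a \<oplus> b)"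
  shows "P x"
  using assms(1) unfolding add_span_def
proof (induction rule: generate.induct)
  case one then show ?case using assms(3) by simp
next
  case (incl h) then show ?case by (rule assms(4))
next
  case (inv h) then show ?case using neg[of h] by (simp add: a_inv_def)
next
  case (eng h1 h2) then show ?case using add[of h1 h2] by (simp add: add_span_def)
qed

lemma add_span_closed: "S \<subseteq> carrier G \<Longrightarrow> add_span G S \<subseteq> carrier G"
proof
  fix x assume S: "S \<subseteq> carrier G" and "x \<in> add_span G S"
  from this(2,1) show "x \<in> carrier G"
  proof (induction rule: add_span_induct)
    case (add a b) then show ?case by simp
  qed (use S in auto)
qed

end

context hecke_setting
begin

text \<open>\<open>M_ge\<close> and \<open>M_gt\<close> are instances, and so are the sums over
  common upper bounds to which products of layers lead.\<close>

definition Msum :: "(nat \<Rightarrow> nat) set \<Rightarrow> (nat \<Rightarrow> nat) \<Rightarrow> (nat \<Rightarrow> nat) \<Rightarrow> 'k hecke set" where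
  "Msum L \<alpha> \<beta> = add_span H (\<Union>\<pi>\<in>L. M_through \<pi> \<alpha> \<beta>)"

lemma M_ge_Msum: "M_ge \<nu> = Msum {\<pi> \<in> compositions n. dom_le \<nu> \<pi>}"
  and M_gt_Msum: "M_gt \<nu> = Msum {\<pi> \<in> compositions n. dom_le \<nu> \<pi> \<and> \<pi> \<noteq> \<nu>}"
  by (auto simp: M_ge_def M_gt_def Msum_def fun_eq_iff)

lemma circ_carrier: "u \<in> MM \<pi> \<beta> \<Longrightarrow> v \<in> MM \<alpha> \<pi> \<Longrightarrow> circ \<pi> u v \<in> carrier H"
  by (rule MM_closed[OF circ_closed])

lemma M_through_gens: "{circ \<pi> u v |u v. u \<in> MM \<pi> \<beta> \<and> v \<in> MM \<alpha> \<pi>} \<subseteq> carrier H"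
  using circ_carrier by blast

lemma M_through_carrier: "(\<Union>\<pi>\<in>L. M_through \<pi> \<alpha> \<beta>) \<subseteq> carrier H"
  unfolding M_through_def using Hk.M.add_span_closed[OF M_through_gens] by blast

lemma MM_neg: "u \<in> MM \<alpha> \<beta> \<Longrightarrow> \<ominus>\<^bsub>H\<^esub> u \<in> MM \<alpha> \<beta>"
  using MM_smult[of "\<ominus> \<one>" u] MM_closed[of u] by (simp add: neg_smult)

lemma circ_neg: "u \<in> MM \<pi> \<beta> \<Longrightarrow> v \<in> MM \<alpha> \<pi> \<Longrightarrow> \<ominus>\<^bsub>H\<^esub> circ \<pi> u v = circ \<pi> (\<ominus>\<^bsub>H\<^esub> u) v"
  using circ_smult_l[of "\<ominus> \<one>" u \<pi> \<beta> v \<alpha>] MM_closed[of u] circ_carrier[of u \<pi> \<beta> v \<alpha>] by (simp add: neg_smult)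

lemma Msum_zero: "\<zero>\<^bsub>H\<^esub> \<in> Msum L \<alpha> \<beta>"
  unfolding Msum_def by (rule Hk.M.add_span_zero)

lemma Msum_add: "x \<in> Msum L \<alpha> \<beta> \<Longrightarrow> y \<in> Msum L \<alpha> \<beta> \<Longrightarrow> x \<oplus>\<^bsub>H\<^esub> y \<in> Msum L \<alpha> \<beta>"
  unfolding Msum_def by (rule Hk.M.add_span_add)

lemma Msum_gen: "\<pi> \<in> L \<Longrightarrow> u \<in> MM \<pi> \<beta> \<Longrightarrow> v \<in> MM \<alpha> \<pi> \<Longrightarrow> circ \<pi> u v \<in> Msum L \<alpha> \<beta>"
  unfolding Msum_def M_through_def by (rule Hk.M.add_span_incl, rule UN_I, assumption, rule Hk.M.add_span_incl) blast

lemma Msum_carrier: "x \<in> Msum L \<alpha> \<beta> \<Longrightarrow> x \<in> carrier H"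
  unfolding Msum_def using Hk.M.add_span_closed[OF M_through_carrier] by blast

text \<open>Flattens the two nested spans and avoids a case for negatives: the sign of a generator
  is absorbed into its left factor.\<close>

lemma Msum_induct [consumes 1, case_names zero gen add]:
  assumes x: "x \<in> Msum L \<alpha> \<beta>" and zero: "P \<zero>\<^bsub>H\<^esub>"
    and gen: "\<And>\<pi> u v. \<pi> \<in> L \<Longrightarrow> u \<in> MM \<pi> \<beta> \<Longrightarrow> v \<in> MM \<alpha> \<pi> \<Longrightarrow> P (circ \<pi> u v)"
    and add: "\<And>a b. a \<in> Msum L \<alpha> \<beta> \<Longrightarrow> b \<in> Msum L \<alpha> \<beta> \<Longrightarrow> P a \<Longrightarrow> P b \<Longrightarrow> P (a \<oplus>\<^bsub>H\<^esub> b)"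
  shows "P x"
proof -
  have thr: "s \<in> Msum L \<alpha> \<beta> \<and> P s \<and> \<ominus>\<^bsub>H\<^esub> s \<in> Msum L \<alpha> \<beta> \<and> P (\<ominus>\<^bsub>H\<^esub> s)"
    if "\<pi> \<in> L" "s \<in> M_through \<pi> \<alpha> \<beta>" for \<pi> s
    using that(2) unfolding M_through_def
  proof (induction rule: Hk.M.add_span_induct[OF _ M_through_gens, consumes 1])
    case 1 show ?case using zero Msum_zero by simp
  next
    case (2 s)
    then obtain u v where uv: "s = circ \<pi> u v" "u \<in> MM \<pi> \<beta>" "v \<in> MM \<alpha> \<pi>" by blast
    then show ?case using gen[OF that(1)] Msum_gen[OF that(1)] MM_neg by (simp add: circ_neg)
  next
    case (3 s)
    then obtain u v where uv: "s = circ \<pi> u v" "u \<in> MM \<pi> \<beta>" "v \<in> MM \<alpha> \<pi>" by blast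
    then show ?case
      using gen[OF that(1)] Msum_gen[OF that(1)] MM_neg circ_carrier[OF uv(2,3)] by (simp add: circ_neg[symmetric]) (simp add: circ_neg)
  next
    case (4 a b)
    have c: "a \<in> carrier H" "b \<in> carrier H" using 4 Msum_carrier by blast+
    then show ?case using 4 add Msum_add by (simp add: Hk.M.minus_add)
  qed
  have "x \<in> Msum L \<alpha> \<beta> \<and> P x"
    using x[unfolded Msum_def]
  proof (induction rule: Hk.M.add_span_induct[OF _ M_through_carrier, consumes 1])
    case 1 then show ?case using zero Msum_zero by simp
  next
    case (2 s) then show ?case using thr by blast
  next
    case (3 s) then show ?case using thr by blast
  next
    case (4 a b) then show ?case using add Msum_add by blast
  qed
  then show ?thesis by blast
qed

lemma Msum_MM: "x \<in> Msum L \<alpha> \<beta> \<Longrightarrow> x \<in> MM \<alpha> \<beta>"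
  by (induction rule: Msum_induct) (auto intro: MM_zero MM_add circ_closed)

lemma Msum_mono: "x \<in> Msum L \<alpha> \<beta> \<Longrightarrow> L \<subseteq> L' \<Longrightarrow> x \<in> Msum L' \<alpha> \<beta>"
  by (induction rule: Msum_induct) (auto intro: Msum_zero Msum_add Msum_gen)

lemma Msum_smult: "x \<in> Msum L \<alpha> \<beta> \<Longrightarrow> c \<in> carrier K \<Longrightarrow> c \<odot>\<^bsub>H\<^esub> x \<in> Msum L \<alpha> \<beta>"
proof (induction rule: Msum_induct)
  case (gen \<pi> u v)
  then show ?case using Msum_gen[OF gen(1) MM_smult[OF gen(4,2)] gen(3)] by (simp add: circ_smult_l)
next
  case (add a b) then show ?case using Msum_carrier by (simp add: Hk.smult_r_distr Msum_add)
qed (simp add: Msum_zero)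

lemma Msum_neg: "x \<in> Msum L \<alpha> \<beta> \<Longrightarrow> \<ominus>\<^bsub>H\<^esub> x \<in> Msum L \<alpha> \<beta>"
  using Msum_smult[of x L \<alpha> \<beta> "\<ominus> \<one>"] Msum_carrier[of x] by (simp add: neg_smult)

lemma circ_zero_l: "v \<in> MM \<alpha> \<kappa> \<Longrightarrow> circ \<kappa> \<zero>\<^bsub>H\<^esub> v = \<zero>\<^bsub>H\<^esub>"
  using circ_smult_l[OF zero_closed m_MM[of \<kappa>], of v \<alpha>] circ_carrier[OF m_MM] by simp

lemma circ_zero_r: "u \<in> MM \<kappa> \<beta> \<Longrightarrow> circ \<kappa> u \<zero>\<^bsub>H\<^esub> = \<zero>\<^bsub>H\<^esub>"
  using circ_smult_r[OF zero_closed _ m_MM[of \<kappa>], of u \<beta>] circ_carrier[OF _ m_MM] by simp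

lemma circ_minus_l:
  assumes "u \<in> MM \<kappa> \<beta>" "u' \<in> MM \<kappa> \<beta>" "v \<in> MM \<alpha> \<kappa>"
  shows "circ \<kappa> (u \<ominus>\<^bsub>H\<^esub> u') v = circ \<kappa> u v \<ominus>\<^bsub>H\<^esub> circ \<kappa> u' v"
  unfolding a_minus_def using circ_add_l[OF assms(1) MM_neg[OF assms(2)] assms(3)] circ_neg[OF assms(2,3)] by simp

lemma circ_minus_r:
  assumes "u \<in> MM \<kappa> \<beta>" "v \<in> MM \<alpha> \<kappa>" "v' \<in> MM \<alpha> \<kappa>"
  shows "circ \<kappa> u (v \<ominus>\<^bsub>H\<^esub> v') = circ \<kappa> u v \<ominus>\<^bsub>H\<^esub> circ \<kappa> u v'"
proof -
  have "circ \<kappa> u (\<ominus>\<^bsub>H\<^esub> v') = \<ominus>\<^bsub>H\<^esub> circ \<kappa> u v'"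
    using circ_smult_r[of "\<ominus> \<one>" u \<kappa> \<beta> v' \<alpha>] assms MM_closed[OF assms(3)] circ_carrier[OF assms(1,3)] by (simp add: neg_smult)
  then show ?thesis unfolding a_minus_def using circ_add_r[OF assms(1,2) MM_neg[OF assms(3)]] by simp
qed

lemma circ_Msum_l: "x \<in> Msum L \<kappa> \<beta> \<Longrightarrow> z \<in> MM \<alpha> \<kappa> \<Longrightarrow> circ \<kappa> x z \<in> Msum L \<alpha> \<beta>"
proof (induction rule: Msum_induct)
  case zero then show ?case by (simp add: circ_zero_l Msum_zero)
next
  case (gen \<pi> u v) then show ?case by (simp add: circ_assoc Msum_gen circ_closed)
next
  case (add a b)
  then show ?case using circ_add_l[OF Msum_MM[OF add.hyps(1)] Msum_MM[OF add.hyps(2)] add.prems] by (simp add: Msum_add)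
qed

lemma circ_Msum_r: "x \<in> Msum L \<alpha> \<kappa> \<Longrightarrow> z \<in> MM \<kappa> \<beta> \<Longrightarrow> circ \<kappa> z x \<in> Msum L \<alpha> \<beta>"
proof (induction rule: Msum_induct)
  case zero then show ?case by (simp add: circ_zero_r Msum_zero)
next
  case (gen \<pi> u v) then show ?case using Msum_gen[OF gen(1) circ_closed[OF gen(4,2)] gen(3)] by (simp add: circ_assoc)
next
  case (add a b)
  then show ?case using circ_add_r[OF add.prems Msum_MM[OF add.hyps(1)] Msum_MM[OF add.hyps(2)]] by (simp add: Msum_add)
qed

lemma star_Msum: "x \<in> Msum L \<alpha> \<beta> \<Longrightarrow> star x \<in> Msum L \<beta> \<alpha>"
proof (induction rule: Msum_induct)
  case zero then show ?case by (simp add: Msum_zero)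
next
  case (gen \<pi> u v) then show ?case by (simp add: star_circ Msum_gen star_MM)
next
  case (add a b) then show ?case using Msum_carrier by (simp add: Msum_add)
qed

text \<open>The middle factor of \<open>(a \<circ> b) \<circ> (c \<circ> d)\<close> lies in \<open>MM \<pi>' \<pi>\<close>, hence passes through compositions
  dominating both \<open>\<pi>\<close> and \<open>\<pi>'\<close>.\<close>

lemma circ_Msum_Msum:
  assumes L: "L \<subseteq> compositions n" and L': "L' \<subseteq> compositions n"
    and x: "x \<in> Msum L \<kappa> \<beta>" and y: "y \<in> Msum L' \<alpha> \<kappa>"
  shows "circ \<kappa> x y \<in> Msum {\<rho> \<in> compositions n. \<exists>\<pi>\<in>L. \<exists>\<pi>'\<in>L'. dom_le \<pi> \<rho> \<and> dom_le \<pi>' \<rho>} \<alpha> \<beta>" (is "_ \<in> ?S")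
proof -
  have mid: "circ \<pi> a (circ \<pi>' f d) \<in> ?S"
    if p: "\<pi> \<in> L" "\<pi>' \<in> L'" and a: "a \<in> MM \<pi> \<beta>" and d: "d \<in> MM \<alpha> \<pi>'" and f: "f \<in> MM \<pi>' \<pi>" for \<pi> \<pi>' a d f
  proof -
    have pc: "\<pi>' \<in> compositions n" "\<pi> \<in> compositions n" using p L L' by blast+
    have "f \<in> MM \<pi>' \<pi> \<and> circ \<pi> a (circ \<pi>' f d) \<in> ?S"
      using pc f
    proof (induction rule: MM_induct)
      case zero then show ?case using MM_zero a d by (simp add: circ_zero_l circ_zero_r Msum_zero)
    next
      case (add f g)
      then have fg: "f \<in> MM \<pi>' \<pi>" "g \<in> MM \<pi>' \<pi>" "circ \<pi> a (circ \<pi>' f d) \<in> ?S" "circ \<pi> a (circ \<pi>' g d) \<in> ?S" by blast+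
      show ?case
        unfolding circ_add_l[OF fg(1,2) d] circ_add_r[OF a circ_closed[OF fg(1) d] circ_closed[OF fg(2) d]]
        using MM_add[OF fg(1,2)] Msum_add[OF fg(3,4)] by blast
    next
      case (m c)
      \<comment> \<open>For a multiple of m the two compositions coincide, and \<pi> itself is the
        common upper bound.\<close>
      have "circ \<pi> a d \<in> ?S" by (rule Msum_gen[OF _ a]) (use m p pc d dom_le_refl in auto)
      then show ?case
        using m a d m_MM[of \<pi>'] MM_smult[OF m(1) m_MM] by (simp add: circ_smult_l circ_smult_r circ_m_l Msum_smult)
    next
      case (circ \<rho> c u v)
      have "circ \<rho> (circ \<pi> a u) (circ \<pi>' v d) \<in> ?S"
        by (rule Msum_gen[OF _ circ_closed[OF a circ(6)] circ_closed[OF circ(7) d]]) (use circ p in auto)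
      moreover have "circ \<pi> a (circ \<pi>' (circ \<rho> u v) d) = circ \<rho> (circ \<pi> a u) (circ \<pi>' v d)"
        using circ_assoc[OF circ(6,7) d] circ_assoc[OF a circ(6) circ_closed[OF circ(7) d]] by simp
      moreover have "circ \<pi> a (circ \<pi>' (c \<odot>\<^bsub>H\<^esub> circ \<rho> u v) d) = c \<odot>\<^bsub>H\<^esub> circ \<pi> a (circ \<pi>' (circ \<rho> u v) d)"
        using circ_smult_l[OF circ(5) circ_closed[OF circ(6,7)] d]
          circ_smult_r[OF circ(5) a circ_closed[OF circ_closed[OF circ(6,7)] d]] by simp
      ultimately show ?case using Msum_smult circ(5) MM_smult circ_closed[OF circ(6,7)] by simp
    qed
    then show ?thesis by blast
  qed
  have outer: "circ \<kappa> (circ \<pi> a b) y \<in> ?S" if "\<pi> \<in> L" "a \<in> MM \<pi> \<beta>" "b \<in> MM \<kappa> \<pi>" for \<pi> a b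
    using y
  proof (induction rule: Msum_induct)
    case zero then show ?case using circ_zero_r[OF circ_closed[OF that(2,3)]] by (simp add: Msum_zero)
  next
    case (gen \<pi>' c d)
    have "circ \<kappa> (circ \<pi> a b) (circ \<pi>' c d) = circ \<pi> a (circ \<pi>' (circ \<kappa> b c) d)"
      using circ_assoc[OF that(2,3) circ_closed[OF gen(2,3)]] circ_assoc[OF that(3) gen(2,3)] by simp
    then show ?case using mid[OF that(1) gen(1) that(2) gen(3) circ_closed[OF that(3) gen(2)]] by simp
  next
    case (add y z)
    then show ?case using circ_add_r[OF circ_closed[OF that(2,3)] Msum_MM[OF add(1)] Msum_MM[OF add(2)]] by (simp add: Msum_add)
  qed
  from x show ?thesis
  proof (induction rule: Msum_induct)
    case zero then show ?case using circ_zero_l[OF Msum_MM[OF y]] by (simp add: Msum_zero)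
  next
    case (gen \<pi> u v) then show ?case by (rule outer)
  next
    case (add a b)
    then show ?case using circ_add_l[OF Msum_MM[OF add(1)] Msum_MM[OF add(2)] Msum_MM[OF y]] by (simp add: Msum_add)
  qed
qed

lemma MM_M_ge: "\<nu> \<in> compositions n \<Longrightarrow> u \<in> MM \<nu> \<beta> \<Longrightarrow> u \<in> M_ge \<nu> \<nu> \<beta>"
  unfolding M_ge_Msum using Msum_gen[OF _ _ m_MM, of \<nu> _ u \<beta>] dom_le_refl by (simp add: circ_m_r)

text \<open>A generator through \<pi> \<noteq> \<nu> lies in \<open>M_gt\<close>, so only multiples
  of \<open>m \<nu>\<close> survive in the quotient. This is what identifies the endomorphism
  algebra at \<nu> with a quotient of the base ring.\<close>

lemma MM_diag:
  assumes \<nu>: "\<nu> \<in> compositions n" and f: "f \<in> MM \<nu> \<nu>"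
  shows "\<exists>c\<in>carrier K. f \<ominus>\<^bsub>H\<^esub> c \<odot>\<^bsub>H\<^esub> m \<nu> \<in> M_gt \<nu> \<nu> \<nu>"
  using \<nu> \<nu> f
proof (induction rule: MM_induct)
  case zero
  show ?case by (rule bexI[of _ \<zero>]) (simp_all add: M_gt_Msum Msum_zero a_minus_def)
next
  case (add a b)
  then obtain c d where cd: "c \<in> carrier K" "a \<ominus>\<^bsub>H\<^esub> c \<odot>\<^bsub>H\<^esub> m \<nu> \<in> M_gt \<nu> \<nu> \<nu>"
    "d \<in> carrier K" "b \<ominus>\<^bsub>H\<^esub> d \<odot>\<^bsub>H\<^esub> m \<nu> \<in> M_gt \<nu> \<nu> \<nu>" by blast
  have "(a \<ominus>\<^bsub>H\<^esub> c \<odot>\<^bsub>H\<^esub> m \<nu>) \<oplus>\<^bsub>H\<^esub> (b \<ominus>\<^bsub>H\<^esub> d \<odot>\<^bsub>H\<^esub> m \<nu>) = (a \<oplus>\<^bsub>H\<^esub> b) \<ominus>\<^bsub>H\<^esub> (c \<oplus> d) \<odot>\<^bsub>H\<^esub> m \<nu>"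
    using cd add(1,2)[THEN MM_closed] by (simp add: a_minus_def Hk.smult_l_distr Hk.M.minus_add Hk.M.a_ac)
  moreover have "(a \<ominus>\<^bsub>H\<^esub> c \<odot>\<^bsub>H\<^esub> m \<nu>) \<oplus>\<^bsub>H\<^esub> (b \<ominus>\<^bsub>H\<^esub> d \<odot>\<^bsub>H\<^esub> m \<nu>) \<in> M_gt \<nu> \<nu> \<nu>"
    using Msum_add cd(2,4) unfolding M_gt_Msum by blast
  ultimately show ?case using cd by (intro bexI[of _ "c \<oplus> d"]) simp_all
next
  case (m c)
  then show ?case by (intro bexI[of _ c]) (simp_all add: a_minus_def Hk.M.r_neg M_gt_Msum Msum_zero)
next
  case (circ \<pi> c u v)
  have "circ \<pi> u v \<in> M_gt \<nu> \<nu> \<nu>" unfolding M_gt_Msum by (rule Msum_gen) (use circ in auto)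
  then have "c \<odot>\<^bsub>H\<^esub> circ \<pi> u v \<in> M_gt \<nu> \<nu> \<nu>" unfolding M_gt_Msum by (rule Msum_smult[OF _ circ(5)])
  then show ?case
    using circ_carrier[OF circ(6,7)] circ(5) by (intro bexI[of _ \<zero>]) (simp_all add: a_minus_def)
qed

lemma B'_ideal: "ideal (B' \<nu>) K"
proof (rule idealI[OF ring_axioms])
  show "subgroup (B' \<nu>) (add_monoid K)"
  proof (rule add.subgroupI)
    show "B' \<nu> \<noteq> {}" using Msum_zero by (auto simp: B'_def M_gt_Msum intro!: exI[of _ \<zero>])
    fix a assume a: "a \<in> B' \<nu>"
    then show "\<ominus> a \<in> B' \<nu>" using Msum_neg by (auto simp: B'_def M_gt_Msum Hk.smult_l_minus)
    fix b assume b: "b \<in> B' \<nu>"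
    show "a \<oplus> b \<in> B' \<nu>" using a b Msum_add by (auto simp: B'_def M_gt_Msum Hk.smult_l_distr)
  qed (auto simp: B'_def)
next
  fix a x assume a: "a \<in> B' \<nu>" and x: "x \<in> carrier K"
  then have "x \<odot>\<^bsub>H\<^esub> (a \<odot>\<^bsub>H\<^esub> m \<nu>) \<in> M_gt \<nu> \<nu> \<nu>" using Msum_smult by (auto simp: B'_def M_gt_Msum)
  then show "x \<otimes> a \<in> B' \<nu>" using a x by (auto simp: B'_def Hk.smult_assoc1)
  then show "a \<otimes> x \<in> B' \<nu>" using a x by (auto simp: B'_def m_comm)
qed

section \<open>Cosets modulo \<open>M_gt\<close>\<close>

definition cs :: "(nat \<Rightarrow> nat) \<Rightarrow> (nat \<Rightarrow> nat) \<Rightarrow> (nat \<Rightarrow> nat) \<Rightarrow> 'k hecke \<Rightarrow> 'k hecke set" where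
  "cs \<nu> \<alpha> \<beta> x = M_gt \<nu> \<alpha> \<beta> +>\<^bsub>H\<^esub> x"

lemma cs_mem: "y \<in> cs \<nu> \<alpha> \<beta> x \<longleftrightarrow> (\<exists>g\<in>M_gt \<nu> \<alpha> \<beta>. y = g \<oplus>\<^bsub>H\<^esub> x)"
  by (auto simp: cs_def a_r_coset_def')

lemma cs_self: "x \<in> carrier H \<Longrightarrow> x \<in> cs \<nu> \<alpha> \<beta> x"
  unfolding cs_mem M_gt_Msum by (rule bexI[OF _ Msum_zero]) simp

lemma cs_mem_iff: "x \<in> carrier H \<Longrightarrow> y \<in> carrier H \<Longrightarrow> y \<in> cs \<nu> \<alpha> \<beta> x \<longleftrightarrow> y \<ominus>\<^bsub>H\<^esub> x \<in> M_gt \<nu> \<alpha> \<beta>"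
proof
  assume c: "x \<in> carrier H" "y \<in> carrier H"
  {
    assume "y \<in> cs \<nu> \<alpha> \<beta> x"
    then obtain g where g: "g \<in> M_gt \<nu> \<alpha> \<beta>" "y = g \<oplus>\<^bsub>H\<^esub> x" unfolding cs_mem by blast
    have "g \<in> carrier H" using g(1) Msum_carrier unfolding M_gt_Msum by blast
    then have "y \<ominus>\<^bsub>H\<^esub> x = g" using c by (simp add: g(2) a_minus_def Hk.M.a_assoc Hk.M.r_neg)
    then show "y \<ominus>\<^bsub>H\<^esub> x \<in> M_gt \<nu> \<alpha> \<beta>" using g by simp
  next
    assume "y \<ominus>\<^bsub>H\<^esub> x \<in> M_gt \<nu> \<alpha> \<beta>"
    moreover have "y = (y \<ominus>\<^bsub>H\<^esub> x) \<oplus>\<^bsub>H\<^esub> x" using c by (simp add: a_minus_def Hk.M.a_assoc Hk.M.l_neg)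
    ultimately show "y \<in> cs \<nu> \<alpha> \<beta> x" unfolding cs_mem by blast
  }
qed

lemma cs_eqI:
  assumes "x \<in> carrier H" "y \<in> carrier H" "x \<ominus>\<^bsub>H\<^esub> y \<in> M_gt \<nu> \<alpha> \<beta>"
  shows "cs \<nu> \<alpha> \<beta> x = cs \<nu> \<alpha> \<beta> y"
proof -
  have sub: "cs \<nu> \<alpha> \<beta> x \<subseteq> cs \<nu> \<alpha> \<beta> y" if c: "x \<in> carrier H" "y \<in> carrier H" and d: "x \<ominus>\<^bsub>H\<^esub> y \<in> M_gt \<nu> \<alpha> \<beta>" for x y
  proof
    fix z assume "z \<in> cs \<nu> \<alpha> \<beta> x"
    then obtain g where g: "g \<in> M_gt \<nu> \<alpha> \<beta>" "z = g \<oplus>\<^bsub>H\<^esub> x" unfolding cs_mem by blast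
    have "g \<in> carrier H" using g(1) Msum_carrier unfolding M_gt_Msum by blast
    then have "z = (g \<oplus>\<^bsub>H\<^esub> (x \<ominus>\<^bsub>H\<^esub> y)) \<oplus>\<^bsub>H\<^esub> y" using c by (simp add: g(2) a_minus_def Hk.M.a_assoc Hk.M.l_neg)
    moreover have "g \<oplus>\<^bsub>H\<^esub> (x \<ominus>\<^bsub>H\<^esub> y) \<in> M_gt \<nu> \<alpha> \<beta>" using g d Msum_add unfolding M_gt_Msum by blast
    ultimately show "z \<in> cs \<nu> \<alpha> \<beta> y" unfolding cs_mem by blast
  qed
  have "y \<ominus>\<^bsub>H\<^esub> x = \<ominus>\<^bsub>H\<^esub> (x \<ominus>\<^bsub>H\<^esub> y)" using assms by (simp add: a_minus_def Hk.M.minus_add Hk.M.a_comm)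
  then have "y \<ominus>\<^bsub>H\<^esub> x \<in> M_gt \<nu> \<alpha> \<beta>" using assms Msum_neg unfolding M_gt_Msum by simp
  then show ?thesis using sub assms by blast
qed

lemma cs_mem_eq: "x \<in> carrier H \<Longrightarrow> y \<in> cs \<nu> \<alpha> \<beta> x \<Longrightarrow> y \<in> carrier H \<and> cs \<nu> \<alpha> \<beta> y = cs \<nu> \<alpha> \<beta> x"
proof
  assume x: "x \<in> carrier H" and y: "y \<in> cs \<nu> \<alpha> \<beta> x"
  then obtain g where g: "g \<in> M_gt \<nu> \<alpha> \<beta>" "y = g \<oplus>\<^bsub>H\<^esub> x" unfolding cs_mem by blast
  then show yc: "y \<in> carrier H" using x Msum_carrier unfolding M_gt_Msum by simp
  show "cs \<nu> \<alpha> \<beta> y = cs \<nu> \<alpha> \<beta> x" by (rule cs_eqI[OF yc x]) (use cs_mem_iff[OF x yc] y in blast)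
qed

lemma cs_zero: "cs \<nu> \<alpha> \<beta> \<zero>\<^bsub>H\<^esub> = M_gt \<nu> \<alpha> \<beta>"
proof -
  have "g \<oplus>\<^bsub>H\<^esub> \<zero>\<^bsub>H\<^esub> = g" if "g \<in> M_gt \<nu> \<alpha> \<beta>" for g using that Msum_carrier unfolding M_gt_Msum by simp
  then show ?thesis
    by (intro equalityI subsetI) (use cs_mem[of _ \<nu> \<alpha> \<beta> "\<zero>\<^bsub>H\<^esub>"] in \<open>metis (no_types)\<close>)+
qed

lemma M_quot_simps:
  "carrier (M_quot \<nu> \<alpha> \<beta>) = cs \<nu> \<alpha> \<beta> ` MM \<alpha> \<beta>"
  "zero (M_quot \<nu> \<alpha> \<beta>) = cs \<nu> \<alpha> \<beta> \<zero>\<^bsub>H\<^esub>"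
  by (auto simp: M_quot_def cs_def[symmetric] cs_zero)

lemma M_quot_add:
  assumes "x \<in> carrier H" "y \<in> carrier H"
  shows "cs \<nu> \<alpha> \<beta> x \<oplus>\<^bsub>M_quot \<nu> \<alpha> \<beta>\<^esub> cs \<nu> \<alpha> \<beta> y = cs \<nu> \<alpha> \<beta> (x \<oplus>\<^bsub>H\<^esub> y)"
proof -
  have c: "g \<in> carrier H" if "g \<in> M_gt \<nu> \<alpha> \<beta>" for g using that Msum_carrier unfolding M_gt_Msum by blast
  have "cs \<nu> \<alpha> \<beta> x <+>\<^bsub>H\<^esub> cs \<nu> \<alpha> \<beta> y = cs \<nu> \<alpha> \<beta> (x \<oplus>\<^bsub>H\<^esub> y)"
  proof (intro equalityI subsetI)
    fix z assume "z \<in> cs \<nu> \<alpha> \<beta> x <+>\<^bsub>H\<^esub> cs \<nu> \<alpha> \<beta> y"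
    then obtain g h where gh: "g \<in> M_gt \<nu> \<alpha> \<beta>" "h \<in> M_gt \<nu> \<alpha> \<beta>" "z = (g \<oplus>\<^bsub>H\<^esub> x) \<oplus>\<^bsub>H\<^esub> (h \<oplus>\<^bsub>H\<^esub> y)"
      by (auto simp: set_add_def' cs_mem)
    then have "z = (g \<oplus>\<^bsub>H\<^esub> h) \<oplus>\<^bsub>H\<^esub> (x \<oplus>\<^bsub>H\<^esub> y)" using assms c by (simp add: Hk.M.a_ac)
    moreover have "g \<oplus>\<^bsub>H\<^esub> h \<in> M_gt \<nu> \<alpha> \<beta>" using gh Msum_add unfolding M_gt_Msum by blast
    ultimately show "z \<in> cs \<nu> \<alpha> \<beta> (x \<oplus>\<^bsub>H\<^esub> y)" unfolding cs_mem by blast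
  next
    fix z assume "z \<in> cs \<nu> \<alpha> \<beta> (x \<oplus>\<^bsub>H\<^esub> y)"
    then obtain g where g: "g \<in> M_gt \<nu> \<alpha> \<beta>" "z = g \<oplus>\<^bsub>H\<^esub> (x \<oplus>\<^bsub>H\<^esub> y)" unfolding cs_mem by blast
    have "z = (g \<oplus>\<^bsub>H\<^esub> x) \<oplus>\<^bsub>H\<^esub> y" using g c assms by (simp add: Hk.M.a_assoc)
    moreover have "g \<oplus>\<^bsub>H\<^esub> x \<in> cs \<nu> \<alpha> \<beta> x" using g(1) cs_mem by blast
    ultimately show "z \<in> cs \<nu> \<alpha> \<beta> x <+>\<^bsub>H\<^esub> cs \<nu> \<alpha> \<beta> y" using cs_self[OF assms(2)] unfolding set_add_def' by blast
  qed
  then show ?thesis by (simp add: M_quot_def)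
qed

lemma M_quot_smult:
  assumes c: "c \<in> carrier K" and x: "x \<in> carrier H"
  shows "c \<odot>\<^bsub>M_quot \<nu> \<alpha> \<beta>\<^esub> cs \<nu> \<alpha> \<beta> x = cs \<nu> \<alpha> \<beta> (c \<odot>\<^bsub>H\<^esub> x)"
proof -
  have "cs \<nu> \<alpha> \<beta> (c \<odot>\<^bsub>H\<^esub> y) = cs \<nu> \<alpha> \<beta> (c \<odot>\<^bsub>H\<^esub> x)" if y: "y \<in> cs \<nu> \<alpha> \<beta> x" for y
  proof (rule cs_eqI)
    have yc: "y \<in> carrier H" using cs_mem_eq[OF x y] by simp
    have "c \<odot>\<^bsub>H\<^esub> (y \<ominus>\<^bsub>H\<^esub> x) \<in> M_gt \<nu> \<alpha> \<beta>" using cs_mem_iff[OF x yc] y Msum_smult[OF _ c] unfolding M_gt_Msum by blast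
    then show "c \<odot>\<^bsub>H\<^esub> y \<ominus>\<^bsub>H\<^esub> c \<odot>\<^bsub>H\<^esub> x \<in> M_gt \<nu> \<alpha> \<beta>"
      using c x yc by (simp add: a_minus_def Hk.smult_r_distr Hk.smult_r_minus)
    show "c \<odot>\<^bsub>H\<^esub> y \<in> carrier H" "c \<odot>\<^bsub>H\<^esub> x \<in> carrier H" using c x yc by simp_all
  qed
  then have "(\<Union>y\<in>cs \<nu> \<alpha> \<beta> x. cs \<nu> \<alpha> \<beta> (c \<odot>\<^bsub>H\<^esub> y)) = cs \<nu> \<alpha> \<beta> (c \<odot>\<^bsub>H\<^esub> x)"
    using cs_self[OF x, of \<nu> \<alpha> \<beta>] by blast
  then show ?thesis by (simp add: M_quot_def cs_def)
qed

lemma abelian_group_M_quot: "abelian_group (M_quot \<nu> \<alpha> \<beta>)"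
proof (rule abelian_groupI)
  fix X assume "X \<in> carrier (M_quot \<nu> \<alpha> \<beta>)"
  then obtain x where x: "x \<in> MM \<alpha> \<beta>" "X = cs \<nu> \<alpha> \<beta> x" by (auto simp: M_quot_simps)
  show "\<exists>Y\<in>carrier (M_quot \<nu> \<alpha> \<beta>). Y \<oplus>\<^bsub>M_quot \<nu> \<alpha> \<beta>\<^esub> X = \<zero>\<^bsub>M_quot \<nu> \<alpha> \<beta>\<^esub>"
    using x MM_neg[OF x(1)] MM_closed[OF x(1)]
    by (intro bexI[of _ "cs \<nu> \<alpha> \<beta> (\<ominus>\<^bsub>H\<^esub> x)"]) (simp_all add: M_quot_simps M_quot_add Hk.M.l_neg)
qed (auto simp: M_quot_simps M_quot_add MM_closed MM_zero MM_add Hk.M.a_ac)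

lemma finsum_cs:
  assumes "finite S" "\<And>i. i \<in> S \<Longrightarrow> f i \<in> MM \<alpha> \<beta>"
  shows "(\<Oplus>\<^bsub>M_quot \<nu> \<alpha> \<beta>\<^esub>i\<in>S. cs \<nu> \<alpha> \<beta> (f i)) = cs \<nu> \<alpha> \<beta> (\<Oplus>\<^bsub>H\<^esub>i\<in>S. f i) \<and> (\<Oplus>\<^bsub>H\<^esub>i\<in>S. f i) \<in> MM \<alpha> \<beta>"
proof -
  interpret Mq: abelian_group "M_quot \<nu> \<alpha> \<beta>" by (rule abelian_group_M_quot)
  show ?thesis
    using assms
  proof (induction S rule: finite_induct)
    case empty then show ?case by (simp add: M_quot_simps MM_zero)
  next
    case (insert i S)
    have f: "f j \<in> MM \<alpha> \<beta>" if "j \<in> insert i S" for j using insert.prems that by blast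
    have IH: "(\<Oplus>\<^bsub>M_quot \<nu> \<alpha> \<beta>\<^esub>i\<in>S. cs \<nu> \<alpha> \<beta> (f i)) = cs \<nu> \<alpha> \<beta> (\<Oplus>\<^bsub>H\<^esub>i\<in>S. f i)" "(\<Oplus>\<^bsub>H\<^esub>i\<in>S. f i) \<in> MM \<alpha> \<beta>"
      using insert by auto
    have "(\<lambda>j. cs \<nu> \<alpha> \<beta> (f j)) \<in> S \<rightarrow> carrier (M_quot \<nu> \<alpha> \<beta>)" "cs \<nu> \<alpha> \<beta> (f i) \<in> carrier (M_quot \<nu> \<alpha> \<beta>)"
      "f \<in> S \<rightarrow> carrier H" "f i \<in> carrier H"
      using f MM_closed by (auto simp: M_quot_simps)
    then show ?case
      using insert.hyps IH f[of i] MM_closed[OF IH(2)] by (simp add: M_quot_add MM_add)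
  qed
qed

text \<open>\<open>M_gt\<close> absorbs \<open>circ\<close> from either side, so all cosets in the
  union defining \<open>qcirc\<close> coincide and the union is a single coset.\<close>

lemma qcirc_cs:
  assumes x: "x \<in> MM \<kappa> \<beta>" and y: "y \<in> MM \<alpha> \<kappa>"
  shows "qcirc \<nu> \<alpha> \<kappa> \<beta> (cs \<nu> \<kappa> \<beta> x) (cs \<nu> \<alpha> \<kappa> y) = cs \<nu> \<alpha> \<beta> (circ \<kappa> x y)"
proof -
  have "cs \<nu> \<alpha> \<beta> (circ \<kappa> x' y') = cs \<nu> \<alpha> \<beta> (circ \<kappa> x y)" if x': "x' \<in> cs \<nu> \<kappa> \<beta> x" and y': "y' \<in> cs \<nu> \<alpha> \<kappa> y" for x' y'
  proof -
    obtain g where g: "g \<in> M_gt \<nu> \<kappa> \<beta>" "x' = g \<oplus>\<^bsub>H\<^esub> x" using x' unfolding cs_mem by blast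
    obtain h where h: "h \<in> M_gt \<nu> \<alpha> \<kappa>" "y' = h \<oplus>\<^bsub>H\<^esub> y" using y' unfolding cs_mem by blast
    note gM = Msum_MM[OF g(1)[unfolded M_gt_Msum]] and hM = Msum_MM[OF h(1)[unfolded M_gt_Msum]]
    have xM: "x' \<in> MM \<kappa> \<beta>" unfolding g(2) by (rule MM_add[OF gM x])
    have "circ \<kappa> x' y' = (circ \<kappa> x' h \<oplus>\<^bsub>H\<^esub> circ \<kappa> g y) \<oplus>\<^bsub>H\<^esub> circ \<kappa> x y"
      unfolding h(2) circ_add_r[OF xM hM y] using circ_add_l[OF gM x y]
        circ_carrier[OF xM hM] circ_carrier[OF gM y] circ_carrier[OF x y] by (simp add: g(2) Hk.M.a_assoc)
    moreover have "circ \<kappa> x' h \<oplus>\<^bsub>H\<^esub> circ \<kappa> g y \<in> M_gt \<nu> \<alpha> \<beta>"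
      using circ_Msum_r[OF h(1)[unfolded M_gt_Msum] xM] circ_Msum_l[OF g(1)[unfolded M_gt_Msum] y] Msum_add
      unfolding M_gt_Msum by blast
    ultimately have "circ \<kappa> x' y' \<in> cs \<nu> \<alpha> \<beta> (circ \<kappa> x y)" unfolding cs_mem by blast
    then show ?thesis using cs_mem_eq[OF circ_carrier[OF x y]] by blast
  qed
  then show ?thesis
    unfolding qcirc_def cs_def[symmetric]
    using cs_self[OF MM_closed[OF x], of \<nu> \<kappa> \<beta>] cs_self[OF MM_closed[OF y], of \<nu> \<alpha> \<kappa>] by blast
qed

lemma star_cs: assumes x: "x \<in> carrier H" shows "star ` cs \<nu> \<alpha> \<beta> x = cs \<nu> \<beta> \<alpha> (star x)"
proof -
  have sub: "star y \<in> cs \<nu> \<beta> \<alpha> (star x)" if yx: "y \<in> cs \<nu> \<alpha> \<beta> x" "x \<in> carrier H" for x y \<alpha> \<beta>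
  proof -
    obtain g where g: "g \<in> M_gt \<nu> \<alpha> \<beta>" "y = g \<oplus>\<^bsub>H\<^esub> x" using yx(1) unfolding cs_mem by blast
    have "g \<in> carrier H" "star g \<in> M_gt \<nu> \<beta> \<alpha>" using g(1) Msum_carrier star_Msum unfolding M_gt_Msum by blast+
    then show ?thesis using yx(2) unfolding cs_mem by (intro bexI[of _ "star g"]) (simp_all add: g(2))
  qed
  show ?thesis
  proof (intro equalityI subsetI)
    fix z assume z: "z \<in> cs \<nu> \<beta> \<alpha> (star x)"
    have "star z \<in> cs \<nu> \<alpha> \<beta> x" using sub[OF z star_closed[OF x]] x by simp
    moreover have "z \<in> carrier H" using cs_mem_eq[OF star_closed[OF x] z] by simp
    ultimately show "z \<in> star ` cs \<nu> \<alpha> \<beta> x" by (metis image_eqI star_star)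
  qed (use sub x in blast)
qed

lemma base_quotient: "algebra_quotient K (self_algebra K) (B' \<nu>)"
proof -
  interpret S: assoc_algebra K "self_algebra K" by (rule assoc_algebra_self[OF is_cring])
  interpret I: ideal "B' \<nu>" K by (rule B'_ideal)
  have s: "carrier (self_algebra K) = carrier K" "add (self_algebra K) = add K" "mult (self_algebra K) = mult K"
    "zero (self_algebra K) = zero K"
    by (simp_all add: self_algebra_def ring.defs module.defs)
  have "ideal (B' \<nu>) (self_algebra K)"
  proof (rule idealI[OF S.A.ring_axioms])
    show "subgroup (B' \<nu>) (add_monoid (self_algebra K))"
    proof (rule S.M.add.subgroupI)
      show "B' \<nu> \<noteq> {}" using additive_subgroup.zero_closed[OF I.additive_subgroup_axioms] by blast
      fix a assume a: "a \<in> B' \<nu>"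
      have "\<ominus> a \<in> B' \<nu>" "\<ominus> a \<oplus> a = \<zero>" "a \<in> carrier K"
        using a I.a_inv_closed I.a_Hcarr[OF a] by (auto simp: l_neg)
      moreover from this have "\<ominus>\<^bsub>self_algebra K\<^esub> a = \<ominus> a"
        by (intro S.M.minus_equality) (simp_all add: s)
      ultimately show "\<ominus>\<^bsub>self_algebra K\<^esub> a \<in> B' \<nu>" by simp
    qed (use I.a_closed I.a_Hcarr in \<open>auto simp: s\<close>)
  qed (auto simp: s I.I_l_closed I.I_r_closed)
  then show ?thesis by (intro algebra_quotient.intro S.assoc_algebra_axioms)
qed

definition kcs :: "(nat \<Rightarrow> nat) \<Rightarrow> 'k \<Rightarrow> 'k set" where
  "kcs \<nu> c = B' \<nu> +>\<^bsub>self_algebra K\<^esub> c"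

lemma of_base_kcs:
  assumes c: "c \<in> carrier K"
  shows "of_base \<nu> (kcs \<nu> c) = cs \<nu> \<nu> \<nu> (c \<odot>\<^bsub>H\<^esub> m \<nu>)"
proof -
  have k: "d \<in> kcs \<nu> c \<longleftrightarrow> (\<exists>b\<in>B' \<nu>. d = b \<oplus> c)" for d
    by (auto simp: kcs_def a_r_coset_def' self_algebra_def ring.defs module.defs)
  have "cs \<nu> \<nu> \<nu> (d \<odot>\<^bsub>H\<^esub> m \<nu>) = cs \<nu> \<nu> \<nu> (c \<odot>\<^bsub>H\<^esub> m \<nu>)" if d: "d \<in> kcs \<nu> c" for d
  proof -
    obtain b where b: "b \<in> B' \<nu>" "d = b \<oplus> c" using d k by blast
    then have bK: "b \<in> carrier K" "b \<odot>\<^bsub>H\<^esub> m \<nu> \<in> M_gt \<nu> \<nu> \<nu>" by (auto simp: B'_def)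
    show ?thesis
      by (rule cs_eqI) (use bK c in \<open>simp_all add: b(2) Hk.smult_l_distr a_minus_def Hk.M.a_assoc Hk.M.r_neg\<close>)
  qed
  moreover have "c \<in> kcs \<nu> c"
    unfolding k by (rule bexI[of _ \<zero>]) (use c Msum_zero in \<open>simp_all add: B'_def M_gt_Msum\<close>)
  ultimately show ?thesis unfolding of_base_def cs_def[symmetric] by blast
qed

text \<open>The scalars representing the class of \<open>f\<close> form one coset of
  \<open>B' \<nu>\<close>, so any \<open>c\<close> obtained from \<open>MM_diag\<close> determines
  the preimage.\<close>

lemma to_base_cs:
  assumes c: "c \<in> carrier K" and f: "f \<in> carrier H" "f \<ominus>\<^bsub>H\<^esub> c \<odot>\<^bsub>H\<^esub> m \<nu> \<in> M_gt \<nu> \<nu> \<nu>"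
  shows "to_base \<nu> (cs \<nu> \<nu> \<nu> f) = kcs \<nu> c"
proof -
  have k: "d \<in> kcs \<nu> c \<longleftrightarrow> (\<exists>b\<in>B' \<nu>. d = b \<oplus> c)" for d
    by (auto simp: kcs_def a_r_coset_def' self_algebra_def ring.defs module.defs)
  have e: "cs \<nu> \<nu> \<nu> f = cs \<nu> \<nu> \<nu> (c \<odot>\<^bsub>H\<^esub> m \<nu>)" by (rule cs_eqI) (use f c in auto)
  have "d \<odot>\<^bsub>H\<^esub> m \<nu> \<in> cs \<nu> \<nu> \<nu> f \<longleftrightarrow> d \<ominus> c \<in> B' \<nu>" if d: "d \<in> carrier K" for d
    unfolding e using cs_mem_iff[of "c \<odot>\<^bsub>H\<^esub> m \<nu>" "d \<odot>\<^bsub>H\<^esub> m \<nu>" \<nu> \<nu> \<nu>] c d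
    by (simp add: B'_def a_minus_def Hk.smult_l_distr Hk.smult_l_minus)
  moreover have "d \<in> kcs \<nu> c \<longleftrightarrow> d \<in> carrier K \<and> d \<ominus> c \<in> B' \<nu>" for d
  proof
    assume "d \<in> kcs \<nu> c"
    then obtain b where b: "b \<in> B' \<nu>" "d = b \<oplus> c" using k by blast
    then have "b \<in> carrier K" by (simp add: B'_def)
    moreover then have "d \<ominus> c = b" using c by (simp add: b(2) a_minus_def a_assoc r_neg)
    ultimately show "d \<in> carrier K \<and> d \<ominus> c \<in> B' \<nu>" using b c by simp
  next
    assume d: "d \<in> carrier K \<and> d \<ominus> c \<in> B' \<nu>"
    then have "d = (d \<ominus> c) \<oplus> c" using c by (simp add: a_minus_def a_assoc l_neg)
    then show "d \<in> kcs \<nu> c" unfolding k using d by blast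
  qed
  ultimately show ?thesis unfolding to_base_def by blast
qed

end

section \<open>Matrix algebras over the spaces \<open>MM\<close>\<close>

context hecke_setting
begin

lemma MM_finsum: "finite S \<Longrightarrow> (\<And>i. i \<in> S \<Longrightarrow> f i \<in> MM \<alpha> \<beta>) \<Longrightarrow> (\<Oplus>\<^bsub>H\<^esub>i\<in>S. f i) \<in> MM \<alpha> \<beta>"
  using finsum_cs by blast

lemma Msum_finsum: "finite S \<Longrightarrow> (\<And>i. i \<in> S \<Longrightarrow> f i \<in> Msum L \<alpha> \<beta>) \<Longrightarrow> (\<Oplus>\<^bsub>H\<^esub>i\<in>S. f i) \<in> Msum L \<alpha> \<beta>"
proof (induction S rule: finite_induct)
  case (insert i S)
  have "f \<in> S \<rightarrow> carrier H" "f i \<in> carrier H" using insert.prems Msum_carrier[of _ L \<alpha> \<beta>] by auto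
  then show ?case using insert by (simp add: Msum_add)
qed (simp add: Msum_zero)

lemma H_sum_cong: "(\<And>i. i \<in> S \<Longrightarrow> f i = g i) \<Longrightarrow> (\<And>i. i \<in> S \<Longrightarrow> g i \<in> carrier H) \<Longrightarrow> (\<Oplus>\<^bsub>H\<^esub>i\<in>S. f i) = (\<Oplus>\<^bsub>H\<^esub>i\<in>S. g i)"
  by (rule Hk.M.finsum_cong') auto

lemma circ_finsum_l:
  assumes "finite S" "\<And>i. i \<in> S \<Longrightarrow> f i \<in> MM \<kappa> \<beta>" "z \<in> MM \<alpha> \<kappa>"
  shows "circ \<kappa> (\<Oplus>\<^bsub>H\<^esub>i\<in>S. f i) z = (\<Oplus>\<^bsub>H\<^esub>i\<in>S. circ \<kappa> (f i) z)"
  using assms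
proof (induction S rule: finite_induct)
  case (insert i S)
  have f: "f j \<in> MM \<kappa> \<beta>" if "j \<in> insert i S" for j using insert.prems that by blast
  have "f \<in> S \<rightarrow> carrier H" "f i \<in> carrier H" "(\<lambda>i. circ \<kappa> (f i) z) \<in> S \<rightarrow> carrier H" "circ \<kappa> (f i) z \<in> carrier H"
    using f MM_closed circ_carrier[OF f insert.prems(2)] by auto
  then show ?case
    using insert f circ_add_l[OF f[of i] MM_finsum[OF insert.hyps(1), of f] insert.prems(2)] by simp
qed (simp add: circ_zero_l)

lemma circ_finsum_r:
  assumes "finite S" "\<And>i. i \<in> S \<Longrightarrow> f i \<in> MM \<alpha> \<kappa>" "z \<in> MM \<kappa> \<beta>"
  shows "circ \<kappa> z (\<Oplus>\<^bsub>H\<^esub>i\<in>S. f i) = (\<Oplus>\<^bsub>H\<^esub>i\<in>S. circ \<kappa> z (f i))"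
  using assms
proof (induction S rule: finite_induct)
  case (insert i S)
  have f: "f j \<in> MM \<alpha> \<kappa>" if "j \<in> insert i S" for j using insert.prems that by blast
  have "f \<in> S \<rightarrow> carrier H" "f i \<in> carrier H" "(\<lambda>i. circ \<kappa> z (f i)) \<in> S \<rightarrow> carrier H" "circ \<kappa> z (f i) \<in> carrier H"
    using f MM_closed circ_carrier[OF insert.prems(2) f] by auto
  then show ?case
    using insert f circ_add_r[OF insert.prems(2) f[of i] MM_finsum[OF insert.hyps(1), of f]] by simp
qed (simp add: circ_zero_r)

lemma H_finsum_swap:
  assumes "finite S" "finite S'" "\<And>i j. i \<in> S \<Longrightarrow> j \<in> S' \<Longrightarrow> f i j \<in> carrier H"
  shows "(\<Oplus>\<^bsub>H\<^esub>i\<in>S. \<Oplus>\<^bsub>H\<^esub>j\<in>S'. f i j) = (\<Oplus>\<^bsub>H\<^esub>j\<in>S'. \<Oplus>\<^bsub>H\<^esub>i\<in>S. f i j)"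
  using assms(1,3)
proof (induction S rule: finite_induct)
  case (insert i S)
  have c: "f k j \<in> carrier H" if "k \<in> insert i S" "j \<in> S'" for k j using insert.prems that by blast
  have s: "(\<Oplus>\<^bsub>H\<^esub>j\<in>S'. f k j) \<in> carrier H" if "k \<in> insert i S" for k
    by (rule Hk.M.finsum_closed) (use c that in auto)
  have s': "(\<Oplus>\<^bsub>H\<^esub>i\<in>S. f i j) \<in> carrier H" if "j \<in> S'" for j
    by (rule Hk.M.finsum_closed) (use c that in auto)
  have IH: "(\<Oplus>\<^bsub>H\<^esub>i\<in>S. \<Oplus>\<^bsub>H\<^esub>j\<in>S'. f i j) = (\<Oplus>\<^bsub>H\<^esub>j\<in>S'. \<Oplus>\<^bsub>H\<^esub>i\<in>S. f i j)" by (rule insert.IH) (use c in blast)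
  have "(\<Oplus>\<^bsub>H\<^esub>k\<in>insert i S. \<Oplus>\<^bsub>H\<^esub>j\<in>S'. f k j) = (\<Oplus>\<^bsub>H\<^esub>j\<in>S'. f i j) \<oplus>\<^bsub>H\<^esub> (\<Oplus>\<^bsub>H\<^esub>j\<in>S'. \<Oplus>\<^bsub>H\<^esub>i\<in>S. f i j)"
    unfolding IH[symmetric] by (rule Hk.M.finsum_insert) (use insert.hyps s in auto)
  also have "\<dots> = (\<Oplus>\<^bsub>H\<^esub>j\<in>S'. f i j \<oplus>\<^bsub>H\<^esub> (\<Oplus>\<^bsub>H\<^esub>i\<in>S. f i j))"
    by (rule Hk.M.finsum_addf[symmetric]) (use c s' in auto)
  also have "\<dots> = (\<Oplus>\<^bsub>H\<^esub>j\<in>S'. \<Oplus>\<^bsub>H\<^esub>i\<in>insert i S. f i j)"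
    by (rule Hk.M.finsum_cong') (use insert.hyps c s' in \<open>auto intro!: Hk.M.finsum_insert[symmetric]\<close>)
  finally show ?case .
qed simp

lemma star_finsum: "finite S \<Longrightarrow> f \<in> S \<rightarrow> carrier H \<Longrightarrow> star (\<Oplus>\<^bsub>H\<^esub>i\<in>S. f i) = (\<Oplus>\<^bsub>H\<^esub>i\<in>S. star (f i))"
  by (induction S rule: finite_induct) (auto simp: Pi_iff)

end

text \<open>Common setting for the Hecke algebra, where \<open>I = {ones n}\<close>, and the q-Schur algebra. Elements of
  \<open>A\<close> correspond to families over \<open>I \<times> I\<close> through \<open>comp\<close> and \<open>mkA\<close>, elements of the two modules to
  families over \<open>I\<close> through \<open>cM\<close> and \<open>mkM\<close>.\<close>

locale filtered_setting = hecke_setting K q n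
  for K :: "('k, 'x) ring_scheme" (structure) and q :: 'k and n :: nat +
  fixes I :: "(nat \<Rightarrow> nat) set" and A :: "('k, 'a) module"
    and comp :: "'a \<Rightarrow> (nat \<Rightarrow> nat) \<Rightarrow> (nat \<Rightarrow> nat) \<Rightarrow> 'k hecke"
    and mkA :: "((nat \<Rightarrow> nat) \<Rightarrow> (nat \<Rightarrow> nat) \<Rightarrow> 'k hecke) \<Rightarrow> 'a"
    and cM :: "'m \<Rightarrow> (nat \<Rightarrow> nat) \<Rightarrow> 'k hecke set" and mkM :: "((nat \<Rightarrow> nat) \<Rightarrow> 'k hecke set) \<Rightarrow> 'm"
    and AF :: "(nat \<Rightarrow> nat) \<Rightarrow> 'a set"
    and M :: "(nat \<Rightarrow> nat) \<Rightarrow> ('k, 'a set, 'k set, 'm) bimodule"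
    and N :: "(nat \<Rightarrow> nat) \<Rightarrow> ('k, 'k set, 'a set, 'm) bimodule"
    and \<eta> :: "(nat \<Rightarrow> nat) \<Rightarrow> 'm \<Rightarrow> 'm \<Rightarrow> 'a set" and \<rho> :: "(nat \<Rightarrow> nat) \<Rightarrow> 'm \<Rightarrow> 'm \<Rightarrow> 'k set"
    and st :: "'a \<Rightarrow> 'a"
  assumes finite_I: "finite I" and I_comp: "I \<subseteq> compositions n"
    and comp_mkA: "\<And>f \<alpha> \<beta>. \<alpha> \<in> I \<Longrightarrow> \<beta> \<in> I \<Longrightarrow> comp (mkA f) \<alpha> \<beta> = f \<alpha> \<beta>"
    and mkA_cong: "\<And>f g. (\<And>\<alpha> \<beta>. \<alpha> \<in> I \<Longrightarrow> \<beta> \<in> I \<Longrightarrow> f \<alpha> \<beta> = g \<alpha> \<beta>) \<Longrightarrow> mkA f = mkA g"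
    and A_carrier: "carrier A = {x. mkA (comp x) = x \<and> (\<forall>\<alpha>\<in>I. \<forall>\<beta>\<in>I. comp x \<alpha> \<beta> \<in> MM \<alpha> \<beta>)}"
    and A_zero: "\<zero>\<^bsub>A\<^esub> = mkA (\<lambda>\<alpha> \<beta>. \<zero>\<^bsub>H\<^esub>)"
    and A_one: "\<one>\<^bsub>A\<^esub> = mkA (\<lambda>\<alpha> \<beta>. if \<alpha> = \<beta> then m \<alpha> else \<zero>\<^bsub>H\<^esub>)"
    and A_add: "\<And>x y. x \<in> carrier A \<Longrightarrow> y \<in> carrier A \<Longrightarrow> x \<oplus>\<^bsub>A\<^esub> y = mkA (\<lambda>\<alpha> \<beta>. comp x \<alpha> \<beta> \<oplus>\<^bsub>H\<^esub> comp y \<alpha> \<beta>)"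
    and A_smult: "\<And>c x. c \<in> carrier K \<Longrightarrow> x \<in> carrier A \<Longrightarrow> c \<odot>\<^bsub>A\<^esub> x = mkA (\<lambda>\<alpha> \<beta>. c \<odot>\<^bsub>H\<^esub> comp x \<alpha> \<beta>)"
    and A_mult: "\<And>x y. x \<in> carrier A \<Longrightarrow> y \<in> carrier A \<Longrightarrow>
      x \<otimes>\<^bsub>A\<^esub> y = mkA (\<lambda>\<alpha> \<beta>. \<Oplus>\<^bsub>H\<^esub>\<kappa>\<in>I. circ \<kappa> (comp x \<kappa> \<beta>) (comp y \<alpha> \<kappa>))"
    and AF_def: "\<And>\<nu>. AF \<nu> = {x. mkA (comp x) = x \<and> (\<forall>\<alpha>\<in>I. \<forall>\<beta>\<in>I. comp x \<alpha> \<beta> \<in> M_ge \<nu> \<alpha> \<beta>)}"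
    and st_def: "\<And>x. x \<in> carrier A \<Longrightarrow> st x = mkA (\<lambda>\<alpha> \<beta>. star (comp x \<beta> \<alpha>))"
    and cM_mkM: "\<And>f \<alpha>. \<alpha> \<in> I \<Longrightarrow> cM (mkM f) \<alpha> = f \<alpha>"
    and mkM_cong: "\<And>f g. (\<And>\<alpha>. \<alpha> \<in> I \<Longrightarrow> f \<alpha> = g \<alpha>) \<Longrightarrow> mkM f = mkM g"
    and M_carrier: "\<And>\<nu>. carrier (M \<nu>) = {Y. mkM (cM Y) = Y \<and> (\<forall>\<alpha>\<in>I. cM Y \<alpha> \<in> carrier (M_quot \<nu> \<nu> \<alpha>))}"
    and N_carrier: "\<And>\<nu>. carrier (N \<nu>) = {Z. mkM (cM Z) = Z \<and> (\<forall>\<alpha>\<in>I. cM Z \<alpha> \<in> carrier (M_quot \<nu> \<alpha> \<nu>))}"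
    and M_zero: "\<And>\<nu>. \<zero>\<^bsub>M \<nu>\<^esub> = mkM (\<lambda>\<alpha>. \<zero>\<^bsub>M_quot \<nu> \<nu> \<alpha>\<^esub>)"
    and N_zero: "\<And>\<nu>. \<zero>\<^bsub>N \<nu>\<^esub> = mkM (\<lambda>\<alpha>. \<zero>\<^bsub>M_quot \<nu> \<alpha> \<nu>\<^esub>)"
    and M_add: "\<And>\<nu> Y Y'. Y \<oplus>\<^bsub>M \<nu>\<^esub> Y' = mkM (\<lambda>\<alpha>. cM Y \<alpha> \<oplus>\<^bsub>M_quot \<nu> \<nu> \<alpha>\<^esub> cM Y' \<alpha>)"
    and N_add: "\<And>\<nu> Y Y'. Y \<oplus>\<^bsub>N \<nu>\<^esub> Y' = mkM (\<lambda>\<alpha>. cM Y \<alpha> \<oplus>\<^bsub>M_quot \<nu> \<alpha> \<nu>\<^esub> cM Y' \<alpha>)"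
    and M_smult: "\<And>\<nu> c Y. c \<odot>\<^bsub>M \<nu>\<^esub> Y = mkM (\<lambda>\<alpha>. c \<odot>\<^bsub>M_quot \<nu> \<nu> \<alpha>\<^esub> cM Y \<alpha>)"
    and N_smult: "\<And>\<nu> c Y. c \<odot>\<^bsub>N \<nu>\<^esub> Y = mkM (\<lambda>\<alpha>. c \<odot>\<^bsub>M_quot \<nu> \<alpha> \<nu>\<^esub> cM Y \<alpha>)"
    and M_lact: "\<And>\<nu> W Y. (\<And>\<alpha> \<beta>. \<alpha> \<in> I \<Longrightarrow> \<beta> \<in> I \<Longrightarrow> (\<lambda>x. comp x \<alpha> \<beta>) ` W \<in> carrier (M_quot \<nu> \<alpha> \<beta>)) \<Longrightarrow> Y \<in> carrier (M \<nu>) \<Longrightarrow>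
      lact (M \<nu>) W Y = mkM (\<lambda>\<beta>. \<Oplus>\<^bsub>M_quot \<nu> \<nu> \<beta>\<^esub>\<alpha>\<in>I. qcirc \<nu> \<nu> \<alpha> \<beta> ((\<lambda>x. comp x \<alpha> \<beta>) ` W) (cM Y \<alpha>))"
    and M_ract: "\<And>\<nu> Y C. ract (M \<nu>) Y C = mkM (\<lambda>\<alpha>. qcirc \<nu> \<nu> \<nu> \<alpha> (cM Y \<alpha>) (of_base \<nu> C))"
    and N_lact: "\<And>\<nu> C Z. lact (N \<nu>) C Z = mkM (\<lambda>\<alpha>. qcirc \<nu> \<alpha> \<nu> \<nu> (of_base \<nu> C) (cM Z \<alpha>))"
    and N_ract: "\<And>\<nu> Z W. (\<And>\<alpha> \<beta>. \<alpha> \<in> I \<Longrightarrow> \<beta> \<in> I \<Longrightarrow> (\<lambda>x. comp x \<alpha> \<beta>) ` W \<in> carrier (M_quot \<nu> \<alpha> \<beta>)) \<Longrightarrow> Z \<in> carrier (N \<nu>) \<Longrightarrow>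
      ract (N \<nu>) Z W = mkM (\<lambda>\<alpha>. \<Oplus>\<^bsub>M_quot \<nu> \<alpha> \<nu>\<^esub>\<beta>\<in>I. qcirc \<nu> \<alpha> \<beta> \<nu> (cM Z \<beta>) ((\<lambda>x. comp x \<alpha> \<beta>) ` W))"
    and \<eta>_def: "\<And>\<nu> Y Z. \<eta> \<nu> Y Z = {x. mkA (comp x) = x \<and> (\<forall>\<alpha>\<in>I. \<forall>\<beta>\<in>I. comp x \<alpha> \<beta> \<in> qcirc \<nu> \<alpha> \<nu> \<beta> (cM Y \<beta>) (cM Z \<alpha>))}"
    and \<rho>_def: "\<And>\<nu> Y Z. Y \<in> carrier (M \<nu>) \<Longrightarrow> Z \<in> carrier (N \<nu>) \<Longrightarrow>
      \<rho> \<nu> Z Y = to_base \<nu> (\<Oplus>\<^bsub>M_quot \<nu> \<nu> \<nu>\<^esub>\<alpha>\<in>I. qcirc \<nu> \<nu> \<alpha> \<nu> (cM Z \<alpha>) (cM Y \<alpha>))"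
begin

text \<open>Row times column, with entries multiplied by \<open>circ\<close>. The matrix product,
  both actions of \<open>A\<close> and the pairing \<open>\<rho>\<close> are all expressed by it on
  representatives.\<close>

definition dot :: "((nat \<Rightarrow> nat) \<Rightarrow> 'k hecke) \<Rightarrow> ((nat \<Rightarrow> nat) \<Rightarrow> 'k hecke) \<Rightarrow> 'k hecke" where
  "dot f g = (\<Oplus>\<^bsub>H\<^esub>\<kappa>\<in>I. circ \<kappa> (f \<kappa>) (g \<kappa>))"

abbreviation col :: "(nat \<Rightarrow> nat) \<Rightarrow> ((nat \<Rightarrow> nat) \<Rightarrow> 'k hecke) set" where
  "col \<alpha> \<equiv> {g. \<forall>\<kappa>\<in>I. g \<kappa> \<in> MM \<alpha> \<kappa>}"

abbreviation row :: "(nat \<Rightarrow> nat) \<Rightarrow> ((nat \<Rightarrow> nat) \<Rightarrow> 'k hecke) set" where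
  "row \<beta> \<equiv> {f. \<forall>\<kappa>\<in>I. f \<kappa> \<in> MM \<kappa> \<beta>}"

lemma dot_cong: "(\<And>\<kappa>. \<kappa> \<in> I \<Longrightarrow> f \<kappa> = f' \<kappa>) \<Longrightarrow> (\<And>\<kappa>. \<kappa> \<in> I \<Longrightarrow> g \<kappa> = g' \<kappa>) \<Longrightarrow> f' \<in> row \<beta> \<Longrightarrow> g' \<in> col \<alpha> \<Longrightarrow> dot f g = dot f' g'"
  unfolding dot_def by (rule Hk.M.finsum_cong') (auto intro: circ_carrier)

lemma dot_closed: "f \<in> row \<beta> \<Longrightarrow> g \<in> col \<alpha> \<Longrightarrow> dot f g \<in> MM \<alpha> \<beta>"
  unfolding dot_def by (rule MM_finsum[OF finite_I]) (auto intro: circ_closed)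

lemma dot_carrier: "f \<in> row \<beta> \<Longrightarrow> g \<in> col \<alpha> \<Longrightarrow> dot f g \<in> carrier H"
  by (rule MM_closed[OF dot_closed])

lemma dot_add_l:
  assumes "f \<in> row \<beta>" "f' \<in> row \<beta>" "g \<in> col \<alpha>"
  shows "dot (\<lambda>\<kappa>. f \<kappa> \<oplus>\<^bsub>H\<^esub> f' \<kappa>) g = dot f g \<oplus>\<^bsub>H\<^esub> dot f' g"
proof -
  have "dot (\<lambda>\<kappa>. f \<kappa> \<oplus>\<^bsub>H\<^esub> f' \<kappa>) g = (\<Oplus>\<^bsub>H\<^esub>\<kappa>\<in>I. circ \<kappa> (f \<kappa>) (g \<kappa>) \<oplus>\<^bsub>H\<^esub> circ \<kappa> (f' \<kappa>) (g \<kappa>))"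
    unfolding dot_def by (rule H_sum_cong, rule circ_add_l[where \<alpha> = \<alpha> and \<beta> = \<beta>]) (use assms in \<open>auto intro!: Hk.M.a_closed circ_carrier\<close>)
  then show ?thesis
    unfolding dot_def by (simp, intro Hk.M.finsum_addf) (use assms in \<open>auto intro: circ_carrier\<close>)
qed

lemma dot_add_r:
  assumes "f \<in> row \<beta>" "g \<in> col \<alpha>" "g' \<in> col \<alpha>"
  shows "dot f (\<lambda>\<kappa>. g \<kappa> \<oplus>\<^bsub>H\<^esub> g' \<kappa>) = dot f g \<oplus>\<^bsub>H\<^esub> dot f g'"
proof -
  have "dot f (\<lambda>\<kappa>. g \<kappa> \<oplus>\<^bsub>H\<^esub> g' \<kappa>) = (\<Oplus>\<^bsub>H\<^esub>\<kappa>\<in>I. circ \<kappa> (f \<kappa>) (g \<kappa>) \<oplus>\<^bsub>H\<^esub> circ \<kappa> (f \<kappa>) (g' \<kappa>))"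
    unfolding dot_def by (rule H_sum_cong, rule circ_add_r[where \<alpha> = \<alpha> and \<beta> = \<beta>]) (use assms in \<open>auto intro!: Hk.M.a_closed circ_carrier\<close>)
  then show ?thesis
    unfolding dot_def by (simp, intro Hk.M.finsum_addf) (use assms in \<open>auto intro: circ_carrier\<close>)
qed

lemma dot_smult_l:
  assumes "c \<in> carrier K" "f \<in> row \<beta>" "g \<in> col \<alpha>"
  shows "dot (\<lambda>\<kappa>. c \<odot>\<^bsub>H\<^esub> f \<kappa>) g = c \<odot>\<^bsub>H\<^esub> dot f g"
proof -
  have "c \<odot>\<^bsub>H\<^esub> dot f g = (\<Oplus>\<^bsub>H\<^esub>\<kappa>\<in>I. c \<odot>\<^bsub>H\<^esub> circ \<kappa> (f \<kappa>) (g \<kappa>))"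
    unfolding dot_def by (rule H_finsum_smult[OF finite_I assms(1)]) (use assms in \<open>auto intro: circ_carrier\<close>)
  also have "\<dots> = dot (\<lambda>\<kappa>. c \<odot>\<^bsub>H\<^esub> f \<kappa>) g"
    unfolding dot_def
    by (rule H_sum_cong, rule circ_smult_l[symmetric, where \<alpha> = \<alpha> and \<beta> = \<beta>])
      (use assms in \<open>auto intro!: circ_carrier MM_smult\<close>)
  finally show ?thesis ..
qed

lemma dot_smult_r:
  assumes "c \<in> carrier K" "f \<in> row \<beta>" "g \<in> col \<alpha>"
  shows "dot f (\<lambda>\<kappa>. c \<odot>\<^bsub>H\<^esub> g \<kappa>) = c \<odot>\<^bsub>H\<^esub> dot f g"
proof -
  have "c \<odot>\<^bsub>H\<^esub> dot f g = (\<Oplus>\<^bsub>H\<^esub>\<kappa>\<in>I. c \<odot>\<^bsub>H\<^esub> circ \<kappa> (f \<kappa>) (g \<kappa>))"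
    unfolding dot_def by (rule H_finsum_smult[OF finite_I assms(1)]) (use assms in \<open>auto intro: circ_carrier\<close>)
  also have "\<dots> = dot f (\<lambda>\<kappa>. c \<odot>\<^bsub>H\<^esub> g \<kappa>)"
    unfolding dot_def
    by (rule H_sum_cong, rule circ_smult_r[symmetric, where \<alpha> = \<alpha> and \<beta> = \<beta>])
      (use assms in \<open>auto intro!: circ_carrier MM_smult\<close>)
  finally show ?thesis ..
qed

lemma circ_dot_l:
  assumes "z \<in> MM \<delta> \<alpha>" "f \<in> row \<beta>" "g \<in> col \<alpha>"
  shows "circ \<alpha> (dot f g) z = dot f (\<lambda>\<kappa>. circ \<alpha> (g \<kappa>) z)"
proof -
  have "circ \<alpha> (dot f g) z = (\<Oplus>\<^bsub>H\<^esub>\<kappa>\<in>I. circ \<alpha> (circ \<kappa> (f \<kappa>) (g \<kappa>)) z)"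
    unfolding dot_def by (rule circ_finsum_l[OF finite_I _ assms(1)]) (use assms in \<open>auto intro: circ_closed\<close>)
  also have "\<dots> = dot f (\<lambda>\<kappa>. circ \<alpha> (g \<kappa>) z)"
    unfolding dot_def by (rule H_sum_cong, rule circ_assoc[where \<gamma> = \<delta> and \<beta> = \<beta>]) (use assms in \<open>auto intro!: circ_carrier circ_closed\<close>)
  finally show ?thesis .
qed

lemma circ_dot_r:
  assumes "z \<in> MM \<beta> \<delta>" "f \<in> row \<beta>" "g \<in> col \<alpha>"
  shows "circ \<beta> z (dot f g) = dot (\<lambda>\<kappa>. circ \<beta> z (f \<kappa>)) g"
proof -
  have "circ \<beta> z (dot f g) = (\<Oplus>\<^bsub>H\<^esub>\<kappa>\<in>I. circ \<beta> z (circ \<kappa> (f \<kappa>) (g \<kappa>)))"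
    unfolding dot_def by (rule circ_finsum_r[OF finite_I _ assms(1)]) (use assms in \<open>auto intro: circ_closed\<close>)
  also have "\<dots> = dot (\<lambda>\<kappa>. circ \<beta> z (f \<kappa>)) g"
    unfolding dot_def
    by (rule H_sum_cong, rule circ_assoc[symmetric, where \<beta> = \<delta> and \<gamma> = \<alpha>]) (use assms in \<open>auto intro!: circ_carrier circ_closed\<close>)
  finally show ?thesis .
qed

lemma dot_assoc:
  assumes a: "a \<in> row \<beta>" and b: "\<And>\<kappa>. \<kappa> \<in> I \<Longrightarrow> b \<kappa> \<in> col \<kappa>" and c: "c \<in> col \<alpha>"
  shows "dot (\<lambda>\<kappa>. dot a (b \<kappa>)) c = dot a (\<lambda>\<delta>. dot (\<lambda>\<kappa>. b \<kappa> \<delta>) c)"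
proof -
  have "dot (\<lambda>\<kappa>. dot a (b \<kappa>)) c = (\<Oplus>\<^bsub>H\<^esub>\<kappa>\<in>I. \<Oplus>\<^bsub>H\<^esub>\<delta>\<in>I. circ \<delta> (a \<delta>) (circ \<kappa> (b \<kappa> \<delta>) (c \<kappa>)))"
    unfolding dot_def[of _ c]
  proof (rule Hk.M.finsum_cong')
    show "(\<lambda>\<kappa>. \<Oplus>\<^bsub>H\<^esub>\<delta>\<in>I. circ \<delta> (a \<delta>) (circ \<kappa> (b \<kappa> \<delta>) (c \<kappa>))) \<in> I \<rightarrow> carrier H"
      using assms by (auto intro!: Hk.M.finsum_closed circ_carrier circ_closed)
    fix \<kappa> assume \<kappa>: "\<kappa> \<in> I"
    show "circ \<kappa> (dot a (b \<kappa>)) (c \<kappa>) = (\<Oplus>\<^bsub>H\<^esub>\<delta>\<in>I. circ \<delta> (a \<delta>) (circ \<kappa> (b \<kappa> \<delta>) (c \<kappa>)))"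
      using circ_dot_l[OF _ a b[OF \<kappa>], of "c \<kappa>" \<alpha>] c \<kappa> by (simp add: dot_def)
  qed simp
  also have "\<dots> = (\<Oplus>\<^bsub>H\<^esub>\<delta>\<in>I. \<Oplus>\<^bsub>H\<^esub>\<kappa>\<in>I. circ \<delta> (a \<delta>) (circ \<kappa> (b \<kappa> \<delta>) (c \<kappa>)))"
    by (rule H_finsum_swap[OF finite_I finite_I]) (use assms in \<open>auto intro!: circ_carrier circ_closed\<close>)
  also have "\<dots> = dot a (\<lambda>\<delta>. dot (\<lambda>\<kappa>. b \<kappa> \<delta>) c)"
    unfolding dot_def[of a]
  proof (rule Hk.M.finsum_cong')
    show "(\<lambda>\<delta>. circ \<delta> (a \<delta>) (dot (\<lambda>\<kappa>. b \<kappa> \<delta>) c)) \<in> I \<rightarrow> carrier H"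
      using assms by (auto intro!: circ_carrier dot_closed)
    fix \<delta> assume \<delta>: "\<delta> \<in> I"
    show "(\<Oplus>\<^bsub>H\<^esub>\<kappa>\<in>I. circ \<delta> (a \<delta>) (circ \<kappa> (b \<kappa> \<delta>) (c \<kappa>))) = circ \<delta> (a \<delta>) (dot (\<lambda>\<kappa>. b \<kappa> \<delta>) c)"
      unfolding dot_def
      by (rule circ_finsum_r[OF finite_I, symmetric]) (use assms \<delta> in \<open>auto intro!: circ_closed\<close>)
  qed simp
  finally show ?thesis .
qed

lemma star_dot:
  assumes "f \<in> row \<beta>" "g \<in> col \<alpha>"
  shows "star (dot f g) = dot (\<lambda>\<kappa>. star (g \<kappa>)) (\<lambda>\<kappa>. star (f \<kappa>))"
proof -
  have "star (dot f g) = (\<Oplus>\<^bsub>H\<^esub>\<kappa>\<in>I. star (circ \<kappa> (f \<kappa>) (g \<kappa>)))"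
    unfolding dot_def by (rule star_finsum[OF finite_I]) (use assms in \<open>auto intro: circ_carrier\<close>)
  also have "\<dots> = dot (\<lambda>\<kappa>. star (g \<kappa>)) (\<lambda>\<kappa>. star (f \<kappa>))"
    unfolding dot_def by (rule H_sum_cong, rule star_circ[where \<alpha> = \<alpha> and \<beta> = \<beta>]) (use assms in \<open>auto intro!: circ_carrier star_MM\<close>)
  finally show ?thesis .
qed

lemma dot_unit_l:
  assumes \<beta>: "\<beta> \<in> I" and g: "g \<in> col \<alpha>"
  shows "dot (\<lambda>\<kappa>. if \<kappa> = \<beta> then m \<kappa> else \<zero>\<^bsub>H\<^esub>) g = g \<beta>"
proof -
  have "dot (\<lambda>\<kappa>. if \<kappa> = \<beta> then m \<kappa> else \<zero>\<^bsub>H\<^esub>) g = (\<Oplus>\<^bsub>H\<^esub>\<kappa>\<in>I. if \<beta> = \<kappa> then g \<kappa> else \<zero>\<^bsub>H\<^esub>)"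
    unfolding dot_def
    by (rule Hk.M.finsum_cong') (use assms MM_closed in \<open>auto simp: circ_m_l circ_zero_l\<close>)
  also have "\<dots> = g \<beta>" by (rule Hk.M.finsum_singleton[OF \<beta> finite_I]) (use g MM_closed in auto)
  finally show ?thesis .
qed

lemma dot_unit_r:
  assumes \<alpha>: "\<alpha> \<in> I" and f: "f \<in> row \<beta>"
  shows "dot f (\<lambda>\<kappa>. if \<alpha> = \<kappa> then m \<alpha> else \<zero>\<^bsub>H\<^esub>) = f \<alpha>"
proof -
  have "dot f (\<lambda>\<kappa>. if \<alpha> = \<kappa> then m \<alpha> else \<zero>\<^bsub>H\<^esub>) = (\<Oplus>\<^bsub>H\<^esub>\<kappa>\<in>I. if \<alpha> = \<kappa> then f \<kappa> else \<zero>\<^bsub>H\<^esub>)"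
    unfolding dot_def
    by (rule Hk.M.finsum_cong') (use assms MM_closed in \<open>auto simp: circ_m_r circ_zero_r\<close>)
  also have "\<dots> = f \<alpha>" by (rule Hk.M.finsum_singleton[OF \<alpha> finite_I]) (use f MM_closed in auto)
  finally show ?thesis .
qed

section \<open>The matrix algebra\<close>

lemma A_comp: "x \<in> carrier A \<Longrightarrow> \<alpha> \<in> I \<Longrightarrow> \<beta> \<in> I \<Longrightarrow> comp x \<alpha> \<beta> \<in> MM \<alpha> \<beta>"
  by (simp add: A_carrier)

lemma A_comp_closed [simp]: "x \<in> carrier A \<Longrightarrow> \<alpha> \<in> I \<Longrightarrow> \<beta> \<in> I \<Longrightarrow> comp x \<alpha> \<beta> \<in> carrier H"
  by (rule MM_closed[OF A_comp])

lemma A_row: "x \<in> carrier A \<Longrightarrow> \<beta> \<in> I \<Longrightarrow> (\<lambda>\<kappa>. comp x \<kappa> \<beta>) \<in> row \<beta>"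
  and A_col: "x \<in> carrier A \<Longrightarrow> \<alpha> \<in> I \<Longrightarrow> comp x \<alpha> \<in> col \<alpha>"
  by (simp_all add: A_comp)

lemma A_eqI: "x \<in> carrier A \<Longrightarrow> y \<in> carrier A \<Longrightarrow> (\<And>\<alpha> \<beta>. \<alpha> \<in> I \<Longrightarrow> \<beta> \<in> I \<Longrightarrow> comp x \<alpha> \<beta> = comp y \<alpha> \<beta>) \<Longrightarrow> x = y"
  using mkA_cong[of "comp x" "comp y"] by (simp add: A_carrier)

lemma mkA_comp_mkA: "mkA (comp (mkA f)) = mkA f"
  by (rule mkA_cong) (rule comp_mkA)

lemma mkA_closed: "(\<And>\<alpha> \<beta>. \<alpha> \<in> I \<Longrightarrow> \<beta> \<in> I \<Longrightarrow> f \<alpha> \<beta> \<in> MM \<alpha> \<beta>) \<Longrightarrow> mkA f \<in> carrier A"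
  by (simp add: A_carrier mkA_comp_mkA comp_mkA)

lemma comp_zero [simp]: "\<alpha> \<in> I \<Longrightarrow> \<beta> \<in> I \<Longrightarrow> comp \<zero>\<^bsub>A\<^esub> \<alpha> \<beta> = \<zero>\<^bsub>H\<^esub>"
  and comp_one: "\<alpha> \<in> I \<Longrightarrow> \<beta> \<in> I \<Longrightarrow> comp \<one>\<^bsub>A\<^esub> \<alpha> \<beta> = (if \<alpha> = \<beta> then m \<alpha> else \<zero>\<^bsub>H\<^esub>)"
  and comp_add [simp]: "x \<in> carrier A \<Longrightarrow> y \<in> carrier A \<Longrightarrow> \<alpha> \<in> I \<Longrightarrow> \<beta> \<in> I \<Longrightarrow> comp (x \<oplus>\<^bsub>A\<^esub> y) \<alpha> \<beta> = comp x \<alpha> \<beta> \<oplus>\<^bsub>H\<^esub> comp y \<alpha> \<beta>"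
  and comp_smult [simp]: "c \<in> carrier K \<Longrightarrow> x \<in> carrier A \<Longrightarrow> \<alpha> \<in> I \<Longrightarrow> \<beta> \<in> I \<Longrightarrow> comp (c \<odot>\<^bsub>A\<^esub> x) \<alpha> \<beta> = c \<odot>\<^bsub>H\<^esub> comp x \<alpha> \<beta>"
  and comp_mult: "x \<in> carrier A \<Longrightarrow> y \<in> carrier A \<Longrightarrow> \<alpha> \<in> I \<Longrightarrow> \<beta> \<in> I \<Longrightarrow> comp (x \<otimes>\<^bsub>A\<^esub> y) \<alpha> \<beta> = dot (\<lambda>\<kappa>. comp x \<kappa> \<beta>) (comp y \<alpha>)"
  by (simp_all add: A_zero A_one A_add A_smult A_mult comp_mkA dot_def)

lemma A_zero_closed: "\<zero>\<^bsub>A\<^esub> \<in> carrier A"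
  unfolding A_zero by (rule mkA_closed) (rule MM_zero)

lemma A_one_closed: "\<one>\<^bsub>A\<^esub> \<in> carrier A"
  unfolding A_one by (rule mkA_closed) (use MM_zero m_MM in auto)

lemma A_add_closed: "x \<in> carrier A \<Longrightarrow> y \<in> carrier A \<Longrightarrow> x \<oplus>\<^bsub>A\<^esub> y \<in> carrier A"
  by (simp add: A_add) (rule mkA_closed, simp add: A_comp MM_add)

lemma A_smult_closed: "c \<in> carrier K \<Longrightarrow> x \<in> carrier A \<Longrightarrow> c \<odot>\<^bsub>A\<^esub> x \<in> carrier A"
  by (simp add: A_smult) (rule mkA_closed, simp add: A_comp MM_smult)

lemma A_mult_closed:
  assumes "x \<in> carrier A" "y \<in> carrier A" shows "x \<otimes>\<^bsub>A\<^esub> y \<in> carrier A"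
  unfolding A_mult[OF assms] dot_def[symmetric] by (rule mkA_closed) (intro dot_closed A_row A_col assms)

lemma ring_A: "ring A"
proof (intro ringI abelian_groupI monoidI)
  fix x assume x: "x \<in> carrier A"
  show "\<exists>y\<in>carrier A. y \<oplus>\<^bsub>A\<^esub> x = \<zero>\<^bsub>A\<^esub>"
  proof (rule bexI)
    show c: "(\<ominus> \<one>) \<odot>\<^bsub>A\<^esub> x \<in> carrier A" by (rule A_smult_closed) (use x in auto)
    show "(\<ominus> \<one>) \<odot>\<^bsub>A\<^esub> x \<oplus>\<^bsub>A\<^esub> x = \<zero>\<^bsub>A\<^esub>"
      by (rule A_eqI) (use x c A_add_closed A_zero_closed in \<open>auto simp: neg_smult[symmetric] Hk.M.l_neg\<close>)
  qed
  show "\<zero>\<^bsub>A\<^esub> \<oplus>\<^bsub>A\<^esub> x = x"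
    by (rule A_eqI) (use x A_add_closed A_zero_closed in auto)
  show "\<one>\<^bsub>A\<^esub> \<otimes>\<^bsub>A\<^esub> x = x"
  proof (rule A_eqI[OF A_mult_closed[OF A_one_closed x] x])
    fix \<alpha> \<beta> assume i: "\<alpha> \<in> I" "\<beta> \<in> I"
    have "dot (\<lambda>\<kappa>. comp \<one>\<^bsub>A\<^esub> \<kappa> \<beta>) (comp x \<alpha>) = dot (\<lambda>\<kappa>. if \<kappa> = \<beta> then m \<kappa> else \<zero>\<^bsub>H\<^esub>) (comp x \<alpha>)"
      by (rule dot_cong) (use i A_col[OF x i(1)] m_MM MM_zero in \<open>auto simp: comp_one\<close>)
    then show "comp (\<one>\<^bsub>A\<^esub> \<otimes>\<^bsub>A\<^esub> x) \<alpha> \<beta> = comp x \<alpha> \<beta>"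
      using dot_unit_l[OF i(2) A_col[OF x i(1)]] by (simp add: comp_mult[OF A_one_closed x i])
  qed
  show "x \<otimes>\<^bsub>A\<^esub> \<one>\<^bsub>A\<^esub> = x"
  proof (rule A_eqI[OF A_mult_closed[OF x A_one_closed] x])
    fix \<alpha> \<beta> assume i: "\<alpha> \<in> I" "\<beta> \<in> I"
    have "dot (\<lambda>\<kappa>. comp x \<kappa> \<beta>) (comp \<one>\<^bsub>A\<^esub> \<alpha>) = dot (\<lambda>\<kappa>. comp x \<kappa> \<beta>) (\<lambda>\<kappa>. if \<alpha> = \<kappa> then m \<alpha> else \<zero>\<^bsub>H\<^esub>)"
      by (rule dot_cong) (use i A_row[OF x i(2)] m_MM MM_zero in \<open>auto simp: comp_one\<close>)
    then show "comp (x \<otimes>\<^bsub>A\<^esub> \<one>\<^bsub>A\<^esub>) \<alpha> \<beta> = comp x \<alpha> \<beta>"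
      using dot_unit_r[OF i(1) A_row[OF x i(2)]] by (simp add: comp_mult[OF x A_one_closed i])
  qed
  fix y assume y: "y \<in> carrier A"
  show "x \<oplus>\<^bsub>A\<^esub> y = y \<oplus>\<^bsub>A\<^esub> x"
    by (rule A_eqI) (use x y A_add_closed in \<open>auto simp: Hk.M.a_comm\<close>)
  fix z assume z: "z \<in> carrier A"
  show "x \<oplus>\<^bsub>A\<^esub> y \<oplus>\<^bsub>A\<^esub> z = x \<oplus>\<^bsub>A\<^esub> (y \<oplus>\<^bsub>A\<^esub> z)"
    by (rule A_eqI) (use x y z A_add_closed in \<open>auto simp: Hk.M.a_assoc\<close>)
  show "x \<otimes>\<^bsub>A\<^esub> y \<otimes>\<^bsub>A\<^esub> z = x \<otimes>\<^bsub>A\<^esub> (y \<otimes>\<^bsub>A\<^esub> z)"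
  proof (rule A_eqI)
    fix \<alpha> \<beta> assume i: "\<alpha> \<in> I" "\<beta> \<in> I"
    have "comp (x \<otimes>\<^bsub>A\<^esub> y \<otimes>\<^bsub>A\<^esub> z) \<alpha> \<beta> = dot (\<lambda>\<kappa>. comp (x \<otimes>\<^bsub>A\<^esub> y) \<kappa> \<beta>) (comp z \<alpha>)"
      by (rule comp_mult[OF A_mult_closed[OF x y] z i])
    also have "\<dots> = dot (\<lambda>\<kappa>. dot (\<lambda>\<delta>. comp x \<delta> \<beta>) (comp y \<kappa>)) (comp z \<alpha>)"
      by (rule dot_cong[where \<beta> = \<beta> and \<alpha> = \<alpha>])
        (use x y z i in \<open>auto simp: comp_mult A_comp intro!: dot_closed\<close>)
    also have "\<dots> = dot (\<lambda>\<delta>. comp x \<delta> \<beta>) (\<lambda>\<delta>. dot (\<lambda>\<kappa>. comp y \<kappa> \<delta>) (comp z \<alpha>))"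
      by (rule dot_assoc[OF A_row[OF x i(2)] A_col[OF y] A_col[OF z i(1)]])
    also have "\<dots> = dot (\<lambda>\<delta>. comp x \<delta> \<beta>) (comp (y \<otimes>\<^bsub>A\<^esub> z) \<alpha>)"
      by (rule dot_cong[where \<beta> = \<beta> and \<alpha> = \<alpha>])
        (use x y z i A_mult_closed in \<open>auto simp: comp_mult A_comp intro!: dot_closed\<close>)
    also have "\<dots> = comp (x \<otimes>\<^bsub>A\<^esub> (y \<otimes>\<^bsub>A\<^esub> z)) \<alpha> \<beta>"
      by (rule comp_mult[OF x A_mult_closed[OF y z] i, symmetric])
    finally show "comp (x \<otimes>\<^bsub>A\<^esub> y \<otimes>\<^bsub>A\<^esub> z) \<alpha> \<beta> = comp (x \<otimes>\<^bsub>A\<^esub> (y \<otimes>\<^bsub>A\<^esub> z)) \<alpha> \<beta>" .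
  qed (intro A_mult_closed x y z)+
  show "(x \<oplus>\<^bsub>A\<^esub> y) \<otimes>\<^bsub>A\<^esub> z = x \<otimes>\<^bsub>A\<^esub> z \<oplus>\<^bsub>A\<^esub> y \<otimes>\<^bsub>A\<^esub> z"
  proof (rule A_eqI)
    fix \<alpha> \<beta> assume i: "\<alpha> \<in> I" "\<beta> \<in> I"
    have "comp ((x \<oplus>\<^bsub>A\<^esub> y) \<otimes>\<^bsub>A\<^esub> z) \<alpha> \<beta> = dot (\<lambda>\<kappa>. comp (x \<oplus>\<^bsub>A\<^esub> y) \<kappa> \<beta>) (comp z \<alpha>)"
      by (rule comp_mult[OF A_add_closed[OF x y] z i])
    also have "\<dots> = dot (\<lambda>\<kappa>. comp x \<kappa> \<beta> \<oplus>\<^bsub>H\<^esub> comp y \<kappa> \<beta>) (comp z \<alpha>)"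
      by (rule dot_cong[where \<beta> = \<beta> and \<alpha> = \<alpha>]) (use x y z i in \<open>auto simp: A_comp MM_add\<close>)
    finally show "comp ((x \<oplus>\<^bsub>A\<^esub> y) \<otimes>\<^bsub>A\<^esub> z) \<alpha> \<beta> = comp (x \<otimes>\<^bsub>A\<^esub> z \<oplus>\<^bsub>A\<^esub> y \<otimes>\<^bsub>A\<^esub> z) \<alpha> \<beta>"
      using dot_add_l[OF A_row[OF x i(2)] A_row[OF y i(2)] A_col[OF z i(1)]] x y z i A_mult_closed
      by (simp add: comp_mult)
  qed (intro A_mult_closed A_add_closed x y z)+
  show "z \<otimes>\<^bsub>A\<^esub> (x \<oplus>\<^bsub>A\<^esub> y) = z \<otimes>\<^bsub>A\<^esub> x \<oplus>\<^bsub>A\<^esub> z \<otimes>\<^bsub>A\<^esub> y"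
  proof (rule A_eqI)
    fix \<alpha> \<beta> assume i: "\<alpha> \<in> I" "\<beta> \<in> I"
    have "comp (z \<otimes>\<^bsub>A\<^esub> (x \<oplus>\<^bsub>A\<^esub> y)) \<alpha> \<beta> = dot (\<lambda>\<kappa>. comp z \<kappa> \<beta>) (comp (x \<oplus>\<^bsub>A\<^esub> y) \<alpha>)"
      by (rule comp_mult[OF z A_add_closed[OF x y] i])
    also have "\<dots> = dot (\<lambda>\<kappa>. comp z \<kappa> \<beta>) (\<lambda>\<kappa>. comp x \<alpha> \<kappa> \<oplus>\<^bsub>H\<^esub> comp y \<alpha> \<kappa>)"
      by (rule dot_cong[where \<beta> = \<beta> and \<alpha> = \<alpha>]) (use x y z i in \<open>auto simp: A_comp MM_add\<close>)
    finally show "comp (z \<otimes>\<^bsub>A\<^esub> (x \<oplus>\<^bsub>A\<^esub> y)) \<alpha> \<beta> = comp (z \<otimes>\<^bsub>A\<^esub> x \<oplus>\<^bsub>A\<^esub> z \<otimes>\<^bsub>A\<^esub> y) \<alpha> \<beta>"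
      using dot_add_r[OF A_row[OF z i(2)] A_col[OF x i(1)] A_col[OF y i(1)]] x y z i A_mult_closed
      by (simp add: comp_mult)
  qed (intro A_mult_closed A_add_closed x y z)+
qed (auto intro: A_zero_closed A_one_closed A_add_closed A_mult_closed A_eqI)

lemma dot_cong_l: "(\<And>\<kappa>. \<kappa> \<in> I \<Longrightarrow> f \<kappa> = f' \<kappa>) \<Longrightarrow> f' \<in> row \<beta> \<Longrightarrow> g \<in> col \<alpha> \<Longrightarrow> dot f g = dot f' g"
  and dot_cong_r: "(\<And>\<kappa>. \<kappa> \<in> I \<Longrightarrow> g \<kappa> = g' \<kappa>) \<Longrightarrow> f \<in> row \<beta> \<Longrightarrow> g' \<in> col \<alpha> \<Longrightarrow> dot f g = dot f g'"
  by (rule dot_cong; simp)+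

lemma assoc_algebra_A: "assoc_algebra K A"
proof -
  interpret A: ring A by (rule ring_A)
  show ?thesis
  proof (rule assoc_algebraI[OF _ ring_A])
    show "module K A"
    proof (rule moduleI[OF is_cring A.is_abelian_group])
      fix a b x y assume ab: "a \<in> carrier K" "b \<in> carrier K" and xy: "x \<in> carrier A" "y \<in> carrier A"
      show "a \<odot>\<^bsub>A\<^esub> x \<in> carrier A" using ab xy by (simp add: A_smult_closed)
      show "(a \<oplus> b) \<odot>\<^bsub>A\<^esub> x = a \<odot>\<^bsub>A\<^esub> x \<oplus>\<^bsub>A\<^esub> b \<odot>\<^bsub>A\<^esub> x"
        by (rule A_eqI) (use ab xy in \<open>auto simp: A_smult_closed A_add_closed Hk.smult_l_distr\<close>)
      show "a \<odot>\<^bsub>A\<^esub> (x \<oplus>\<^bsub>A\<^esub> y) = a \<odot>\<^bsub>A\<^esub> x \<oplus>\<^bsub>A\<^esub> a \<odot>\<^bsub>A\<^esub> y"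
        by (rule A_eqI) (use ab xy in \<open>auto simp: A_smult_closed A_add_closed Hk.smult_r_distr\<close>)
      show "(a \<otimes> b) \<odot>\<^bsub>A\<^esub> x = a \<odot>\<^bsub>A\<^esub> (b \<odot>\<^bsub>A\<^esub> x)"
        by (rule A_eqI) (use ab xy in \<open>auto simp: A_smult_closed Hk.smult_assoc1\<close>)
    next
      fix x assume "x \<in> carrier A"
      then show "\<one> \<odot>\<^bsub>A\<^esub> x = x"
        by (intro A_eqI) (auto simp: A_smult_closed)
    qed
  next
    fix c x y assume c: "c \<in> carrier K" and x: "x \<in> carrier A" and y: "y \<in> carrier A"
    show "(c \<odot>\<^bsub>A\<^esub> x) \<otimes>\<^bsub>A\<^esub> y = c \<odot>\<^bsub>A\<^esub> (x \<otimes>\<^bsub>A\<^esub> y)"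
    proof (rule A_eqI)
      fix \<alpha> \<beta> assume i: "\<alpha> \<in> I" "\<beta> \<in> I"
      have "dot (\<lambda>\<kappa>. comp (c \<odot>\<^bsub>A\<^esub> x) \<kappa> \<beta>) (comp y \<alpha>) = dot (\<lambda>\<kappa>. c \<odot>\<^bsub>H\<^esub> comp x \<kappa> \<beta>) (comp y \<alpha>)"
        by (rule dot_cong[where \<beta> = \<beta> and \<alpha> = \<alpha>]) (use c x y i in \<open>auto simp: A_comp MM_smult\<close>)
      then show "comp ((c \<odot>\<^bsub>A\<^esub> x) \<otimes>\<^bsub>A\<^esub> y) \<alpha> \<beta> = comp (c \<odot>\<^bsub>A\<^esub> (x \<otimes>\<^bsub>A\<^esub> y)) \<alpha> \<beta>"
        using dot_smult_l[OF c A_row[OF x i(2)] A_col[OF y i(1)]] c x y i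
        by (simp add: comp_mult A_smult_closed A_mult_closed)
    qed (use c x y in \<open>auto intro: A_smult_closed A_mult_closed\<close>)
    show "x \<otimes>\<^bsub>A\<^esub> (c \<odot>\<^bsub>A\<^esub> y) = c \<odot>\<^bsub>A\<^esub> (x \<otimes>\<^bsub>A\<^esub> y)"
    proof (rule A_eqI)
      fix \<alpha> \<beta> assume i: "\<alpha> \<in> I" "\<beta> \<in> I"
      have "dot (\<lambda>\<kappa>. comp x \<kappa> \<beta>) (comp (c \<odot>\<^bsub>A\<^esub> y) \<alpha>) = dot (\<lambda>\<kappa>. comp x \<kappa> \<beta>) (\<lambda>\<kappa>. c \<odot>\<^bsub>H\<^esub> comp y \<alpha> \<kappa>)"
        by (rule dot_cong[where \<beta> = \<beta> and \<alpha> = \<alpha>]) (use c x y i in \<open>auto simp: A_comp MM_smult\<close>)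
      then show "comp (x \<otimes>\<^bsub>A\<^esub> (c \<odot>\<^bsub>A\<^esub> y)) \<alpha> \<beta> = comp (c \<odot>\<^bsub>A\<^esub> (x \<otimes>\<^bsub>A\<^esub> y)) \<alpha> \<beta>"
        using dot_smult_r[OF c A_row[OF x i(2)] A_col[OF y i(1)]] c x y i
        by (simp add: comp_mult A_smult_closed A_mult_closed)
    qed (use c x y in \<open>auto intro: A_smult_closed A_mult_closed\<close>)
  qed
qed

sublocale Al: assoc_algebra K A by (rule assoc_algebra_A)

end

section \<open>The standard filter\<close>

context filtered_setting
begin

definition Asum :: "(nat \<Rightarrow> nat) set \<Rightarrow> 'a set" where
  "Asum L = {x \<in> carrier A. \<forall>\<alpha>\<in>I. \<forall>\<beta>\<in>I. comp x \<alpha> \<beta> \<in> Msum L \<alpha> \<beta>}"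

definition sgl :: "(nat \<Rightarrow> nat) \<Rightarrow> (nat \<Rightarrow> nat) \<Rightarrow> 'k hecke \<Rightarrow> 'a" where
  "sgl \<alpha> \<beta> f = mkA (\<lambda>\<alpha>' \<beta>'. if \<alpha>' = \<alpha> \<and> \<beta>' = \<beta> then f else \<zero>\<^bsub>H\<^esub>)"

lemma sgl_closed: "f \<in> MM \<alpha> \<beta> \<Longrightarrow> sgl \<alpha> \<beta> f \<in> carrier A"
  unfolding sgl_def by (rule mkA_closed) (auto intro: MM_zero)

lemma comp_sgl: "\<alpha>' \<in> I \<Longrightarrow> \<beta>' \<in> I \<Longrightarrow> comp (sgl \<alpha> \<beta> f) \<alpha>' \<beta>' = (if \<alpha>' = \<alpha> \<and> \<beta>' = \<beta> then f else \<zero>\<^bsub>H\<^esub>)"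
  by (simp add: sgl_def comp_mkA)

lemma Asum_closed: "x \<in> Asum L \<Longrightarrow> x \<in> carrier A"
  by (simp add: Asum_def)

lemma Asum_zero: "\<zero>\<^bsub>A\<^esub> \<in> Asum L"
  by (simp add: Asum_def Msum_zero A_zero_closed)

lemma Asum_add: "x \<in> Asum L \<Longrightarrow> y \<in> Asum L \<Longrightarrow> x \<oplus>\<^bsub>A\<^esub> y \<in> Asum L"
  by (simp add: Asum_def Msum_add A_add_closed)

lemma A_neg_smult: "x \<in> carrier A \<Longrightarrow> \<ominus>\<^bsub>A\<^esub> x = (\<ominus> \<one>) \<odot>\<^bsub>A\<^esub> x"
  using Al.smult_l_minus[of \<one> x] by simp

lemma Asum_neg: "x \<in> Asum L \<Longrightarrow> \<ominus>\<^bsub>A\<^esub> x \<in> Asum L"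
  by (simp add: Asum_def A_neg_smult A_smult_closed Msum_smult)

lemma comp_minus [simp]:
  assumes "x \<in> carrier A" "y \<in> carrier A" "\<alpha> \<in> I" "\<beta> \<in> I"
  shows "comp (x \<ominus>\<^bsub>A\<^esub> y) \<alpha> \<beta> = comp x \<alpha> \<beta> \<ominus>\<^bsub>H\<^esub> comp y \<alpha> \<beta>"
  using assms by (simp add: a_minus_def A_neg_smult A_smult_closed neg_smult)

lemma Asum_sgl:
  assumes "f \<in> Msum L \<alpha> \<beta>" shows "sgl \<alpha> \<beta> f \<in> Asum L"
  using assms sgl_closed[OF Msum_MM[OF assms]] by (auto simp: Asum_def comp_sgl Msum_zero)

text \<open>A matrix is a sum of matrices with one nonzero entry, and each entry is treated by
  \<open>Msum_induct\<close>; so the generators are matrices with a single entry u o v.\<close>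

lemma Asum_induct [consumes 1, case_names zero gen add]:
  assumes x: "x \<in> Asum L" and zero: "P \<zero>\<^bsub>A\<^esub>"
    and gen: "\<And>\<pi> \<alpha> \<beta> u v. \<pi> \<in> L \<Longrightarrow> \<alpha> \<in> I \<Longrightarrow> \<beta> \<in> I \<Longrightarrow> u \<in> MM \<pi> \<beta> \<Longrightarrow> v \<in> MM \<alpha> \<pi> \<Longrightarrow> P (sgl \<alpha> \<beta> (circ \<pi> u v))"
    and add: "\<And>a b. a \<in> Asum L \<Longrightarrow> b \<in> Asum L \<Longrightarrow> P a \<Longrightarrow> P b \<Longrightarrow> P (a \<oplus>\<^bsub>A\<^esub> b)"
  shows "P x"
proof -
  have xc: "x \<in> carrier A" and xs: "\<And>\<alpha> \<beta>. \<alpha> \<in> I \<Longrightarrow> \<beta> \<in> I \<Longrightarrow> comp x \<alpha> \<beta> \<in> Msum L \<alpha> \<beta>" using x by (auto simp: Asum_def)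
  have P_sgl: "P (sgl \<alpha> \<beta> f)" if i: "\<alpha> \<in> I" "\<beta> \<in> I" and "f \<in> Msum L \<alpha> \<beta>" for \<alpha> \<beta> f
    using that(3)
  proof (induction rule: Msum_induct)
    case zero
    have "sgl \<alpha> \<beta> \<zero>\<^bsub>H\<^esub> = \<zero>\<^bsub>A\<^esub>" unfolding sgl_def A_zero by (rule mkA_cong) simp
    then show ?case using assms(2) by simp
  next
    case (gen \<pi> u v) then show ?case using i by (intro assms(3))
  next
    case (add f g)
    have c: "sgl \<alpha> \<beta> f \<in> carrier A" "sgl \<alpha> \<beta> g \<in> carrier A"
      using sgl_closed Msum_MM add.hyps by blast+
    have "sgl \<alpha> \<beta> (f \<oplus>\<^bsub>H\<^esub> g) = sgl \<alpha> \<beta> f \<oplus>\<^bsub>A\<^esub> sgl \<alpha> \<beta> g"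
      unfolding A_add[OF c] sgl_def[of _ _ "f \<oplus>\<^bsub>H\<^esub> g"] by (rule mkA_cong) (auto simp: comp_sgl)
    then show ?case using assms(4)[OF Asum_sgl[OF add.hyps(1)] Asum_sgl[OF add.hyps(2)]] add.IH by simp
  qed
  \<comment> \<open>Cuts \<open>x\<close> down to the entries in \<open>S\<close>, so that
    \<open>x\<close> is assembled one entry at a time.\<close>
  define part where "part = (\<lambda>S. mkA (\<lambda>\<alpha> \<beta>. if (\<alpha>, \<beta>) \<in> S then comp x \<alpha> \<beta> else \<zero>\<^bsub>H\<^esub>))"
  have part: "P (part S) \<and> part S \<in> Asum L" if "finite S" "S \<subseteq> I \<times> I" for S
    using that
  proof (induction S rule: finite_induct)
    case empty
    have "part {} = \<zero>\<^bsub>A\<^esub>" unfolding part_def A_zero by (rule mkA_cong) simp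
    then show ?case using zero Asum_zero by simp
  next
    case (insert ab S)
    obtain \<alpha> \<beta> where ab: "ab = (\<alpha>, \<beta>)" "\<alpha> \<in> I" "\<beta> \<in> I" using insert.prems by auto
    have s: "sgl \<alpha> \<beta> (comp x \<alpha> \<beta>) \<in> Asum L" "P (sgl \<alpha> \<beta> (comp x \<alpha> \<beta>))"
      using Asum_sgl P_sgl xs ab by blast+
    have IH: "P (part S)" "part S \<in> Asum L" using insert by auto
    have "part (insert ab S) = sgl \<alpha> \<beta> (comp x \<alpha> \<beta>) \<oplus>\<^bsub>A\<^esub> part S"
    proof -
      have cp: "comp (part S) \<alpha>' \<beta>' = (if (\<alpha>', \<beta>') \<in> S then comp x \<alpha>' \<beta>' else \<zero>\<^bsub>H\<^esub>)" if "\<alpha>' \<in> I" "\<beta>' \<in> I" for \<alpha>' \<beta>'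
        using that by (simp add: part_def comp_mkA)
      have "mkA (\<lambda>\<alpha>' \<beta>'. if (\<alpha>', \<beta>') \<in> insert ab S then comp x \<alpha>' \<beta>' else \<zero>\<^bsub>H\<^esub>)
          = mkA (\<lambda>\<alpha>' \<beta>'. comp (sgl \<alpha> \<beta> (comp x \<alpha> \<beta>)) \<alpha>' \<beta>' \<oplus>\<^bsub>H\<^esub> comp (part S) \<alpha>' \<beta>')"
        by (rule mkA_cong) (use insert.hyps ab xc in \<open>auto simp: comp_sgl cp\<close>)
      then show ?thesis unfolding A_add[OF Asum_closed[OF s(1)] Asum_closed[OF IH(2)]] by (simp add: part_def)
    qed
    then show ?case using add[OF s(1) IH(2) s(2) IH(1)] Asum_add[OF s(1) IH(2)] by simp
  qed
  have "part (I \<times> I) = mkA (comp x)" unfolding part_def by (rule mkA_cong) auto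
  also have "\<dots> = x" using xc by (simp add: A_carrier)
  finally show ?thesis using part[of "I \<times> I"] finite_I by simp
qed

lemma dot_Msum_r: "f \<in> row \<beta> \<Longrightarrow> (\<And>\<kappa>. \<kappa> \<in> I \<Longrightarrow> g \<kappa> \<in> Msum L \<alpha> \<kappa>) \<Longrightarrow> dot f g \<in> Msum L \<alpha> \<beta>"
  unfolding dot_def by (rule Msum_finsum[OF finite_I]) (auto intro: circ_Msum_r)

lemma dot_Msum_l: "(\<And>\<kappa>. \<kappa> \<in> I \<Longrightarrow> f \<kappa> \<in> Msum L \<kappa> \<beta>) \<Longrightarrow> g \<in> col \<alpha> \<Longrightarrow> dot f g \<in> Msum L \<alpha> \<beta>"
  unfolding dot_def by (rule Msum_finsum[OF finite_I]) (auto intro: circ_Msum_l)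

lemma ideal_Asum: "ideal (Asum L) A"
proof (rule idealI[OF Al.A.ring_axioms])
  show "subgroup (Asum L) (add_monoid A)"
  proof (rule Al.M.add.subgroupI)
    show "Asum L \<subseteq> carrier A" using Asum_closed by blast
    show "Asum L \<noteq> {}" using Asum_zero by blast
  qed (simp_all add: Asum_neg Asum_add)
next
  fix a x assume a: "a \<in> Asum L" and x: "x \<in> carrier A"
  have ac: "a \<in> carrier A" and as: "\<And>\<alpha> \<beta>. \<alpha> \<in> I \<Longrightarrow> \<beta> \<in> I \<Longrightarrow> comp a \<alpha> \<beta> \<in> Msum L \<alpha> \<beta>"
    using a by (auto simp: Asum_def)
  have "comp (x \<otimes>\<^bsub>A\<^esub> a) \<alpha> \<beta> \<in> Msum L \<alpha> \<beta>" if i: "\<alpha> \<in> I" "\<beta> \<in> I" for \<alpha> \<beta>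
    unfolding comp_mult[OF x ac i] by (rule dot_Msum_r[OF A_row[OF x i(2)] as[OF i(1)]])
  then show "x \<otimes>\<^bsub>A\<^esub> a \<in> Asum L" using A_mult_closed[OF x ac] by (simp add: Asum_def)
  have "comp (a \<otimes>\<^bsub>A\<^esub> x) \<alpha> \<beta> \<in> Msum L \<alpha> \<beta>" if i: "\<alpha> \<in> I" "\<beta> \<in> I" for \<alpha> \<beta>
    unfolding comp_mult[OF ac x i] by (rule dot_Msum_l[OF as[OF _ i(2)] A_col[OF x i(1)]])
  then show "a \<otimes>\<^bsub>A\<^esub> x \<in> Asum L" using A_mult_closed[OF ac x] by (simp add: Asum_def)
qed

lemma AF_Asum: "AF \<nu> = Asum {\<pi> \<in> compositions n. dom_le \<nu> \<pi>}"
  by (auto simp: AF_def Asum_def A_carrier M_ge_Msum dest: Msum_MM)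

lemma Asum_mono: "L \<subseteq> L' \<Longrightarrow> Asum L \<subseteq> Asum L'"
  by (auto simp: Asum_def intro: Msum_mono)

text \<open>A single-entry generator through \<pi> belongs to the layer of any k in \<open>J\<close>
  dominated by \<pi>. The spans occurring in the filter axioms thus become explicit conditions on
  entries.\<close>

lemma span_filter:
  assumes J: "J \<subseteq> compositions n"
  shows "add_span A (\<Union>k\<in>J. AF k) = Asum {\<pi> \<in> compositions n. \<exists>k\<in>J. dom_le k \<pi>}" (is "_ = ?S")
proof (intro equalityI subsetI)
  have sub: "(\<Union>k\<in>J. AF k) \<subseteq> carrier A" by (auto simp: AF_Asum Asum_closed)
  have inc: "x \<in> ?S" if "x \<in> (\<Union>k\<in>J. AF k)" for x
    using that Asum_mono[of "{\<pi> \<in> compositions n. dom_le k \<pi>}" "{\<pi> \<in> compositions n. \<exists>k\<in>J. dom_le k \<pi>}" for k]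
    unfolding AF_Asum by blast
  fix x assume "x \<in> add_span A (\<Union>k\<in>J. AF k)"
  from this sub show "x \<in> ?S"
  proof (induction rule: Al.M.add_span_induct)
    case (neg s) then show ?case using inc Asum_neg by blast
  qed (use Asum_zero inc Asum_add in auto)
next
  fix x assume "x \<in> ?S"
  then show "x \<in> add_span A (\<Union>k\<in>J. AF k)"
  proof (induction rule: Asum_induct)
    case zero then show ?case by (rule Al.M.add_span_zero)
  next
    case (gen \<pi> \<alpha> \<beta> u v)
    then obtain k where k: "k \<in> J" "\<pi> \<in> {\<pi> \<in> compositions n. dom_le k \<pi>}" by blast
    have "sgl \<alpha> \<beta> (circ \<pi> u v) \<in> AF k" unfolding AF_Asum by (rule Asum_sgl[OF Msum_gen[OF k(2) gen(4,5)]])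
    then show ?case using k(1) by (intro Al.M.add_span_incl) blast
  next
    case (add a b) then show ?case by (intro Al.M.add_span_add)
  qed
qed

definition A_gt :: "(nat \<Rightarrow> nat) \<Rightarrow> 'a set" where
  "A_gt \<nu> = Asum {\<pi> \<in> compositions n. dom_le \<nu> \<pi> \<and> \<pi> \<noteq> \<nu>}"

lemma A_gt_iff: "x \<in> A_gt \<nu> \<longleftrightarrow> x \<in> carrier A \<and> (\<forall>\<alpha>\<in>I. \<forall>\<beta>\<in>I. comp x \<alpha> \<beta> \<in> M_gt \<nu> \<alpha> \<beta>)"
  by (simp add: A_gt_def Asum_def M_gt_Msum)

text \<open>In the reversed order, the elements below \<nu> are the compositions that strictly
  dominate it. This set is closed upwards by transitivity and antisymmetry, and each of its members
  is its own witness.\<close>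

lemma filter_below_eq: "filter_below A (compositions n) dom_ge AF \<nu> = A_gt \<nu>"
proof -
  have "{\<pi> \<in> compositions n. \<exists>k\<in>{k \<in> compositions n. dom_ge k \<nu> \<and> k \<noteq> \<nu>}. dom_le k \<pi>}
      = {\<pi> \<in> compositions n. dom_le \<nu> \<pi> \<and> \<pi> \<noteq> \<nu>}"
  proof (intro equalityI subsetI)
    fix \<pi> assume "\<pi> \<in> {\<pi> \<in> compositions n. \<exists>k\<in>{k \<in> compositions n. dom_ge k \<nu> \<and> k \<noteq> \<nu>}. dom_le k \<pi>}"
    then obtain k where k: "\<pi> \<in> compositions n" "dom_le \<nu> k" "k \<noteq> \<nu>" "dom_le k \<pi>" by (auto simp: dom_ge_def)
    then have "dom_le \<nu> \<pi>" "\<pi> \<noteq> \<nu>" using dom_le_trans[OF k(2,4)] dom_le_antisym[of k \<nu>] by auto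
    then show "\<pi> \<in> {\<pi> \<in> compositions n. dom_le \<nu> \<pi> \<and> \<pi> \<noteq> \<nu>}" using k(1) by simp
  next
    fix \<pi> assume \<pi>: "\<pi> \<in> {\<pi> \<in> compositions n. dom_le \<nu> \<pi> \<and> \<pi> \<noteq> \<nu>}"
    then show "\<pi> \<in> {\<pi> \<in> compositions n. \<exists>k\<in>{k \<in> compositions n. dom_ge k \<nu> \<and> k \<noteq> \<nu>}. dom_le k \<pi>}"
      using dom_le_refl[of \<pi>] by (auto simp: dom_ge_def)
  qed
  then show ?thesis
    unfolding filter_below_def A_gt_def by (subst span_filter) auto
qed

section \<open>Quotients of the matrix algebra and representatives of module elements\<close>

abbreviation AQ :: "(nat \<Rightarrow> nat) \<Rightarrow> ('k, 'a set) module" where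
  "AQ \<nu> \<equiv> quotient_algebra A (A_gt \<nu>)"

abbreviation KB :: "(nat \<Rightarrow> nat) \<Rightarrow> ('k, 'k set) module" where
  "KB \<nu> \<equiv> quotient_algebra (self_algebra K) (B' \<nu>)"

definition acs :: "(nat \<Rightarrow> nat) \<Rightarrow> 'a \<Rightarrow> 'a set" where
  "acs \<nu> x = A_gt \<nu> +>\<^bsub>A\<^esub> x"

lemma AQ_quotient: "algebra_quotient K A (A_gt \<nu>)"
  unfolding A_gt_def by (intro algebra_quotient.intro Al.assoc_algebra_axioms ideal_Asum)

lemmas AQ_assoc = algebra_quotient.assoc_algebra_Q[OF AQ_quotient]
  and KB_assoc = algebra_quotient.assoc_algebra_Q[OF base_quotient]

lemmas acs_closed = algebra_quotient.coset_closed[OF AQ_quotient, folded acs_def]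
  and AQ_E = algebra_quotient.coset_cases[OF AQ_quotient, folded acs_def]
  and acs_eq_iff = algebra_quotient.coset_eq_iff[OF AQ_quotient, folded acs_def]
  and acs_add = algebra_quotient.coset_add[OF AQ_quotient, folded acs_def]
  and acs_mult = algebra_quotient.coset_mult[OF AQ_quotient, folded acs_def]
  and acs_smult = algebra_quotient.coset_smult[OF AQ_quotient, folded acs_def]
  and acs_one = algebra_quotient.coset_one[OF AQ_quotient, folded acs_def]
  and acs_zero = algebra_quotient.coset_zero[OF AQ_quotient, folded acs_def]

lemma self_simps: "carrier (self_algebra K) = carrier K" "add (self_algebra K) = add K" "mult (self_algebra K) = mult K"
    "one (self_algebra K) = one K" "smult (self_algebra K) = mult K"
  by (simp_all add: self_algebra_def ring.defs module.defs)

lemmas kcs_closed = algebra_quotient.coset_closed[OF base_quotient, folded kcs_def, unfolded self_simps]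
  and KB_E = algebra_quotient.coset_cases[OF base_quotient, folded kcs_def, unfolded self_simps]
  and kcs_add = algebra_quotient.coset_add[OF base_quotient, folded kcs_def, unfolded self_simps]
  and kcs_mult = algebra_quotient.coset_mult[OF base_quotient, folded kcs_def, unfolded self_simps]
  and kcs_smult = algebra_quotient.coset_smult[OF base_quotient, folded kcs_def, unfolded self_simps]
  and kcs_one = algebra_quotient.coset_one[OF base_quotient, folded kcs_def, unfolded self_simps]

lemma acs_mem: "y \<in> acs \<nu> x \<longleftrightarrow> (\<exists>g\<in>A_gt \<nu>. y = g \<oplus>\<^bsub>A\<^esub> x)"
  by (auto simp: acs_def a_r_coset_def')

text \<open>A coset of matrices is a product of cosets of entries, which is the form in which
  \<open>\<eta>\<close> is given.\<close>

lemma acs_mem_iff: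
  assumes x: "x \<in> carrier A"
  shows "y \<in> acs \<nu> x \<longleftrightarrow> mkA (comp y) = y \<and> (\<forall>\<alpha>\<in>I. \<forall>\<beta>\<in>I. comp y \<alpha> \<beta> \<in> cs \<nu> \<alpha> \<beta> (comp x \<alpha> \<beta>))"
proof
  assume "y \<in> acs \<nu> x"
  then obtain g where gA: "g \<in> A_gt \<nu>" and gy: "y = g \<oplus>\<^bsub>A\<^esub> x" unfolding acs_mem by blast
  have g: "g \<in> carrier A" "\<And>\<alpha> \<beta>. \<alpha> \<in> I \<Longrightarrow> \<beta> \<in> I \<Longrightarrow> comp g \<alpha> \<beta> \<in> M_gt \<nu> \<alpha> \<beta>" "y = g \<oplus>\<^bsub>A\<^esub> x"
    using gA gy unfolding A_gt_iff by simp_all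
  have "mkA (comp y) = y" using A_add_closed[OF g(1) x] by (simp add: g(3) A_carrier)
  moreover have "comp y \<alpha> \<beta> \<in> cs \<nu> \<alpha> \<beta> (comp x \<alpha> \<beta>)" if "\<alpha> \<in> I" "\<beta> \<in> I" for \<alpha> \<beta>
    unfolding cs_mem using g(2)[OF that] g x that by (intro bexI[of _ "comp g \<alpha> \<beta>"]) auto
  ultimately show "mkA (comp y) = y \<and> (\<forall>\<alpha>\<in>I. \<forall>\<beta>\<in>I. comp y \<alpha> \<beta> \<in> cs \<nu> \<alpha> \<beta> (comp x \<alpha> \<beta>))" by blast
next
  assume y: "mkA (comp y) = y \<and> (\<forall>\<alpha>\<in>I. \<forall>\<beta>\<in>I. comp y \<alpha> \<beta> \<in> cs \<nu> \<alpha> \<beta> (comp x \<alpha> \<beta>))"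
  have "comp y \<alpha> \<beta> \<in> MM \<alpha> \<beta>" if i: "\<alpha> \<in> I" "\<beta> \<in> I" for \<alpha> \<beta>
  proof -
    obtain g where "g \<in> M_gt \<nu> \<alpha> \<beta>" "comp y \<alpha> \<beta> = g \<oplus>\<^bsub>H\<^esub> comp x \<alpha> \<beta>" using y i unfolding cs_mem by blast
    then show ?thesis using A_comp[OF x i] Msum_MM[of g _ \<alpha> \<beta>] MM_add unfolding M_gt_Msum by simp
  qed
  then have yc: "y \<in> carrier A" using y by (simp add: A_carrier)
  have "comp y \<alpha> \<beta> \<ominus>\<^bsub>H\<^esub> comp x \<alpha> \<beta> \<in> M_gt \<nu> \<alpha> \<beta>" if i: "\<alpha> \<in> I" "\<beta> \<in> I" for \<alpha> \<beta>
    using cs_mem_iff[OF A_comp_closed[OF x i] A_comp_closed[OF yc i]] y i by blast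
  then have "y \<ominus>\<^bsub>A\<^esub> x \<in> A_gt \<nu>" using x yc by (simp add: A_gt_iff)
  moreover have "y = (y \<ominus>\<^bsub>A\<^esub> x) \<oplus>\<^bsub>A\<^esub> x" using x yc by (simp add: a_minus_def Al.M.a_assoc Al.M.l_neg)
  ultimately show "y \<in> acs \<nu> x" unfolding acs_mem by blast
qed

text \<open>Every element of the entry coset is attained: a change by an element of
  \<open>M_gt\<close> is realized by a matrix with only that entry.\<close>

lemma comp_image:
  assumes x: "x \<in> carrier A" and i: "\<alpha> \<in> I" "\<beta> \<in> I"
  shows "(\<lambda>x. comp x \<alpha> \<beta>) ` acs \<nu> x = cs \<nu> \<alpha> \<beta> (comp x \<alpha> \<beta>)"
proof (intro equalityI subsetI)
  fix z assume "z \<in> (\<lambda>x. comp x \<alpha> \<beta>) ` acs \<nu> x"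
  then show "z \<in> cs \<nu> \<alpha> \<beta> (comp x \<alpha> \<beta>)" using acs_mem_iff[OF x] i by blast
next
  fix z assume "z \<in> cs \<nu> \<alpha> \<beta> (comp x \<alpha> \<beta>)"
  then obtain g where g: "g \<in> M_gt \<nu> \<alpha> \<beta>" "z = g \<oplus>\<^bsub>H\<^esub> comp x \<alpha> \<beta>" unfolding cs_mem by blast
  have s: "sgl \<alpha> \<beta> g \<in> A_gt \<nu>" unfolding A_gt_def by (rule Asum_sgl) (use g(1) M_gt_Msum in simp)
  then have "sgl \<alpha> \<beta> g \<oplus>\<^bsub>A\<^esub> x \<in> acs \<nu> x" unfolding acs_mem by blast
  moreover have "comp (sgl \<alpha> \<beta> g \<oplus>\<^bsub>A\<^esub> x) \<alpha> \<beta> = z" using s x i by (simp add: A_gt_iff comp_sgl g(2))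
  ultimately show "z \<in> (\<lambda>x. comp x \<alpha> \<beta>) ` acs \<nu> x" by blast
qed

text \<open>The class in \<open>M \<nu>\<close> of a column \<open>p\<close>, and the class in \<open>N \<nu>\<close> of a row \<open>s\<close>.\<close>

definition YM :: "(nat \<Rightarrow> nat) \<Rightarrow> ((nat \<Rightarrow> nat) \<Rightarrow> 'k hecke) \<Rightarrow> 'm" where
  "YM \<nu> p = mkM (\<lambda>\<alpha>. cs \<nu> \<nu> \<alpha> (p \<alpha>))"

definition ZN :: "(nat \<Rightarrow> nat) \<Rightarrow> ((nat \<Rightarrow> nat) \<Rightarrow> 'k hecke) \<Rightarrow> 'm" where
  "ZN \<nu> s = mkM (\<lambda>\<alpha>. cs \<nu> \<alpha> \<nu> (s \<alpha>))"

lemma colD: "p \<in> col \<nu> \<Longrightarrow> \<alpha> \<in> I \<Longrightarrow> p \<alpha> \<in> MM \<nu> \<alpha>" and rowD: "s \<in> row \<nu> \<Longrightarrow> \<alpha> \<in> I \<Longrightarrow> s \<alpha> \<in> MM \<alpha> \<nu>"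
  by simp_all

lemma colH: "p \<in> col \<nu> \<Longrightarrow> \<alpha> \<in> I \<Longrightarrow> p \<alpha> \<in> carrier H" and rowH: "s \<in> row \<nu> \<Longrightarrow> \<alpha> \<in> I \<Longrightarrow> s \<alpha> \<in> carrier H"
  using MM_closed by auto

lemma cM_YM: "\<alpha> \<in> I \<Longrightarrow> cM (YM \<nu> p) \<alpha> = cs \<nu> \<nu> \<alpha> (p \<alpha>)" and cM_ZN: "\<alpha> \<in> I \<Longrightarrow> cM (ZN \<nu> s) \<alpha> = cs \<nu> \<alpha> \<nu> (s \<alpha>)"
  by (simp_all add: YM_def ZN_def cM_mkM)

lemma mkM_cM_mkM: "mkM (cM (mkM f)) = mkM f"
  by (rule mkM_cong) (rule cM_mkM)

lemma YM_closed: "p \<in> col \<nu> \<Longrightarrow> YM \<nu> p \<in> carrier (M \<nu>)" and ZN_closed: "s \<in> row \<nu> \<Longrightarrow> ZN \<nu> s \<in> carrier (N \<nu>)"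
  by (simp_all add: M_carrier N_carrier cM_YM cM_ZN M_quot_simps) (simp_all add: YM_def ZN_def mkM_cM_mkM)

text \<open>The classes are lifted simultaneously over \<open>I\<close>, so that elements of
  \<open>M \<nu>\<close> can be handled through columns of representatives.\<close>

lemma M_E: assumes "Y \<in> carrier (M \<nu>)" obtains p where "p \<in> col \<nu>" "Y = YM \<nu> p"
proof -
  have Y: "mkM (cM Y) = Y" "\<forall>\<alpha>\<in>I. \<exists>x\<in>MM \<nu> \<alpha>. cM Y \<alpha> = cs \<nu> \<nu> \<alpha> x" using assms by (auto simp: M_carrier M_quot_simps)
  from bchoice[of I "\<lambda>\<alpha> x. x \<in> MM \<nu> \<alpha> \<and> cM Y \<alpha> = cs \<nu> \<nu> \<alpha> x"] Y(2)
  obtain p where p: "\<forall>\<alpha>\<in>I. p \<alpha> \<in> MM \<nu> \<alpha> \<and> cM Y \<alpha> = cs \<nu> \<nu> \<alpha> (p \<alpha>)" by blast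
  have "mkM (cM Y) = YM \<nu> p" unfolding YM_def by (rule mkM_cong) (use p in blast)
  then show thesis using that[of p] p Y(1) by simp
qed

lemma N_E: assumes "Z \<in> carrier (N \<nu>)" obtains s where "s \<in> row \<nu>" "Z = ZN \<nu> s"
proof -
  have Z: "mkM (cM Z) = Z" "\<forall>\<alpha>\<in>I. \<exists>x\<in>MM \<alpha> \<nu>. cM Z \<alpha> = cs \<nu> \<alpha> \<nu> x" using assms by (auto simp: N_carrier M_quot_simps)
  from bchoice[of I "\<lambda>\<alpha> x. x \<in> MM \<alpha> \<nu> \<and> cM Z \<alpha> = cs \<nu> \<alpha> \<nu> x"] Z(2)
  obtain s where s: "\<forall>\<alpha>\<in>I. s \<alpha> \<in> MM \<alpha> \<nu> \<and> cM Z \<alpha> = cs \<nu> \<alpha> \<nu> (s \<alpha>)" by blast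
  have "mkM (cM Z) = ZN \<nu> s" unfolding ZN_def by (rule mkM_cong) (use s in blast)
  then show thesis using that[of s] s Z(1) by simp
qed

lemma YM_cong: "(\<And>\<alpha>. \<alpha> \<in> I \<Longrightarrow> p \<alpha> = p' \<alpha>) \<Longrightarrow> YM \<nu> p = YM \<nu> p'"
  and ZN_cong: "(\<And>\<alpha>. \<alpha> \<in> I \<Longrightarrow> p \<alpha> = p' \<alpha>) \<Longrightarrow> ZN \<nu> p = ZN \<nu> p'"
  unfolding YM_def ZN_def by (rule mkM_cong; simp)+

lemma YM_eqI: "p \<in> col \<nu> \<Longrightarrow> p' \<in> col \<nu> \<Longrightarrow> (\<And>\<alpha>. \<alpha> \<in> I \<Longrightarrow> p \<alpha> \<ominus>\<^bsub>H\<^esub> p' \<alpha> \<in> M_gt \<nu> \<nu> \<alpha>) \<Longrightarrow> YM \<nu> p = YM \<nu> p'"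
  unfolding YM_def by (rule mkM_cong, rule cs_eqI) (use MM_closed in auto)

lemma ZN_eqI: "p \<in> row \<nu> \<Longrightarrow> p' \<in> row \<nu> \<Longrightarrow> (\<And>\<alpha>. \<alpha> \<in> I \<Longrightarrow> p \<alpha> \<ominus>\<^bsub>H\<^esub> p' \<alpha> \<in> M_gt \<nu> \<alpha> \<nu>) \<Longrightarrow> ZN \<nu> p = ZN \<nu> p'"
  unfolding ZN_def by (rule mkM_cong, rule cs_eqI) (use MM_closed in auto)

lemma YM_zero: "\<zero>\<^bsub>M \<nu>\<^esub> = YM \<nu> (\<lambda>_. \<zero>\<^bsub>H\<^esub>)" and ZN_zero: "\<zero>\<^bsub>N \<nu>\<^esub> = ZN \<nu> (\<lambda>_. \<zero>\<^bsub>H\<^esub>)"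
  by (simp_all add: M_zero N_zero YM_def ZN_def M_quot_simps)

lemma YM_add: "p \<in> col \<nu> \<Longrightarrow> p' \<in> col \<nu> \<Longrightarrow> YM \<nu> p \<oplus>\<^bsub>M \<nu>\<^esub> YM \<nu> p' = YM \<nu> (\<lambda>\<alpha>. p \<alpha> \<oplus>\<^bsub>H\<^esub> p' \<alpha>)"
  unfolding M_add YM_def[of _ "\<lambda>\<alpha>. p \<alpha> \<oplus>\<^bsub>H\<^esub> p' \<alpha>"] by (rule mkM_cong) (use colH[of p \<nu>] colH[of p' \<nu>] in \<open>simp add: cM_YM M_quot_add\<close>)

lemma ZN_add: "p \<in> row \<nu> \<Longrightarrow> p' \<in> row \<nu> \<Longrightarrow> ZN \<nu> p \<oplus>\<^bsub>N \<nu>\<^esub> ZN \<nu> p' = ZN \<nu> (\<lambda>\<alpha>. p \<alpha> \<oplus>\<^bsub>H\<^esub> p' \<alpha>)"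
  unfolding N_add ZN_def[of _ "\<lambda>\<alpha>. p \<alpha> \<oplus>\<^bsub>H\<^esub> p' \<alpha>"] by (rule mkM_cong) (use rowH[of p \<nu>] rowH[of p' \<nu>] in \<open>simp add: cM_ZN M_quot_add\<close>)

lemma YM_smult: "c \<in> carrier K \<Longrightarrow> p \<in> col \<nu> \<Longrightarrow> c \<odot>\<^bsub>M \<nu>\<^esub> YM \<nu> p = YM \<nu> (\<lambda>\<alpha>. c \<odot>\<^bsub>H\<^esub> p \<alpha>)"
  unfolding M_smult YM_def[of _ "\<lambda>\<alpha>. c \<odot>\<^bsub>H\<^esub> p \<alpha>"] by (rule mkM_cong) (use colH[of p \<nu>] in \<open>simp add: cM_YM M_quot_smult\<close>)

lemma ZN_smult: "c \<in> carrier K \<Longrightarrow> p \<in> row \<nu> \<Longrightarrow> c \<odot>\<^bsub>N \<nu>\<^esub> ZN \<nu> p = ZN \<nu> (\<lambda>\<alpha>. c \<odot>\<^bsub>H\<^esub> p \<alpha>)"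
  unfolding N_smult ZN_def[of _ "\<lambda>\<alpha>. c \<odot>\<^bsub>H\<^esub> p \<alpha>"] by (rule mkM_cong) (use rowH[of p \<nu>] in \<open>simp add: cM_ZN M_quot_smult\<close>)

lemma col_ops:
  "(\<lambda>_. \<zero>\<^bsub>H\<^esub>) \<in> col \<nu>" "p \<in> col \<nu> \<Longrightarrow> p' \<in> col \<nu> \<Longrightarrow> (\<lambda>\<alpha>. p \<alpha> \<oplus>\<^bsub>H\<^esub> p' \<alpha>) \<in> col \<nu>"
  "c \<in> carrier K \<Longrightarrow> p \<in> col \<nu> \<Longrightarrow> (\<lambda>\<alpha>. c \<odot>\<^bsub>H\<^esub> p \<alpha>) \<in> col \<nu>"
  by (simp_all add: MM_zero MM_add MM_smult)

lemma row_ops: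
  "(\<lambda>_. \<zero>\<^bsub>H\<^esub>) \<in> row \<nu>" "p \<in> row \<nu> \<Longrightarrow> p' \<in> row \<nu> \<Longrightarrow> (\<lambda>\<alpha>. p \<alpha> \<oplus>\<^bsub>H\<^esub> p' \<alpha>) \<in> row \<nu>"
  "c \<in> carrier K \<Longrightarrow> p \<in> row \<nu> \<Longrightarrow> (\<lambda>\<alpha>. c \<odot>\<^bsub>H\<^esub> p \<alpha>) \<in> row \<nu>"
  by (simp_all add: MM_zero MM_add MM_smult)

lemma module_M: "module K (M \<nu>)"
proof (rule moduleI[OF is_cring])
  show "abelian_group (M \<nu>)"
  proof (rule abelian_groupI)
    fix Y assume "Y \<in> carrier (M \<nu>)"
    then obtain p where p: "p \<in> col \<nu>" "Y = YM \<nu> p" by (rule M_E)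
    have np: "(\<lambda>\<alpha>. (\<ominus> \<one>) \<odot>\<^bsub>H\<^esub> p \<alpha>) \<in> col \<nu>" by (rule col_ops(3)[OF _ p(1)]) simp
    have "YM \<nu> (\<lambda>\<alpha>. (\<ominus> \<one>) \<odot>\<^bsub>H\<^esub> p \<alpha>) \<oplus>\<^bsub>M \<nu>\<^esub> Y = \<zero>\<^bsub>M \<nu>\<^esub>"
      unfolding p(2) YM_add[OF np p(1)] YM_zero
      by (rule YM_cong) (use colH[OF p(1)] in \<open>simp add: neg_smult[symmetric] Hk.M.l_neg\<close>)
    then show "\<exists>X\<in>carrier (M \<nu>). X \<oplus>\<^bsub>M \<nu>\<^esub> Y = \<zero>\<^bsub>M \<nu>\<^esub>" using YM_closed[OF np] by blast
    fix X assume "X \<in> carrier (M \<nu>)"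
    then obtain p' where p': "p' \<in> col \<nu>" "X = YM \<nu> p'" by (rule M_E)
    show "Y \<oplus>\<^bsub>M \<nu>\<^esub> X \<in> carrier (M \<nu>)"
      unfolding p(2) p'(2) YM_add[OF p(1) p'(1)] by (rule YM_closed[OF col_ops(2)[OF p(1) p'(1)]])
    show "Y \<oplus>\<^bsub>M \<nu>\<^esub> X = X \<oplus>\<^bsub>M \<nu>\<^esub> Y"
      unfolding p(2) p'(2) YM_add[OF p(1) p'(1)] YM_add[OF p'(1) p(1)]
      by (rule YM_cong) (simp add: colH[OF p(1)] colH[OF p'(1)] Hk.M.a_comm)
    show "\<zero>\<^bsub>M \<nu>\<^esub> \<oplus>\<^bsub>M \<nu>\<^esub> Y = Y"
      unfolding p(2) YM_zero YM_add[OF col_ops(1) p(1)] by (rule YM_cong) (simp add: colH[OF p(1)])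
    fix Z assume "Z \<in> carrier (M \<nu>)"
    then obtain r where r: "r \<in> col \<nu>" "Z = YM \<nu> r" by (rule M_E)
    show "Y \<oplus>\<^bsub>M \<nu>\<^esub> X \<oplus>\<^bsub>M \<nu>\<^esub> Z = Y \<oplus>\<^bsub>M \<nu>\<^esub> (X \<oplus>\<^bsub>M \<nu>\<^esub> Z)"
      unfolding p(2) p'(2) r(2) YM_add[OF p(1) p'(1)] YM_add[OF p'(1) r(1)]
        YM_add[OF col_ops(2)[OF p(1) p'(1)] r(1)] YM_add[OF p(1) col_ops(2)[OF p'(1) r(1)]]
      by (rule YM_cong) (simp add: colH[OF p(1)] colH[OF p'(1)] colH[OF r(1)] Hk.M.a_assoc)
  qed (simp add: YM_zero YM_closed[OF col_ops(1)])
next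
  fix c d Y X assume c: "c \<in> carrier K" "d \<in> carrier K" and "Y \<in> carrier (M \<nu>)" "X \<in> carrier (M \<nu>)"
  then obtain p p' where p: "p \<in> col \<nu>" "Y = YM \<nu> p" and p': "p' \<in> col \<nu>" "X = YM \<nu> p'" by (elim M_E) blast
  note cl = col_ops(3)[OF c(1) p(1)] col_ops(3)[OF c(2) p(1)] col_ops(3)[OF c(1) p'(1)]
  show "c \<odot>\<^bsub>M \<nu>\<^esub> Y \<in> carrier (M \<nu>)"
    unfolding p(2) YM_smult[OF c(1) p(1)] by (rule YM_closed[OF cl(1)])
  show "(c \<oplus> d) \<odot>\<^bsub>M \<nu>\<^esub> Y = c \<odot>\<^bsub>M \<nu>\<^esub> Y \<oplus>\<^bsub>M \<nu>\<^esub> d \<odot>\<^bsub>M \<nu>\<^esub> Y"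
    unfolding p(2) YM_smult[OF c(1) p(1)] YM_smult[OF c(2) p(1)] YM_smult[OF a_closed[OF c] p(1)] YM_add[OF cl(1,2)]
    by (rule YM_cong) (simp add: colH[OF p(1)] c Hk.smult_l_distr)
  show "c \<odot>\<^bsub>M \<nu>\<^esub> (Y \<oplus>\<^bsub>M \<nu>\<^esub> X) = c \<odot>\<^bsub>M \<nu>\<^esub> Y \<oplus>\<^bsub>M \<nu>\<^esub> c \<odot>\<^bsub>M \<nu>\<^esub> X"
    unfolding p(2) p'(2) YM_add[OF p(1) p'(1)] YM_smult[OF c(1) p(1)] YM_smult[OF c(1) p'(1)]
      YM_smult[OF c(1) col_ops(2)[OF p(1) p'(1)]] YM_add[OF cl(1,3)]
    by (rule YM_cong) (simp add: colH[OF p(1)] colH[OF p'(1)] c Hk.smult_r_distr)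
  show "(c \<otimes> d) \<odot>\<^bsub>M \<nu>\<^esub> Y = c \<odot>\<^bsub>M \<nu>\<^esub> (d \<odot>\<^bsub>M \<nu>\<^esub> Y)"
    unfolding p(2) YM_smult[OF c(2) p(1)] YM_smult[OF m_closed[OF c] p(1)] YM_smult[OF c(1) cl(2)]
    by (rule YM_cong) (simp add: colH[OF p(1)] c Hk.smult_assoc1)
next
  fix Y assume "Y \<in> carrier (M \<nu>)"
  then obtain p where p: "p \<in> col \<nu>" "Y = YM \<nu> p" by (rule M_E)
  show "\<one> \<odot>\<^bsub>M \<nu>\<^esub> Y = Y"
    unfolding p(2) YM_smult[OF one_closed p(1)] by (rule YM_cong) (simp add: colH[OF p(1)])
qed

lemma module_N: "module K (N \<nu>)"
proof (rule moduleI[OF is_cring])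
  show "abelian_group (N \<nu>)"
  proof (rule abelian_groupI)
    fix Y assume "Y \<in> carrier (N \<nu>)"
    then obtain p where p: "p \<in> row \<nu>" "Y = ZN \<nu> p" by (rule N_E)
    have np: "(\<lambda>\<alpha>. (\<ominus> \<one>) \<odot>\<^bsub>H\<^esub> p \<alpha>) \<in> row \<nu>" by (rule row_ops(3)[OF _ p(1)]) simp
    have "ZN \<nu> (\<lambda>\<alpha>. (\<ominus> \<one>) \<odot>\<^bsub>H\<^esub> p \<alpha>) \<oplus>\<^bsub>N \<nu>\<^esub> Y = \<zero>\<^bsub>N \<nu>\<^esub>"
      unfolding p(2) ZN_add[OF np p(1)] ZN_zero
      by (rule ZN_cong) (use rowH[OF p(1)] in \<open>simp add: neg_smult[symmetric] Hk.M.l_neg\<close>)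
    then show "\<exists>X\<in>carrier (N \<nu>). X \<oplus>\<^bsub>N \<nu>\<^esub> Y = \<zero>\<^bsub>N \<nu>\<^esub>" using ZN_closed[OF np] by blast
    fix X assume "X \<in> carrier (N \<nu>)"
    then obtain p' where p': "p' \<in> row \<nu>" "X = ZN \<nu> p'" by (rule N_E)
    show "Y \<oplus>\<^bsub>N \<nu>\<^esub> X \<in> carrier (N \<nu>)"
      unfolding p(2) p'(2) ZN_add[OF p(1) p'(1)] by (rule ZN_closed[OF row_ops(2)[OF p(1) p'(1)]])
    show "Y \<oplus>\<^bsub>N \<nu>\<^esub> X = X \<oplus>\<^bsub>N \<nu>\<^esub> Y"
      unfolding p(2) p'(2) ZN_add[OF p(1) p'(1)] ZN_add[OF p'(1) p(1)]
      by (rule ZN_cong) (simp add: rowH[OF p(1)] rowH[OF p'(1)] Hk.M.a_comm)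
    show "\<zero>\<^bsub>N \<nu>\<^esub> \<oplus>\<^bsub>N \<nu>\<^esub> Y = Y"
      unfolding p(2) ZN_zero ZN_add[OF row_ops(1) p(1)] by (rule ZN_cong) (simp add: rowH[OF p(1)])
    fix Z assume "Z \<in> carrier (N \<nu>)"
    then obtain r where r: "r \<in> row \<nu>" "Z = ZN \<nu> r" by (rule N_E)
    show "Y \<oplus>\<^bsub>N \<nu>\<^esub> X \<oplus>\<^bsub>N \<nu>\<^esub> Z = Y \<oplus>\<^bsub>N \<nu>\<^esub> (X \<oplus>\<^bsub>N \<nu>\<^esub> Z)"
      unfolding p(2) p'(2) r(2) ZN_add[OF p(1) p'(1)] ZN_add[OF p'(1) r(1)]
        ZN_add[OF row_ops(2)[OF p(1) p'(1)] r(1)] ZN_add[OF p(1) row_ops(2)[OF p'(1) r(1)]]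
      by (rule ZN_cong) (simp add: rowH[OF p(1)] rowH[OF p'(1)] rowH[OF r(1)] Hk.M.a_assoc)
  qed (simp add: ZN_zero ZN_closed[OF row_ops(1)])
next
  fix c d Y X assume c: "c \<in> carrier K" "d \<in> carrier K" and "Y \<in> carrier (N \<nu>)" "X \<in> carrier (N \<nu>)"
  then obtain p p' where p: "p \<in> row \<nu>" "Y = ZN \<nu> p" and p': "p' \<in> row \<nu>" "X = ZN \<nu> p'" by (elim N_E) blast
  note cl = row_ops(3)[OF c(1) p(1)] row_ops(3)[OF c(2) p(1)] row_ops(3)[OF c(1) p'(1)]
  show "c \<odot>\<^bsub>N \<nu>\<^esub> Y \<in> carrier (N \<nu>)"
    unfolding p(2) ZN_smult[OF c(1) p(1)] by (rule ZN_closed[OF cl(1)])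
  show "(c \<oplus> d) \<odot>\<^bsub>N \<nu>\<^esub> Y = c \<odot>\<^bsub>N \<nu>\<^esub> Y \<oplus>\<^bsub>N \<nu>\<^esub> d \<odot>\<^bsub>N \<nu>\<^esub> Y"
    unfolding p(2) ZN_smult[OF c(1) p(1)] ZN_smult[OF c(2) p(1)] ZN_smult[OF a_closed[OF c] p(1)] ZN_add[OF cl(1,2)]
    by (rule ZN_cong) (simp add: rowH[OF p(1)] c Hk.smult_l_distr)
  show "c \<odot>\<^bsub>N \<nu>\<^esub> (Y \<oplus>\<^bsub>N \<nu>\<^esub> X) = c \<odot>\<^bsub>N \<nu>\<^esub> Y \<oplus>\<^bsub>N \<nu>\<^esub> c \<odot>\<^bsub>N \<nu>\<^esub> X"
    unfolding p(2) p'(2) ZN_add[OF p(1) p'(1)] ZN_smult[OF c(1) p(1)] ZN_smult[OF c(1) p'(1)]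
      ZN_smult[OF c(1) row_ops(2)[OF p(1) p'(1)]] ZN_add[OF cl(1,3)]
    by (rule ZN_cong) (simp add: rowH[OF p(1)] rowH[OF p'(1)] c Hk.smult_r_distr)
  show "(c \<otimes> d) \<odot>\<^bsub>N \<nu>\<^esub> Y = c \<odot>\<^bsub>N \<nu>\<^esub> (d \<odot>\<^bsub>N \<nu>\<^esub> Y)"
    unfolding p(2) ZN_smult[OF c(2) p(1)] ZN_smult[OF m_closed[OF c] p(1)] ZN_smult[OF c(1) cl(2)]
    by (rule ZN_cong) (simp add: rowH[OF p(1)] c Hk.smult_assoc1)
next
  fix Y assume "Y \<in> carrier (N \<nu>)"
  then obtain p where p: "p \<in> row \<nu>" "Y = ZN \<nu> p" by (rule N_E)
  show "\<one> \<odot>\<^bsub>N \<nu>\<^esub> Y = Y"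
    unfolding p(2) ZN_smult[OF one_closed p(1)] by (rule ZN_cong) (simp add: rowH[OF p(1)])
qed

section \<open>Actions on representatives and the bimodule axioms\<close>

definition lv :: "'a \<Rightarrow> ((nat \<Rightarrow> nat) \<Rightarrow> 'k hecke) \<Rightarrow> (nat \<Rightarrow> nat) \<Rightarrow> 'k hecke" where
  "lv x p = (\<lambda>\<beta>. dot (\<lambda>\<alpha>. comp x \<alpha> \<beta>) p)"

definition rv :: "((nat \<Rightarrow> nat) \<Rightarrow> 'k hecke) \<Rightarrow> 'a \<Rightarrow> (nat \<Rightarrow> nat) \<Rightarrow> 'k hecke" where
  "rv s x = (\<lambda>\<alpha>. dot s (comp x \<alpha>))"

lemma lv_col: "x \<in> carrier A \<Longrightarrow> p \<in> col \<nu> \<Longrightarrow> lv x p \<in> col \<nu>"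
  unfolding lv_def using dot_closed[OF A_row] by blast

lemma rv_row: "x \<in> carrier A \<Longrightarrow> s \<in> row \<nu> \<Longrightarrow> rv s x \<in> row \<nu>"
  unfolding rv_def using dot_closed[OF _ A_col] by blast

lemma lact_YM:
  assumes x: "x \<in> carrier A" and p: "p \<in> col \<nu>"
  shows "lact (M \<nu>) (acs \<nu> x) (YM \<nu> p) = YM \<nu> (lv x p)"
proof -
  have "lact (M \<nu>) (acs \<nu> x) (YM \<nu> p) = mkM (\<lambda>\<beta>. \<Oplus>\<^bsub>M_quot \<nu> \<nu> \<beta>\<^esub>\<alpha>\<in>I. qcirc \<nu> \<nu> \<alpha> \<beta> ((\<lambda>x. comp x \<alpha> \<beta>) ` acs \<nu> x) (cM (YM \<nu> p) \<alpha>))"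
    by (rule M_lact[OF _ YM_closed[OF p]]) (use A_comp[OF x] in \<open>simp add: comp_image[OF x] M_quot_simps\<close>)
  also have "\<dots> = YM \<nu> (lv x p)"
    unfolding YM_def[of _ "lv x p"]
  proof (rule mkM_cong)
    fix \<beta> assume \<beta>: "\<beta> \<in> I"
    interpret Mq: abelian_group "M_quot \<nu> \<nu> \<beta>" by (rule abelian_group_M_quot)
    have c: "circ \<alpha> (comp x \<alpha> \<beta>) (p \<alpha>) \<in> MM \<nu> \<beta>" if "\<alpha> \<in> I" for \<alpha>
      by (rule circ_closed[OF A_comp[OF x that \<beta>] colD[OF p that]])
    have "(\<Oplus>\<^bsub>M_quot \<nu> \<nu> \<beta>\<^esub>\<alpha>\<in>I. qcirc \<nu> \<nu> \<alpha> \<beta> ((\<lambda>x. comp x \<alpha> \<beta>) ` acs \<nu> x) (cM (YM \<nu> p) \<alpha>))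
        = (\<Oplus>\<^bsub>M_quot \<nu> \<nu> \<beta>\<^esub>\<alpha>\<in>I. cs \<nu> \<nu> \<beta> (circ \<alpha> (comp x \<alpha> \<beta>) (p \<alpha>)))"
      by (rule Mq.finsum_cong')
        (use c \<beta> in \<open>auto simp: comp_image[OF x] cM_YM qcirc_cs[OF A_comp[OF x] colD[OF p]] M_quot_simps\<close>)
    then show "(\<Oplus>\<^bsub>M_quot \<nu> \<nu> \<beta>\<^esub>\<alpha>\<in>I. qcirc \<nu> \<nu> \<alpha> \<beta> ((\<lambda>x. comp x \<alpha> \<beta>) ` acs \<nu> x) (cM (YM \<nu> p) \<alpha>)) = cs \<nu> \<nu> \<beta> (lv x p \<beta>)"
      using finsum_cs[OF finite_I c, where \<nu> = \<nu>] by (simp add: lv_def dot_def)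
  qed
  finally show ?thesis .
qed

lemma ract_ZN:
  assumes x: "x \<in> carrier A" and s: "s \<in> row \<nu>"
  shows "ract (N \<nu>) (ZN \<nu> s) (acs \<nu> x) = ZN \<nu> (rv s x)"
proof -
  have "ract (N \<nu>) (ZN \<nu> s) (acs \<nu> x) = mkM (\<lambda>\<alpha>. \<Oplus>\<^bsub>M_quot \<nu> \<alpha> \<nu>\<^esub>\<beta>\<in>I. qcirc \<nu> \<alpha> \<beta> \<nu> (cM (ZN \<nu> s) \<beta>) ((\<lambda>x. comp x \<alpha> \<beta>) ` acs \<nu> x))"
    by (rule N_ract[OF _ ZN_closed[OF s]]) (use A_comp[OF x] in \<open>simp add: comp_image[OF x] M_quot_simps\<close>)
  also have "\<dots> = ZN \<nu> (rv s x)"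
    unfolding ZN_def[of _ "rv s x"]
  proof (rule mkM_cong)
    fix \<alpha> assume \<alpha>: "\<alpha> \<in> I"
    interpret Mq: abelian_group "M_quot \<nu> \<alpha> \<nu>" by (rule abelian_group_M_quot)
    have c: "circ \<beta> (s \<beta>) (comp x \<alpha> \<beta>) \<in> MM \<alpha> \<nu>" if "\<beta> \<in> I" for \<beta>
      by (rule circ_closed[OF rowD[OF s that] A_comp[OF x \<alpha> that]])
    have "(\<Oplus>\<^bsub>M_quot \<nu> \<alpha> \<nu>\<^esub>\<beta>\<in>I. qcirc \<nu> \<alpha> \<beta> \<nu> (cM (ZN \<nu> s) \<beta>) ((\<lambda>x. comp x \<alpha> \<beta>) ` acs \<nu> x))
        = (\<Oplus>\<^bsub>M_quot \<nu> \<alpha> \<nu>\<^esub>\<beta>\<in>I. cs \<nu> \<alpha> \<nu> (circ \<beta> (s \<beta>) (comp x \<alpha> \<beta>)))"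
      by (rule Mq.finsum_cong')
        (use c \<alpha> in \<open>auto simp: comp_image[OF x] cM_ZN qcirc_cs[OF rowD[OF s] A_comp[OF x]] M_quot_simps\<close>)
    then show "(\<Oplus>\<^bsub>M_quot \<nu> \<alpha> \<nu>\<^esub>\<beta>\<in>I. qcirc \<nu> \<alpha> \<beta> \<nu> (cM (ZN \<nu> s) \<beta>) ((\<lambda>x. comp x \<alpha> \<beta>) ` acs \<nu> x)) = cs \<nu> \<alpha> \<nu> (rv s x \<alpha>)"
      using finsum_cs[OF finite_I c, where \<nu> = \<nu>] by (simp add: rv_def dot_def)
  qed
  finally show ?thesis .
qed

lemma ract_YM:
  assumes c: "c \<in> carrier K" and p: "p \<in> col \<nu>"
  shows "ract (M \<nu>) (YM \<nu> p) (kcs \<nu> c) = YM \<nu> (\<lambda>\<alpha>. c \<odot>\<^bsub>H\<^esub> p \<alpha>)"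
  unfolding M_ract of_base_kcs[OF c] YM_def[of _ "\<lambda>\<alpha>. c \<odot>\<^bsub>H\<^esub> p \<alpha>"]
proof (rule mkM_cong)
  fix \<alpha> assume \<alpha>: "\<alpha> \<in> I"
  have "circ \<nu> (p \<alpha>) (c \<odot>\<^bsub>H\<^esub> m \<nu>) = c \<odot>\<^bsub>H\<^esub> p \<alpha>"
    using circ_smult_r[OF c colD[OF p \<alpha>] m_MM] circ_m_r[OF colD[OF p \<alpha>]] by simp
  then show "qcirc \<nu> \<nu> \<nu> \<alpha> (cM (YM \<nu> p) \<alpha>) (cs \<nu> \<nu> \<nu> (c \<odot>\<^bsub>H\<^esub> m \<nu>)) = cs \<nu> \<nu> \<alpha> (c \<odot>\<^bsub>H\<^esub> p \<alpha>)"
    using qcirc_cs[OF colD[OF p \<alpha>] MM_smult[OF c m_MM]] by (simp add: cM_YM \<alpha>)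
qed

lemma lact_ZN:
  assumes c: "c \<in> carrier K" and s: "s \<in> row \<nu>"
  shows "lact (N \<nu>) (kcs \<nu> c) (ZN \<nu> s) = ZN \<nu> (\<lambda>\<alpha>. c \<odot>\<^bsub>H\<^esub> s \<alpha>)"
  unfolding N_lact of_base_kcs[OF c] ZN_def[of _ "\<lambda>\<alpha>. c \<odot>\<^bsub>H\<^esub> s \<alpha>"]
proof (rule mkM_cong)
  fix \<alpha> assume \<alpha>: "\<alpha> \<in> I"
  have "circ \<nu> (c \<odot>\<^bsub>H\<^esub> m \<nu>) (s \<alpha>) = c \<odot>\<^bsub>H\<^esub> s \<alpha>"
    using circ_smult_l[OF c m_MM rowD[OF s \<alpha>]] circ_m_l[OF rowD[OF s \<alpha>]] by simp
  then show "qcirc \<nu> \<alpha> \<nu> \<nu> (cs \<nu> \<nu> \<nu> (c \<odot>\<^bsub>H\<^esub> m \<nu>)) (cM (ZN \<nu> s) \<alpha>) = cs \<nu> \<alpha> \<nu> (c \<odot>\<^bsub>H\<^esub> s \<alpha>)"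
    using qcirc_cs[OF MM_smult[OF c m_MM] rowD[OF s \<alpha>]] by (simp add: cM_ZN \<alpha>)
qed

lemma lv_ops:
  assumes x: "x \<in> carrier A" and y: "y \<in> carrier A" and p: "p \<in> col \<nu>" and p': "p' \<in> col \<nu>" and c: "c \<in> carrier K" and \<beta>: "\<beta> \<in> I"
  shows "lv (x \<oplus>\<^bsub>A\<^esub> y) p \<beta> = lv x p \<beta> \<oplus>\<^bsub>H\<^esub> lv y p \<beta>"
    and "lv x (\<lambda>\<alpha>. p \<alpha> \<oplus>\<^bsub>H\<^esub> p' \<alpha>) \<beta> = lv x p \<beta> \<oplus>\<^bsub>H\<^esub> lv x p' \<beta>"
    and "lv (x \<otimes>\<^bsub>A\<^esub> y) p \<beta> = lv x (lv y p) \<beta>"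
    and "lv \<one>\<^bsub>A\<^esub> p \<beta> = p \<beta>"
    and "lv (c \<odot>\<^bsub>A\<^esub> x) p \<beta> = c \<odot>\<^bsub>H\<^esub> lv x p \<beta>"
    and "lv x (\<lambda>\<alpha>. c \<odot>\<^bsub>H\<^esub> p \<alpha>) \<beta> = c \<odot>\<^bsub>H\<^esub> lv x p \<beta>"
proof -
  note rx = A_row[OF x \<beta>] and ry = A_row[OF y \<beta>]
  have "dot (\<lambda>\<alpha>. comp (x \<oplus>\<^bsub>A\<^esub> y) \<alpha> \<beta>) p = dot (\<lambda>\<alpha>. comp x \<alpha> \<beta> \<oplus>\<^bsub>H\<^esub> comp y \<alpha> \<beta>) p"
    by (rule dot_cong_l[OF _ row_ops(2)[OF rx ry] p]) (use x y \<beta> in simp)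
  then show "lv (x \<oplus>\<^bsub>A\<^esub> y) p \<beta> = lv x p \<beta> \<oplus>\<^bsub>H\<^esub> lv y p \<beta>" unfolding lv_def using dot_add_l[OF rx ry p] by simp
  show "lv x (\<lambda>\<alpha>. p \<alpha> \<oplus>\<^bsub>H\<^esub> p' \<alpha>) \<beta> = lv x p \<beta> \<oplus>\<^bsub>H\<^esub> lv x p' \<beta>" unfolding lv_def by (rule dot_add_r[OF rx p p'])
  have "dot (\<lambda>\<alpha>. comp (x \<otimes>\<^bsub>A\<^esub> y) \<alpha> \<beta>) p = dot (\<lambda>\<alpha>. dot (\<lambda>\<delta>. comp x \<delta> \<beta>) (comp y \<alpha>)) p"
    by (rule dot_cong_l[OF _ _ p, where \<beta> = \<beta>]) (use x y \<beta> dot_closed[OF rx A_col[OF y]] in \<open>auto simp: comp_mult\<close>)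
  also have "\<dots> = dot (\<lambda>\<delta>. comp x \<delta> \<beta>) (\<lambda>\<delta>. dot (\<lambda>\<alpha>. comp y \<alpha> \<delta>) p)" by (rule dot_assoc[OF rx A_col[OF y] p])
  finally show "lv (x \<otimes>\<^bsub>A\<^esub> y) p \<beta> = lv x (lv y p) \<beta>" unfolding lv_def .
  have "dot (\<lambda>\<alpha>. comp \<one>\<^bsub>A\<^esub> \<alpha> \<beta>) p = dot (\<lambda>\<kappa>. if \<kappa> = \<beta> then m \<kappa> else \<zero>\<^bsub>H\<^esub>) p"
    by (rule dot_cong_l[OF _ _ p]) (use \<beta> m_MM MM_zero in \<open>auto simp: comp_one\<close>)
  then show "lv \<one>\<^bsub>A\<^esub> p \<beta> = p \<beta>" unfolding lv_def using dot_unit_l[OF \<beta> p] by simp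
  have "dot (\<lambda>\<alpha>. comp (c \<odot>\<^bsub>A\<^esub> x) \<alpha> \<beta>) p = dot (\<lambda>\<alpha>. c \<odot>\<^bsub>H\<^esub> comp x \<alpha> \<beta>) p"
    by (rule dot_cong_l[OF _ row_ops(3)[OF c rx] p]) (use x c \<beta> in simp)
  then show "lv (c \<odot>\<^bsub>A\<^esub> x) p \<beta> = c \<odot>\<^bsub>H\<^esub> lv x p \<beta>" unfolding lv_def using dot_smult_l[OF c rx p] by simp
  show "lv x (\<lambda>\<alpha>. c \<odot>\<^bsub>H\<^esub> p \<alpha>) \<beta> = c \<odot>\<^bsub>H\<^esub> lv x p \<beta>" unfolding lv_def by (rule dot_smult_r[OF c rx p])
qed

lemma rv_ops:
  assumes x: "x \<in> carrier A" and y: "y \<in> carrier A" and s: "s \<in> row \<nu>" and s': "s' \<in> row \<nu>" and c: "c \<in> carrier K" and \<alpha>: "\<alpha> \<in> I"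
  shows "rv s (x \<oplus>\<^bsub>A\<^esub> y) \<alpha> = rv s x \<alpha> \<oplus>\<^bsub>H\<^esub> rv s y \<alpha>"
    and "rv (\<lambda>\<alpha>. s \<alpha> \<oplus>\<^bsub>H\<^esub> s' \<alpha>) x \<alpha> = rv s x \<alpha> \<oplus>\<^bsub>H\<^esub> rv s' x \<alpha>"
    and "rv s (x \<otimes>\<^bsub>A\<^esub> y) \<alpha> = rv (rv s x) y \<alpha>"
    and "rv s \<one>\<^bsub>A\<^esub> \<alpha> = s \<alpha>"
    and "rv s (c \<odot>\<^bsub>A\<^esub> x) \<alpha> = c \<odot>\<^bsub>H\<^esub> rv s x \<alpha>"
    and "rv (\<lambda>\<alpha>. c \<odot>\<^bsub>H\<^esub> s \<alpha>) x \<alpha> = c \<odot>\<^bsub>H\<^esub> rv s x \<alpha>"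
proof -
  note cx = A_col[OF x \<alpha>] and cy = A_col[OF y \<alpha>]
  have "dot s (comp (x \<oplus>\<^bsub>A\<^esub> y) \<alpha>) = dot s (\<lambda>\<kappa>. comp x \<alpha> \<kappa> \<oplus>\<^bsub>H\<^esub> comp y \<alpha> \<kappa>)"
    by (rule dot_cong_r[OF _ s col_ops(2)[OF cx cy]]) (use x y \<alpha> in simp)
  then show "rv s (x \<oplus>\<^bsub>A\<^esub> y) \<alpha> = rv s x \<alpha> \<oplus>\<^bsub>H\<^esub> rv s y \<alpha>" unfolding rv_def using dot_add_r[OF s cx cy] by simp
  show "rv (\<lambda>\<alpha>. s \<alpha> \<oplus>\<^bsub>H\<^esub> s' \<alpha>) x \<alpha> = rv s x \<alpha> \<oplus>\<^bsub>H\<^esub> rv s' x \<alpha>" unfolding rv_def by (rule dot_add_l[OF s s' cx])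
  have "dot s (comp (x \<otimes>\<^bsub>A\<^esub> y) \<alpha>) = dot s (\<lambda>\<delta>. dot (\<lambda>\<kappa>. comp x \<kappa> \<delta>) (comp y \<alpha>))"
    by (rule dot_cong_r[OF _ s, where \<alpha> = \<alpha>]) (use x y \<alpha> dot_closed[OF A_row[OF x] cy] in \<open>auto simp: comp_mult\<close>)
  also have "\<dots> = dot (\<lambda>\<kappa>. dot s (comp x \<kappa>)) (comp y \<alpha>)" by (rule dot_assoc[OF s A_col[OF x] cy, symmetric])
  finally show "rv s (x \<otimes>\<^bsub>A\<^esub> y) \<alpha> = rv (rv s x) y \<alpha>" unfolding rv_def .
  have "dot s (comp \<one>\<^bsub>A\<^esub> \<alpha>) = dot s (\<lambda>\<kappa>. if \<alpha> = \<kappa> then m \<alpha> else \<zero>\<^bsub>H\<^esub>)"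
    by (rule dot_cong_r[OF _ s]) (use \<alpha> m_MM MM_zero in \<open>auto simp: comp_one\<close>)
  then show "rv s \<one>\<^bsub>A\<^esub> \<alpha> = s \<alpha>" unfolding rv_def using dot_unit_r[OF \<alpha> s] by simp
  have "dot s (comp (c \<odot>\<^bsub>A\<^esub> x) \<alpha>) = dot s (\<lambda>\<kappa>. c \<odot>\<^bsub>H\<^esub> comp x \<alpha> \<kappa>)"
    by (rule dot_cong_r[OF _ s col_ops(3)[OF c cx]]) (use x c \<alpha> in simp)
  then show "rv s (c \<odot>\<^bsub>A\<^esub> x) \<alpha> = c \<odot>\<^bsub>H\<^esub> rv s x \<alpha>" unfolding rv_def using dot_smult_r[OF c s cx] by simp
  show "rv (\<lambda>\<alpha>. c \<odot>\<^bsub>H\<^esub> s \<alpha>) x \<alpha> = c \<odot>\<^bsub>H\<^esub> rv s x \<alpha>" unfolding rv_def by (rule dot_smult_l[OF c s cx])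
qed

lemma bimodule_M: "bimodule K (AQ \<nu>) (KB \<nu>) (M \<nu>)"
proof (intro bimodule.intro bimodule_axioms.intro AQ_assoc KB_assoc module_M)
  fix W W' Y Y' assume W: "W \<in> carrier (AQ \<nu>)" "W' \<in> carrier (AQ \<nu>)" and Y: "Y \<in> carrier (M \<nu>)" "Y' \<in> carrier (M \<nu>)"
  obtain x where x: "x \<in> carrier A" "W = acs \<nu> x" using W(1) by (rule AQ_E)
  obtain y where y: "y \<in> carrier A" "W' = acs \<nu> y" using W(2) by (rule AQ_E)
  obtain p where p: "p \<in> col \<nu>" "Y = YM \<nu> p" using Y(1) by (rule M_E)
  obtain p' where p': "p' \<in> col \<nu>" "Y' = YM \<nu> p'" using Y(2) by (rule M_E)
  note xp = lv_col[OF x(1) p(1)] and yp = lv_col[OF y(1) p(1)] and xp' = lv_col[OF x(1) p'(1)]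
  note axp = lact_YM[OF x(1) p(1)] and ayp = lact_YM[OF y(1) p(1)] and axp' = lact_YM[OF x(1) p'(1)]
  show "lact (M \<nu>) W Y \<in> carrier (M \<nu>)"
    unfolding x(2) p(2) axp by (rule YM_closed[OF xp])
  show "lact (M \<nu>) (W \<oplus>\<^bsub>AQ \<nu>\<^esub> W') Y = lact (M \<nu>) W Y \<oplus>\<^bsub>M \<nu>\<^esub> lact (M \<nu>) W' Y"
    unfolding x(2) y(2) p(2) acs_add[OF x(1) y(1)] lact_YM[OF A_add_closed[OF x(1) y(1)] p(1)] axp ayp YM_add[OF xp yp]
    by (rule YM_cong) (rule lv_ops(1)[OF x(1) y(1) p(1) p(1) zero_closed])
  show "lact (M \<nu>) W (Y \<oplus>\<^bsub>M \<nu>\<^esub> Y') = lact (M \<nu>) W Y \<oplus>\<^bsub>M \<nu>\<^esub> lact (M \<nu>) W Y'"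
    unfolding x(2) p(2) p'(2) YM_add[OF p(1) p'(1)] lact_YM[OF x(1) col_ops(2)[OF p(1) p'(1)]] axp axp' YM_add[OF xp xp']
    by (rule YM_cong) (rule lv_ops(2)[OF x(1) y(1) p(1) p'(1) zero_closed])
  show "lact (M \<nu>) (W \<otimes>\<^bsub>AQ \<nu>\<^esub> W') Y = lact (M \<nu>) W (lact (M \<nu>) W' Y)"
    unfolding x(2) y(2) p(2) acs_mult[OF x(1) y(1)] lact_YM[OF A_mult_closed[OF x(1) y(1)] p(1)] ayp lact_YM[OF x(1) yp]
    by (rule YM_cong) (rule lv_ops(3)[OF x(1) y(1) p(1) p(1) zero_closed])
next
  fix Y assume Y: "Y \<in> carrier (M \<nu>)"
  obtain p where p: "p \<in> col \<nu>" "Y = YM \<nu> p" using Y by (rule M_E)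
  show "lact (M \<nu>) (\<one>\<^bsub>AQ \<nu>\<^esub>) Y = Y"
    unfolding p(2) acs_one lact_YM[OF A_one_closed p(1)]
    by (rule YM_cong) (rule lv_ops(4)[OF A_one_closed A_one_closed p(1) p(1) zero_closed])
  show "ract (M \<nu>) Y (\<one>\<^bsub>KB \<nu>\<^esub>) = Y"
    unfolding p(2) kcs_one ract_YM[OF one_closed p(1)] by (rule YM_cong) (simp add: colH[OF p(1)])
next
  fix k W Y assume k: "k \<in> carrier K" and W: "W \<in> carrier (AQ \<nu>)" and Y: "Y \<in> carrier (M \<nu>)"
  obtain x where x: "x \<in> carrier A" "W = acs \<nu> x" using W by (rule AQ_E)
  obtain p where p: "p \<in> col \<nu>" "Y = YM \<nu> p" using Y by (rule M_E)
  note xp = lv_col[OF x(1) p(1)]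
  show "lact (M \<nu>) (k \<odot>\<^bsub>AQ \<nu>\<^esub> W) Y = k \<odot>\<^bsub>M \<nu>\<^esub> lact (M \<nu>) W Y"
    unfolding x(2) p(2) acs_smult[OF k x(1)] lact_YM[OF A_smult_closed[OF k x(1)] p(1)] lact_YM[OF x(1) p(1)] YM_smult[OF k xp]
    by (rule YM_cong) (rule lv_ops(5)[OF x(1) x(1) p(1) p(1) k])
  show "lact (M \<nu>) W (k \<odot>\<^bsub>M \<nu>\<^esub> Y) = k \<odot>\<^bsub>M \<nu>\<^esub> lact (M \<nu>) W Y"
    unfolding x(2) p(2) YM_smult[OF k p(1)] lact_YM[OF x(1) col_ops(3)[OF k p(1)]] lact_YM[OF x(1) p(1)] YM_smult[OF k xp]
    by (rule YM_cong) (rule lv_ops(6)[OF x(1) x(1) p(1) p(1) k])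
next
  fix C C' Y Y' assume C: "C \<in> carrier (KB \<nu>)" "C' \<in> carrier (KB \<nu>)" and Y: "Y \<in> carrier (M \<nu>)" "Y' \<in> carrier (M \<nu>)"
  obtain c where c: "c \<in> carrier K" "C = kcs \<nu> c" using C(1) by (rule KB_E)
  obtain d where d: "d \<in> carrier K" "C' = kcs \<nu> d" using C(2) by (rule KB_E)
  obtain p where p: "p \<in> col \<nu>" "Y = YM \<nu> p" using Y(1) by (rule M_E)
  obtain p' where p': "p' \<in> col \<nu>" "Y' = YM \<nu> p'" using Y(2) by (rule M_E)
  note cp = col_ops(3)[OF c(1) p(1)] and dp = col_ops(3)[OF d(1) p(1)] and cp' = col_ops(3)[OF c(1) p'(1)]
  note h = colH[OF p(1)] colH[OF p'(1)]
  show "ract (M \<nu>) Y C \<in> carrier (M \<nu>)"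
    unfolding c(2) p(2) ract_YM[OF c(1) p(1)] by (rule YM_closed[OF cp])
  show "ract (M \<nu>) Y (C \<oplus>\<^bsub>KB \<nu>\<^esub> C') = ract (M \<nu>) Y C \<oplus>\<^bsub>M \<nu>\<^esub> ract (M \<nu>) Y C'"
    unfolding c(2) d(2) p(2) kcs_add[OF c(1) d(1)] ract_YM[OF a_closed[OF c(1) d(1)] p(1)] ract_YM[OF c(1) p(1)] ract_YM[OF d(1) p(1)] YM_add[OF cp dp]
    by (rule YM_cong) (simp add: h c(1) d(1) Hk.smult_l_distr)
  show "ract (M \<nu>) (Y \<oplus>\<^bsub>M \<nu>\<^esub> Y') C = ract (M \<nu>) Y C \<oplus>\<^bsub>M \<nu>\<^esub> ract (M \<nu>) Y' C"
    unfolding c(2) p(2) p'(2) YM_add[OF p(1) p'(1)] ract_YM[OF c(1) col_ops(2)[OF p(1) p'(1)]] ract_YM[OF c(1) p(1)] ract_YM[OF c(1) p'(1)] YM_add[OF cp cp']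
    by (rule YM_cong) (simp add: h c(1) Hk.smult_r_distr)
  show "ract (M \<nu>) Y (C \<otimes>\<^bsub>KB \<nu>\<^esub> C') = ract (M \<nu>) (ract (M \<nu>) Y C) C'"
    unfolding c(2) d(2) p(2) kcs_mult[OF c(1) d(1)] ract_YM[OF m_closed[OF c(1) d(1)] p(1)] ract_YM[OF c(1) p(1)] ract_YM[OF d(1) cp]
    by (rule YM_cong) (simp add: h c(1) d(1) Hk.smult_assoc1[symmetric] m_comm)
next
  fix k C Y assume k: "k \<in> carrier K" and C: "C \<in> carrier (KB \<nu>)" and Y: "Y \<in> carrier (M \<nu>)"
  obtain c where c: "c \<in> carrier K" "C = kcs \<nu> c" using C by (rule KB_E)
  obtain p where p: "p \<in> col \<nu>" "Y = YM \<nu> p" using Y by (rule M_E)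
  note cp = col_ops(3)[OF c(1) p(1)]
  show "ract (M \<nu>) Y (k \<odot>\<^bsub>KB \<nu>\<^esub> C) = k \<odot>\<^bsub>M \<nu>\<^esub> ract (M \<nu>) Y C"
    unfolding c(2) p(2) kcs_smult[OF k c(1)] ract_YM[OF m_closed[OF k c(1)] p(1)] ract_YM[OF c(1) p(1)] YM_smult[OF k cp]
    by (rule YM_cong) (simp add: colH[OF p(1)] c(1) k Hk.smult_assoc1)
  show "ract (M \<nu>) (k \<odot>\<^bsub>M \<nu>\<^esub> Y) C = k \<odot>\<^bsub>M \<nu>\<^esub> ract (M \<nu>) Y C"
    unfolding c(2) p(2) YM_smult[OF k p(1)] ract_YM[OF c(1) col_ops(3)[OF k p(1)]] ract_YM[OF c(1) p(1)] YM_smult[OF k cp]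
    by (rule YM_cong) (simp add: colH[OF p(1)] c(1) k Hk.smult_assoc1[symmetric] m_comm)
next
  fix W C Y assume W: "W \<in> carrier (AQ \<nu>)" and C: "C \<in> carrier (KB \<nu>)" and Y: "Y \<in> carrier (M \<nu>)"
  obtain x where x: "x \<in> carrier A" "W = acs \<nu> x" using W by (rule AQ_E)
  obtain c where c: "c \<in> carrier K" "C = kcs \<nu> c" using C by (rule KB_E)
  obtain p where p: "p \<in> col \<nu>" "Y = YM \<nu> p" using Y by (rule M_E)
  have "lact (M \<nu>) W (ract (M \<nu>) Y C) = ract (M \<nu>) (lact (M \<nu>) W Y) C"
    unfolding x(2) c(2) p(2) lact_YM[OF x(1) p(1)] ract_YM[OF c(1) p(1)] lact_YM[OF x(1) col_ops(3)[OF c(1) p(1)]] ract_YM[OF c(1) lv_col[OF x(1) p(1)]]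
    by (rule YM_cong) (rule lv_ops(6)[OF x(1) x(1) p(1) p(1) c(1)])
  then show "ract (M \<nu>) (lact (M \<nu>) W Y) C = lact (M \<nu>) W (ract (M \<nu>) Y C)" by (rule sym)
qed

lemma bimodule_N: "bimodule K (KB \<nu>) (AQ \<nu>) (N \<nu>)"
proof (intro bimodule.intro bimodule_axioms.intro AQ_assoc KB_assoc module_N)
  fix W W' Y Y' assume W: "W \<in> carrier (AQ \<nu>)" "W' \<in> carrier (AQ \<nu>)" and Y: "Y \<in> carrier (N \<nu>)" "Y' \<in> carrier (N \<nu>)"
  obtain x where x: "x \<in> carrier A" "W = acs \<nu> x" using W(1) by (rule AQ_E)
  obtain y where y: "y \<in> carrier A" "W' = acs \<nu> y" using W(2) by (rule AQ_E)
  obtain p where p: "p \<in> row \<nu>" "Y = ZN \<nu> p" using Y(1) by (rule N_E)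
  obtain p' where p': "p' \<in> row \<nu>" "Y' = ZN \<nu> p'" using Y(2) by (rule N_E)
  note xp = rv_row[OF x(1) p(1)] and yp = rv_row[OF y(1) p(1)] and xp' = rv_row[OF x(1) p'(1)]
  note axp = ract_ZN[OF x(1) p(1)] and ayp = ract_ZN[OF y(1) p(1)] and axp' = ract_ZN[OF x(1) p'(1)]
  show "ract (N \<nu>) Y W \<in> carrier (N \<nu>)"
    unfolding x(2) p(2) axp by (rule ZN_closed[OF xp])
  show "ract (N \<nu>) Y (W \<oplus>\<^bsub>AQ \<nu>\<^esub> W') = ract (N \<nu>) Y W \<oplus>\<^bsub>N \<nu>\<^esub> ract (N \<nu>) Y W'"
    unfolding x(2) y(2) p(2) acs_add[OF x(1) y(1)] ract_ZN[OF A_add_closed[OF x(1) y(1)] p(1)] axp ayp ZN_add[OF xp yp]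
    by (rule ZN_cong) (rule rv_ops(1)[OF x(1) y(1) p(1) p(1) zero_closed])
  show "ract (N \<nu>) (Y \<oplus>\<^bsub>N \<nu>\<^esub> Y') W = ract (N \<nu>) Y W \<oplus>\<^bsub>N \<nu>\<^esub> ract (N \<nu>) Y' W"
    unfolding x(2) p(2) p'(2) ZN_add[OF p(1) p'(1)] ract_ZN[OF x(1) row_ops(2)[OF p(1) p'(1)]] axp axp' ZN_add[OF xp xp']
    by (rule ZN_cong) (rule rv_ops(2)[OF x(1) y(1) p(1) p'(1) zero_closed])
  show "ract (N \<nu>) Y (W \<otimes>\<^bsub>AQ \<nu>\<^esub> W') = ract (N \<nu>) (ract (N \<nu>) Y W) W'"
    unfolding x(2) y(2) p(2) acs_mult[OF x(1) y(1)] ract_ZN[OF A_mult_closed[OF x(1) y(1)] p(1)] axp ract_ZN[OF y(1) xp]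
    by (rule ZN_cong) (rule rv_ops(3)[OF x(1) y(1) p(1) p(1) zero_closed])
next
  fix Y assume Y: "Y \<in> carrier (N \<nu>)"
  obtain p where p: "p \<in> row \<nu>" "Y = ZN \<nu> p" using Y by (rule N_E)
  show "ract (N \<nu>) Y (\<one>\<^bsub>AQ \<nu>\<^esub>) = Y"
    unfolding p(2) acs_one ract_ZN[OF A_one_closed p(1)]
    by (rule ZN_cong) (rule rv_ops(4)[OF A_one_closed A_one_closed p(1) p(1) zero_closed])
  show "lact (N \<nu>) (\<one>\<^bsub>KB \<nu>\<^esub>) Y = Y"
    unfolding p(2) kcs_one lact_ZN[OF one_closed p(1)] by (rule ZN_cong) (simp add: rowH[OF p(1)])
next
  fix k W Y assume k: "k \<in> carrier K" and W: "W \<in> carrier (AQ \<nu>)" and Y: "Y \<in> carrier (N \<nu>)"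
  obtain x where x: "x \<in> carrier A" "W = acs \<nu> x" using W by (rule AQ_E)
  obtain p where p: "p \<in> row \<nu>" "Y = ZN \<nu> p" using Y by (rule N_E)
  note xp = rv_row[OF x(1) p(1)]
  show "ract (N \<nu>) Y (k \<odot>\<^bsub>AQ \<nu>\<^esub> W) = k \<odot>\<^bsub>N \<nu>\<^esub> ract (N \<nu>) Y W"
    unfolding x(2) p(2) acs_smult[OF k x(1)] ract_ZN[OF A_smult_closed[OF k x(1)] p(1)] ract_ZN[OF x(1) p(1)] ZN_smult[OF k xp]
    by (rule ZN_cong) (rule rv_ops(5)[OF x(1) x(1) p(1) p(1) k])
  show "ract (N \<nu>) (k \<odot>\<^bsub>N \<nu>\<^esub> Y) W = k \<odot>\<^bsub>N \<nu>\<^esub> ract (N \<nu>) Y W"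
    unfolding x(2) p(2) ZN_smult[OF k p(1)] ract_ZN[OF x(1) row_ops(3)[OF k p(1)]] ract_ZN[OF x(1) p(1)] ZN_smult[OF k xp]
    by (rule ZN_cong) (rule rv_ops(6)[OF x(1) x(1) p(1) p(1) k])
next
  fix C C' Y Y' assume C: "C \<in> carrier (KB \<nu>)" "C' \<in> carrier (KB \<nu>)" and Y: "Y \<in> carrier (N \<nu>)" "Y' \<in> carrier (N \<nu>)"
  obtain c where c: "c \<in> carrier K" "C = kcs \<nu> c" using C(1) by (rule KB_E)
  obtain d where d: "d \<in> carrier K" "C' = kcs \<nu> d" using C(2) by (rule KB_E)
  obtain p where p: "p \<in> row \<nu>" "Y = ZN \<nu> p" using Y(1) by (rule N_E)
  obtain p' where p': "p' \<in> row \<nu>" "Y' = ZN \<nu> p'" using Y(2) by (rule N_E)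
  note cp = row_ops(3)[OF c(1) p(1)] and dp = row_ops(3)[OF d(1) p(1)] and cp' = row_ops(3)[OF c(1) p'(1)]
  note h = rowH[OF p(1)] rowH[OF p'(1)]
  show "lact (N \<nu>) C Y \<in> carrier (N \<nu>)"
    unfolding c(2) p(2) lact_ZN[OF c(1) p(1)] by (rule ZN_closed[OF cp])
  show "lact (N \<nu>) (C \<oplus>\<^bsub>KB \<nu>\<^esub> C') Y = lact (N \<nu>) C Y \<oplus>\<^bsub>N \<nu>\<^esub> lact (N \<nu>) C' Y"
    unfolding c(2) d(2) p(2) kcs_add[OF c(1) d(1)] lact_ZN[OF a_closed[OF c(1) d(1)] p(1)] lact_ZN[OF c(1) p(1)] lact_ZN[OF d(1) p(1)] ZN_add[OF cp dp]
    by (rule ZN_cong) (simp add: h c(1) d(1) Hk.smult_l_distr)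
  show "lact (N \<nu>) C (Y \<oplus>\<^bsub>N \<nu>\<^esub> Y') = lact (N \<nu>) C Y \<oplus>\<^bsub>N \<nu>\<^esub> lact (N \<nu>) C Y'"
    unfolding c(2) p(2) p'(2) ZN_add[OF p(1) p'(1)] lact_ZN[OF c(1) row_ops(2)[OF p(1) p'(1)]] lact_ZN[OF c(1) p(1)] lact_ZN[OF c(1) p'(1)] ZN_add[OF cp cp']
    by (rule ZN_cong) (simp add: h c(1) Hk.smult_r_distr)
  show "lact (N \<nu>) (C \<otimes>\<^bsub>KB \<nu>\<^esub> C') Y = lact (N \<nu>) C (lact (N \<nu>) C' Y)"
    unfolding c(2) d(2) p(2) kcs_mult[OF c(1) d(1)] lact_ZN[OF m_closed[OF c(1) d(1)] p(1)] lact_ZN[OF d(1) p(1)] lact_ZN[OF c(1) dp]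
    by (rule ZN_cong) (simp add: h c(1) d(1) Hk.smult_assoc1[symmetric] m_comm)
next
  fix k C Y assume k: "k \<in> carrier K" and C: "C \<in> carrier (KB \<nu>)" and Y: "Y \<in> carrier (N \<nu>)"
  obtain c where c: "c \<in> carrier K" "C = kcs \<nu> c" using C by (rule KB_E)
  obtain p where p: "p \<in> row \<nu>" "Y = ZN \<nu> p" using Y by (rule N_E)
  note cp = row_ops(3)[OF c(1) p(1)]
  show "lact (N \<nu>) (k \<odot>\<^bsub>KB \<nu>\<^esub> C) Y = k \<odot>\<^bsub>N \<nu>\<^esub> lact (N \<nu>) C Y"
    unfolding c(2) p(2) kcs_smult[OF k c(1)] lact_ZN[OF m_closed[OF k c(1)] p(1)] lact_ZN[OF c(1) p(1)] ZN_smult[OF k cp]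
    by (rule ZN_cong) (simp add: rowH[OF p(1)] c(1) k Hk.smult_assoc1)
  show "lact (N \<nu>) C (k \<odot>\<^bsub>N \<nu>\<^esub> Y) = k \<odot>\<^bsub>N \<nu>\<^esub> lact (N \<nu>) C Y"
    unfolding c(2) p(2) ZN_smult[OF k p(1)] lact_ZN[OF c(1) row_ops(3)[OF k p(1)]] lact_ZN[OF c(1) p(1)] ZN_smult[OF k cp]
    by (rule ZN_cong) (simp add: rowH[OF p(1)] c(1) k Hk.smult_assoc1[symmetric] m_comm)
next
  fix W C Y assume W: "W \<in> carrier (AQ \<nu>)" and C: "C \<in> carrier (KB \<nu>)" and Y: "Y \<in> carrier (N \<nu>)"
  obtain x where x: "x \<in> carrier A" "W = acs \<nu> x" using W by (rule AQ_E)
  obtain c where c: "c \<in> carrier K" "C = kcs \<nu> c" using C by (rule KB_E)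
  obtain p where p: "p \<in> row \<nu>" "Y = ZN \<nu> p" using Y by (rule N_E)
  have "ract (N \<nu>) (lact (N \<nu>) C Y) W = lact (N \<nu>) C (ract (N \<nu>) Y W)"
    unfolding x(2) c(2) p(2) ract_ZN[OF x(1) p(1)] lact_ZN[OF c(1) p(1)] ract_ZN[OF x(1) row_ops(3)[OF c(1) p(1)]] lact_ZN[OF c(1) rv_row[OF x(1) p(1)]]
    by (rule ZN_cong) (rule rv_ops(6)[OF x(1) x(1) p(1) p(1) c(1)])
  then show "ract (N \<nu>) (lact (N \<nu>) C Y) W = lact (N \<nu>) C (ract (N \<nu>) Y W)" by this
qed

text \<open>Column times row through \<nu>. It represents \<open>\<eta>\<close>, as
  \<open>dot\<close>, row times column, represents \<open>\<rho>\<close>.\<close>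

definition ev :: "(nat \<Rightarrow> nat) \<Rightarrow> ((nat \<Rightarrow> nat) \<Rightarrow> 'k hecke) \<Rightarrow> ((nat \<Rightarrow> nat) \<Rightarrow> 'k hecke) \<Rightarrow> 'a" where
  "ev \<nu> p s = mkA (\<lambda>\<alpha> \<beta>. circ \<nu> (p \<beta>) (s \<alpha>))"

lemma ev_closed: "p \<in> col \<nu> \<Longrightarrow> s \<in> row \<nu> \<Longrightarrow> ev \<nu> p s \<in> carrier A"
  unfolding ev_def by (rule mkA_closed) (intro circ_closed colD rowD)

lemma comp_ev: "\<alpha> \<in> I \<Longrightarrow> \<beta> \<in> I \<Longrightarrow> comp (ev \<nu> p s) \<alpha> \<beta> = circ \<nu> (p \<beta>) (s \<alpha>)"
  by (simp add: ev_def comp_mkA)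

lemma eta_YM_ZN:
  assumes p: "p \<in> col \<nu>" and s: "s \<in> row \<nu>"
  shows "\<eta> \<nu> (YM \<nu> p) (ZN \<nu> s) = acs \<nu> (ev \<nu> p s)"
proof -
  have "qcirc \<nu> \<alpha> \<nu> \<beta> (cM (YM \<nu> p) \<beta>) (cM (ZN \<nu> s) \<alpha>) = cs \<nu> \<alpha> \<beta> (comp (ev \<nu> p s) \<alpha> \<beta>)" if "\<alpha> \<in> I" "\<beta> \<in> I" for \<alpha> \<beta>
    using qcirc_cs[OF colD[OF p that(2)] rowD[OF s that(1)]] that by (simp add: cM_YM cM_ZN comp_ev)
  then show ?thesis unfolding \<eta>_def by (auto simp: acs_mem_iff[OF ev_closed[OF p s]])
qed

lemma ev_ops:
  assumes p: "p \<in> col \<nu>" and p': "p' \<in> col \<nu>" and s: "s \<in> row \<nu>" and s': "s' \<in> row \<nu>"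
    and x: "x \<in> carrier A" and c: "c \<in> carrier K"
  shows "ev \<nu> (\<lambda>\<alpha>. p \<alpha> \<oplus>\<^bsub>H\<^esub> p' \<alpha>) s = ev \<nu> p s \<oplus>\<^bsub>A\<^esub> ev \<nu> p' s"
    and "ev \<nu> p (\<lambda>\<alpha>. s \<alpha> \<oplus>\<^bsub>H\<^esub> s' \<alpha>) = ev \<nu> p s \<oplus>\<^bsub>A\<^esub> ev \<nu> p s'"
    and "ev \<nu> (\<lambda>\<alpha>. c \<odot>\<^bsub>H\<^esub> p \<alpha>) s = ev \<nu> p (\<lambda>\<alpha>. c \<odot>\<^bsub>H\<^esub> s \<alpha>)"
    and "ev \<nu> (lv x p) s = x \<otimes>\<^bsub>A\<^esub> ev \<nu> p s"
    and "ev \<nu> p (rv s x) = ev \<nu> p s \<otimes>\<^bsub>A\<^esub> x"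
proof -
  note e = ev_closed[OF p s] ev_closed[OF p' s] ev_closed[OF p s']
  show "ev \<nu> (\<lambda>\<alpha>. p \<alpha> \<oplus>\<^bsub>H\<^esub> p' \<alpha>) s = ev \<nu> p s \<oplus>\<^bsub>A\<^esub> ev \<nu> p' s"
    unfolding A_add[OF e(1,2)] ev_def[of _ "\<lambda>\<alpha>. p \<alpha> \<oplus>\<^bsub>H\<^esub> p' \<alpha>"]
    by (rule mkA_cong) (simp add: comp_ev circ_add_l[OF colD[OF p] colD[OF p'] rowD[OF s]])
  show "ev \<nu> p (\<lambda>\<alpha>. s \<alpha> \<oplus>\<^bsub>H\<^esub> s' \<alpha>) = ev \<nu> p s \<oplus>\<^bsub>A\<^esub> ev \<nu> p s'"
    unfolding A_add[OF e(1,3)] ev_def[of _ _ "\<lambda>\<alpha>. s \<alpha> \<oplus>\<^bsub>H\<^esub> s' \<alpha>"]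
    by (rule mkA_cong) (simp add: comp_ev circ_add_r[OF colD[OF p] rowD[OF s] rowD[OF s']])
  show "ev \<nu> (\<lambda>\<alpha>. c \<odot>\<^bsub>H\<^esub> p \<alpha>) s = ev \<nu> p (\<lambda>\<alpha>. c \<odot>\<^bsub>H\<^esub> s \<alpha>)"
    unfolding ev_def by (rule mkA_cong) (simp add: circ_smult_l[OF c colD[OF p] rowD[OF s]] circ_smult_r[OF c colD[OF p] rowD[OF s]])
  show "ev \<nu> (lv x p) s = x \<otimes>\<^bsub>A\<^esub> ev \<nu> p s"
  proof (rule A_eqI[OF ev_closed[OF lv_col[OF x p] s] A_mult_closed[OF x e(1)]])
    fix \<alpha> \<beta> assume i: "\<alpha> \<in> I" "\<beta> \<in> I"
    have cc: "(\<lambda>\<kappa>. circ \<nu> (p \<kappa>) (s \<alpha>)) \<in> col \<alpha>" using circ_closed[OF colD[OF p] rowD[OF s i(1)]] by simp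
    have "dot (\<lambda>\<kappa>. comp x \<kappa> \<beta>) (comp (ev \<nu> p s) \<alpha>) = dot (\<lambda>\<kappa>. comp x \<kappa> \<beta>) (\<lambda>\<kappa>. circ \<nu> (p \<kappa>) (s \<alpha>))"
      by (rule dot_cong_r[OF _ A_row[OF x i(2)] cc]) (simp add: comp_ev i)
    then show "comp (ev \<nu> (lv x p) s) \<alpha> \<beta> = comp (x \<otimes>\<^bsub>A\<^esub> ev \<nu> p s) \<alpha> \<beta>"
      using circ_dot_l[OF rowD[OF s i(1)] A_row[OF x i(2)] p] by (simp add: comp_ev[OF i] comp_mult[OF x e(1) i] lv_def)
  qed
  show "ev \<nu> p (rv s x) = ev \<nu> p s \<otimes>\<^bsub>A\<^esub> x"
  proof (rule A_eqI[OF ev_closed[OF p rv_row[OF x s]] A_mult_closed[OF e(1) x]])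
    fix \<alpha> \<beta> assume i: "\<alpha> \<in> I" "\<beta> \<in> I"
    have cc: "(\<lambda>\<kappa>. circ \<nu> (p \<beta>) (s \<kappa>)) \<in> row \<beta>" using circ_closed[OF colD[OF p i(2)] rowD[OF s]] by simp
    have "dot (\<lambda>\<kappa>. comp (ev \<nu> p s) \<kappa> \<beta>) (comp x \<alpha>) = dot (\<lambda>\<kappa>. circ \<nu> (p \<beta>) (s \<kappa>)) (comp x \<alpha>)"
      by (rule dot_cong_l[OF _ cc A_col[OF x i(1)]]) (simp add: comp_ev i)
    then show "comp (ev \<nu> p (rv s x)) \<alpha> \<beta> = comp (ev \<nu> p s \<otimes>\<^bsub>A\<^esub> x) \<alpha> \<beta>"
      using circ_dot_r[OF colD[OF p i(2)] s A_col[OF x i(1)]] by (simp add: comp_ev[OF i] comp_mult[OF e(1) x i] rv_def)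
  qed
qed

text \<open>\<open>f\<close> acts on the quotients by \<open>M_gt\<close> as the scalar \<open>c\<close>.\<close>

definition rel :: "(nat \<Rightarrow> nat) \<Rightarrow> 'k hecke \<Rightarrow> 'k \<Rightarrow> bool" where
  "rel \<nu> f c \<longleftrightarrow> c \<in> carrier K \<and> f \<in> MM \<nu> \<nu> \<and> f \<ominus>\<^bsub>H\<^esub> c \<odot>\<^bsub>H\<^esub> m \<nu> \<in> M_gt \<nu> \<nu> \<nu>"

lemma rel_E: assumes "\<nu> \<in> compositions n" "f \<in> MM \<nu> \<nu>" obtains c where "rel \<nu> f c"
  using MM_diag[OF assms] assms(2) unfolding rel_def by blast

lemma relK: "rel \<nu> f c \<Longrightarrow> c \<in> carrier K"
  by (simp add: rel_def)

lemma rel_add: assumes f: "rel \<nu> f c" and g: "rel \<nu> g d" shows "rel \<nu> (f \<oplus>\<^bsub>H\<^esub> g) (c \<oplus> d)"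
proof -
  have "(f \<oplus>\<^bsub>H\<^esub> g) \<ominus>\<^bsub>H\<^esub> (c \<oplus> d) \<odot>\<^bsub>H\<^esub> m \<nu> = (f \<ominus>\<^bsub>H\<^esub> c \<odot>\<^bsub>H\<^esub> m \<nu>) \<oplus>\<^bsub>H\<^esub> (g \<ominus>\<^bsub>H\<^esub> d \<odot>\<^bsub>H\<^esub> m \<nu>)"
    using f g MM_closed[of f \<nu> \<nu>] MM_closed[of g \<nu> \<nu>]
    by (simp add: rel_def a_minus_def Hk.smult_l_distr Hk.M.minus_add Hk.M.a_ac)
  then show ?thesis using f g MM_add Msum_add unfolding rel_def M_gt_Msum by simp
qed

lemma rel_smult: assumes f: "rel \<nu> f c" and k: "k \<in> carrier K" shows "rel \<nu> (k \<odot>\<^bsub>H\<^esub> f) (k \<otimes> c)"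
proof -
  have "k \<odot>\<^bsub>H\<^esub> f \<ominus>\<^bsub>H\<^esub> (k \<otimes> c) \<odot>\<^bsub>H\<^esub> m \<nu> = k \<odot>\<^bsub>H\<^esub> (f \<ominus>\<^bsub>H\<^esub> c \<odot>\<^bsub>H\<^esub> m \<nu>)"
    using f k MM_closed[of f \<nu> \<nu>] by (simp add: rel_def a_minus_def Hk.smult_r_distr Hk.smult_r_minus Hk.smult_assoc1)
  then show ?thesis using f k MM_smult Msum_smult unfolding rel_def M_gt_Msum by simp
qed

lemma rel_act_r:
  assumes f: "rel \<nu> f c" and p: "p \<in> MM \<nu> \<beta>" shows "circ \<nu> p f \<ominus>\<^bsub>H\<^esub> c \<odot>\<^bsub>H\<^esub> p \<in> M_gt \<nu> \<nu> \<beta>"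
proof -
  have c: "c \<in> carrier K" "f \<in> MM \<nu> \<nu>" "f \<ominus>\<^bsub>H\<^esub> c \<odot>\<^bsub>H\<^esub> m \<nu> \<in> M_gt \<nu> \<nu> \<nu>" using f by (simp_all add: rel_def)
  have "circ \<nu> p (f \<ominus>\<^bsub>H\<^esub> c \<odot>\<^bsub>H\<^esub> m \<nu>) = circ \<nu> p f \<ominus>\<^bsub>H\<^esub> c \<odot>\<^bsub>H\<^esub> p"
    using circ_minus_r[OF p c(2) MM_smult[OF c(1) m_MM]] circ_smult_r[OF c(1) p m_MM] circ_m_r[OF p] by simp
  then show ?thesis using circ_Msum_r[OF c(3)[unfolded M_gt_Msum] p] by (simp add: M_gt_Msum)
qed

lemma rel_act_l:
  assumes f: "rel \<nu> f c" and s: "s \<in> MM \<alpha> \<nu>" shows "circ \<nu> f s \<ominus>\<^bsub>H\<^esub> c \<odot>\<^bsub>H\<^esub> s \<in> M_gt \<nu> \<alpha> \<nu>"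
proof -
  have c: "c \<in> carrier K" "f \<in> MM \<nu> \<nu>" "f \<ominus>\<^bsub>H\<^esub> c \<odot>\<^bsub>H\<^esub> m \<nu> \<in> M_gt \<nu> \<nu> \<nu>" using f by (simp_all add: rel_def)
  have "circ \<nu> (f \<ominus>\<^bsub>H\<^esub> c \<odot>\<^bsub>H\<^esub> m \<nu>) s = circ \<nu> f s \<ominus>\<^bsub>H\<^esub> c \<odot>\<^bsub>H\<^esub> s"
    using circ_minus_l[OF c(2) MM_smult[OF c(1) m_MM] s] circ_smult_l[OF c(1) m_MM s] circ_m_l[OF s] by simp
  then show ?thesis using circ_Msum_l[OF c(3)[unfolded M_gt_Msum] s] by (simp add: M_gt_Msum)
qed

text \<open>\<open>star\<close> fixes \<open>m\<close> and preserves \<open>M_gt\<close>, so the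
  scalar does not change; this is the trivial anti-involution on the base ring.\<close>

lemma rel_star: assumes f: "rel \<nu> f c" shows "rel \<nu> (star f) c"
proof -
  have c: "c \<in> carrier K" "f \<in> MM \<nu> \<nu>" "f \<ominus>\<^bsub>H\<^esub> c \<odot>\<^bsub>H\<^esub> m \<nu> \<in> M_gt \<nu> \<nu> \<nu>" using f by (simp_all add: rel_def)
  have "star (f \<ominus>\<^bsub>H\<^esub> c \<odot>\<^bsub>H\<^esub> m \<nu>) = star f \<ominus>\<^bsub>H\<^esub> c \<odot>\<^bsub>H\<^esub> m \<nu>"
    using c(1) MM_closed[OF c(2)] by (simp add: a_minus_def neg_smult star_m)
  then show ?thesis using star_Msum[OF c(3)[unfolded M_gt_Msum]] star_MM[OF c(2)] c(1) by (simp add: rel_def M_gt_Msum)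
qed

lemma rho_ZN_YM:
  assumes p: "p \<in> col \<nu>" and s: "s \<in> row \<nu>" and c: "rel \<nu> (dot s p) c"
  shows "\<rho> \<nu> (ZN \<nu> s) (YM \<nu> p) = kcs \<nu> c"
proof -
  interpret Mq: abelian_group "M_quot \<nu> \<nu> \<nu>" by (rule abelian_group_M_quot)
  have m: "circ \<alpha> (s \<alpha>) (p \<alpha>) \<in> MM \<nu> \<nu>" if "\<alpha> \<in> I" for \<alpha> by (rule circ_closed[OF rowD[OF s that] colD[OF p that]])
  have "(\<Oplus>\<^bsub>M_quot \<nu> \<nu> \<nu>\<^esub>\<alpha>\<in>I. qcirc \<nu> \<nu> \<alpha> \<nu> (cM (ZN \<nu> s) \<alpha>) (cM (YM \<nu> p) \<alpha>)) = (\<Oplus>\<^bsub>M_quot \<nu> \<nu> \<nu>\<^esub>\<alpha>\<in>I. cs \<nu> \<nu> \<nu> (circ \<alpha> (s \<alpha>) (p \<alpha>)))"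
    by (rule Mq.finsum_cong') (use m in \<open>auto simp: cM_ZN cM_YM qcirc_cs[OF rowD[OF s] colD[OF p]] M_quot_simps\<close>)
  also have "\<dots> = cs \<nu> \<nu> \<nu> (dot s p)" using finsum_cs[OF finite_I m, where \<nu> = \<nu>] by (simp add: dot_def)
  finally show ?thesis
    unfolding \<rho>_def[OF YM_closed[OF p] ZN_closed[OF s]] using to_base_cs[of c "dot s p" \<nu>] c dot_carrier[OF s p] by (simp add: rel_def)
qed

text \<open>Each axiom is an identity between representatives. The two compatibility laws are
  associativity, (p s) p' = p (s p') and (s p) s' = s (p s'), where the inner product s p' or s p
  acts on the quotients as a scalar by \<open>rel_act_r\<close> and
  \<open>rel_act_l\<close>.\<close>

lemma morita:
  assumes \<nu>: "\<nu> \<in> compositions n"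
  shows "morita_context K (AQ \<nu>) (KB \<nu>) (M \<nu>) (N \<nu>) (\<eta> \<nu>) (\<rho> \<nu>)"
proof (intro morita_context.intro tensor_bimodule_map.intro tensor_bimodule_map_axioms.intro morita_context_axioms.intro bimodule_M bimodule_N)
  fix Y Y' Z Z' assume Y: "Y \<in> carrier (M \<nu>)" "Y' \<in> carrier (M \<nu>)" and Z: "Z \<in> carrier (N \<nu>)" "Z' \<in> carrier (N \<nu>)"
  obtain p where p: "p \<in> col \<nu>" "Y = YM \<nu> p" using Y(1) by (rule M_E)
  obtain p' where p': "p' \<in> col \<nu>" "Y' = YM \<nu> p'" using Y(2) by (rule M_E)
  obtain s where s: "s \<in> row \<nu>" "Z = ZN \<nu> s" using Z(1) by (rule N_E)
  obtain s' where s': "s' \<in> row \<nu>" "Z' = ZN \<nu> s'" using Z(2) by (rule N_E)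
  note pp = col_ops(2)[OF p(1) p'(1)] and ss = row_ops(2)[OF s(1) s'(1)]
  note e = ev_closed[OF p(1) s(1)] ev_closed[OF p'(1) s(1)] ev_closed[OF p(1) s'(1)]
  note ops = ev_ops[OF p(1) p'(1) s(1) s'(1) A_zero_closed zero_closed]
  show "\<eta> \<nu> Y Z \<in> carrier (AQ \<nu>)" unfolding p(2) s(2) eta_YM_ZN[OF p(1) s(1)] by (rule acs_closed[OF e(1)])
  show "\<eta> \<nu> (Y \<oplus>\<^bsub>M \<nu>\<^esub> Y') Z = \<eta> \<nu> Y Z \<oplus>\<^bsub>AQ \<nu>\<^esub> \<eta> \<nu> Y' Z"
    unfolding p(2) p'(2) s(2) YM_add[OF p(1) p'(1)] eta_YM_ZN[OF pp s(1)] eta_YM_ZN[OF p(1) s(1)] eta_YM_ZN[OF p'(1) s(1)] acs_add[OF e(1,2)] ops(1) ..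
  show "\<eta> \<nu> Y (Z \<oplus>\<^bsub>N \<nu>\<^esub> Z') = \<eta> \<nu> Y Z \<oplus>\<^bsub>AQ \<nu>\<^esub> \<eta> \<nu> Y Z'"
    unfolding p(2) s(2) s'(2) ZN_add[OF s(1) s'(1)] eta_YM_ZN[OF p(1) ss] eta_YM_ZN[OF p(1) s(1)] eta_YM_ZN[OF p(1) s'(1)] acs_add[OF e(1,3)] ops(2) ..
  obtain c where c: "rel \<nu> (dot s p) c" by (rule rel_E[OF \<nu> dot_closed[OF s(1) p(1)]])
  obtain c1 where c1: "rel \<nu> (dot s p') c1" by (rule rel_E[OF \<nu> dot_closed[OF s(1) p'(1)]])
  obtain c2 where c2: "rel \<nu> (dot s' p) c2" by (rule rel_E[OF \<nu> dot_closed[OF s'(1) p(1)]])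
  have d1: "rel \<nu> (dot s (\<lambda>\<alpha>. p \<alpha> \<oplus>\<^bsub>H\<^esub> p' \<alpha>)) (c \<oplus> c1)" unfolding dot_add_r[OF s(1) p(1) p'(1)] by (rule rel_add[OF c c1])
  have d2: "rel \<nu> (dot (\<lambda>\<alpha>. s \<alpha> \<oplus>\<^bsub>H\<^esub> s' \<alpha>) p) (c \<oplus> c2)" unfolding dot_add_l[OF s(1) s'(1) p(1)] by (rule rel_add[OF c c2])
  show "\<rho> \<nu> Z Y \<in> carrier (KB \<nu>)" unfolding p(2) s(2) rho_ZN_YM[OF p(1) s(1) c] by (rule kcs_closed[OF relK[OF c]])
  show "\<rho> \<nu> Z (Y \<oplus>\<^bsub>M \<nu>\<^esub> Y') = \<rho> \<nu> Z Y \<oplus>\<^bsub>KB \<nu>\<^esub> \<rho> \<nu> Z Y'"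
    unfolding p(2) p'(2) s(2) YM_add[OF p(1) p'(1)] rho_ZN_YM[OF pp s(1) d1] rho_ZN_YM[OF p(1) s(1) c] rho_ZN_YM[OF p'(1) s(1) c1]
      kcs_add[OF relK[OF c] relK[OF c1]] ..
  show "\<rho> \<nu> (Z \<oplus>\<^bsub>N \<nu>\<^esub> Z') Y = \<rho> \<nu> Z Y \<oplus>\<^bsub>KB \<nu>\<^esub> \<rho> \<nu> Z' Y"
    unfolding p(2) s(2) s'(2) ZN_add[OF s(1) s'(1)] rho_ZN_YM[OF p(1) ss d2] rho_ZN_YM[OF p(1) s(1) c] rho_ZN_YM[OF p(1) s'(1) c2]
      kcs_add[OF relK[OF c] relK[OF c2]] ..
  have ep: "(\<lambda>\<beta>. circ \<nu> (p \<beta>) (dot s p')) \<in> col \<nu>" using circ_closed[OF colD[OF p(1)] dot_closed[OF s(1) p'(1)]] by simp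
  have "YM \<nu> (lv (ev \<nu> p s) p') = YM \<nu> (\<lambda>\<beta>. circ \<nu> (p \<beta>) (dot s p'))"
  proof (rule YM_cong)
    fix \<beta> assume \<beta>: "\<beta> \<in> I"
    have "dot (\<lambda>\<kappa>. comp (ev \<nu> p s) \<kappa> \<beta>) p' = dot (\<lambda>\<kappa>. circ \<nu> (p \<beta>) (s \<kappa>)) p'"
      by (rule dot_cong_l[OF _ _ p'(1), where \<beta> = \<beta>]) (use \<beta> circ_closed[OF colD[OF p(1) \<beta>] rowD[OF s(1)]] in \<open>auto simp: comp_ev\<close>)
    then show "lv (ev \<nu> p s) p' \<beta> = circ \<nu> (p \<beta>) (dot s p')"
      unfolding lv_def using circ_dot_r[OF colD[OF p(1) \<beta>] s(1) p'(1)] by simp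
  qed
  also have "\<dots> = YM \<nu> (\<lambda>\<beta>. c1 \<odot>\<^bsub>H\<^esub> p \<beta>)"
    by (rule YM_eqI[OF ep col_ops(3)[OF relK[OF c1] p(1)]]) (rule rel_act_r[OF c1 colD[OF p(1)]])
  finally show "lact (M \<nu>) (\<eta> \<nu> Y Z) Y' = ract (M \<nu>) Y (\<rho> \<nu> Z Y')"
    unfolding p(2) p'(2) s(2) eta_YM_ZN[OF p(1) s(1)] lact_YM[OF e(1) p'(1)] rho_ZN_YM[OF p'(1) s(1) c1] ract_YM[OF relK[OF c1] p(1)] .
  have es: "(\<lambda>\<alpha>. circ \<nu> (dot s p) (s' \<alpha>)) \<in> row \<nu>" using circ_closed[OF dot_closed[OF s(1) p(1)] rowD[OF s'(1)]] by simp
  have "ZN \<nu> (rv s (ev \<nu> p s')) = ZN \<nu> (\<lambda>\<alpha>. circ \<nu> (dot s p) (s' \<alpha>))"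
  proof (rule ZN_cong)
    fix \<alpha> assume \<alpha>: "\<alpha> \<in> I"
    have "dot s (comp (ev \<nu> p s') \<alpha>) = dot s (\<lambda>\<kappa>. circ \<nu> (p \<kappa>) (s' \<alpha>))"
      by (rule dot_cong_r[OF _ s(1), where \<alpha> = \<alpha>]) (use \<alpha> circ_closed[OF colD[OF p(1)] rowD[OF s'(1) \<alpha>]] in \<open>auto simp: comp_ev\<close>)
    then show "rv s (ev \<nu> p s') \<alpha> = circ \<nu> (dot s p) (s' \<alpha>)"
      unfolding rv_def using circ_dot_l[OF rowD[OF s'(1) \<alpha>] s(1) p(1)] by simp
  qed
  also have "\<dots> = ZN \<nu> (\<lambda>\<alpha>. c \<odot>\<^bsub>H\<^esub> s' \<alpha>)"
    by (rule ZN_eqI[OF es row_ops(3)[OF relK[OF c] s'(1)]]) (rule rel_act_l[OF c rowD[OF s'(1)]])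
  finally show "lact (N \<nu>) (\<rho> \<nu> Z Y) Z' = ract (N \<nu>) Z (\<eta> \<nu> Y Z')"
    unfolding p(2) s(2) s'(2) eta_YM_ZN[OF p(1) s'(1)] ract_ZN[OF e(3) s(1)] rho_ZN_YM[OF p(1) s(1) c] lact_ZN[OF relK[OF c] s'(1)] ..
next
  fix Y C Z assume Y: "Y \<in> carrier (M \<nu>)" and C: "C \<in> carrier (KB \<nu>)" and Z: "Z \<in> carrier (N \<nu>)"
  obtain p where p: "p \<in> col \<nu>" "Y = YM \<nu> p" using Y by (rule M_E)
  obtain s where s: "s \<in> row \<nu>" "Z = ZN \<nu> s" using Z by (rule N_E)
  obtain k where k: "k \<in> carrier K" "C = kcs \<nu> k" using C by (rule KB_E)
  note kp = col_ops(3)[OF k(1) p(1)] and ks = row_ops(3)[OF k(1) s(1)]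
  show "\<eta> \<nu> (ract (M \<nu>) Y C) Z = \<eta> \<nu> Y (lact (N \<nu>) C Z)"
    unfolding p(2) s(2) k(2) ract_YM[OF k(1) p(1)] lact_ZN[OF k(1) s(1)] eta_YM_ZN[OF kp s(1)] eta_YM_ZN[OF p(1) ks]
      ev_ops(3)[OF p(1) p(1) s(1) s(1) A_zero_closed k(1)] ..
  obtain c where c: "rel \<nu> (dot s p) c" by (rule rel_E[OF \<nu> dot_closed[OF s(1) p(1)]])
  note kc = rel_smult[OF c k(1)]
  have d1: "rel \<nu> (dot (\<lambda>\<alpha>. k \<odot>\<^bsub>H\<^esub> s \<alpha>) p) (k \<otimes> c)" unfolding dot_smult_l[OF k(1) s(1) p(1)] by (rule kc)
  have d2: "rel \<nu> (dot s (\<lambda>\<alpha>. k \<odot>\<^bsub>H\<^esub> p \<alpha>)) (k \<otimes> c)" unfolding dot_smult_r[OF k(1) s(1) p(1)] by (rule kc)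
  show "\<rho> \<nu> (lact (N \<nu>) C Z) Y = C \<otimes>\<^bsub>KB \<nu>\<^esub> \<rho> \<nu> Z Y"
    unfolding p(2) s(2) k(2) lact_ZN[OF k(1) s(1)] rho_ZN_YM[OF p(1) ks d1] rho_ZN_YM[OF p(1) s(1) c] kcs_mult[OF k(1) relK[OF c]] ..
  show "\<rho> \<nu> Z (ract (M \<nu>) Y C) = \<rho> \<nu> Z Y \<otimes>\<^bsub>KB \<nu>\<^esub> C"
    unfolding p(2) s(2) k(2) ract_YM[OF k(1) p(1)] rho_ZN_YM[OF kp s(1) d2] rho_ZN_YM[OF p(1) s(1) c] kcs_mult[OF relK[OF c] k(1)]
      m_comm[OF relK[OF c] k(1)] ..
next
  fix W Y Z assume W: "W \<in> carrier (AQ \<nu>)" and Y: "Y \<in> carrier (M \<nu>)" and Z: "Z \<in> carrier (N \<nu>)"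
  obtain x where x: "x \<in> carrier A" "W = acs \<nu> x" using W by (rule AQ_E)
  obtain p where p: "p \<in> col \<nu>" "Y = YM \<nu> p" using Y by (rule M_E)
  obtain s where s: "s \<in> row \<nu>" "Z = ZN \<nu> s" using Z by (rule N_E)
  note xp = lv_col[OF x(1) p(1)] and sx = rv_row[OF x(1) s(1)] and e = ev_closed[OF p(1) s(1)]
  show "\<eta> \<nu> (lact (M \<nu>) W Y) Z = W \<otimes>\<^bsub>AQ \<nu>\<^esub> \<eta> \<nu> Y Z"
    unfolding x(2) p(2) s(2) lact_YM[OF x(1) p(1)] eta_YM_ZN[OF xp s(1)] eta_YM_ZN[OF p(1) s(1)] acs_mult[OF x(1) e]
      ev_ops(4)[OF p(1) p(1) s(1) s(1) x(1) zero_closed] ..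
  show "\<eta> \<nu> Y (ract (N \<nu>) Z W) = \<eta> \<nu> Y Z \<otimes>\<^bsub>AQ \<nu>\<^esub> W"
    unfolding x(2) p(2) s(2) ract_ZN[OF x(1) s(1)] eta_YM_ZN[OF p(1) sx] eta_YM_ZN[OF p(1) s(1)] acs_mult[OF e x(1)]
      ev_ops(5)[OF p(1) p(1) s(1) s(1) x(1) zero_closed] ..
  have d: "dot (rv s x) p = dot s (lv x p)"
    unfolding rv_def lv_def by (rule dot_assoc[OF s(1) A_col[OF x(1)] p(1)])
  obtain c where c: "rel \<nu> (dot s (lv x p)) c" by (rule rel_E[OF \<nu> dot_closed[OF s(1) xp]])
  show "\<rho> \<nu> (ract (N \<nu>) Z W) Y = \<rho> \<nu> Z (lact (M \<nu>) W Y)"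
    unfolding x(2) p(2) s(2) lact_YM[OF x(1) p(1)] ract_ZN[OF x(1) s(1)] rho_ZN_YM[OF xp s(1) c]
    by (rule rho_ZN_YM[OF p(1) sx]) (simp only: d c)
qed

lemma acs_neg: assumes x: "x \<in> carrier A" shows "\<ominus>\<^bsub>AQ \<nu>\<^esub> acs \<nu> x = acs \<nu> (\<ominus>\<^bsub>A\<^esub> x)"
proof -
  interpret Qa: assoc_algebra K "AQ \<nu>" by (rule AQ_assoc)
  show ?thesis
    by (rule Qa.M.minus_equality) (use x acs_add[of "\<ominus>\<^bsub>A\<^esub> x" x \<nu>] in \<open>simp_all add: acs_closed acs_zero Al.M.l_neg\<close>)
qed

lemma ev_AF:
  assumes "\<nu> \<in> compositions n" "p \<in> col \<nu>" "s \<in> row \<nu>" shows "ev \<nu> p s \<in> AF \<nu>"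
proof -
  have "circ \<nu> (p \<beta>) (s \<alpha>) \<in> Msum {\<pi> \<in> compositions n. dom_le \<nu> \<pi>} \<alpha> \<beta>" if "\<alpha> \<in> I" "\<beta> \<in> I" for \<alpha> \<beta>
    by (rule Msum_gen[OF _ colD[OF assms(2) that(2)] rowD[OF assms(3) that(1)]]) (use assms(1) dom_le_refl in simp)
  then show ?thesis using ev_closed[OF assms(2,3)] by (simp add: AF_Asum Asum_def comp_ev)
qed

text \<open>A column and a row with one nonzero entry each multiply to a matrix with one nonzero
  entry.\<close>

lemma sgl_ev:
  assumes i: "\<alpha> \<in> I" "\<beta> \<in> I" and u: "u \<in> MM \<nu> \<beta>" and v: "v \<in> MM \<alpha> \<nu>"
  shows "\<exists>p\<in>col \<nu>. \<exists>s\<in>row \<nu>. sgl \<alpha> \<beta> (circ \<nu> u v) = ev \<nu> p s"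
proof -
  let ?p = "\<lambda>\<kappa>. if \<kappa> = \<beta> then u else \<zero>\<^bsub>H\<^esub>" and ?s = "\<lambda>\<kappa>. if \<kappa> = \<alpha> then v else \<zero>\<^bsub>H\<^esub>"
  have c: "?p \<in> col \<nu>" "?s \<in> row \<nu>" using u v MM_zero by auto
  have "sgl \<alpha> \<beta> (circ \<nu> u v) = ev \<nu> ?p ?s"
    unfolding sgl_def ev_def
    by (rule mkA_cong) (use circ_zero_l[OF v] circ_zero_r[OF u] circ_zero_l[OF MM_zero] in auto)
  then show ?thesis using c by blast
qed

text \<open>The generators of \<open>AF \<nu>\<close> have a single entry through some \<pi>
  dominating \<nu>. For \<pi> = \<nu> the class is a value of \<open>\<eta>\<close>; otherwise the
  generator lies in \<open>A_gt \<nu>\<close> and its class vanishes.\<close>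

lemma trace_eq:
  assumes \<nu>: "\<nu> \<in> compositions n"
  shows "trace_ideal (AQ \<nu>) (M \<nu>) (N \<nu>) (\<eta> \<nu>) = acs \<nu> ` AF \<nu>"
proof -
  interpret Qa: assoc_algebra K "AQ \<nu>" by (rule AQ_assoc)
  interpret Mc: morita_context K "AQ \<nu>" "KB \<nu>" "M \<nu>" "N \<nu>" "\<eta> \<nu>" "\<rho> \<nu>" by (rule morita[OF \<nu>])
  let ?S = "{\<eta> \<nu> Y Z |Y Z. Y \<in> carrier (M \<nu>) \<and> Z \<in> carrier (N \<nu>)}"
  have S: "?S \<subseteq> carrier (AQ \<nu>)" using Mc.eta.map_closed by blast
  have gens: "\<exists>x\<in>AF \<nu>. X = acs \<nu> x" if X: "X \<in> ?S" for X
  proof -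
    obtain Y Z where YZ: "X = \<eta> \<nu> Y Z" "Y \<in> carrier (M \<nu>)" "Z \<in> carrier (N \<nu>)" using X by blast
    obtain p where p: "p \<in> col \<nu>" "Y = YM \<nu> p" using YZ(2) by (rule M_E)
    obtain s where s: "s \<in> row \<nu>" "Z = ZN \<nu> s" using YZ(3) by (rule N_E)
    show ?thesis unfolding YZ(1) p(2) s(2) eta_YM_ZN[OF p(1) s(1)] using ev_AF[OF \<nu> p(1) s(1)] by blast
  qed
  show ?thesis
    unfolding trace_ideal_def
  proof (intro equalityI subsetI)
    fix X assume "X \<in> add_span (AQ \<nu>) ?S"
    from this S show "X \<in> acs \<nu> ` AF \<nu>"
    proof (induction rule: Qa.M.add_span_induct)
      case zero then show ?case unfolding acs_zero AF_Asum using Asum_zero by blast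
    next
      case (incl X) then show ?case using gens by blast
    next
      case (neg X)
      then obtain x where "x \<in> AF \<nu>" "X = acs \<nu> x" using gens by blast
      then show ?case unfolding AF_Asum using acs_neg[OF Asum_closed] Asum_neg by blast
    next
      case (add X Y)
      then obtain x y where "x \<in> AF \<nu>" "X = acs \<nu> x" "y \<in> AF \<nu>" "Y = acs \<nu> y" by blast
      then show ?case unfolding AF_Asum using acs_add[OF Asum_closed Asum_closed] Asum_add by blast
    qed
  next
    fix X assume "X \<in> acs \<nu> ` AF \<nu>"
    then obtain x where x: "x \<in> Asum {\<pi> \<in> compositions n. dom_le \<nu> \<pi>}" "X = acs \<nu> x" unfolding AF_Asum by blast
    from x(1) have "acs \<nu> x \<in> add_span (AQ \<nu>) ?S"
    proof (induction rule: Asum_induct)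
      case zero then show ?case unfolding acs_zero[symmetric] by (rule Qa.M.add_span_zero)
    next
      case (gen \<pi> \<alpha> \<beta> u v)
      show ?case
      proof (cases "\<pi> = \<nu>")
        case True
        then obtain p s where ps: "p \<in> col \<nu>" "s \<in> row \<nu>" "sgl \<alpha> \<beta> (circ \<nu> u v) = ev \<nu> p s"
          using sgl_ev[OF gen(2,3)] gen(4,5) by blast
        then have "acs \<nu> (sgl \<alpha> \<beta> (circ \<pi> u v)) = \<eta> \<nu> (YM \<nu> p) (ZN \<nu> s)" using True eta_YM_ZN by simp
        then show ?thesis using YM_closed[OF ps(1)] ZN_closed[OF ps(2)] by (intro Qa.M.add_span_incl) blast
      next
        case False
        have "sgl \<alpha> \<beta> (circ \<pi> u v) \<in> A_gt \<nu>" unfolding A_gt_def by (rule Asum_sgl[OF Msum_gen]) (use gen False in auto)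
        then have g: "sgl \<alpha> \<beta> (circ \<pi> u v) \<ominus>\<^bsub>A\<^esub> \<zero>\<^bsub>A\<^esub> \<in> A_gt \<nu>" "sgl \<alpha> \<beta> (circ \<pi> u v) \<in> carrier A"
          using Asum_closed by (auto simp: A_gt_def a_minus_def)
        have "acs \<nu> (sgl \<alpha> \<beta> (circ \<pi> u v)) = \<zero>\<^bsub>AQ \<nu>\<^esub>"
          unfolding acs_zero using acs_eq_iff[OF g(2) A_zero_closed] g(1) by blast
        then show ?thesis using Qa.M.add_span_zero by simp
      qed
    next
      case (add a b)
      show ?case
        unfolding acs_add[OF Asum_closed[OF add.hyps(1)] Asum_closed[OF add.hyps(2)], symmetric]
        by (rule Qa.M.add_span_add[OF add.IH])
    qed
    then show "X \<in> add_span (AQ \<nu>) ?S" using x(2) by simp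
  qed
qed

text \<open>The product passes through compositions dominating both k and l. None of them equals l,
  because l does not dominate k.\<close>

lemma circ_M_ge:
  assumes "k \<in> compositions n" "l \<in> compositions n" "\<not> dom_le k l"
    and x: "x \<in> M_ge k \<kappa> \<beta>" and y: "y \<in> M_ge l \<alpha> \<kappa>"
  shows "circ \<kappa> x y \<in> M_gt l \<alpha> \<beta>"
proof -
  have "circ \<kappa> x y \<in> Msum {\<rho> \<in> compositions n. \<exists>\<pi>\<in>{\<pi> \<in> compositions n. dom_le k \<pi>}. \<exists>\<pi>'\<in>{\<pi> \<in> compositions n. dom_le l \<pi>}. dom_le \<pi> \<rho> \<and> dom_le \<pi>' \<rho>} \<alpha> \<beta>"
    by (rule circ_Msum_Msum[OF _ _ x[unfolded M_ge_Msum] y[unfolded M_ge_Msum]]) auto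
  then show ?thesis
    unfolding M_gt_Msum
  proof (rule Msum_mono, intro subsetI)
    fix \<rho> assume "\<rho> \<in> {\<rho> \<in> compositions n. \<exists>\<pi>\<in>{\<pi> \<in> compositions n. dom_le k \<pi>}. \<exists>\<pi>'\<in>{\<pi> \<in> compositions n. dom_le l \<pi>}. dom_le \<pi> \<rho> \<and> dom_le \<pi>' \<rho>}"
    then have "\<rho> \<in> compositions n" "dom_le k \<rho>" "dom_le l \<rho>" using dom_le_trans by blast+
    then show "\<rho> \<in> {\<pi> \<in> compositions n. dom_le l \<pi> \<and> \<pi> \<noteq> l}" using assms(3) by auto
  qed
qed

lemma AF_comp: "x \<in> AF k \<Longrightarrow> \<alpha> \<in> I \<Longrightarrow> \<beta> \<in> I \<Longrightarrow> comp x \<alpha> \<beta> \<in> M_ge k \<alpha> \<beta>" and AF_closed: "x \<in> AF k \<Longrightarrow> x \<in> carrier A"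
  by (auto simp: AF_Asum Asum_def M_ge_Msum)

text \<open>Every entry u of a column is u o m and so already passes through l;
  \<open>circ_M_ge\<close> then sends the product with an element of level k to zero in the
  quotient.\<close>

lemma annihil_M:
  assumes kl: "k \<in> compositions n" "l \<in> compositions n" "\<not> dom_le k l" and a: "a \<in> AF k" and Y: "Y \<in> carrier (M l)"
  shows "lact (M l) (acs l a) Y = \<zero>\<^bsub>M l\<^esub>"
proof -
  obtain p where p: "p \<in> col l" "Y = YM l p" using Y by (rule M_E)
  note ac = AF_closed[OF a]
  have z: "lv a p \<beta> \<in> M_gt l l \<beta>" if \<beta>: "\<beta> \<in> I" for \<beta>
    unfolding lv_def dot_def M_gt_Msum
    by (rule Msum_finsum[OF finite_I], fold M_gt_Msum, rule circ_M_ge[OF kl AF_comp[OF a _ \<beta>] MM_M_ge[OF kl(2) colD[OF p(1)]]])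
  have "YM l (lv a p) = YM l (\<lambda>_. \<zero>\<^bsub>H\<^esub>)"
    by (rule YM_eqI[OF lv_col[OF ac p(1)] col_ops(1)]) (use z colH[OF lv_col[OF ac p(1)]] in \<open>simp add: a_minus_def\<close>)
  then show ?thesis unfolding p(2) lact_YM[OF ac p(1)] YM_zero .
qed

text \<open>\<open>circ_M_ge\<close> expects the factor of level k on the left, whereas it acts from
  the right here; \<open>star\<close> moves it across and back.\<close>

lemma annihil_N:
  assumes kl: "k \<in> compositions n" "l \<in> compositions n" "\<not> dom_le k l" and a: "a \<in> AF k" and Z: "Z \<in> carrier (N l)"
  shows "ract (N l) Z (acs l a) = \<zero>\<^bsub>N l\<^esub>"
proof -
  obtain s where s: "s \<in> row l" "Z = ZN l s" using Z by (rule N_E)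
  note ac = AF_closed[OF a]
  have z: "rv s a \<alpha> \<in> M_gt l \<alpha> l" if \<alpha>: "\<alpha> \<in> I" for \<alpha>
  proof -
    have "circ \<kappa> (s \<kappa>) (comp a \<alpha> \<kappa>) \<in> M_gt l \<alpha> l" if \<kappa>: "\<kappa> \<in> I" for \<kappa>
    proof -
      have "star (comp a \<alpha> \<kappa>) \<in> M_ge k \<kappa> \<alpha>" using AF_comp[OF a \<alpha> \<kappa>] star_Msum unfolding M_ge_Msum by blast
      then have "circ \<kappa> (star (comp a \<alpha> \<kappa>)) (star (s \<kappa>)) \<in> M_gt l l \<alpha>"
        by (rule circ_M_ge[OF kl _ MM_M_ge[OF kl(2) star_MM[OF rowD[OF s(1) \<kappa>]]]])
      then have "star (star (circ \<kappa> (s \<kappa>) (comp a \<alpha> \<kappa>))) \<in> M_gt l \<alpha> l"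
        unfolding star_circ[OF rowD[OF s(1) \<kappa>] A_comp[OF ac \<alpha> \<kappa>]] using star_Msum unfolding M_gt_Msum by blast
      then show ?thesis using circ_carrier[OF rowD[OF s(1) \<kappa>] A_comp[OF ac \<alpha> \<kappa>]] by simp
    qed
    then show ?thesis unfolding rv_def dot_def M_gt_Msum by (intro Msum_finsum[OF finite_I])
  qed
  have "ZN l (rv s a) = ZN l (\<lambda>_. \<zero>\<^bsub>H\<^esub>)"
    by (rule ZN_eqI[OF rv_row[OF ac s(1)] row_ops(1)]) (use z rowH[OF rv_row[OF ac s(1)]] in \<open>simp add: a_minus_def\<close>)
  then show ?thesis unfolding s(2) ract_ZN[OF ac s(1)] ZN_zero .
qed

lemma standard_filter_A: "standard_filter K A (compositions n) dom_ge AF B' M N \<eta> \<rho>"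
proof (rule standard_filter.intro[OF Al.assoc_algebra_axioms standard_filter_axioms.intro])
  show "reflp_on (compositions n) dom_ge" "transp_on (compositions n) dom_ge" "antisymp_on (compositions n) dom_ge"
    using dom_le_refl dom_le_trans dom_le_antisym
    by (auto simp: dom_ge_def reflp_on_def transp_on_def antisymp_on_def)
  fix k l assume kl: "k \<in> compositions n" "l \<in> compositions n"
  show "AF k \<subseteq> AF l" if "dom_ge k l"
    unfolding AF_Asum by (rule Asum_mono) (use that dom_le_trans in \<open>auto simp: dom_ge_def\<close>)
  show "a \<otimes>\<^bsub>A\<^esub> b \<in> add_span A (\<Union>j\<in>{j \<in> compositions n. dom_ge j k \<and> dom_ge j l}. AF j)" if a: "a \<in> AF k" and b: "b \<in> AF l" for a b
  proof -
    note ac = AF_closed[OF a] and bc = AF_closed[OF b]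
    let ?L = "{\<pi> \<in> compositions n. \<exists>j\<in>{j \<in> compositions n. dom_ge j k \<and> dom_ge j l}. dom_le j \<pi>}"
    have "comp (a \<otimes>\<^bsub>A\<^esub> b) \<alpha> \<beta> \<in> Msum ?L \<alpha> \<beta>" if i: "\<alpha> \<in> I" "\<beta> \<in> I" for \<alpha> \<beta>
      unfolding comp_mult[OF ac bc i] dot_def
    proof (rule Msum_finsum[OF finite_I])
      fix \<kappa> assume \<kappa>: "\<kappa> \<in> I"
      have "circ \<kappa> (comp a \<kappa> \<beta>) (comp b \<alpha> \<kappa>) \<in> Msum {\<rho> \<in> compositions n. \<exists>\<pi>\<in>{\<pi> \<in> compositions n. dom_le k \<pi>}.
          \<exists>\<pi>'\<in>{\<pi> \<in> compositions n. dom_le l \<pi>}. dom_le \<pi> \<rho> \<and> dom_le \<pi>' \<rho>} \<alpha> \<beta>"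
        by (rule circ_Msum_Msum) (use AF_comp[OF a \<kappa> i(2)] AF_comp[OF b i(1) \<kappa>] in \<open>auto simp: M_ge_Msum\<close>)
      then show "circ \<kappa> (comp a \<kappa> \<beta>) (comp b \<alpha> \<kappa>) \<in> Msum ?L \<alpha> \<beta>"
      proof (rule Msum_mono, intro subsetI)
        fix \<rho> assume "\<rho> \<in> {\<rho> \<in> compositions n. \<exists>\<pi>\<in>{\<pi> \<in> compositions n. dom_le k \<pi>}. \<exists>\<pi>'\<in>{\<pi> \<in> compositions n. dom_le l \<pi>}. dom_le \<pi> \<rho> \<and> dom_le \<pi>' \<rho>}"
        then have "\<rho> \<in> compositions n" "dom_le k \<rho>" "dom_le l \<rho>" using dom_le_trans by blast+
        then show "\<rho> \<in> ?L" using dom_le_refl[of \<rho>] unfolding dom_ge_def by blast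
      qed
    qed
    then have "a \<otimes>\<^bsub>A\<^esub> b \<in> Asum ?L" using A_mult_closed[OF ac bc] by (simp add: Asum_def)
    then show ?thesis by (subst span_filter) auto
  qed
  show "lact (M l) (filter_below A (compositions n) dom_ge AF l +>\<^bsub>A\<^esub> a) x = \<zero>\<^bsub>M l\<^esub>"
    if "\<not> dom_ge l k" "a \<in> AF k" "x \<in> carrier (M l)" for a x
    unfolding filter_below_eq acs_def[symmetric] using annihil_M[OF kl _ that(2,3)] that(1) by (simp add: dom_ge_def)
  show "ract (N l) y (filter_below A (compositions n) dom_ge AF l +>\<^bsub>A\<^esub> a) = \<zero>\<^bsub>N l\<^esub>"
    if "\<not> dom_ge l k" "a \<in> AF k" "y \<in> carrier (N l)" for a y
    unfolding filter_below_eq acs_def[symmetric] using annihil_N[OF kl _ that(2,3)] that(1) by (simp add: dom_ge_def)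
next
  fix l assume l: "l \<in> compositions n"
  show "ideal (AF l) A" unfolding AF_Asum by (rule ideal_Asum)
  show "ideal (B' l) K" by (rule B'_ideal)
  show "morita_context K (quotient_algebra A (filter_below A (compositions n) dom_ge AF l)) (KB l) (M l) (N l) (\<eta> l) (\<rho> l)"
    unfolding filter_below_eq by (rule morita[OF l])
  show "trace_ideal (quotient_algebra A (filter_below A (compositions n) dom_ge AF l)) (M l) (N l) (\<eta> l)
      = (\<lambda>a. filter_below A (compositions n) dom_ge AF l +>\<^bsub>A\<^esub> a) ` AF l"
    unfolding filter_below_eq acs_def[symmetric] by (rule trace_eq[OF l])
next
  show "add_span A (\<Union>l\<in>compositions n. AF l) = carrier A"
  proof (subst span_filter[OF order_refl], intro equalityI subsetI)
    fix x assume x: "x \<in> carrier A"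
    \<comment> \<open>Each entry f is f o m and hence passes through its own index \<alpha>, which
      belongs to the poset.\<close>
    have "comp x \<alpha> \<beta> \<in> Msum {\<pi> \<in> compositions n. \<exists>k\<in>compositions n. dom_le k \<pi>} \<alpha> \<beta>" if i: "\<alpha> \<in> I" "\<beta> \<in> I" for \<alpha> \<beta>
      using Msum_gen[OF _ A_comp[OF x i] m_MM, of "{\<pi> \<in> compositions n. \<exists>k\<in>compositions n. dom_le k \<pi>}"]
        circ_m_r[OF A_comp[OF x i]] i(1) I_comp dom_le_refl by auto
    then show "x \<in> Asum {\<pi> \<in> compositions n. \<exists>k\<in>compositions n. dom_le k \<pi>}" using x by (simp add: Asum_def)
  qed (rule Asum_closed)
qed

section \<open>The anti-involution and the involutive contexts\<close>

lemma st_closed: "x \<in> carrier A \<Longrightarrow> st x \<in> carrier A"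
  unfolding st_def by (rule mkA_closed) (intro star_MM A_comp)

lemma comp_st: "x \<in> carrier A \<Longrightarrow> \<alpha> \<in> I \<Longrightarrow> \<beta> \<in> I \<Longrightarrow> comp (st x) \<alpha> \<beta> = star (comp x \<beta> \<alpha>)"
  by (simp add: st_def comp_mkA)

lemma st_st: "x \<in> carrier A \<Longrightarrow> st (st x) = x"
  by (rule A_eqI) (simp_all add: st_closed comp_st)

lemma anti_involution_st: "anti_involution K A st"
  unfolding anti_involution_def
proof (intro conjI ballI funcsetI)
  fix x assume x: "x \<in> carrier A"
  show "st x \<in> carrier A" by (rule st_closed[OF x])
  show "st (st x) = x" by (rule st_st[OF x])
  show "st (c \<odot>\<^bsub>A\<^esub> x) = c \<odot>\<^bsub>A\<^esub> st x" if c: "c \<in> carrier K" for c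
    by (rule A_eqI) (use x c in \<open>simp_all add: st_closed A_smult_closed comp_st\<close>)
  fix y assume y: "y \<in> carrier A"
  show "st (x \<oplus>\<^bsub>A\<^esub> y) = st x \<oplus>\<^bsub>A\<^esub> st y"
    by (rule A_eqI) (use x y in \<open>simp_all add: st_closed A_add_closed comp_st\<close>)
  show "st (x \<otimes>\<^bsub>A\<^esub> y) = st y \<otimes>\<^bsub>A\<^esub> st x"
  proof (rule A_eqI[OF st_closed[OF A_mult_closed[OF x y]] A_mult_closed[OF st_closed[OF y] st_closed[OF x]]])
    fix \<alpha> \<beta> assume i: "\<alpha> \<in> I" "\<beta> \<in> I"
    have "star (dot (\<lambda>\<kappa>. comp x \<kappa> \<alpha>) (comp y \<beta>)) = dot (\<lambda>\<kappa>. star (comp y \<beta> \<kappa>)) (\<lambda>\<kappa>. star (comp x \<kappa> \<alpha>))"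
      by (rule star_dot[OF A_row[OF x i(1)] A_col[OF y i(2)]])
    also have "\<dots> = dot (\<lambda>\<kappa>. comp (st y) \<kappa> \<beta>) (comp (st x) \<alpha>)"
      by (rule dot_cong[where \<beta> = \<beta> and \<alpha> = \<alpha>])
        (use A_comp[OF st_closed[OF x] i(1)] A_comp[OF st_closed[OF y] _ i(2)] x y i in \<open>auto simp: comp_st\<close>)
    finally show "comp (st (x \<otimes>\<^bsub>A\<^esub> y)) \<alpha> \<beta> = comp (st y \<otimes>\<^bsub>A\<^esub> st x) \<alpha> \<beta>"
      using x y i by (simp add: comp_st A_mult_closed comp_mult st_closed)
  qed
qed

lemma st_Asum: "x \<in> Asum L \<Longrightarrow> st x \<in> Asum L"
  by (auto simp: Asum_def st_closed comp_st intro: star_Msum)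

lemma st_image_Asum: "st ` Asum L = Asum L"
  using st_Asum st_st Asum_closed by (metis (no_types, lifting) image_eqI image_subsetI subset_antisym subsetI)

lemma st_acs: assumes x: "x \<in> carrier A" shows "st ` acs \<nu> x = acs \<nu> (st x)"
proof -
  have sub: "st y \<in> acs \<nu> (st x)" if y: "y \<in> acs \<nu> x" and x: "x \<in> carrier A" for x y
  proof -
    obtain g where g: "g \<in> A_gt \<nu>" "y = g \<oplus>\<^bsub>A\<^esub> x" using y unfolding acs_mem by blast
    have "st y = st g \<oplus>\<^bsub>A\<^esub> st x"
      unfolding g(2) using anti_involution_st g(1) x unfolding anti_involution_def A_gt_iff by blast
    then show ?thesis using g(1) st_Asum unfolding acs_mem A_gt_def by blast
  qed
  show ?thesis
  proof (intro equalityI subsetI)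
    fix z assume z: "z \<in> acs \<nu> (st x)"
    then have "st z \<in> acs \<nu> x" using sub[OF z st_closed[OF x]] st_st[OF x] by simp
    moreover obtain g where "g \<in> A_gt \<nu>" "z = g \<oplus>\<^bsub>A\<^esub> st x" using z unfolding acs_mem by blast
    then have "z \<in> carrier A" using A_add_closed[OF _ st_closed[OF x]] by (simp add: A_gt_iff)
    ultimately show "z \<in> st ` acs \<nu> x" using st_st by (metis image_eqI)
  qed (use sub x in blast)
qed

text \<open>The elements of both modules have the same type, so one map serves in both directions
  and is its own inverse on the carriers.\<close>

definition star_fam :: "'m \<Rightarrow> 'm" where
  "star_fam Y = mkM (\<lambda>\<alpha>. star ` cM Y \<alpha>)"

lemma star_fam_YM: "p \<in> col \<nu> \<Longrightarrow> star_fam (YM \<nu> p) = ZN \<nu> (\<lambda>\<alpha>. star (p \<alpha>))"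
  unfolding star_fam_def ZN_def by (rule mkM_cong) (use colH[of p \<nu>] in \<open>simp add: cM_YM star_cs\<close>)

lemma star_fam_ZN: "s \<in> row \<nu> \<Longrightarrow> star_fam (ZN \<nu> s) = YM \<nu> (\<lambda>\<alpha>. star (s \<alpha>))"
  unfolding star_fam_def YM_def by (rule mkM_cong) (use rowH[of s \<nu>] in \<open>simp add: cM_ZN star_cs\<close>)

lemma star_col: "p \<in> col \<nu> \<Longrightarrow> (\<lambda>\<alpha>. star (p \<alpha>)) \<in> row \<nu>" and star_row: "s \<in> row \<nu> \<Longrightarrow> (\<lambda>\<alpha>. star (s \<alpha>)) \<in> col \<nu>"
  by (simp_all add: star_MM)

lemma star_fam_bij: "bij_betw star_fam (carrier (M \<nu>)) (carrier (N \<nu>))"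
proof (rule bij_betwI[where g = star_fam])
  show "star_fam \<in> carrier (M \<nu>) \<rightarrow> carrier (N \<nu>)"
  proof (rule funcsetI)
    fix Y assume "Y \<in> carrier (M \<nu>)"
    then obtain p where p: "p \<in> col \<nu>" "Y = YM \<nu> p" by (rule M_E)
    show "star_fam Y \<in> carrier (N \<nu>)" unfolding p(2) star_fam_YM[OF p(1)] by (rule ZN_closed[OF star_col[OF p(1)]])
  qed
  show "star_fam \<in> carrier (N \<nu>) \<rightarrow> carrier (M \<nu>)"
  proof (rule funcsetI)
    fix Z assume "Z \<in> carrier (N \<nu>)"
    then obtain s where s: "s \<in> row \<nu>" "Z = ZN \<nu> s" by (rule N_E)
    show "star_fam Z \<in> carrier (M \<nu>)" unfolding s(2) star_fam_ZN[OF s(1)] by (rule YM_closed[OF star_row[OF s(1)]])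
  qed
  fix Y assume "Y \<in> carrier (M \<nu>)"
  then obtain p where p: "p \<in> col \<nu>" "Y = YM \<nu> p" by (rule M_E)
  show "star_fam (star_fam Y) = Y"
    unfolding p(2) star_fam_YM[OF p(1)] star_fam_ZN[OF star_col[OF p(1)]] by (rule YM_cong) (simp add: colH[OF p(1)])
next
  fix Z assume "Z \<in> carrier (N \<nu>)"
  then obtain s where s: "s \<in> row \<nu>" "Z = ZN \<nu> s" by (rule N_E)
  show "star_fam (star_fam Z) = Z"
    unfolding s(2) star_fam_ZN[OF s(1)] star_fam_YM[OF star_row[OF s(1)]] by (rule ZN_cong) (simp add: rowH[OF s(1)])
qed

lemma swap_sides_simps:
  "carrier (swap_sides sA sB X) = carrier X" "add (swap_sides sA sB X) = add X" "smult (swap_sides sA sB X) = smult X"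
  "lact (swap_sides sA sB X) = (\<lambda>a y. ract X y (sA a))" "ract (swap_sides sA sB X) = (\<lambda>y b. lact X (sB b) y)"
  by (simp_all add: swap_sides_def module.defs bimodule.defs)

lemma star_fam_iso: "bimodule_iso K (AQ \<nu>) (KB \<nu>) (M \<nu>) (swap_sides (\<lambda>W. st ` W) (\<lambda>C. C) (N \<nu>)) star_fam"
  unfolding bimodule_iso_def swap_sides_simps
proof (intro conjI ballI star_fam_bij)
  fix Y assume "Y \<in> carrier (M \<nu>)"
  then obtain p where p: "p \<in> col \<nu>" "Y = YM \<nu> p" by (rule M_E)
  note sp = star_col[OF p(1)] and pH = colH[OF p(1)]
  {
    fix Y' assume "Y' \<in> carrier (M \<nu>)"
    then obtain p' where p': "p' \<in> col \<nu>" "Y' = YM \<nu> p'" by (rule M_E)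
    show "star_fam (Y \<oplus>\<^bsub>M \<nu>\<^esub> Y') = star_fam Y \<oplus>\<^bsub>N \<nu>\<^esub> star_fam Y'"
      unfolding p(2) p'(2) YM_add[OF p(1) p'(1)] star_fam_YM[OF col_ops(2)[OF p(1) p'(1)]] star_fam_YM[OF p(1)] star_fam_YM[OF p'(1)]
        ZN_add[OF sp star_col[OF p'(1)]]
      by (rule ZN_cong) (simp add: pH colH[OF p'(1)])
  next
    fix c assume c: "c \<in> carrier K"
    show "star_fam (c \<odot>\<^bsub>M \<nu>\<^esub> Y) = c \<odot>\<^bsub>N \<nu>\<^esub> star_fam Y"
      unfolding p(2) YM_smult[OF c p(1)] star_fam_YM[OF col_ops(3)[OF c p(1)]] star_fam_YM[OF p(1)] ZN_smult[OF c sp]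
      by (rule ZN_cong) (simp add: pH c)
  next
    fix C assume "C \<in> carrier (KB \<nu>)"
    then obtain c where c: "c \<in> carrier K" "C = kcs \<nu> c" by (rule KB_E)
    show "star_fam (ract (M \<nu>) Y C) = lact (N \<nu>) C (star_fam Y)"
      unfolding p(2) c(2) ract_YM[OF c(1) p(1)] star_fam_YM[OF col_ops(3)[OF c(1) p(1)]] star_fam_YM[OF p(1)] lact_ZN[OF c(1) sp]
      by (rule ZN_cong) (simp add: pH c(1))
  next
    fix W assume "W \<in> carrier (AQ \<nu>)"
    then obtain x where x: "x \<in> carrier A" "W = acs \<nu> x" by (rule AQ_E)
    show "star_fam (lact (M \<nu>) W Y) = ract (N \<nu>) (star_fam Y) (st ` W)"
      unfolding p(2) x(2) lact_YM[OF x(1) p(1)] star_fam_YM[OF lv_col[OF x(1) p(1)]] star_fam_YM[OF p(1)] st_acs[OF x(1)]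
        ract_ZN[OF st_closed[OF x(1)] sp]
    proof (rule ZN_cong)
      fix \<beta> assume \<beta>: "\<beta> \<in> I"
      have "star (dot (\<lambda>\<alpha>. comp x \<alpha> \<beta>) p) = dot (\<lambda>\<alpha>. star (p \<alpha>)) (\<lambda>\<alpha>. star (comp x \<alpha> \<beta>))"
        by (rule star_dot[OF A_row[OF x(1) \<beta>] p(1)])
      also have "\<dots> = dot (\<lambda>\<alpha>. star (p \<alpha>)) (comp (st x) \<beta>)"
        by (rule dot_cong_r[OF _ sp A_col[OF st_closed[OF x(1)] \<beta>]]) (simp add: comp_st[OF x(1) \<beta>])
      finally show "star (lv x p \<beta>) = rv (\<lambda>\<alpha>. star (p \<alpha>)) (st x) \<beta>" by (simp add: lv_def rv_def)
    qed
  }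
qed

lemma involutive_filter_A: "involutive_standard_filter K A (compositions n) dom_ge AF B' M N \<eta> \<rho> st"
proof (rule involutive_standard_filter.intro[OF standard_filter_A involutive_standard_filter_axioms.intro])
  show "anti_involution K A st" by (rule anti_involution_st)
  fix l assume l: "l \<in> compositions n"
  show "st ` AF l = AF l" unfolding AF_Asum by (rule st_image_Asum)
  show "involutive_context K (quotient_algebra A (filter_below A (compositions n) dom_ge AF l)) (KB l) (\<lambda>W. st ` W) (\<lambda>C. C) (M l) (N l) (\<eta> l) (\<rho> l)"
    unfolding filter_below_eq involutive_context_def
  proof (intro exI[of _ star_fam] conjI ballI star_fam_iso)
    fix Y Z assume "Y \<in> carrier (M l)" "Z \<in> carrier (N l)"
    then obtain p s where p: "p \<in> col l" "Y = YM l p" and s: "s \<in> row l" "Z = ZN l s" by (elim M_E N_E) blast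
    note sp = star_col[OF p(1)] and ss = star_row[OF s(1)]
    have "star_fam (YM l (\<lambda>\<alpha>. star (s \<alpha>))) = ZN l s"
      unfolding star_fam_YM[OF ss] by (rule ZN_cong) (simp add: rowH[OF s(1)])
    \<comment> \<open>The inverse of the isomorphism is again entrywise \<open>star\<close>, so the
      two identities reduce to \<open>star_circ\<close> for the entries of \<open>\<eta>\<close> and
      to \<open>rel_star\<close> for the scalar of \<open>\<rho>\<close>.\<close>
    then have inv: "inv_into (carrier (M l)) star_fam Z = YM l (\<lambda>\<alpha>. star (s \<alpha>))"
      unfolding s(2) by (rule inv_into_f_eq[OF bij_betw_imp_inj_on[OF star_fam_bij] YM_closed[OF ss]])
    have "st (ev l p s) = ev l (\<lambda>\<alpha>. star (s \<alpha>)) (\<lambda>\<alpha>. star (p \<alpha>))"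
      unfolding st_def[OF ev_closed[OF p(1) s(1)]] ev_def[of _ "\<lambda>\<alpha>. star (s \<alpha>)"]
      by (rule mkA_cong) (simp add: comp_ev star_circ[OF colD[OF p(1)] rowD[OF s(1)]])
    then show "st ` \<eta> l Y Z = \<eta> l (inv_into (carrier (M l)) star_fam Z) (star_fam Y)"
      unfolding inv unfolding p(2) s(2) star_fam_YM[OF p(1)] eta_YM_ZN[OF p(1) s(1)] eta_YM_ZN[OF ss sp] st_acs[OF ev_closed[OF p(1) s(1)]]
      by simp
    obtain c where c: "rel l (dot s p) c" by (rule rel_E[OF l dot_closed[OF s(1) p(1)]])
    have c': "rel l (dot (\<lambda>\<alpha>. star (p \<alpha>)) (\<lambda>\<alpha>. star (s \<alpha>))) c"
      using rel_star[OF c] unfolding star_dot[OF s(1) p(1)] .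
    show "\<rho> l Z Y = \<rho> l (star_fam Y) (inv_into (carrier (M l)) star_fam Z)"
      unfolding inv unfolding p(2) s(2) star_fam_YM[OF p(1)] rho_ZN_YM[OF p(1) s(1) c] rho_ZN_YM[OF ss sp c'] ..
  qed
qed

end

section \<open>The Hecke algebra and the q-Schur algebra as instances\<close>

lemma finite_compositions_upto: "finite (compositions_upto r n)"
proof (rule finite_subset[OF _ finite_set_of_finite_funs[of "{..<r}" "{..n}" 0]])
  show "compositions_upto r n \<subseteq> {f. \<forall>x. (x \<in> {..<r} \<longrightarrow> f x \<in> {..n}) \<and> (x \<notin> {..<r} \<longrightarrow> f x = 0)}"
  proof (intro subsetI CollectI allI conjI impI)
    fix \<nu> i assume \<nu>: "\<nu> \<in> compositions_upto r n"
    then show "\<nu> i = 0" if "i \<notin> {..<r}" using that by (simp add: compositions_upto_def)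
    have "(\<Sum>j<Suc i. \<nu> j) \<le> n" using \<nu> compositions_psum_le[of \<nu> n "Suc i"] by (simp add: compositions_upto_def)
    then show "\<nu> i \<in> {..n}" by simp
  qed
qed auto

context hecke_setting
begin

lemma m_ones: "m (ones n) = \<one>\<^bsub>H\<^esub>"
  unfolding m_def young_subgroup_eq[OF ones_compositions] yg_ones by (simp add: T_id)

lemma MM_ones: "MM (ones n) (ones n) = carrier H"
  using MM_closed MM_I[of _ _ _ "ones n" "ones n"] by (auto simp: m_ones)

lemma circ_ones: "x \<in> carrier H \<Longrightarrow> y \<in> carrier H \<Longrightarrow> circ (ones n) x y = x \<otimes>\<^bsub>H\<^esub> y"
  using circ_eq(1)[of x y x "ones n" y] by (simp add: m_ones)

text \<open>A one-term sum equals its term only inside the carrier. For the one-element index set of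
  the Hecke algebra this explains the membership conditions in \<open>M_lact\<close>,
  \<open>N_ract\<close> and \<open>\<rho>_def\<close>.\<close>

lemma M_quot_sum_single:
  assumes "f j \<in> carrier (M_quot \<nu> \<alpha> \<beta>)" shows "(\<Oplus>\<^bsub>M_quot \<nu> \<alpha> \<beta>\<^esub>i\<in>{j}. f i) = f j"
proof -
  interpret Mq: abelian_group "M_quot \<nu> \<alpha> \<beta>" by (rule abelian_group_M_quot)
  show ?thesis using assms by simp
qed

lemma qcirc_closed:
  assumes "X \<in> carrier (M_quot \<nu> \<kappa> \<beta>)" "Y \<in> carrier (M_quot \<nu> \<alpha> \<kappa>)"
  shows "qcirc \<nu> \<alpha> \<kappa> \<beta> X Y \<in> carrier (M_quot \<nu> \<alpha> \<beta>)"
  using assms circ_closed by (auto simp: M_quot_simps qcirc_cs)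

lemma filtered_setting_hecke:
  "filtered_setting K q n {ones n} H (\<lambda>h _ _. h) (\<lambda>f. f (ones n) (ones n)) (\<lambda>Y _. Y) (\<lambda>f. f (ones n))
     hecke_filter hecke_S hecke_S' hecke_eta hecke_rho star"
proof -
  note defs = hecke_S_def hecke_S'_def module.defs bimodule.defs
  have [simp]: "carrier (hecke_S \<nu>) = carrier (M_quot \<nu> \<nu> (ones n))" "carrier (hecke_S' \<nu>) = carrier (M_quot \<nu> (ones n) \<nu>)" for \<nu>
    by (simp_all add: defs)
  show ?thesis
  proof (rule filtered_setting.intro[OF hecke_setting_axioms filtered_setting_axioms.intro])
    fix \<nu>
    show "carrier H = {x. x = x \<and> (\<forall>\<alpha>\<in>{ones n}. \<forall>\<beta>\<in>{ones n}. x \<in> MM \<alpha> \<beta>)}" by (simp add: MM_ones)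
    show "hecke_filter \<nu> = {x. x = x \<and> (\<forall>\<alpha>\<in>{ones n}. \<forall>\<beta>\<in>{ones n}. x \<in> M_ge \<nu> \<alpha> \<beta>)}" by (simp add: hecke_filter_def)
    fix Y Z
    show "hecke_eta \<nu> Y Z = {x. x = x \<and> (\<forall>\<alpha>\<in>{ones n}. \<forall>\<beta>\<in>{ones n}. x \<in> qcirc \<nu> \<alpha> \<nu> \<beta> Y Z)}"
      by (simp add: hecke_eta_def)
    show "x \<otimes>\<^bsub>H\<^esub> y = (\<Oplus>\<^bsub>H\<^esub>\<kappa>\<in>{ones n}. circ \<kappa> x y)" if "x \<in> carrier H" "y \<in> carrier H" for x y
      using that by (simp add: circ_ones)
    show "hecke_rho \<nu> Z Y = to_base \<nu> (\<Oplus>\<^bsub>M_quot \<nu> \<nu> \<nu>\<^esub>\<alpha>\<in>{ones n}. qcirc \<nu> \<nu> \<alpha> \<nu> Z Y)"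
      if "Y \<in> carrier (hecke_S \<nu>)" "Z \<in> carrier (hecke_S' \<nu>)"
      by (subst M_quot_sum_single) (use that in \<open>simp_all add: qcirc_closed hecke_rho_def\<close>)
    fix W
    assume "\<And>\<alpha> \<beta>. \<alpha> \<in> {ones n} \<Longrightarrow> \<beta> \<in> {ones n} \<Longrightarrow> (\<lambda>x. x) ` W \<in> carrier (M_quot \<nu> \<alpha> \<beta>)"
    then have W: "W \<in> carrier (M_quot \<nu> (ones n) (ones n))" by simp
    show "lact (hecke_S \<nu>) W Y = (\<Oplus>\<^bsub>M_quot \<nu> \<nu> (ones n)\<^esub>\<alpha>\<in>{ones n}. qcirc \<nu> \<nu> \<alpha> (ones n) ((\<lambda>x. x) ` W) Y)"
      if "Y \<in> carrier (hecke_S \<nu>)"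
      by (subst M_quot_sum_single) (use that W in \<open>simp_all add: qcirc_closed, simp add: defs\<close>)
    show "ract (hecke_S' \<nu>) Z W = (\<Oplus>\<^bsub>M_quot \<nu> (ones n) \<nu>\<^esub>\<beta>\<in>{ones n}. qcirc \<nu> (ones n) \<beta> \<nu> Z ((\<lambda>x. x) ` W))"
      if "Z \<in> carrier (hecke_S' \<nu>)"
      by (subst M_quot_sum_single) (use that W in \<open>simp_all add: qcirc_closed, simp add: defs\<close>)
  qed (simp_all add: ones_compositions m_ones defs)
qed

lemma filtered_setting_schur:
  "filtered_setting K q n (compositions_upto r n) (schur_algebra r) (\<lambda>x \<alpha> \<beta>. x (\<alpha>, \<beta>))
     (\<lambda>f. \<lambda>(\<alpha>, \<beta>)\<in>compositions_upto r n \<times> compositions_upto r n. f \<alpha> \<beta>)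
     (\<lambda>Y. Y) (\<lambda>f. restrict f (compositions_upto r n))
     (schur_filter r) (schur_S r) (schur_S' r) (schur_eta r) (schur_rho r) (schur_star r)"
proof -
  define I where "I = compositions_upto r n"
  \<comment> \<open>Extensionality is restated as invariance under restriction, the form
    \<open>mkA (comp x) = x\<close> in which the common setting describes its carriers.\<close>
  have PiE2: "PiE (S \<times> S) (\<lambda>(\<alpha>, \<beta>). P \<alpha> \<beta>) = {x. restrict (\<lambda>(\<alpha>, \<beta>). x (\<alpha>, \<beta>)) (S \<times> S) = x \<and> (\<forall>\<alpha>\<in>S. \<forall>\<beta>\<in>S. x (\<alpha>, \<beta>) \<in> P \<alpha> \<beta>)}"
    for S :: "'i set" and P :: "'i \<Rightarrow> 'i \<Rightarrow> 'j set"
    by (auto simp: PiE_def Pi_iff extensional_def restrict_def fun_eq_iff split: if_splits)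
  have PiE1: "PiE S P = {x. restrict x S = x \<and> (\<forall>\<alpha>\<in>S. x \<alpha> \<in> P \<alpha>)}" for S :: "'i set" and P :: "'i \<Rightarrow> 'j set"
    by (auto simp: PiE_def Pi_iff extensional_def restrict_def fun_eq_iff split: if_splits)
  note defs = schur_S_def schur_S'_def dsum_def Let_def module.defs bimodule.defs I_def[symmetric]
  show ?thesis
    unfolding I_def[symmetric]
  proof (rule filtered_setting.intro[OF hecke_setting_axioms filtered_setting_axioms.intro])
    fix \<nu>
    show "finite I" "I \<subseteq> compositions n" by (auto simp: I_def finite_compositions_upto) (simp add: compositions_upto_def)
    show "carrier (schur_algebra r) = {x. restrict (\<lambda>(\<alpha>, \<beta>). x (\<alpha>, \<beta>)) (I \<times> I) = x \<and> (\<forall>\<alpha>\<in>I. \<forall>\<beta>\<in>I. x (\<alpha>, \<beta>) \<in> MM \<alpha> \<beta>)}"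
      by (simp only: schur_algebra_def I_def[symmetric] Let_def partial_object.select_convs PiE2)
    show "schur_filter r \<nu> = {x. restrict (\<lambda>(\<alpha>, \<beta>). x (\<alpha>, \<beta>)) (I \<times> I) = x \<and> (\<forall>\<alpha>\<in>I. \<forall>\<beta>\<in>I. x (\<alpha>, \<beta>) \<in> M_ge \<nu> \<alpha> \<beta>)}"
      by (simp only: schur_filter_def I_def[symmetric] PiE2)
    show "schur_eta r \<nu> Y Z = {x. restrict (\<lambda>(\<alpha>, \<beta>). x (\<alpha>, \<beta>)) (I \<times> I) = x \<and> (\<forall>\<alpha>\<in>I. \<forall>\<beta>\<in>I. x (\<alpha>, \<beta>) \<in> qcirc \<nu> \<alpha> \<nu> \<beta> (Y \<beta>) (Z \<alpha>))}" for Y Z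
      by (simp only: schur_eta_def I_def[symmetric] PiE2)
    show "carrier (schur_S r \<nu>) = {Y. restrict Y I = Y \<and> (\<forall>\<alpha>\<in>I. Y \<alpha> \<in> carrier (M_quot \<nu> \<nu> \<alpha>))}"
      unfolding PiE1[symmetric] by (simp add: defs)
    show "carrier (schur_S' r \<nu>) = {Y. restrict Y I = Y \<and> (\<forall>\<alpha>\<in>I. Y \<alpha> \<in> carrier (M_quot \<nu> \<alpha> \<nu>))}"
      unfolding PiE1[symmetric] by (simp add: defs)
    show "restrict (\<lambda>(\<alpha>, \<beta>). f \<alpha> \<beta>) (I \<times> I) = restrict (\<lambda>(\<alpha>, \<beta>). g \<alpha> \<beta>) (I \<times> I)" 
      if "\<And>\<alpha> \<beta>. \<alpha> \<in> I \<Longrightarrow> \<beta> \<in> I \<Longrightarrow> f \<alpha> \<beta> = g \<alpha> \<beta>" for f g :: "(nat \<Rightarrow> nat) \<Rightarrow> (nat \<Rightarrow> nat) \<Rightarrow> 'k hecke"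
      by (rule restrict_ext) (use that in auto)
    show "restrict f I = restrict g I" if "\<And>\<alpha>. \<alpha> \<in> I \<Longrightarrow> f \<alpha> = g \<alpha>" for f g :: "(nat \<Rightarrow> nat) \<Rightarrow> 'k hecke set"
      by (rule restrict_ext) (use that in auto)
  qed (simp_all only: defs schur_algebra_def schur_star_def schur_rho_def component_def, simp_all)
qed

end

theorem theorem5p11:
  fixes K :: "('k, 'x) ring_scheme" and q :: 'k and n r :: nat
  assumes "cring K" and "q \<in> carrier K"
  shows
    "carrier (hecke_algebra K q n) = q_schur_data.MM K q n (ones n) (ones n) \<and>
     (\<forall>x\<in>carrier (hecke_algebra K q n). \<forall>y\<in>carrier (hecke_algebra K q n).
        q_schur_data.circ K q n (ones n) x y = x \<otimes>\<^bsub>hecke_algebra K q n\<^esub> y) \<and>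
     standard_filter K (hecke_algebra K q n) (compositions n) dom_ge
       (q_schur_data.hecke_filter K q n)
       (q_schur_data.B' K q n)
       (q_schur_data.hecke_S K q n) (q_schur_data.hecke_S' K q n)
       (q_schur_data.hecke_eta K q n) (q_schur_data.hecke_rho K q n) \<and>
     standard_filter K (q_schur_data.schur_algebra K q n r) (compositions n) dom_ge
       (q_schur_data.schur_filter K q n r)
       (q_schur_data.B' K q n)
       (q_schur_data.schur_S K q n r) (q_schur_data.schur_S' K q n r)
       (q_schur_data.schur_eta K q n r) (q_schur_data.schur_rho K q n r) \<and>
     involutive_standard_filter K (hecke_algebra K q n) (compositions n) dom_ge
       (q_schur_data.hecke_filter K q n)
       (q_schur_data.B' K q n)
       (q_schur_data.hecke_S K q n) (q_schur_data.hecke_S' K q n)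
       (q_schur_data.hecke_eta K q n) (q_schur_data.hecke_rho K q n)
       (q_schur_data.star K q n) \<and>
     involutive_standard_filter K (q_schur_data.schur_algebra K q n r) (compositions n) dom_ge
       (q_schur_data.schur_filter K q n r)
       (q_schur_data.B' K q n)
       (q_schur_data.schur_S K q n r) (q_schur_data.schur_S' K q n r)
       (q_schur_data.schur_eta K q n r) (q_schur_data.schur_rho K q n r)
       (q_schur_data.schur_star K q n r)"
proof -
  interpret hecke_setting K q n
    using assms by (simp add: hecke_setting_def hecke_setting_axioms_def)
  interpret Hecke: filtered_setting K q n "{ones n}" H "\<lambda>h _ _. h" "\<lambda>f. f (ones n) (ones n)"
      "\<lambda>Y _. Y" "\<lambda>f. f (ones n)" hecke_filter hecke_S hecke_S' hecke_eta hecke_rho star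
    by (rule filtered_setting_hecke)
  interpret Schur: filtered_setting K q n "compositions_upto r n" "schur_algebra r" "\<lambda>x \<alpha> \<beta>. x (\<alpha>, \<beta>)"
      "\<lambda>f. \<lambda>(\<alpha>, \<beta>)\<in>compositions_upto r n \<times> compositions_upto r n. f \<alpha> \<beta>"
      "\<lambda>Y. Y" "\<lambda>f. restrict f (compositions_upto r n)"
      "schur_filter r" "schur_S r" "schur_S' r" "schur_eta r" "schur_rho r" "schur_star r"
    by (rule filtered_setting_schur)
  show ?thesis
    using MM_ones circ_ones Hecke.standard_filter_A Schur.standard_filter_A Hecke.involutive_filter_A
      Schur.involutive_filter_A by blast
qed

end
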